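(* Let $k,n\ge 1$ be integers and let $\xi=(\xi_1\ge\xi_2\ge\cdots\ge\xi_{n+1}>0)$ be a partition of $k$ into exactly $n+1$ parts. Let $A_k=\mathbb{C}[t_1,\dots,t_k]$ with its standard grading, let $A_k^{S_k}$ be the subalgebra of symmetric polynomials, and let $M_{k,\xi}$ be the $A_k^{S_k}$-submodule of $A_k$ generated by the polynomials $\mathbf{p}(\mathbf{r})$, $\mathbf{r}\in\mathbb{Z}_+^{\xi_2}\times\cdots\times\mathbb{Z}_+^{\xi_{n+1}}$ (defined in the context). Then: (a) $M_{k,\xi}$ is a graded free $A_k^{S_k}$-module, and the number of elements of grade $s$ in a homogeneous basis is the coefficient of $q^s$ in the Kostka polynomial $\kappa_{1^k,\xi^{tr}}$. (b) There is an isomorphism of graded $S_k$- and $A_k^{S_k}$-modules $$A_k^{\xi}\;\cong\; M_{k,\xi}\otimes \xi ,$$ where on the right-hand side $A_k^{S_k}$ acts on the factor $M_{k,\xi}$ and $S_k$ acts on the factor $\xi$. (c) In particular, if $I_k$ is the augmentation ideal of $A_k^{S_k}$, there is an isomorphism of $\mathbb{Z}_+$-graded vector spaces $$M_{k,\xi}/I_kM_{k,\xi}\;\cong\;\mathrm{Hom}_{S_k}(\xi,\mathbb{C}[S_k]),$$ where $\mathbb{C}[S_k]$ carries the $\mathbb{Z}_+$-grading transported from the graded $S_k$-module $A_k/I_kA_k\cong\mathbb{C}[S_k]$.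
   Context: $\mathbb{Z}_+$ is the set of non-negative integers. $S_k$ acts on the right on $A_k=\mathbb{C}[t_1,\dots,t_k]$ by permuting the variables, each $t_i$ having grade one. The augmentation ideal $I_k$ of $A_k^{S_k}$ is the ideal of symmetric polynomials with zero constant term. For a partition $\xi$ of $k$, the symbol $\xi$ also denotes the irreducible complex representation of $S_k$ attached to $\xi$ in the standard way, with $(k)$ corresponding to the trivial representation; in $M_{k,\xi}\otimes\xi$ the space $\xi$ is placed in grade $0$. $A_k^\xi$ is the $\xi$-isotypical component of the $S_k$-module $A_k$; it is a graded $A_k^{S_k}$-submodule of $A_k$. By a classical result $A_k/I_kA_k\cong\mathbb{C}[S_k]$ as $S_k$-modules. $\xi^{tr}$ is the transpose (conjugate) partition, and $\kappa_{1^k,\xi^{tr}}(q)$ is the Kostka(-Foulkes) polynomial usually written $K_{\xi^{tr},(1^k)}(q)$; explicitly it equals $q^{\sum_i (i-1)\xi_i}\prod_{i=1}^k(1-q^i)\big/\prod_{x\in\xi}(1-q^{h(x)})$, where $x$ runs over the boxes of the Young diagram of $\xi$ and $h(x)$ is the hook length. Definition of $\mathbf{p}(\mathbf{r})$. Put $k_i=\xi_i-\xi_{i+1}$ for $1\le i\le n$ and $k_{n+1}=\xi_{n+1}$, so $k=\sum_{i=1}^{n+1} i\,k_i$. Identify $$A_k=A_1^{\otimes k_1}\otimes A_2^{\otimes k_2}\otimes\cdots\otimes A_{n+1}^{\otimes k_{n+1}}$$ by splitting the variables $t_1,\dots,t_k$, in order, into $k_1$ blocks of size $1$, then $k_2$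 blocks of size $2$, ..., then $k_{n+1}$ blocks of size $n+1$; the variables of each block of size $\ell$ are renamed $t_1,\dots,t_\ell$ in the corresponding factor $A_\ell$. Write $\mathbf{r}=(\mathbf{r}^{(2)},\dots,\mathbf{r}^{(n+1)})$ with $\mathbf{r}^{(j)}=(r^{(j)}_1,\dots,r^{(j)}_{\xi_j})\in\mathbb{Z}_+^{\xi_j}$. Place the $\mathbf{r}^{(j)}$ as right-justified rows of an array with $\xi_2$ columns and read off its columns: for $2\le\ell\le n+1$ and $1\le s\le k_\ell$ set $$\Phi_\xi^{\ell,s}(\mathbf{r})=\bigl(r^{(2)}_{\xi_2-\xi_\ell+s},\,r^{(3)}_{\xi_3-\xi_\ell+s},\dots,r^{(\ell)}_{s}\bigr)\in\mathbb{Z}_+^{\ell-1}.$$ For $(r_1,\dots,r_\ell)\in\mathbb{Z}_+^\ell$ set $$\mathbf{a}(r_1,\dots,r_\ell)=\sum_{\tau\in S_{\ell+1}}\mathrm{sgn}(\tau)\,t_{\tau(1)}^{r_1}\cdots t_{\tau(\ell)}^{r_\ell}\in A_{\ell+1}.$$ Set $$\mathbf{b}(\mathbf{r})=1^{\otimes k_1}\otimes\mathbf{a}(\Phi_\xi^{2,1}(\mathbf{r}))\otimes\cdots\otimes\mathbf{a}(\Phi_\xi^{2,k_2}(\mathbf{r}))\otimes\cdots\otimes\mathbf{a}(\Phi_\xi^{n+1,1}(\mathbf{r}))\otimes\cdots\otimes\mathbf{a}(\Phi_\xi^{n+1,k_{n+1}}(\mathbf{r}))\in A_k$$ (factors with $k_\ell=0$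 are omitted), and $$\mathbf{p}(\mathbf{r})=\sum_{\sigma\in S_{\xi_2}\times\cdots\times S_{\xi_{n+1}}}\mathbf{b}(\sigma(\mathbf{r})),$$ where $S_{\xi_j}$ permutes the coordinates of $\mathbb{Z}_+^{\xi_j}$. *)

theory Defs
  imports
    "HOL-Library.Poly_Mapping"
    "HOL-Library.FuncSet"
    "HOL-Combinatorics.Permutations"
    "HOL-Computational_Algebra.Formal_Power_Series"
begin

text \<open>
  Polynomials over the complex numbers in variables indexed by natural numbers are finitely
  supported functions on monomials, with the convolution product of \<^theory>\<open>HOL-Library.Poly_Mapping\<close>.
  The group algebra of the symmetric group is modelled (as a vector space) by finitely supported
  functions on permutations. Both are instances of \<open>'a \<Rightarrow>\<^sub>0 complex\<close>.
\<close>

type_synonym mpol = "(nat \<Rightarrow>\<^sub>0 nat) \<Rightarrow>\<^sub>0 complex"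
type_synonym galg = "(nat \<Rightarrow> nat) \<Rightarrow>\<^sub>0 complex"

definition cscale :: "complex \<Rightarrow> ('a \<Rightarrow>\<^sub>0 complex) \<Rightarrow> ('a \<Rightarrow>\<^sub>0 complex)" where
  "cscale c v = Poly_Mapping.map ((*) c) v"

lemma lookup_cscale: "Poly_Mapping.lookup (cscale c v) x = c * Poly_Mapping.lookup v x"
  by (simp add: cscale_def Poly_Mapping.map.rep_eq when_def)

global_interpretation cvs: vector_space "cscale :: complex \<Rightarrow> ('a \<Rightarrow>\<^sub>0 complex) \<Rightarrow> _"
  by unfold_locales
    (auto intro!: poly_mapping_eqI simp: lookup_cscale lookup_add algebra_simps)

text \<open>Push-forward of a finitely supported function along a map of the index sets.\<close>

definition push_keys :: "('a \<Rightarrow> 'b) \<Rightarrow> ('a \<Rightarrow>\<^sub>0 'c::comm_monoid_add) \<Rightarrow> ('b \<Rightarrow>\<^sub>0 'c)" where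
  "push_keys f v =
     (\<Sum>x\<in>Poly_Mapping.keys v. Poly_Mapping.single (f x) (Poly_Mapping.lookup v x))"

definition lin_on :: "('a \<Rightarrow>\<^sub>0 complex) set \<Rightarrow> (('a \<Rightarrow>\<^sub>0 complex) \<Rightarrow> ('b \<Rightarrow>\<^sub>0 complex)) \<Rightarrow> bool" where
  "lin_on U \<phi> \<longleftrightarrow>
     (\<forall>u\<in>U. \<forall>v\<in>U. \<phi> (u + v) = \<phi> u + \<phi> v) \<and> (\<forall>c. \<forall>u\<in>U. \<phi> (cscale c u) = cscale c (\<phi> u))"

text \<open>Equivariance for right actions \<open>a\<close> and \<open>b\<close> of the symmetric group on \<open>{1..k}\<close>.\<close>

definition equivar_on ::
  "nat \<Rightarrow> 'u set \<Rightarrow> ('u \<Rightarrow> (nat \<Rightarrow> nat) \<Rightarrow> 'u) \<Rightarrow> ('v \<Rightarrow> (nat \<Rightarrow> nat) \<Rightarrow> 'v) \<Rightarrow> ('u \<Rightarrow> 'v) \<Rightarrow> bool" where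
  "equivar_on k U a b \<phi> \<longleftrightarrow> (\<forall>\<sigma>. \<sigma> permutes {1..k} \<longrightarrow> (\<forall>u\<in>U. \<phi> (a u \<sigma>) = b (\<phi> u) \<sigma>))"

definition tvar :: "nat \<Rightarrow> mpol" where
  "tvar i = Poly_Mapping.single (Poly_Mapping.single i 1) 1"

definition polys :: "nat \<Rightarrow> mpol set" where
  "polys k = {p. \<forall>m\<in>Poly_Mapping.keys p. Poly_Mapping.keys m \<subseteq> {1..k}}"

text \<open>Substitution of \<open>tvar (f i)\<close> for \<open>tvar i\<close>: inner push-forward on exponents, outer on monomials.\<close>

definition rename :: "(nat \<Rightarrow> nat) \<Rightarrow> mpol \<Rightarrow> mpol" where
  "rename f = push_keys (push_keys f)"

text \<open>With permutations composed as functions, \<open>t\<^sub>i \<mapsto> t\<^sub>j\<close> for \<open>j = \<sigma>\<inverse> i\<close> is a right action.\<close>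

definition act :: "mpol \<Rightarrow> (nat \<Rightarrow> nat) \<Rightarrow> mpol" where
  "act p \<sigma> = rename (inv \<sigma>) p"

definition sympolys :: "nat \<Rightarrow> mpol set" where
  "sympolys k = {p \<in> polys k. \<forall>\<sigma>. \<sigma> permutes {1..k} \<longrightarrow> act p \<sigma> = p}"

definition augm :: "nat \<Rightarrow> mpol set" where
  "augm k = {p \<in> sympolys k. Poly_Mapping.lookup p 0 = 0}"

definition mdeg :: "(nat \<Rightarrow>\<^sub>0 nat) \<Rightarrow> nat" where
  "mdeg m = (\<Sum>i\<in>Poly_Mapping.keys m. Poly_Mapping.lookup m i)"

definition homog :: "nat \<Rightarrow> mpol \<Rightarrow> bool" where
  "homog s p \<longleftrightarrow> (\<forall>m\<in>Poly_Mapping.keys p. mdeg m = s)"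

definition hom_part :: "nat \<Rightarrow> mpol \<Rightarrow> mpol" where
  "hom_part s p =
     (\<Sum>m | m \<in> Poly_Mapping.keys p \<and> mdeg m = s. Poly_Mapping.single m (Poly_Mapping.lookup p m))"

definition submod :: "mpol set \<Rightarrow> mpol set \<Rightarrow> bool" where
  "submod R N \<longleftrightarrow> 0 \<in> N \<and> (\<forall>p\<in>N. \<forall>q\<in>N. p + q \<in> N) \<and> (\<forall>f\<in>R. \<forall>p\<in>N. f * p \<in> N)"

definition gen_submod :: "mpol set \<Rightarrow> mpol set \<Rightarrow> mpol set" where
  "gen_submod R G = submod R hull G"

definition graded :: "mpol set \<Rightarrow> bool" where
  "graded N \<longleftrightarrow> (\<forall>p\<in>N. \<forall>s. hom_part s p \<in> N)"

definition is_basis :: "mpol set \<Rightarrow> mpol set \<Rightarrow> mpol set \<Rightarrow> bool" where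
  "is_basis R N B \<longleftrightarrow> gen_submod R B = N \<and>
     (\<forall>F c. finite F \<and> F \<subseteq> B \<and> c ` F \<subseteq> R \<and> (\<Sum>b\<in>F. c b * b) = 0 \<longrightarrow> (\<forall>b\<in>F. c b = 0))"

definition homog_basis :: "mpol set \<Rightarrow> mpol set \<Rightarrow> mpol set \<Rightarrow> bool" where
  "homog_basis R N B \<longleftrightarrow> is_basis R N B \<and> (\<forall>b\<in>B. \<exists>s. homog s b)"

definition augm_mult :: "nat \<Rightarrow> mpol set \<Rightarrow> mpol set" where
  "augm_mult k N = gen_submod (sympolys k) {f * p | f p. f \<in> augm k \<and> p \<in> N}"

text \<open>
  A quotient \<open>N / L\<close> is the set of cosets of elements of \<open>N\<close>; the operations on it are those
  induced by representatives, so a map \<open>\<psi>\<close> on cosets is linear (equivariant) iff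
  \<open>\<lambda>p. \<psi> (coset L p)\<close> is linear (equivariant) on \<open>N\<close>. Its component of grade \<open>s\<close> is the image of
  the component of \<open>N\<close> of grade \<open>s\<close>.
\<close>

definition coset :: "mpol set \<Rightarrow> mpol \<Rightarrow> mpol set" where
  "coset L p = (+) p ` L"

definition quot :: "mpol set \<Rightarrow> mpol set \<Rightarrow> mpol set set" where
  "quot N L = coset L ` N"

definition quot_grade :: "mpol set \<Rightarrow> mpol set \<Rightarrow> nat \<Rightarrow> mpol set set" where
  "quot_grade N L s = coset L ` {p \<in> N. homog s p}"

text \<open>A partition is a weakly decreasing list of positive numbers; parts are numbered from 1.\<close>

definition is_partition :: "nat list \<Rightarrow> bool" where
  "is_partition \<xi> \<longleftrightarrow> sorted_wrt (\<ge>) \<xi> \<and> (\<forall>x\<in>set \<xi>. 0 < x)"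

definition part :: "nat list \<Rightarrow> nat \<Rightarrow> nat" where
  "part \<xi> i = (if 1 \<le> i \<and> i \<le> length \<xi> then \<xi> ! (i - 1) else 0)"

definition boxes :: "nat list \<Rightarrow> (nat \<times> nat) set" where
  "boxes \<xi> = {(i, j). i \<in> {1..length \<xi>} \<and> j \<in> {1..part \<xi> i}}"

definition hook :: "nat list \<Rightarrow> nat \<times> nat \<Rightarrow> nat" where
  "hook \<xi> = (\<lambda>(i, j). card {(i', j') \<in> boxes \<xi>. (i' = i \<and> j \<le> j') \<or> (j' = j \<and> i \<le> i')})"

text \<open>
  The Kostka(-Foulkes) polynomial \<open>K\<^bsub>\<lambda>,(1^k)\<^esub>(q)\<close>, where \<open>\<lambda>\<close> is the transpose of \<open>\<xi>\<close>, by its hook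
  formula. The quotient is formed in the ring of formal power series, where every factor of the
  denominator is a unit.
\<close>

definition kostka_transpose :: "nat list \<Rightarrow> rat fps" where
  "kostka_transpose \<xi> =
     fps_X ^ (\<Sum>i\<in>{1..length \<xi>}. (i - 1) * part \<xi> i) * (\<Prod>i\<in>{1..sum_list \<xi>}. 1 - fps_X ^ i)
     / (\<Prod>x\<in>boxes \<xi>. 1 - fps_X ^ hook \<xi> x)"

text \<open>
  The right regular representation: \<open>Poly_Mapping.single g 1\<close> is sent by \<open>\<sigma>\<close> to
  \<open>Poly_Mapping.single (g \<circ> \<sigma>) 1\<close>. The coefficients are left arbitrary, so that the same formula
  also gives the action on the second factor of a tensor product (see below).
\<close>

definition gact :: "((nat \<Rightarrow> nat) \<Rightarrow>\<^sub>0 'c::comm_monoid_add) \<Rightarrow> (nat \<Rightarrow> nat) \<Rightarrow> ((nat \<Rightarrow> nat) \<Rightarrow>\<^sub>0 'c)" where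
  "gact v \<sigma> = push_keys (\<lambda>g. g \<circ> \<sigma>) v"

definition GA :: "nat \<Rightarrow> galg set" where
  "GA k = {v. Poly_Mapping.keys v \<subseteq> {\<sigma>. \<sigma> permutes {1..k}}}"

text \<open>
  The standard tableau of shape \<open>\<xi>\<close> obtained by filling in \<open>1, 2, \<dots>\<close> row by row, its row and column
  stabilizers, and the Young symmetrizer \<open>a\<^sub>\<xi> b\<^sub>\<xi>\<close>. The irreducible representation attached to \<open>\<xi>\<close>
  is the right ideal generated by it (for \<open>\<xi> = (k)\<close>, the trivial representation).
\<close>

definition tab :: "nat list \<Rightarrow> nat \<Rightarrow> nat \<Rightarrow> nat" where
  "tab \<xi> i j = (\<Sum>i'\<in>{1..<i}. part \<xi> i') + j"

definition row_group :: "nat list \<Rightarrow> (nat \<Rightarrow> nat) set" where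
  "row_group \<xi> = {g. g permutes {1..sum_list \<xi>} \<and>
     (\<forall>i. g ` {tab \<xi> i j | j. (i, j) \<in> boxes \<xi>} = {tab \<xi> i j | j. (i, j) \<in> boxes \<xi>})}"

definition col_group :: "nat list \<Rightarrow> (nat \<Rightarrow> nat) set" where
  "col_group \<xi> = {g. g permutes {1..sum_list \<xi>} \<and>
     (\<forall>j. g ` {tab \<xi> i j | i. (i, j) \<in> boxes \<xi>} = {tab \<xi> i j | i. (i, j) \<in> boxes \<xi>})}"

definition young_symmetrizer :: "nat list \<Rightarrow> galg" where
  "young_symmetrizer \<xi> =
     (\<Sum>g\<in>row_group \<xi>. \<Sum>h\<in>col_group \<xi>. Poly_Mapping.single (g \<circ> h) (of_int (sign h)))"

definition irrep :: "nat list \<Rightarrow> galg set" where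
  "irrep \<xi> = cvs.span {gact (young_symmetrizer \<xi>) \<sigma> | \<sigma>. \<sigma> permutes {1..sum_list \<xi>}}"

text \<open>The \<open>\<xi>\<close>-isotypical component of \<open>A\<^sub>k\<close>: the sum of all submodules isomorphic to \<open>\<xi>\<close>.\<close>

definition subrep :: "nat \<Rightarrow> mpol set \<Rightarrow> bool" where
  "subrep k N \<longleftrightarrow> cvs.subspace N \<and> N \<subseteq> polys k \<and>
     (\<forall>\<sigma>. \<sigma> permutes {1..k} \<longrightarrow> (\<forall>p\<in>N. act p \<sigma> \<in> N))"

definition isotypic :: "nat \<Rightarrow> nat list \<Rightarrow> mpol set" where
  "isotypic k \<xi> = cvs.span (\<Union>{N. subrep k N \<and>
     (\<exists>\<phi>. bij_betw \<phi> N (irrep \<xi>) \<and> lin_on N \<phi> \<and> equivar_on k N act gact \<phi>)})"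

definition Hom_irrep :: "nat \<Rightarrow> nat list \<Rightarrow> (galg \<Rightarrow> galg) set" where
  "Hom_irrep k \<xi> =
     {h \<in> irrep \<xi> \<rightarrow>\<^sub>E GA k. lin_on (irrep \<xi>) h \<and> equivar_on k (irrep \<xi>) gact gact h}"

text \<open>
  An isomorphism of representations from the coinvariants \<open>A\<^sub>k / I\<^sub>k A\<^sub>k\<close> to the group algebra. It
  transports the grading of the coinvariants to the group algebra: the component of grade \<open>s\<close> is
  \<open>\<psi> ` quot_grade (polys k) (augm_mult k (polys k)) s\<close>.
\<close>

definition coinvariants_iso :: "nat \<Rightarrow> (mpol set \<Rightarrow> galg) \<Rightarrow> bool" where
  "coinvariants_iso k \<psi> \<longleftrightarrow>
     (let J = augm_mult k (polys k)
      in bij_betw \<psi> (quot (polys k) J) (GA k) \<and>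
         lin_on (polys k) (\<lambda>p. \<psi> (coset J p)) \<and>
         equivar_on k (polys k) act gact (\<lambda>p. \<psi> (coset J p)))"

text \<open>
  For a subspace \<open>M\<close> of the polynomials and a subspace \<open>V\<close> of the group algebra, the tensor product
  \<open>M \<otimes> V\<close> over the complex numbers is realized inside the polynomial-valued functions on
  permutations, \<open>p \<otimes> v\<close> being \<open>g \<mapsto> v(g) p\<close>. This is the image of \<open>M \<otimes> V\<close> under the injective map to
  (polynomials) \<open>\<otimes>\<close> (group algebra), the latter being free over the polynomials on the permutations.
\<close>

definition tens :: "mpol \<Rightarrow> galg \<Rightarrow> ((nat \<Rightarrow> nat) \<Rightarrow>\<^sub>0 mpol)" where
  "tens p v = Poly_Mapping.map (\<lambda>c. cscale c p) v"

definition tensor :: "mpol set \<Rightarrow> galg set \<Rightarrow> ((nat \<Rightarrow> nat) \<Rightarrow>\<^sub>0 mpol) set" where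
  "tensor M V = {(\<Sum>i<N. tens (p i) (v i)) | (N::nat) p v. \<forall>i<N. p i \<in> M \<and> v i \<in> V}"

definition tens_mult :: "mpol \<Rightarrow> ((nat \<Rightarrow> nat) \<Rightarrow>\<^sub>0 mpol) \<Rightarrow> ((nat \<Rightarrow> nat) \<Rightarrow>\<^sub>0 mpol)" where
  "tens_mult f F = Poly_Mapping.map ((*) f) F"

definition tens_homog :: "nat \<Rightarrow> ((nat \<Rightarrow> nat) \<Rightarrow>\<^sub>0 mpol) \<Rightarrow> bool" where
  "tens_homog s F \<longleftrightarrow> (\<forall>g. homog s (Poly_Mapping.lookup F g))"

definition part_mult :: "nat list \<Rightarrow> nat \<Rightarrow> nat" where
  "part_mult \<xi> i = part \<xi> i - part \<xi> (i + 1)"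

text \<open>
  The array \<open>r\<close> has entries \<open>r j s\<close> for \<open>2 \<le> j \<le> length \<xi>\<close> and \<open>1 \<le> s \<le> part \<xi> j\<close>; other values of \<open>r\<close>
  are irrelevant. The differences below are never truncated, since \<open>j \<le> l\<close>.
\<close>

definition array_column :: "nat list \<Rightarrow> nat \<Rightarrow> nat \<Rightarrow> (nat \<Rightarrow> nat \<Rightarrow> nat) \<Rightarrow> nat list" where
  "array_column \<xi> l s r = List.map (\<lambda>j. r j (part \<xi> j - part \<xi> l + s)) [2..<l + 1]"

definition alternant :: "nat list \<Rightarrow> mpol" where
  "alternant rs =
     (\<Sum>\<tau> | \<tau> permutes {1..length rs + 1}.
        of_int (sign \<tau>) * (\<Prod>i\<in>{1..length rs}. tvar (\<tau> i) ^ (rs ! (i - 1))))"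

text \<open>Number of variables preceding the \<open>s\<close>-th block of size \<open>l\<close>.\<close>

definition block_start :: "nat list \<Rightarrow> nat \<Rightarrow> nat \<Rightarrow> nat" where
  "block_start \<xi> l s = (\<Sum>i\<in>{1..<l}. i * part_mult \<xi> i) + (s - 1) * l"

definition bpol :: "nat list \<Rightarrow> (nat \<Rightarrow> nat \<Rightarrow> nat) \<Rightarrow> mpol" where
  "bpol \<xi> r =
     (\<Prod>l\<in>{2..length \<xi>}. \<Prod>s\<in>{1..part_mult \<xi> l}.
        rename (\<lambda>i. block_start \<xi> l s + i) (alternant (array_column \<xi> l s r)))"

definition ppol :: "nat list \<Rightarrow> (nat \<Rightarrow> nat \<Rightarrow> nat) \<Rightarrow> mpol" where
  "ppol \<xi> r =
     (\<Sum>\<sigma>\<in>(\<Pi>\<^sub>E j\<in>{2..length \<xi>}. {\<pi>. \<pi> permutes {1..part \<xi> j}}).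
        bpol \<xi> (\<lambda>j s. r j (\<sigma> j s)))"

definition Mmod :: "nat \<Rightarrow> nat list \<Rightarrow> mpol set" where
  "Mmod k \<xi> = gen_submod (sympolys k) (range (ppol \<xi>))"

end

theory Submission
  imports Defs "Jordan_Normal_Form.Determinant" "HOL-Computational_Algebra.Polynomial"
begin

text \<open>
  Write \<open>A\<close> for the polynomials in \<open>t\<^sub>1, \<dots>, t\<^sub>k\<close> and \<open>\<Lambda>\<close> for the symmetric ones. A tableau of shape \<open>\<xi>\<close>, a
  bijection between \<open>{1..k}\<close> and the boxes of \<open>\<xi>\<close>, has a Young symmetrizer \<open>e\<close> in the group algebra: sum
  over the row group, then signed sum over the column group. Everything is read off from the subspace
  \<open>A e\<close>, which is a \<open>\<Lambda>\<close>-submodule because symmetric polynomials commute with permutations.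

  \<^bold>\<open>The module is \<open>A e\<close>.\<close> The variables of a block are the column of a tableau \<open>T'\<close> whose columns
  are filled one after the other, and an alternant is the signed sum over such a column of a monomial
  with exponent \<open>0\<close> in the first row. So, up to a factor, \<open>p(r)\<close> is \<open>m e'\<close> for the symmetrizer \<open>e'\<close> of \<open>T'\<close>
  and the monomial \<open>m\<close> whose exponents in the rows from the second on are the array \<open>r\<close>
  (\<open>ppol_eq_esym\<close>). Such elements generate all of \<open>A e'\<close>: a symmetric function of the variables of the
  first row can be expressed through \<open>\<Lambda>\<close> and the symmetric functions of the other rows
  (\<open>esym_mon_in_first_row_zero\<close>). Hence the module is \<open>A e'\<close> (\<open>Mmod_eq_esym\<close>).

  \<^bold>\<open>The isotypic component.\<close> A permutation is either a row permutation times a column permutation, or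
  takes two entries of some column to the same row (\<open>row_col_dichotomy\<close>). Therefore
  \<open>e g\<inverse> e = c e(g) e\<close> for every permutation \<open>g\<close>, with a constant \<open>c\<close> (\<open>esym_\<alpha>_esym\<close>), and \<open>c\<close> is not \<open>0\<close>
  because row and column sums are self-adjoint for a positive definite form (\<open>esym_const_nonzero\<close>).
  An equivariant map from the right ideal \<open>e \<complex>[S\<^sub>k]\<close> to \<open>A\<close> is multiplication by an element of \<open>A e\<close>, so
  the isotypic component is the image of \<open>A e \<otimes> e \<complex>[S\<^sub>k]\<close> under multiplication; the inverse map is explicit,
  \<open>p \<mapsto> (g \<mapsto> p g\<inverse> e)\<close> divided by \<open>c\<^sup>2\<close> (\<open>bij_to_tensor\<close>). It is visibly \<open>\<Lambda>\<close>-linear, equivariant and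
  graded. The tableau for the representation is filled row by row and differs from \<open>T'\<close>, but a
  renumbering \<open>\<pi>\<close> of the variables conjugates one symmetrizer into the other.

  \<^bold>\<open>Freeness.\<close> The harmonic polynomials, the orthogonal complement \<open>H\<close> of the ideal generated by the
  augmentation ideal, generate \<open>A\<close> over \<open>\<Lambda>\<close> by the graded Nakayama lemma, and \<open>dim H \<le> k!\<close> since the
  coinvariants are spanned by the Artin monomials. Evaluation on the orbit of a point with distinct
  coordinates maps \<open>A\<close> onto the \<open>k!\<close>-dimensional group algebra and turns \<open>\<Lambda>\<close> into scalars, so it maps \<open>H\<close>
  isomorphically (\<open>orbit_eval_harmonic_inj\<close>). This identifies the coinvariants with the regular
  representation, and shows that vectors of \<open>H\<close> that are linearly independent remain independent over
  \<open>\<Lambda>\<close>: a relation, evaluated at a point where a coefficient does not vanish, becomes a linear one. So a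
  homogeneous linear basis of \<open>H e\<close> is a \<open>\<Lambda>\<close>-basis of \<open>A e\<close> (\<open>ex_homog_basis_esym\<close>).

  \<^bold>\<open>The graded rank.\<close> The part of \<open>A e\<close> of degree \<open>d\<close> has as a basis the \<open>m e\<close> where the exponents of \<open>m\<close>
  decrease weakly along the rows, strictly down the columns, and add up to \<open>d\<close>: spanning follows from
  Garnir relations, independence from the rearrangement inequality. The nonzero entries of such a
  filling form a smaller shape, and decreasing them by \<open>1\<close> gives a recursion for the generating function.
  A Jacobi-Trudi determinant satisfies the same recursion, and Newton interpolation evaluates it as
  the hook product (\<open>rtab_gf\<close>). Since \<open>\<Lambda>\<close> itself is the case of one row, the quotient of the two
  generating functions counts the basis elements and is the Kostka polynomial.

  \<^bold>\<open>The quotient.\<close> Given any isomorphism \<open>\<psi>\<close> from the coinvariants to the group algebra, the class of an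
  element \<open>m\<close> of the module is sent to the homomorphism \<open>v \<mapsto> \<psi> (m v)\<close> (\<open>class_hom_iso\<close>).
\<close>

section \<open>Polynomials as finitely supported functions\<close>

\<comment> \<open>The notation \<open>inv\<close> is kept for the inverse function.\<close>
unbundle no m_inv_syntax

\<comment> \<open>Boxes and variables are numbered from \<open>1\<close>, which would be rewritten to \<open>Suc 0\<close>.\<close>
declare One_nat_def [simp del]

abbreviation lookup :: "('a \<Rightarrow>\<^sub>0 'b::zero) \<Rightarrow> 'a \<Rightarrow> 'b" where "lookup \<equiv> Poly_Mapping.lookup"
abbreviation keys :: "('a \<Rightarrow>\<^sub>0 'b::zero) \<Rightarrow> 'a set" where "keys \<equiv> Poly_Mapping.keys"
abbreviation single :: "'a \<Rightarrow> 'b \<Rightarrow> ('a \<Rightarrow>\<^sub>0 'b::zero)" where "single \<equiv> Poly_Mapping.single"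
abbreviation lin :: "(('a \<Rightarrow>\<^sub>0 complex) \<Rightarrow> ('b \<Rightarrow>\<^sub>0 complex)) \<Rightarrow> bool" where
  "lin \<equiv> module_hom cscale cscale"

lemma poly_mapping_sum_single: "(\<Sum>x\<in>keys v. single x (lookup v x)) = v"
  by (rule poly_mapping_eqI) (simp add: lookup_sum lookup_single when_def in_keys_iff)

lemma poly_mapping_single_induct [case_names single add]:
  fixes v :: "'a \<Rightarrow>\<^sub>0 'b::comm_monoid_add"
  assumes "\<And>x c. P (single x c)" and "\<And>u v. P u \<Longrightarrow> P v \<Longrightarrow> P (u + v)"
  shows "P v"
proof -
  have "P (\<Sum>x\<in>F. single x (lookup v x))" if "finite F" for F
    using that
  proof induction
    case empty
    show ?case using assms(1)[of undefined 0] by simp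
  next
    case (insert x F)
    then show ?case by (simp add: assms)
  qed
  from this[of "keys v"] show ?thesis by (simp add: poly_mapping_sum_single)
qed

subsection \<open>Linear maps\<close>

lemma linI:
  assumes "\<And>x y. f (x + y) = f x + f y" and "\<And>c x. f (cscale c x) = cscale c (f x)"
  shows "lin f"
  by (simp add: module_hom_iff cvs.module_axioms assms)

lemma cscale_single [simp]: "cscale c (single x d) = single x (c * d)"
  by (rule poly_mapping_eqI) (simp add: lookup_cscale lookup_single when_def)

lemma lin_cscale [intro]: "lin f \<Longrightarrow> lin (\<lambda>x. cscale c (f x))"
  by (intro linI) (simp_all add: module_hom.add module_hom.scale cvs.scale_right_distrib mult.commute)

lemma lin_sum [intro]: "(\<And>i. i \<in> I \<Longrightarrow> lin (f i)) \<Longrightarrow> lin (\<lambda>x. \<Sum>i\<in>I. f i x)"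
proof (rule linI)
  assume f: "\<And>i. i \<in> I \<Longrightarrow> lin (f i)"
  show "(\<Sum>i\<in>I. f i (x + y)) = (\<Sum>i\<in>I. f i x) + (\<Sum>i\<in>I. f i y)" for x y
    unfolding sum.distrib[symmetric] by (rule sum.cong) (simp_all add: module_hom.add[OF f])
  show "(\<Sum>i\<in>I. f i (cscale c x)) = cscale c (\<Sum>i\<in>I. f i x)" for c x
    unfolding cvs.scale_sum_right by (rule sum.cong) (simp_all add: module_hom.scale[OF f])
qed

lemma lin_comp: "lin f \<Longrightarrow> lin g \<Longrightarrow> lin (\<lambda>x. f (g x))"
  by (intro linI) (simp_all add: module_hom.add module_hom.scale)

lemma span_subset_subspaceI: "S \<subseteq> T \<Longrightarrow> cvs.subspace T \<Longrightarrow> cvs.span S \<subseteq> T"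
  by (rule cvs.span_minimal)

lemma lin_span_image: "lin f \<Longrightarrow> f ` cvs.span S = cvs.span (f ` S)"
  by (rule module_hom.span_image[symmetric])

text \<open>A linear map out of a space spanned by at most \<open>N\<close> vectors that hits \<open>N\<close> independent vectors
  cannot kill a nonzero vector: extend that vector to a basis, and count the images of the rest.\<close>

lemma lin_inj_by_count:
  assumes f: "lin f" and S: "finite S" "card S \<le> card I" and I: "cvs.independent I" "finite I"
    and sub: "I \<subseteq> f ` cvs.span S" and h: "h \<in> cvs.span S" "f h = 0"
  shows "h = 0"
proof (rule ccontr)
  assume "h \<noteq> 0"
  then have "cvs.independent {h}" by simp
  from cvs.maximal_independent_subset_extend[of "{h}" "cvs.span S", OF _ this] h(1)
  obtain B where B: "{h} \<subseteq> B" "B \<subseteq> cvs.span S" "cvs.independent B" "cvs.span S \<subseteq> cvs.span B"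
    by blast
  from cvs.independent_span_bound[OF S(1) B(3) B(2)] have fB: "finite B" "card B \<le> card S" by auto
  have "f ` cvs.span S \<subseteq> cvs.span (f ` (B - {h}))"
  proof
    fix y assume "y \<in> f ` cvs.span S"
    then have "y \<in> f ` cvs.span B" using B(4) by blast
    then have "y \<in> cvs.span (f ` B)" by (simp add: lin_span_image[OF f])
    moreover have "f ` B = insert 0 (f ` (B - {h}))" using B(1) h(2) by auto
    ultimately show "y \<in> cvs.span (f ` (B - {h}))" by simp
  qed
  with sub have "I \<subseteq> cvs.span (f ` (B - {h}))" by blast
  from cvs.independent_span_bound[OF _ I(1) this] fB
  have "card I \<le> card (f ` (B - {h}))" by simp
  also have "\<dots> \<le> card (B - {h})" using fB by (simp add: card_image_le)
  also have "\<dots> < card B" using B(1) fB by (intro psubset_card_mono) auto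
  finally show False using fB S by simp
qed

subsection \<open>Push-forward\<close>

lemma push_keys_superset:
  assumes "finite S" "keys v \<subseteq> S"
  shows "push_keys f v = (\<Sum>x\<in>S. single (f x) (lookup v x))"
  unfolding push_keys_def using assms
  by (intro sum.mono_neutral_left) (auto simp: in_keys_iff)

lemma push_keys_add: "push_keys f (u + v) = push_keys f u + push_keys f v"
proof -
  let ?S = "keys u \<union> keys v"
  have "keys (u + v) \<subseteq> ?S" by (rule keys_add)
  then show ?thesis
    by (simp add: push_keys_superset[of ?S] lookup_add single_add sum.distrib)
qed

lemma push_keys_single [simp]: "push_keys f (single x c) = single (f x) c"
  by (cases "c = 0") (simp_all add: push_keys_def)

lemma push_keys_zero [simp]: "push_keys f 0 = 0"
  by (simp add: push_keys_def)

lemma push_keys_sum: "push_keys f (sum g I) = (\<Sum>i\<in>I. push_keys f (g i))"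
  by (induction I rule: infinite_finite_induct) (simp_all add: push_keys_add)

lemma lin_push_keys: "lin (push_keys f)"
proof (rule linI)
  fix c v show "push_keys f (cscale c v) = cscale c (push_keys f v)"
    by (induction v rule: poly_mapping_single_induct)
      (simp_all add: push_keys_add cvs.scale_right_distrib)
qed (rule push_keys_add)

lemma push_keys_comp: "push_keys f (push_keys g v) = push_keys (\<lambda>x. f (g x)) v"
  by (induction v rule: poly_mapping_single_induct) (simp_all add: push_keys_add)

lemma push_keys_ident [simp]: "push_keys (\<lambda>x. x) v = v"
  by (simp add: push_keys_def poly_mapping_sum_single)

lemma push_keys_id [simp]: "push_keys id v = v"
  using push_keys_ident by (simp add: id_def)

lemma lookup_push_keys_inj:
  assumes "inj f" shows "lookup (push_keys f v) (f x) = lookup v x"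
proof -
  have "(f y = f x) = (y = x)" for y using assms by (auto dest: injD)
  then show ?thesis
    by (simp add: push_keys_def lookup_sum lookup_single when_def in_keys_iff)
qed

lemma lookup_push_keys_outside: "y \<notin> f ` keys v \<Longrightarrow> lookup (push_keys f v) y = 0"
  by (auto simp: push_keys_def lookup_sum lookup_single when_def intro!: sum.neutral)

lemma keys_push_keys_subset: "keys (push_keys f v) \<subseteq> f ` keys v"
  using lookup_push_keys_outside by (fastforce simp: in_keys_iff)

lemma keys_push_keys_inj: "inj f \<Longrightarrow> keys (push_keys f v) = f ` keys v"
  using keys_push_keys_subset[of f v] by (auto simp: in_keys_iff lookup_push_keys_inj)

lemma lookup_push_keys_bij:
  assumes "bij f" shows "lookup (push_keys f v) y = lookup v (inv f y)"
  using lookup_push_keys_inj[of f v "inv f y"] assms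
  by (simp add: bij_is_inj bij_is_surj surj_f_inv_f)

subsection \<open>Monomials and degrees\<close>

abbreviation mon :: "(nat \<Rightarrow>\<^sub>0 nat) \<Rightarrow> mpol" where "mon m \<equiv> single m 1"

definition Mon :: "nat \<Rightarrow> (nat \<Rightarrow>\<^sub>0 nat) set" where "Mon k = {m. keys m \<subseteq> {1..k}}"

lemma mdeg_superset: "finite S \<Longrightarrow> keys m \<subseteq> S \<Longrightarrow> mdeg m = (\<Sum>i\<in>S. lookup m i)"
  unfolding mdeg_def by (intro sum.mono_neutral_left) (auto simp: in_keys_iff)

lemma mdeg_Mon: "m \<in> Mon k \<Longrightarrow> mdeg m = (\<Sum>i=1..k. lookup m i)"
  by (rule mdeg_superset) (auto simp: Mon_def)

lemma mdeg_add: "mdeg (m + m') = mdeg m + mdeg m'"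
proof -
  let ?S = "keys m \<union> keys m'"
  have "keys (m + m') \<subseteq> ?S" by (rule keys_add)
  then show ?thesis by (simp add: mdeg_superset[of ?S] lookup_add sum.distrib)
qed

lemma mdeg_0 [simp]: "mdeg 0 = 0"
  by (simp add: mdeg_def)

lemma mdeg_eq_0_iff [simp]: "mdeg m = 0 \<longleftrightarrow> m = 0"
  by (auto simp: mdeg_def in_keys_iff intro: poly_mapping_eqI)

lemma Mon_add: "m \<in> Mon k \<Longrightarrow> m' \<in> Mon k \<Longrightarrow> m + m' \<in> Mon k"
  using keys_add[of m m'] by (auto simp: Mon_def)

lemma Mon_0 [simp]: "0 \<in> Mon k"
  by (simp add: Mon_def)

lemma lookup_le_mdeg: "lookup m i \<le> mdeg m"
proof (cases "i \<in> keys m")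
  case True
  then show ?thesis unfolding mdeg_def by (intro member_le_sum) auto
qed (simp add: in_keys_iff)

lemma finite_bounded_Mon: "finite {m \<in> Mon k. \<forall>i. lookup m i \<le> N i}"
proof -
  have "inj_on (\<lambda>m. restrict (lookup m) {1..k}) {m \<in> Mon k. \<forall>i. lookup m i \<le> N i}"
  proof (rule inj_onI)
    fix m m' assume mm: "m \<in> {m \<in> Mon k. \<forall>i. lookup m i \<le> N i}" "m' \<in> {m \<in> Mon k. \<forall>i. lookup m i \<le> N i}"
      and eq: "restrict (lookup m) {1..k} = restrict (lookup m') {1..k}"
    show "m = m'"
    proof (rule poly_mapping_eqI)
      fix i show "lookup m i = lookup m' i"
      proof (cases "i \<in> {1..k}")
        case True
        then show ?thesis using fun_cong[OF eq, of i] by simp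
      next
        case False
        then have "i \<notin> keys m" "i \<notin> keys m'" using mm by (auto simp: Mon_def)
        then show ?thesis by (simp add: in_keys_iff)
      qed
    qed
  qed
  moreover have "(\<lambda>m. restrict (lookup m) {1..k}) ` {m \<in> Mon k. \<forall>i. lookup m i \<le> N i} \<subseteq> (\<Pi>\<^sub>E i\<in>{1..k}. {..N i})"
    by auto
  ultimately show ?thesis
    by (meson finite_PiE finite_atLeastAtMost finite_atMost inj_on_finite)
qed

lemma finite_Mon_deg: "finite {m \<in> Mon k. mdeg m = d}"
  by (rule finite_subset[OF _ finite_bounded_Mon[of k "\<lambda>_. d"]]) (auto intro: lookup_le_mdeg)

definition polys_deg :: "nat \<Rightarrow> nat \<Rightarrow> mpol set" where "polys_deg k d = {p \<in> polys k. homog d p}"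

lemma span_mon: "cvs.span (mon ` S) = {p. keys p \<subseteq> S}"
proof (intro equalityI span_subset_subspaceI)
  show "cvs.subspace {p::mpol. keys p \<subseteq> S}"
  proof (intro cvs.subspaceI)
    fix p q :: mpol assume "p \<in> {p. keys p \<subseteq> S}" "q \<in> {p. keys p \<subseteq> S}"
    then show "p + q \<in> {p. keys p \<subseteq> S}" using keys_add[of p q] by auto
  qed (auto simp: in_keys_iff lookup_cscale)
  show "{p. keys p \<subseteq> S} \<subseteq> cvs.span (mon ` S)"
  proof
    fix p :: mpol assume p: "p \<in> {p. keys p \<subseteq> S}"
    have "(\<Sum>x\<in>keys p. cscale (lookup p x) (mon x)) \<in> cvs.span (mon ` S)"
      using p by (intro cvs.span_sum cvs.span_scale cvs.span_base) auto
    then show "p \<in> cvs.span (mon ` S)" by (simp add: poly_mapping_sum_single)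
  qed
qed auto

lemma polys_alt: "polys k = cvs.span (mon ` Mon k)"
  by (auto simp: span_mon polys_def Mon_def)

lemma polys_deg_alt: "polys_deg k d = cvs.span (mon ` {m \<in> Mon k. mdeg m = d})"
  by (auto simp: span_mon polys_deg_def polys_def Mon_def homog_def)

lemma subspace_polys: "cvs.subspace (polys k)"
  by (simp add: polys_alt)

lemma subspace_polys_deg: "cvs.subspace (polys_deg k d)"
  by (simp add: polys_deg_alt)

lemma mon_in_polys: "m \<in> Mon k \<Longrightarrow> single m c \<in> polys k"
  by (auto simp: polys_def Mon_def)

lemma polys_mult: assumes "p \<in> polys k" "q \<in> polys k" shows "p * q \<in> polys k"
  unfolding polys_def
proof (intro CollectI ballI)
  fix m assume "m \<in> keys (p * q)"
  then obtain a b where "m = a + b" "a \<in> keys p" "b \<in> keys q" using keys_mult[of p q] by blast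
  moreover from this assms have "keys a \<subseteq> {1..k}" "keys b \<subseteq> {1..k}" by (auto simp: polys_def)
  ultimately show "keys m \<subseteq> {1..k}" using keys_add[of a b] by blast
qed

lemma polys_sum: "(\<And>i. i \<in> I \<Longrightarrow> f i \<in> polys k) \<Longrightarrow> sum f I \<in> polys k"
  by (rule cvs.subspace_sum[OF subspace_polys])

lemma single_0_in_polys [simp]: "single 0 c \<in> polys k"
  by (simp add: mon_in_polys)

lemma one_in_polys [simp]: "1 \<in> polys k"
  using single_0_in_polys[of 1 k] by simp

lemma polys_prod: "(\<And>i. i \<in> I \<Longrightarrow> f i \<in> polys k) \<Longrightarrow> prod f I \<in> polys k"
  by (induction I rule: infinite_finite_induct) (auto intro: polys_mult)

lemma cscale_conv_mult: "cscale c p = single 0 c * (p::mpol)"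
  by (simp add: cscale_def mult_map_scale_conv_mult)

lemma cscale_mult_left: "cscale c p * q = cscale c (p * q::mpol)"
  by (simp add: cscale_conv_mult mult.assoc)

lemma cscale_mult_right: "p * cscale c q = cscale c (p * q::mpol)"
  by (simp add: cscale_conv_mult mult.left_commute)

lemma lin_mult_left: "lin (\<lambda>q. p * q :: mpol)"
  by (rule linI) (simp_all add: distrib_left cscale_mult_right)

lemma lin_mult_right: "lin (\<lambda>q. q * p :: mpol)"
  by (rule linI) (simp_all add: distrib_right cscale_mult_left)

lemma lookup_hom_part: "lookup (hom_part s p) m = (if mdeg m = s then lookup p m else 0)"
proof -
  have "hom_part s p = (\<Sum>m'\<in>keys p. if mdeg m' = s then single m' (lookup p m') else 0)"
    unfolding hom_part_def by (intro sum.mono_neutral_cong_left) auto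
  then have "lookup (hom_part s p) m = (\<Sum>m'\<in>keys p. lookup (if mdeg m' = s then single m' (lookup p m') else 0) m)"
    by (simp only: lookup_sum)
  also have "\<dots> = (\<Sum>m'\<in>keys p. if m' = m then if mdeg m = s then lookup p m else 0 else 0)"
    by (rule sum.cong) (auto simp: lookup_single when_def)
  finally have "lookup (hom_part s p) m = \<dots>" .
  then show ?thesis by (simp add: in_keys_iff)
qed

lemma lin_hom_part: "lin (hom_part s)"
  by (rule linI; rule poly_mapping_eqI) (simp_all add: lookup_hom_part lookup_add lookup_cscale)

lemmas hom_part_add = module_hom.add[OF lin_hom_part]
  and hom_part_scale = module_hom.scale[OF lin_hom_part]
  and hom_part_sum = module_hom.sum[OF lin_hom_part]

lemma hom_part_single: "hom_part s (single m c) = (if mdeg m = s then single m c else 0)"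
  by (rule poly_mapping_eqI) (auto simp: lookup_hom_part lookup_single when_def)

lemma homog_hom_part: "homog s (hom_part s p)"
  by (auto simp: homog_def in_keys_iff lookup_hom_part split: if_splits)

lemma homog_iff_hom_part: "homog s p \<longleftrightarrow> hom_part s p = p"
proof
  assume "homog s p"
  then show "hom_part s p = p"
    by (intro poly_mapping_eqI) (auto simp: lookup_hom_part homog_def in_keys_iff)
qed (metis homog_hom_part)

lemma hom_part_homog: "homog s p \<Longrightarrow> hom_part t p = (if s = t then p else 0)"
  by (auto intro!: poly_mapping_eqI simp: lookup_hom_part homog_def in_keys_iff)

lemma homog_0 [simp]: "homog s 0"
  by (simp add: homog_def)

lemma homog_scale: "homog s p \<Longrightarrow> homog s (cscale c p)"
  by (simp add: homog_iff_hom_part hom_part_scale)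

lemma homog_sum: "(\<And>i. i \<in> I \<Longrightarrow> homog s (f i)) \<Longrightarrow> homog s (sum f I)"
  by (simp add: homog_iff_hom_part hom_part_sum)

lemma homog_unique: "homog s p \<Longrightarrow> homog t p \<Longrightarrow> p \<noteq> 0 \<Longrightarrow> s = t"
  by (metis hom_part_homog homog_iff_hom_part)

lemma homog_mult:
  assumes "homog s p" "homog t q" shows "homog (s + t) (p * q)"
  unfolding homog_def
proof
  fix m assume "m \<in> keys (p * q)"
  then obtain a b where "m = a + b" "a \<in> keys p" "b \<in> keys q" using keys_mult[of p q] by blast
  then show "mdeg m = s + t" using assms by (auto simp: homog_def mdeg_add)
qed

lemma sum_hom_part:
  assumes "\<And>m. m \<in> keys p \<Longrightarrow> mdeg m \<le> N"
  shows "(\<Sum>s\<le>N. hom_part s p) = p"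
proof (rule poly_mapping_eqI)
  fix m
  show "lookup (\<Sum>s\<le>N. hom_part s p) m = lookup p m"
    using assms[of m] by (cases "m \<in> keys p") (auto simp: lookup_sum lookup_hom_part in_keys_iff)
qed

lemma ex_sum_hom_part: "\<exists>N. (\<Sum>s\<le>N. hom_part s p) = p"
proof
  show "(\<Sum>s\<le>Max (mdeg ` keys p). hom_part s p) = p" by (rule sum_hom_part) simp
qed

lemma hom_part_mult: "hom_part d (p * q) = (\<Sum>s\<le>d. hom_part s p * hom_part (d - s) q)"
proof (induction p rule: poly_mapping_single_induct)
  case (single m c)
  show ?case
  proof (induction q rule: poly_mapping_single_induct)
    case (single m' c')
    have "(\<Sum>s\<le>d. hom_part s (single m c) * hom_part (d - s) (single m' c'))
      = (\<Sum>s\<le>d. if s = mdeg m then (if mdeg m' = d - mdeg m then single (m + m') (c * c') else 0) else 0)"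
      by (intro sum.cong) (auto simp: hom_part_single mult_single)
    also have "\<dots> = hom_part d (single m c * single m' c')"
      by (auto simp: mult_single hom_part_single mdeg_add)
    finally show ?case ..
  qed (simp add: distrib_left hom_part_add sum.distrib)
qed (simp add: distrib_right hom_part_add sum.distrib)

lemma hom_part_homog_mult:
  assumes "homog s b"
  shows "hom_part d (f * b) = (if s \<le> d then hom_part (d - s) f * b else 0)"
proof -
  have "hom_part d (f * b) = (\<Sum>t\<le>d. hom_part t f * (if s = d - t then b else 0))"
    by (simp add: hom_part_mult hom_part_homog[OF assms])
  also have "\<dots> = (\<Sum>t\<le>d. if s \<le> d \<and> t = d - s then hom_part (d - s) f * b else 0)"
    by (intro sum.cong) auto
  finally show ?thesis by simp
qed

lemma hom_part_polys: "p \<in> polys k \<Longrightarrow> hom_part s p \<in> polys_deg k s"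
  by (auto simp: polys_deg_def homog_hom_part polys_def in_keys_iff lookup_hom_part split: if_splits)

subsection \<open>The action\<close>

definition mperm :: "(nat \<Rightarrow>\<^sub>0 nat) \<Rightarrow> (nat \<Rightarrow> nat) \<Rightarrow> (nat \<Rightarrow>\<^sub>0 nat)" where
  "mperm m \<sigma> = push_keys (inv \<sigma>) m"

lemma lookup_mperm: "bij \<sigma> \<Longrightarrow> lookup (mperm m \<sigma>) x = lookup m (\<sigma> x)"
  by (simp add: mperm_def lookup_push_keys_bij bij_imp_bij_inv inv_inv_eq)

lemma keys_mperm: "bij \<sigma> \<Longrightarrow> keys (mperm m \<sigma>) = inv \<sigma> ` keys m"
  by (simp add: mperm_def keys_push_keys_inj bij_imp_bij_inv bij_is_inj)

lemma mperm_comp: "bij \<sigma> \<Longrightarrow> bij \<tau> \<Longrightarrow> mperm (mperm m \<sigma>) \<tau> = mperm m (\<sigma> \<circ> \<tau>)"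
  by (rule poly_mapping_eqI) (simp add: lookup_mperm bij_comp)

lemma mperm_id [simp]: "mperm m id = m" "mperm m (\<lambda>x. x) = m"
  by (simp_all add: mperm_def inv_id[unfolded id_def])

lemma mdeg_mperm: "bij \<sigma> \<Longrightarrow> mdeg (mperm m \<sigma>) = mdeg m"
proof -
  assume b: "bij \<sigma>"
  have "mdeg (mperm m \<sigma>) = (\<Sum>i\<in>inv \<sigma> ` keys m. lookup m (\<sigma> i))"
    by (simp add: mdeg_def keys_mperm[OF b] lookup_mperm[OF b])
  also have "\<dots> = mdeg m"
    using b by (subst sum.reindex) (auto simp: mdeg_def bij_is_surj surj_f_inv_f inj_on_def intro: injD dest: bij_imp_bij_inv[THEN bij_is_inj, THEN injD])
  finally show ?thesis .
qed

lemma mperm_Mon: "\<sigma> permutes {1..k} \<Longrightarrow> m \<in> Mon k \<Longrightarrow> mperm m \<sigma> \<in> Mon k"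
  using permutes_in_image[OF permutes_inv, of \<sigma> "{1..k}"]
  by (auto simp: Mon_def keys_mperm permutes_bij)

lemma mperm_inj: "bij \<sigma> \<Longrightarrow> mperm m \<sigma> = mperm m' \<sigma> \<longleftrightarrow> m = m'"
proof
  assume b: "bij \<sigma>" and "mperm m \<sigma> = mperm m' \<sigma>"
  then have "lookup m (\<sigma> (inv \<sigma> x)) = lookup m' (\<sigma> (inv \<sigma> x))" for x
    by (metis lookup_mperm)
  then show "m = m'" using b by (auto intro!: poly_mapping_eqI simp: bij_is_surj surj_f_inv_f)
qed simp

lemma rename_single [simp]: "rename f (single m c) = single (push_keys f m) c"
  by (simp add: rename_def)

lemma lin_rename: "lin (rename f)"
  by (simp add: rename_def lin_push_keys)

lemma rename_add: "rename f (p + q) = rename f p + rename f q"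
  by (simp add: rename_def push_keys_add)

lemma rename_mult: "rename f (p * q) = rename f p * rename f q"
proof (induction p rule: poly_mapping_single_induct)
  case (single m c)
  show ?case
    by (induction q rule: poly_mapping_single_induct)
      (simp_all add: mult_single push_keys_add distrib_left rename_add)
qed (simp add: distrib_right rename_add)

lemma act_single [simp]: "act (single m c) \<sigma> = single (mperm m \<sigma>) c"
  by (simp add: act_def mperm_def)

lemma act_mult: "act (p * q) \<sigma> = act p \<sigma> * act q \<sigma>"
  by (simp add: act_def rename_mult)

lemma lin_act: "lin (\<lambda>p. act p \<sigma>)"
  by (simp add: act_def lin_rename)

lemmas act_add = module_hom.add[OF lin_act]
  and act_scale = module_hom.scale[OF lin_act]
  and act_sum = module_hom.sum[OF lin_act]
  and act_0 [simp] = module_hom.zero[OF lin_act]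

lemma act_comp: "bij \<sigma> \<Longrightarrow> bij \<tau> \<Longrightarrow> act (act p \<sigma>) \<tau> = act p (\<sigma> \<circ> \<tau>)"
  by (induction p rule: poly_mapping_single_induct) (simp_all add: mperm_comp act_add)

lemma act_id [simp]: "act p id = p"
  by (induction p rule: poly_mapping_single_induct) (simp_all add: act_add)

lemma hom_part_act: "bij \<sigma> \<Longrightarrow> hom_part s (act p \<sigma>) = act (hom_part s p) \<sigma>"
  by (induction p rule: poly_mapping_single_induct)
    (simp_all add: act_add hom_part_add hom_part_single mdeg_mperm)

lemma homog_act: "bij \<sigma> \<Longrightarrow> homog s p \<Longrightarrow> homog s (act p \<sigma>)"
  by (simp add: homog_iff_hom_part hom_part_act)

lemma act_polys: assumes "\<sigma> permutes {1..k}" "p \<in> polys k" shows "act p \<sigma> \<in> polys k"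
proof -
  have "act p \<sigma> \<in> (\<lambda>p. act p \<sigma>) ` cvs.span (mon ` Mon k)" using assms by (auto simp: polys_alt)
  also have "\<dots> = cvs.span ((\<lambda>p. act p \<sigma>) ` mon ` Mon k)" by (simp add: lin_span_image lin_act)
  also have "\<dots> \<subseteq> polys k" unfolding polys_alt
    using assms by (intro cvs.span_mono) (auto intro!: imageI mperm_Mon)
  finally show ?thesis .
qed

lemma gact_single [simp]: "gact (single g c) \<sigma> = single (g \<circ> \<sigma>) c"
  by (simp add: gact_def)

lemma lin_gact: "lin (\<lambda>v. gact v \<sigma>)"
  by (simp add: gact_def lin_push_keys)

lemma gact_comp: "gact (gact v \<sigma>) \<tau> = gact v (\<sigma> \<circ> \<tau>)"
  by (simp add: gact_def push_keys_comp comp_def)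

lemma gact_id [simp]: "gact v id = v"
  by (simp add: gact_def)

lemma inj_comp_right: "bij \<sigma> \<Longrightarrow> inj (\<lambda>g. g \<circ> \<sigma>)"
  by (rule injI) (metis bij_is_surj comp_id o_assoc surj_iff)

lemma lookup_gact: "bij \<sigma> \<Longrightarrow> lookup (gact v \<sigma>) g = lookup v (g \<circ> inv \<sigma>)"
  using lookup_push_keys_inj[OF inj_comp_right, of \<sigma> v "g \<circ> inv \<sigma>"]
  by (simp add: gact_def o_assoc[symmetric] bij_is_inj inv_o_cancel)

lemma gact_GA: assumes "\<sigma> permutes {1..k}" "v \<in> GA k" shows "gact v \<sigma> \<in> GA k"
  using keys_push_keys_subset[of "\<lambda>g. g \<circ> \<sigma>" v] assms permutes_compose
  by (fastforce simp: GA_def gact_def)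

lemma GA_alt: "GA k = cvs.span ((\<lambda>g. single g 1) ` {g. g permutes {1..k}})"
proof (intro equalityI span_subset_subspaceI)
  show "GA k \<subseteq> cvs.span ((\<lambda>g. single g 1) ` {g. g permutes {1..k}})"
  proof
    fix v assume v: "v \<in> GA k"
    have "(\<Sum>x\<in>keys v. cscale (lookup v x) (single x 1)) \<in> cvs.span ((\<lambda>g. single g 1) ` {g. g permutes {1..k}})"
      using v by (intro cvs.span_sum cvs.span_scale cvs.span_base) (auto simp: GA_def)
    then show "v \<in> cvs.span ((\<lambda>g. single g 1) ` {g. g permutes {1..k}})"
      by (simp add: poly_mapping_sum_single)
  qed
  show "cvs.subspace (GA k)"
  proof (intro cvs.subspaceI)
    fix p q assume "p \<in> GA k" "q \<in> GA k"
    then show "p + q \<in> GA k" using keys_add[of p q] by (auto simp: GA_def)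
  qed (auto simp: in_keys_iff lookup_cscale GA_def)
qed (auto simp: GA_def)

lemma subspace_GA: "cvs.subspace (GA k)"
  by (simp add: GA_alt)

subsection \<open>Symmetric polynomials and submodules\<close>

lemma sympolys_polys: "f \<in> sympolys k \<Longrightarrow> f \<in> polys k"
  by (simp add: sympolys_def)

lemma sympolys_act: "f \<in> sympolys k \<Longrightarrow> \<sigma> permutes {1..k} \<Longrightarrow> act f \<sigma> = f"
  by (simp add: sympolys_def)

lemma subspace_sympolys: "cvs.subspace (sympolys k)"
  by (intro cvs.subspaceI)
    (auto simp: sympolys_def act_add act_scale cvs.subspace_0[OF subspace_polys]
      intro: cvs.subspace_add[OF subspace_polys] cvs.subspace_scale[OF subspace_polys])

lemma sympolys_mult: "f \<in> sympolys k \<Longrightarrow> g \<in> sympolys k \<Longrightarrow> f * g \<in> sympolys k"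
  by (simp add: sympolys_def act_mult polys_mult)

lemma sympolys_const [simp]: "single 0 c \<in> sympolys k"
  by (simp add: sympolys_def mperm_def)

lemma sympolys_1 [simp]: "1 \<in> sympolys k"
  using sympolys_const[of 1 k] by simp

lemma sympolys_hom_part: "f \<in> sympolys k \<Longrightarrow> hom_part s f \<in> sympolys k"
  using hom_part_polys[of f k s]
  by (auto simp: sympolys_def polys_deg_def hom_part_act[symmetric] permutes_bij)

lemma submod_subspace: "submod (sympolys k) N \<Longrightarrow> cvs.subspace N"
  by (intro cvs.subspaceI) (auto simp: submod_def cscale_conv_mult)

lemma submod_span_mult:
  "submod (sympolys k) (cvs.span {f * g | f g. f \<in> sympolys k \<and> g \<in> G})"
  unfolding submod_def
proof (intro conjI ballI cvs.span_zero cvs.span_add)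
  let ?S = "{f * g | f g. f \<in> sympolys k \<and> g \<in> G}"
  fix f p assume f: "f \<in> sympolys k" and "p \<in> cvs.span ?S"
  then have "f * p \<in> (\<lambda>p. f * p) ` cvs.span ?S" by blast
  also have "\<dots> = cvs.span ((\<lambda>p. f * p) ` ?S)" by (simp add: lin_span_image lin_mult_left)
  also have "\<dots> \<subseteq> cvs.span ?S"
  proof (intro cvs.span_mono subsetI)
    fix x assume "x \<in> (\<lambda>p. f * p) ` ?S"
    then obtain f' g where "f' \<in> sympolys k" "g \<in> G" "x = (f * f') * g" by (auto simp: mult.assoc)
    then show "x \<in> ?S" using sympolys_mult[OF f] by blast
  qed
  finally show "f * p \<in> cvs.span ?S" .
qed

text \<open>Constants are symmetric, so a submodule is in particular a subspace, and generating it
  amounts to taking the linear span of the multiples of the generators.\<close>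

lemma gen_submod_eq_span:
  "gen_submod (sympolys k) G = cvs.span {f * g | f g. f \<in> sympolys k \<and> g \<in> G}"
  unfolding gen_submod_def
proof (rule hull_unique)
  show "G \<subseteq> cvs.span {f * g | f g. f \<in> sympolys k \<and> g \<in> G}"
  proof
    fix g assume "g \<in> G"
    then have "1 * g \<in> {f * g | f g. f \<in> sympolys k \<and> g \<in> G}" using sympolys_1 by blast
    then show "g \<in> cvs.span {f * g | f g. f \<in> sympolys k \<and> g \<in> G}" by (simp add: cvs.span_base)
  qed
next
  fix N assume "G \<subseteq> N" "submod (sympolys k) N"
  then show "cvs.span {f * g | f g. f \<in> sympolys k \<and> g \<in> G} \<subseteq> N"
    by (intro span_subset_subspaceI) (auto simp: submod_subspace, auto simp: submod_def)
qed (rule submod_span_mult)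

lemma gen_submod_base: "g \<in> G \<Longrightarrow> g \<in> gen_submod R G"
  by (simp add: gen_submod_def hull_inc)

lemma gen_submod_minimal: "G \<subseteq> N \<Longrightarrow> submod R N \<Longrightarrow> gen_submod R G \<subseteq> N"
  by (simp add: gen_submod_def hull_minimal)

lemma submod_gen_submod: "submod (sympolys k) (gen_submod (sympolys k) G)"
  unfolding gen_submod_eq_span by (rule submod_span_mult)

lemma subspace_gen_submod: "cvs.subspace (gen_submod (sympolys k) G)"
  by (simp add: gen_submod_eq_span)

lemma gen_submod_mult: "f \<in> sympolys k \<Longrightarrow> p \<in> gen_submod (sympolys k) G \<Longrightarrow> f * p \<in> gen_submod (sympolys k) G"
  using submod_gen_submod by (auto simp: submod_def)

lemma augm_mult_eq_span:
  assumes "submod (sympolys k) N"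
  shows "augm_mult k N = cvs.span {f * p | f p. f \<in> augm k \<and> p \<in> N}"
  unfolding augm_mult_def
proof (intro equalityI gen_submod_minimal cvs.span_superset)
  show "cvs.span {f * p | f p. f \<in> augm k \<and> p \<in> N} \<subseteq> gen_submod (sympolys k) {f * p | f p. f \<in> augm k \<and> p \<in> N}"
    by (intro span_subset_subspaceI subspace_gen_submod) (auto intro: gen_submod_base)
  let ?S = "{f * p | f p. f \<in> augm k \<and> p \<in> N}"
  show "submod (sympolys k) (cvs.span ?S)"
    unfolding submod_def
  proof (intro conjI ballI cvs.span_zero cvs.span_add)
    fix f p assume f: "f \<in> sympolys k" and "p \<in> cvs.span ?S"
    then have "f * p \<in> (\<lambda>p. f * p) ` cvs.span ?S" by blast
    also have "\<dots> = cvs.span ((\<lambda>p. f * p) ` ?S)" by (simp add: lin_span_image lin_mult_left)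
    also have "\<dots> \<subseteq> cvs.span ?S"
    proof (intro cvs.span_mono subsetI)
      fix x assume "x \<in> (\<lambda>p. f * p) ` ?S"
      then obtain f' p where "f' \<in> augm k" "p \<in> N" "x = f' * (f * p)" by (auto simp: mult.left_commute)
      moreover from this have "f * p \<in> N" using f assms by (simp add: submod_def)
      ultimately show "x \<in> ?S" by blast
    qed
    finally show "f * p \<in> cvs.span ?S" .
  qed
qed

lemma submod_polys: "submod (sympolys k) (polys k)"
  by (auto simp: submod_def sympolys_def intro: polys_mult cvs.subspace_add[OF subspace_polys]
    cvs.subspace_0[OF subspace_polys])

subsection \<open>The Hermitian form\<close>

text \<open>The form for which the basis elements are orthonormal. Permutations of the basis preserve it, so
  row and column sums are self-adjoint and orthogonal complements of invariant subspaces are invariant.\<close>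

definition ip :: "('a \<Rightarrow>\<^sub>0 complex) \<Rightarrow> ('a \<Rightarrow>\<^sub>0 complex) \<Rightarrow> complex" where
  "ip u v = (\<Sum>x\<in>keys u. lookup u x * cnj (lookup v x))"

lemma ip_superset: "finite S \<Longrightarrow> keys u \<subseteq> S \<Longrightarrow> ip u v = (\<Sum>x\<in>S. lookup u x * cnj (lookup v x))"
  unfolding ip_def by (intro sum.mono_neutral_left) (auto simp: in_keys_iff)

lemma ip_add_left: "ip (u + u') v = ip u v + ip u' v"
proof -
  let ?S = "keys u \<union> keys u'"
  have "keys (u + u') \<subseteq> ?S" by (rule keys_add)
  then show ?thesis by (simp add: ip_superset[of ?S] lookup_add sum.distrib distrib_right)
qed

lemma ip_scale_left: "ip (cscale c u) v = c * ip u v"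
proof -
  have "keys (cscale c u) \<subseteq> keys u" by (auto simp: in_keys_iff lookup_cscale)
  then show ?thesis by (simp add: ip_superset[of "keys u"] lookup_cscale sum_distrib_left mult.assoc)
qed

lemma ip_commute: "ip u v = cnj (ip v u)"
proof -
  let ?S = "keys u \<union> keys v"
  show ?thesis by (simp add: ip_superset[of ?S] mult.commute)
qed

lemma ip_add_right: "ip u (v + v') = ip u v + ip u v'"
  by (simp add: ip_commute[of u] ip_add_left)

lemma ip_scale_right: "ip u (cscale c v) = cnj c * ip u v"
  by (simp add: ip_commute[of u] ip_scale_left)

lemma ip_0_left [simp]: "ip 0 v = 0" by (simp add: ip_def)
lemma ip_0_right [simp]: "ip u 0 = 0" by (simp add: ip_def)

lemma ip_minus_left: "ip (u - u') v = ip u v - ip u' v"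
  using ip_add_left[of "u - u'" u' v] by simp

lemma ip_sum_left: "ip (sum f I) v = (\<Sum>i\<in>I. ip (f i) v)"
  by (induction I rule: infinite_finite_induct) (simp_all add: ip_add_left)

lemma ip_sum_right: "ip u (sum f I) = (\<Sum>i\<in>I. ip u (f i))"
  by (induction I rule: infinite_finite_induct) (simp_all add: ip_add_right)

lemma ip_eq_0_iff [simp]: "ip u u = 0 \<longleftrightarrow> u = 0"
proof
  assume "ip u u = 0"
  then have "Re (\<Sum>x\<in>keys u. lookup u x * cnj (lookup u x)) = 0" by (simp add: ip_def)
  then have "(\<Sum>x\<in>keys u. (cmod (lookup u x))\<^sup>2) = 0"
    by (simp add: complex_mult_cnj cmod_def)
  then have "\<forall>x\<in>keys u. (cmod (lookup u x))\<^sup>2 = 0"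
    by (subst (asm) sum_nonneg_eq_0_iff) auto
  then show "u = 0" by (intro poly_mapping_eqI) (auto simp: in_keys_iff)
qed simp

lemma ip_push_keys: "inj f \<Longrightarrow> ip (push_keys f u) (push_keys f v) = ip u v"
  by (simp add: ip_def keys_push_keys_inj lookup_push_keys_inj sum.reindex inj_on_subset)

lemma subspace_orthogonal: "cvs.subspace {u. \<forall>v\<in>S. ip u v = 0}"
  by (intro cvs.subspaceI) (auto simp: ip_add_left ip_scale_left)

lemma orthogonal_span:
  assumes "\<And>s. s \<in> S \<Longrightarrow> ip u s = 0" and "w \<in> cvs.span S"
  shows "ip u w = 0"
proof -
  have "cvs.subspace {w. ip u w = 0}"
    by (intro cvs.subspaceI) (auto simp: ip_add_right ip_scale_right)
  then have "cvs.span S \<subseteq> {w. ip u w = 0}" using assms(1) by (intro span_subset_subspaceI) auto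
  then show ?thesis using assms(2) by blast
qed

text \<open>Gram-Schmidt: adding a generator enlarges the span by its component orthogonal to the old one.\<close>

lemma ex_orthogonal_projection:
  assumes "finite S"
  shows "\<exists>w\<in>cvs.span S. \<forall>s\<in>cvs.span S. ip (u - w) s = 0"
  using assms
proof (induction S arbitrary: u)
  case empty
  show ?case by simp
next
  case (insert x S)
  from insert.IH obtain y where y: "y \<in> cvs.span S" "\<forall>s\<in>cvs.span S. ip (x - y) s = 0" by blast
  from insert.IH obtain z where z: "z \<in> cvs.span S" "\<forall>s\<in>cvs.span S. ip (u - z) s = 0" by blast
  \<comment> \<open>If \<open>x\<close> lies in the old span then \<open>x - y = 0\<close>, and \<open>c\<close> is \<open>0 / 0 = 0\<close>.\<close>
  define c where "c = ip (u - z) (x - y) / ip (x - y) (x - y)"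
  define w where "w = z + cscale c (x - y)"
  have w: "w \<in> cvs.span (insert x S)"
    using y(1) z(1) cvs.span_mono[of S "insert x S"] unfolding w_def
    by (intro cvs.span_add cvs.span_scale cvs.span_diff) (auto intro: cvs.span_base)
  have S: "ip (u - w) s = 0" if "s \<in> cvs.span S" for s
    using y z that by (simp add: w_def diff_diff_add[symmetric] ip_minus_left ip_scale_left)
  have "ip (u - w) (x - y) = ip (u - z) (x - y) - c * ip (x - y) (x - y)"
    by (simp add: w_def diff_diff_add[symmetric] ip_minus_left[of "u - z"] ip_scale_left)
  also have "\<dots> = 0"
    using ip_eq_0_iff[of "x - y"] by (cases "x - y = 0") (simp_all add: c_def del: ip_eq_0_iff)
  finally have "ip (u - w) (x - y) = 0" .
  with S[OF y(1)] have "ip (u - w) x = 0"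
    using ip_add_right[of "u - w" "x - y" y] by simp
  with S have "\<forall>s\<in>insert x S. ip (u - w) s = 0" by (auto intro: cvs.span_base)
  then have "\<forall>s\<in>cvs.span (insert x S). ip (u - w) s = 0" using orthogonal_span by blast
  with w show ?case by blast
qed

section \<open>Young symmetrizers\<close>

subsection \<open>Right modules over the symmetric group\<close>

locale perm_module =
  fixes k :: nat and \<alpha> :: "('a \<Rightarrow>\<^sub>0 complex) \<Rightarrow> (nat \<Rightarrow> nat) \<Rightarrow> ('a \<Rightarrow>\<^sub>0 complex)"
  assumes lin_\<alpha>: "lin (\<lambda>x. \<alpha> x \<sigma>)"
    and \<alpha>_comp: "\<sigma> permutes {1..k} \<Longrightarrow> \<tau> permutes {1..k} \<Longrightarrow> \<alpha> (\<alpha> x \<sigma>) \<tau> = \<alpha> x (\<sigma> \<circ> \<tau>)"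
    and \<alpha>_id: "\<alpha> x id = x"
    and \<alpha>_ip: "\<sigma> permutes {1..k} \<Longrightarrow> ip (\<alpha> x \<sigma>) (\<alpha> y \<sigma>) = ip x y"
begin

lemmas \<alpha>_scale = module_hom.scale[OF lin_\<alpha>]
  and \<alpha>_sum = module_hom.sum[OF lin_\<alpha>]

lemma ip_\<alpha>_left: "\<sigma> permutes {1..k} \<Longrightarrow> ip (\<alpha> x \<sigma>) y = ip x (\<alpha> y (inv \<sigma>))"
  using \<alpha>_ip[of \<sigma> x "\<alpha> y (inv \<sigma>)"] \<alpha>_comp[of "inv \<sigma>" \<sigma> y]
  by (simp add: permutes_inv permutes_inv_o \<alpha>_id)

end

lemma perm_module_act: "perm_module k act"
proof
  fix \<sigma> :: "nat \<Rightarrow> nat" and x y :: mpol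
  assume s: "\<sigma> permutes {1..k}"
  have "inj (inv \<sigma>)" by (rule permutes_inj[OF permutes_inv[OF s]])
  moreover have "inj (push_keys (inv \<sigma>) :: (nat \<Rightarrow>\<^sub>0 nat) \<Rightarrow> _)"
    using mperm_inj[OF permutes_bij[OF s]] by (auto simp: inj_def mperm_def)
  ultimately show "ip (act x \<sigma>) (act y \<sigma>) = ip x y"
    by (simp add: act_def rename_def ip_push_keys)
qed (simp_all only: act_add act_scale act_comp permutes_bij act_id)

lemma perm_module_gact: "perm_module k gact"
proof
  fix \<sigma> :: "nat \<Rightarrow> nat" and x y :: galg
  assume s: "\<sigma> permutes {1..k}"
  then show "ip (gact x \<sigma>) (gact y \<sigma>) = ip x y"
    by (simp add: gact_def ip_push_keys inj_comp_right permutes_bij)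
qed (simp_all only: module_hom.add[OF lin_gact] module_hom.scale[OF lin_gact] gact_comp gact_id)

text \<open>The right multiplication \<open>x v\<close> by an element \<open>v\<close> of the group algebra; coefficients of \<open>v\<close> outside
  the permutations of \<open>{1..k}\<close> are ignored.\<close>

definition rext :: "nat \<Rightarrow> (('a \<Rightarrow>\<^sub>0 complex) \<Rightarrow> (nat \<Rightarrow> nat) \<Rightarrow> ('a \<Rightarrow>\<^sub>0 complex)) \<Rightarrow>
    ('a \<Rightarrow>\<^sub>0 complex) \<Rightarrow> galg \<Rightarrow> ('a \<Rightarrow>\<^sub>0 complex)" where
  "rext k \<alpha> x v = (\<Sum>g | g permutes {1..k}. cscale (lookup v g) (\<alpha> x g))"

lemma finite_perms [simp]: "finite {g. g permutes {1..k::nat}}"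
  by (simp add: finite_permutations)

context perm_module
begin

lemma lin_rext_left: "lin (\<lambda>x. rext k \<alpha> x v)"
  unfolding rext_def by (intro lin_sum lin_cscale lin_\<alpha>)

lemma lin_rext_right: "lin (rext k \<alpha> x)"
  by (rule linI) (simp_all add: rext_def lookup_add lookup_cscale cvs.scale_left_distrib sum.distrib cvs.scale_sum_right)

lemma rext_single: "g permutes {1..k} \<Longrightarrow> rext k \<alpha> x (single g c) = cscale c (\<alpha> x g)"
proof -
  assume g: "g permutes {1..k}"
  have "rext k \<alpha> x (single g c) = (\<Sum>h | h permutes {1..k}. if h = g then cscale c (\<alpha> x g) else 0)"
    unfolding rext_def by (intro sum.cong) (auto simp: lookup_single when_def)
  then show ?thesis using g by simp
qed

lemma rext_gact:
  assumes s: "\<sigma> permutes {1..k}"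
  shows "rext k \<alpha> x (gact v \<sigma>) = \<alpha> (rext k \<alpha> x v) \<sigma>"
proof -
  have "rext k \<alpha> x (gact v \<sigma>) = (\<Sum>g | g permutes {1..k}. cscale (lookup v g) (\<alpha> x (g \<circ> \<sigma>)))"
    unfolding rext_def
    by (rule sum.reindex_bij_witness[of _ "\<lambda>g. g \<circ> \<sigma>" "\<lambda>g. g \<circ> inv \<sigma>"])
      (use s in \<open>auto simp: permutes_compose permutes_inv lookup_gact permutes_bij permutes_inv_o o_assoc[symmetric]\<close>)
  also have "\<dots> = \<alpha> (rext k \<alpha> x v) \<sigma>"
    using s by (simp add: rext_def \<alpha>_sum \<alpha>_scale \<alpha>_comp)
  finally show ?thesis .
qed

end

subsection \<open>Partitions\<close>

lemma part_antimono:
  assumes "is_partition \<xi>" "1 \<le> i" "i \<le> i'" shows "part \<xi> i' \<le> part \<xi> i"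
proof (cases "i' \<le> length \<xi> \<and> i \<noteq> i'")
  case True
  then have "i - 1 < i' - 1" "i' - 1 < length \<xi>" using assms by auto
  then have "\<xi> ! (i' - 1) \<le> \<xi> ! (i - 1)"
    using assms(1) by (auto simp: is_partition_def sorted_wrt_iff_nth_less)
  then show ?thesis using True assms by (auto simp: part_def)
qed (use assms in \<open>auto simp: part_def\<close>)

lemma boxes_alt: "boxes \<xi> = {(i, j). 1 \<le> i \<and> 1 \<le> j \<and> j \<le> part \<xi> i}"
  by (auto simp: boxes_def part_def split: if_splits)

lemma boxes_Sigma: "boxes \<xi> = (SIGMA i:{1..length \<xi>}. {1..part \<xi> i})"
  by (auto simp: boxes_def)

lemma finite_boxes [simp]: "finite (boxes \<xi>)"
  by (simp add: boxes_Sigma)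

lemma sum_part: "(\<Sum>i=1..length \<xi>. part \<xi> i) = sum_list \<xi>"
proof -
  have "(\<Sum>i=1..length \<xi>. part \<xi> i) = (\<Sum>i<length \<xi>. \<xi> ! i)"
    by (rule sum.reindex_bij_witness[of _ Suc "\<lambda>i. i - 1"]) (auto simp: part_def)
  then show ?thesis by (simp add: sum_list_sum_nth atLeast0LessThan)
qed

lemma card_boxes: "card (boxes \<xi>) = sum_list \<xi>"
  by (simp add: boxes_Sigma sum_part)

lemma boxes_up: "is_partition \<xi> \<Longrightarrow> (i, j) \<in> boxes \<xi> \<Longrightarrow> 1 \<le> i' \<Longrightarrow> i' \<le> i \<Longrightarrow> (i', j) \<in> boxes \<xi>"
  using part_antimono[of \<xi> i' i] by (auto simp: boxes_alt)

subsection \<open>Tableaux and their row and column groups\<close>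

locale tableau =
  fixes \<xi> :: "nat list" and k :: nat and cell :: "nat \<Rightarrow> nat \<times> nat"
  assumes partition: "is_partition \<xi>"
    and cell: "bij_betw cell {1..k} (boxes \<xi>)"

abbreviation rw :: "(nat \<Rightarrow> nat \<times> nat) \<Rightarrow> nat \<Rightarrow> nat" where "rw cell x \<equiv> fst (cell x)"
abbreviation cl :: "(nat \<Rightarrow> nat \<times> nat) \<Rightarrow> nat \<Rightarrow> nat" where "cl cell x \<equiv> snd (cell x)"

text \<open>For the labelling of the entries of a tableau by rows (by columns) this is the row group (the
  column group).\<close>

definition stab :: "nat \<Rightarrow> (nat \<Rightarrow> nat) \<Rightarrow> (nat \<Rightarrow> nat) set" where
  "stab k f = {g. g permutes {1..k} \<and> (\<forall>x\<in>{1..k}. f (g x) = f x)}"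

lemma perm_in: "g permutes {1..k::nat} \<Longrightarrow> x \<in> {1..k} \<Longrightarrow> g x \<in> {1..k}"
  by (simp only: permutes_in_image)

lemma stab_permutes: "g \<in> stab k f \<Longrightarrow> g permutes {1..k}"
  by (simp add: stab_def)

lemma finite_stab [simp]: "finite (stab k f)"
  by (rule finite_subset[OF _ finite_perms[of k]]) (auto simp: stab_def)

lemma id_in_stab [simp]: "id \<in> stab k f"
  by (simp add: stab_def permutes_id)

lemma stab_comp: "g \<in> stab k f \<Longrightarrow> h \<in> stab k f \<Longrightarrow> g \<circ> h \<in> stab k f"
  using perm_in by (auto simp: stab_def permutes_compose simp del: atLeastAtMost_iff)

lemma stab_inv:
  assumes "g \<in> stab k f" shows "inv g \<in> stab k f"
proof -
  have g: "g permutes {1..k}" using assms by (rule stab_permutes)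
  have "f (inv g x) = f x" if "x \<in> {1..k}" for x
  proof -
    have "inv g x \<in> {1..k}" using that permutes_in_image[OF permutes_inv[OF g]] by simp
    then have "f (g (inv g x)) = f (inv g x)" using assms by (auto simp: stab_def)
    then show ?thesis using g by (simp add: permutes_inverses)
  qed
  then show ?thesis using g by (simp add: stab_def permutes_inv)
qed

lemma stab_transpose:
  assumes "x \<in> {1..k}" "y \<in> {1..k}" "f x = f y" shows "Transposition.transpose x y \<in> stab k f"
  using assms by (auto simp: stab_def permutes_swap_id Transposition.transpose_def)

lemma sum_stab_left: "g \<in> stab k f \<Longrightarrow> (\<Sum>h\<in>stab k f. F (g \<circ> h)) = (\<Sum>h\<in>stab k f. F h)"
  by (rule sum.reindex_bij_witness[of _ "\<lambda>h. inv g \<circ> h" "\<lambda>h. g \<circ> h"])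
    (auto intro: stab_comp stab_inv simp: o_assoc permutes_inv_o[OF stab_permutes])

lemma sum_stab_right: "g \<in> stab k f \<Longrightarrow> (\<Sum>h\<in>stab k f. F (h \<circ> g)) = (\<Sum>h\<in>stab k f. F h)"
  by (rule sum.reindex_bij_witness[of _ "\<lambda>h. h \<circ> inv g" "\<lambda>h. h \<circ> g"])
    (auto intro: stab_comp stab_inv simp: o_assoc[symmetric] permutes_inv_o[OF stab_permutes])

lemma sum_stab_inv: "(\<Sum>h\<in>stab k f. F (inv h)) = (\<Sum>h\<in>stab k f. F h)"
  by (rule sum.reindex_bij_witness[of _ inv inv])
    (auto intro: stab_inv simp: inv_inv_eq permutes_bij[OF stab_permutes])

lemma permutation_if_permutes: "g permutes {1..k::nat} \<Longrightarrow> permutation g"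
  by (rule permutes_imp_permutation[of "{1..k}"]) auto

lemma sign_comp_permutes:
  "g permutes {1..k} \<Longrightarrow> h permutes {1..k::nat} \<Longrightarrow> sign (g \<circ> h) = sign g * sign h"
  by (simp add: sign_compose permutation_if_permutes)

lemma sign_inv_permutes: "g permutes {1..k::nat} \<Longrightarrow> sign (inv g) = sign g"
  by (simp add: sign_inverse permutation_if_permutes)

lemma sign_mult_sign [simp]: "complex_of_int (sign p) * complex_of_int (sign p) = 1"
  "complex_of_int (sign p) * (complex_of_int (sign p) * c) = c"
  by (simp_all add: sign_def)

text \<open>The three operators below make sense on every module, so that the same lemmas apply to polynomials
  and to the group algebra. Since the modules are right modules, \<open>x e\<close> sums over rows first.\<close>

definition asym where
  "asym k cell \<alpha> x = (\<Sum>g\<in>stab k (rw cell). \<alpha> x g)"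

definition bsym where
  "bsym k cell \<alpha> x = (\<Sum>h\<in>stab k (cl cell). cscale (of_int (sign h)) (\<alpha> x h))"

definition esym where
  "esym k cell \<alpha> x = bsym k cell \<alpha> (asym k cell \<alpha> x)"

definition symmetrizer :: "nat \<Rightarrow> (nat \<Rightarrow> nat \<times> nat) \<Rightarrow> galg" where
  "symmetrizer k cell =
     (\<Sum>g\<in>stab k (rw cell). \<Sum>h\<in>stab k (cl cell). single (g \<circ> h) (of_int (sign h)))"

text \<open>The coefficient \<open>c\<close> in \<open>e e = c e\<close>, in the form in which it arises when the product is expanded.\<close>

definition esym_const :: "nat \<Rightarrow> (nat \<Rightarrow> nat \<times> nat) \<Rightarrow> complex" where
  "esym_const k cell = (\<Sum>h\<in>stab k (cl cell). \<Sum>g\<in>stab k (rw cell).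
     of_int (sign h) * lookup (symmetrizer k cell) (h \<circ> g))"

lemma sum_card_le_sum:
  assumes "finite S" "\<And>i. i \<in> S \<Longrightarrow> 1 \<le> (i::nat)"
  shows "\<Sum>{1..card S} \<le> \<Sum>S"
  using assms
proof (induction "card S" arbitrary: S)
  case (Suc n)
  then have ne: "S \<noteq> {}" by auto
  let ?M = "Max S"
  have "S \<subseteq> {1..?M}" using Suc.prems by auto
  then have "card S \<le> ?M" using card_mono[of "{1..?M}" S] by simp
  moreover have "\<Sum>{1..card (S - {?M})} \<le> \<Sum>(S - {?M})"
    using Suc ne by (intro Suc.hyps(1)) auto
  moreover have "\<Sum>S = ?M + \<Sum>(S - {?M})" using Suc.prems ne by (intro sum.remove) auto
  moreover have "card (S - {?M}) = n" using Suc ne by auto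
  ultimately show ?case using Suc.hyps(2)[symmetric] by simp
qed simp

lemma eq_initial_segment_of_sum:
  assumes "finite S" "\<And>i. i \<in> S \<Longrightarrow> 1 \<le> (i::nat)" "\<Sum>S \<le> \<Sum>{1..card S}"
  shows "S = {1..card S}"
proof (cases "S = {}")
  case False
  let ?M = "Max S"
  have card: "card S = Suc (card (S - {?M}))"
    using assms(1) False by (metis Max_in card_Suc_Diff1)
  have "\<Sum>{1..card (S - {?M})} \<le> \<Sum>(S - {?M})"
    using assms by (intro sum_card_le_sum) auto
  moreover have "\<Sum>S = ?M + \<Sum>(S - {?M})" using assms False by (intro sum.remove) auto
  ultimately have "?M \<le> card S" using assms(3) card by simp
  then have "S \<subseteq> {1..card S}" using assms(1,2) by (meson Max_ge atLeastAtMost_iff order_trans subsetI)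
  then show ?thesis by (intro card_subset_eq) auto
qed simp

lemma down_closed_eq_initial_segment:
  assumes "finite S" "\<And>i. i \<in> S \<Longrightarrow> 1 \<le> (i::nat)" "\<And>i i'. i \<in> S \<Longrightarrow> 1 \<le> i' \<Longrightarrow> i' \<le> i \<Longrightarrow> i' \<in> S"
  shows "S = {1..card S}"
proof (cases "S = {}")
  case False
  have "S = {1..Max S}"
  proof (intro equalityI subsetI)
    fix i assume "i \<in> {1..Max S}"
    then show "i \<in> S" using assms(3)[of "Max S" i] Max_in[OF assms(1) False] by auto
  qed (use assms(1,2) in auto)
  moreover from this have "card S = Max S" by (metis card_atLeastAtMost diff_Suc_1 One_nat_def)
  ultimately show ?thesis by simp
qed simp

context tableau
begin

abbreviation "X \<equiv> {1..k}"

lemma cell_boxes: "x \<in> X \<Longrightarrow> cell x \<in> boxes \<xi>"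
  using cell by (auto simp: bij_betw_def)

lemma cell_eqD: "x \<in> X \<Longrightarrow> y \<in> X \<Longrightarrow> rw cell x = rw cell y \<Longrightarrow> cl cell x = cl cell y \<Longrightarrow> x = y"
  by (rule inj_onD[OF bij_betw_imp_inj_on[OF cell] prod_eqI])

lemma ex_cell: "b \<in> boxes \<xi> \<Longrightarrow> \<exists>x\<in>X. cell x = b"
  using bij_betw_imp_surj_on[OF cell] by (metis imageE)

lemma k_eq: "k = sum_list \<xi>"
  using bij_betw_same_card[OF cell] by (simp add: card_boxes)

lemma rw_pos: "x \<in> X \<Longrightarrow> 1 \<le> rw cell x"
  using cell_boxes[of x] by (auto simp: boxes_alt)

lemma cl_pos: "x \<in> X \<Longrightarrow> 1 \<le> cl cell x"
  using cell_boxes[of x] by (auto simp: boxes_alt)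

text \<open>Row and column together determine an entry. It follows that a factorization into a row permutation
  and a column permutation is unique, and thus that the coefficients of the symmetrizer are \<open>0\<close>, \<open>1\<close> or \<open>-1\<close>.\<close>

lemma row_col_trivial:
  assumes "g \<in> stab k (rw cell)" "g \<in> stab k (cl cell)" shows "g = id"
proof
  fix x show "g x = id x"
  proof (cases "x \<in> X")
    case True
    have "g x \<in> X" by (rule perm_in[OF stab_permutes[OF assms(1)] True])
    then show ?thesis using True assms by (auto simp: stab_def intro: cell_eqD)
  next
    case False
    then show ?thesis using stab_permutes[OF assms(1)] by (simp add: permutes_def)
  qed
qed

lemma lookup_symmetrizer_comp:
  assumes g: "g \<in> stab k (rw cell)" and h: "h \<in> stab k (cl cell)"
  shows "lookup (symmetrizer k cell) (g \<circ> h) = of_int (sign h)"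
proof -
  have eq: "g' = g \<and> h' = h"
    if "g' \<in> stab k (rw cell)" "h' \<in> stab k (cl cell)" "g' \<circ> h' = g \<circ> h" for g' h'
  proof -
    note p = that(1,2)[THEN stab_permutes] g[THEN stab_permutes] h[THEN stab_permutes]
    have "inv g \<circ> (g' \<circ> h') \<circ> inv h' = inv g \<circ> (g \<circ> h) \<circ> inv h'" by (simp add: that(3))
    then have "inv g \<circ> g' \<circ> (h' \<circ> inv h') = (inv g \<circ> g) \<circ> h \<circ> inv h'" by (simp add: o_assoc)
    then have *: "inv g \<circ> g' = h \<circ> inv h'" using p by (simp add: permutes_inv_o)
    moreover have "inv g \<circ> g' \<in> stab k (rw cell)" using that g by (intro stab_comp stab_inv)
    moreover have "h \<circ> inv h' \<in> stab k (cl cell)" using that h by (intro stab_comp stab_inv)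
    ultimately have 1: "inv g \<circ> g' = id" "h \<circ> inv h' = id" using row_col_trivial by metis+
    then have "g \<circ> (inv g \<circ> g') = g" "h \<circ> inv h' \<circ> h' = h'" by simp_all
    then show ?thesis using p by (simp add: o_assoc permutes_inv_o) (simp add: o_assoc[symmetric] permutes_inv_o)
  qed
  have "lookup (symmetrizer k cell) (g \<circ> h)
    = (\<Sum>g'\<in>stab k (rw cell). \<Sum>h'\<in>stab k (cl cell). if g' \<circ> h' = g \<circ> h then of_int (sign h') else 0)"
    by (simp add: symmetrizer_def lookup_sum lookup_single when_def)
  also have "\<dots> = (\<Sum>g'\<in>stab k (rw cell). \<Sum>h'\<in>stab k (cl cell).
      if h' = h then if g' = g then of_int (sign h) else 0 else 0)"
    using eq by (intro sum.cong) auto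
  also have "\<dots> = of_int (sign h)" using g h by simp
  finally show ?thesis .
qed

lemma lookup_symmetrizer_outside:
  assumes "\<And>g' h'. g' \<in> stab k (rw cell) \<Longrightarrow> h' \<in> stab k (cl cell) \<Longrightarrow> g \<noteq> g' \<circ> h'"
  shows "lookup (symmetrizer k cell) g = 0"
proof -
  have "(g' \<circ> h' = g) = False" if "g' \<in> stab k (rw cell)" "h' \<in> stab k (cl cell)" for g' h'
    using assms[OF that] by metis
  then show ?thesis by (simp add: symmetrizer_def lookup_sum lookup_single when_def)
qed

lemma symmetrizer_GA: "symmetrizer k cell \<in> GA k"
  unfolding symmetrizer_def
  by (intro cvs.subspace_sum[OF subspace_GA])
    (auto simp: GA_def intro: permutes_compose[OF stab_permutes stab_permutes])

lemma rows_of_column: "rw cell ` {x \<in> X. cl cell x = j} = {1..card {x \<in> X. cl cell x = j}}"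
proof -
  let ?S = "{x \<in> X. cl cell x = j}"
  have "inj_on (rw cell) ?S" by (rule inj_onI) (auto intro: cell_eqD)
  then have "card (rw cell ` ?S) = card ?S" by (rule card_image)
  moreover have "rw cell ` ?S = {1..card (rw cell ` ?S)}"
  proof (rule down_closed_eq_initial_segment)
    fix i i' assume "i \<in> rw cell ` ?S" "1 \<le> i'" "i' \<le> i"
    then obtain x where x: "x \<in> ?S" "i = rw cell x" by blast
    then have "(i, j) \<in> boxes \<xi>" using cell_boxes[of x] by (cases "cell x") auto
    then have "(i', j) \<in> boxes \<xi>" using boxes_up[OF partition] \<open>1 \<le> i'\<close> \<open>i' \<le> i\<close> by blast
    then obtain y where "y \<in> X" "cell y = (i', j)" using ex_cell by blast
    then show "i' \<in> rw cell ` ?S" by force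
  qed (auto dest: rw_pos simp del: atLeastAtMost_iff)
  ultimately show ?thesis by simp
qed

text \<open>Von Neumann's dichotomy. If \<open>g\<close> puts the entries of each column into distinct rows, then each
  column of length \<open>l\<close> hits rows whose indices add up to at least \<open>1 + \<dots> + l\<close>. In total these sums agree,
  so each column hits exactly the first \<open>l\<close> rows and can be rearranged to match \<open>g\<close> up to a row
  permutation.\<close>

lemma row_col_dichotomy:
  assumes g: "g permutes X"
  obtains (factor) r h where "r \<in> stab k (rw cell)" "h \<in> stab k (cl cell)" "g = r \<circ> h"
    | (clash) x y where "x \<in> X" "y \<in> X" "x \<noteq> y" "cl cell x = cl cell y" "rw cell (g x) = rw cell (g y)"
proof (cases "\<exists>x\<in>X. \<exists>y\<in>X. x \<noteq> y \<and> cl cell x = cl cell y \<and> rw cell (g x) = rw cell (g y)")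
  case False
  define f where "f x = rw cell (g x)" for x
  define S where "S j = {x \<in> X. cl cell x = j}" for j
  have fS: "finite (S j)" for j by (simp add: S_def)
  have inj: "inj_on f (S j)" for j
  proof (rule inj_onI)
    fix x y assume "x \<in> S j" "y \<in> S j" "f x = f y"
    then show "x = y" using False unfolding S_def f_def by (metis (mono_tags, lifting) mem_Collect_eq)
  qed
  have gX: "g x \<in> X" if "x \<in> X" for x using that by (rule perm_in[OF g])
  have f_pos: "1 \<le> i" if "i \<in> f ` S j" for i j
    using that gX rw_pos by (auto simp: f_def S_def)
  have le: "\<Sum>{1..card (S j)} \<le> (\<Sum>x\<in>S j. f x)" for j
    using sum_card_le_sum[of "f ` S j"] f_pos fS by (simp add: card_image inj sum.reindex[OF inj])
  have eq1: "\<Sum>{1..card (S j)} = (\<Sum>x\<in>S j. rw cell x)" for j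
  proof -
    have "inj_on (rw cell) (S j)" by (rule inj_onI) (auto simp: S_def intro: cell_eqD)
    then show ?thesis using rows_of_column[of j] sum.reindex[of "rw cell" "S j" "\<lambda>i. i"]
      by (simp add: S_def)
  qed
  have tot: "(\<Sum>j\<in>cl cell ` X. \<Sum>x\<in>S j. F x) = (\<Sum>x\<in>X. F x)" for F :: "nat \<Rightarrow> nat"
    unfolding S_def by (rule sum.group) auto
  have "(\<Sum>x\<in>X. f x) = (\<Sum>x\<in>X. rw cell x)"
    unfolding f_def using sum.permute[OF g, of "rw cell"] by (simp add: comp_def)
  then have total: "(\<Sum>j\<in>cl cell ` X. \<Sum>x\<in>S j. f x) = (\<Sum>j\<in>cl cell ` X. \<Sum>{1..card (S j)})"
    by (simp add: tot eq1)
  \<comment> \<open>A strict excess in one column would have to be compensated in another one.\<close>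
  have "(\<Sum>x\<in>S j. f x) \<le> \<Sum>{1..card (S j)}" if "j \<in> cl cell ` X" for j
  proof (rule ccontr)
    assume "\<not> ?thesis"
    then have "(\<Sum>j\<in>cl cell ` X. \<Sum>{1..card (S j)}) < (\<Sum>j\<in>cl cell ` X. \<Sum>x\<in>S j. f x)"
      using that le by (intro sum_strict_mono_ex1) (auto simp: not_le)
    then show False using total by simp
  qed
  then have fim: "f ` S j = {1..card (S j)}" if "j \<in> cl cell ` X" for j
    using eq_initial_segment_of_sum[of "f ` S j"] f_pos fS that
    by (simp add: card_image inj sum.reindex[OF inj])
  \<comment> \<open>So in every column some \<open>y\<close> is moved by \<open>g\<close> to the row of \<open>x\<close>; sending \<open>x\<close> to \<open>y\<close> is the column permutation.\<close>
  have ex: "\<exists>y\<in>S (cl cell x). f y = rw cell x" if "x \<in> X" for x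
  proof -
    have "rw cell x \<in> {1..card (S (cl cell x))}"
      using rows_of_column[of "cl cell x"] that by (auto simp: S_def)
    also have "\<dots> = f ` S (cl cell x)" using fim[of "cl cell x"] that by blast
    finally show ?thesis by (metis imageE)
  qed
  define h where "h x = (if x \<in> X then SOME y. y \<in> S (cl cell x) \<and> f y = rw cell x else x)" for x
  have h: "h x \<in> S (cl cell x)" "f (h x) = rw cell x" if "x \<in> X" for x
    using someI_ex[of "\<lambda>y. y \<in> S (cl cell x) \<and> f y = rw cell x"] ex[OF that] that
    by (auto simp: h_def)
  have hX: "h x \<in> X" "cl cell (h x) = cl cell x" if "x \<in> X" for x
    using h(1)[OF that] by (auto simp: S_def)
  have "inj_on h X"
    by (rule inj_onI) (metis hX(2) h(2) cell_eqD)
  moreover from this have "h ` X = X" using hX by (intro endo_inj_surj) auto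
  ultimately have hp: "h permutes X"
    by (intro bij_imp_permutes) (auto simp: bij_betw_def h_def)
  then have hC: "h \<in> stab k (cl cell)" using hX by (simp add: stab_def)
  have "g \<circ> h \<in> stab k (rw cell)"
    using hp g h(2) by (auto simp: stab_def permutes_compose f_def)
  moreover have "g = (g \<circ> h) \<circ> inv h" using hp by (simp add: o_assoc[symmetric] permutes_inv_o)
  ultimately show ?thesis using factor stab_inv[OF hC] by blast
qed (use clash in blast)

end

subsection \<open>The symmetrizer as an operator\<close>

locale tableau_module = tableau \<xi> k cell + perm_module k \<alpha>
  for \<xi> :: "nat list" and k :: nat and cell :: "nat \<Rightarrow> nat \<times> nat"
    and \<alpha> :: "('a \<Rightarrow>\<^sub>0 complex) \<Rightarrow> (nat \<Rightarrow> nat) \<Rightarrow> ('a \<Rightarrow>\<^sub>0 complex)"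
begin

abbreviation "R \<equiv> stab k (rw cell)"
abbreviation "C \<equiv> stab k (cl cell)"
abbreviation "as \<equiv> asym k cell \<alpha>"
abbreviation "bs \<equiv> bsym k cell \<alpha>"
abbreviation "es \<equiv> esym k cell \<alpha>"
abbreviation "e \<equiv> symmetrizer k cell"

lemma lin_asym: "lin as"
  unfolding asym_def by (intro lin_sum lin_\<alpha>)

lemma lin_bsym: "lin bs"
  unfolding bsym_def by (intro lin_sum lin_cscale lin_\<alpha>)

lemma lin_esym: "lin es"
  unfolding esym_def by (rule lin_comp[OF lin_bsym lin_asym])

lemma asym_\<alpha>: "g \<in> R \<Longrightarrow> as (\<alpha> x g) = as x"
  using sum_stab_left[of g k "rw cell" "\<alpha> x"] by (simp add: asym_def \<alpha>_comp stab_permutes)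

lemma \<alpha>_asym: "g \<in> R \<Longrightarrow> \<alpha> (as x) g = as x"
  using sum_stab_right[of g k "rw cell" "\<alpha> x"] by (simp add: asym_def \<alpha>_sum \<alpha>_comp stab_permutes)

lemma bsym_\<alpha>: "h \<in> C \<Longrightarrow> bs (\<alpha> x h) = cscale (of_int (sign h)) (bs x)"
proof -
  assume h: "h \<in> C"
  have "cscale (of_int (sign h)) (bs x) = cscale (of_int (sign h)) (\<Sum>g\<in>C. cscale (of_int (sign (h \<circ> g))) (\<alpha> x (h \<circ> g)))"
    using sum_stab_left[OF h, of "\<lambda>g. cscale (of_int (sign g)) (\<alpha> x g)"] by (simp add: bsym_def)
  also have "\<dots> = (\<Sum>g\<in>C. cscale (of_int (sign g)) (\<alpha> (\<alpha> x h) g))"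
    unfolding cvs.scale_sum_right
    by (rule sum.cong) (simp_all add: sign_comp_permutes[OF stab_permutes[OF h] stab_permutes] \<alpha>_comp[OF stab_permutes[OF h] stab_permutes])
  also have "\<dots> = bs (\<alpha> x h)"
    by (simp add: bsym_def)
  finally show ?thesis ..
qed

lemma \<alpha>_bsym: "h \<in> C \<Longrightarrow> \<alpha> (bs x) h = cscale (of_int (sign h)) (bs x)"
proof -
  assume h: "h \<in> C"
  have "cscale (of_int (sign h)) (bs x) = cscale (of_int (sign h)) (\<Sum>g\<in>C. cscale (of_int (sign (g \<circ> h))) (\<alpha> x (g \<circ> h)))"
    using sum_stab_right[OF h, of "\<lambda>g. cscale (of_int (sign g)) (\<alpha> x g)"] by (simp add: bsym_def)
  also have "\<dots> = (\<Sum>g\<in>C. cscale (of_int (sign g)) (\<alpha> (\<alpha> x g) h))"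
    unfolding cvs.scale_sum_right
    by (rule sum.cong) (simp_all add: sign_comp_permutes[OF stab_permutes stab_permutes[OF h]] \<alpha>_comp[OF stab_permutes stab_permutes[OF h]] mult.left_commute)
  also have "\<dots> = \<alpha> (bs x) h"
    by (simp add: bsym_def \<alpha>_sum \<alpha>_scale)
  finally show ?thesis ..
qed

lemma asym_asym: "as (as x) = cscale (of_nat (card R)) (as x)"
  by (subst (1) asym_def) (simp add: \<alpha>_asym cvs.sum_constant_scale)

lemma bsym_bsym: "bs (bs x) = cscale (of_nat (card C)) (bs x)"
  by (subst (1) bsym_def) (simp add: \<alpha>_bsym cvs.sum_constant_scale of_int_mult[symmetric] del: of_int_mult)

lemma eq_neg_imp_0: "v = cscale (- 1) v \<Longrightarrow> v = 0"
proof -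
  assume "v = cscale (- 1) v"
  then have "lookup v y = - lookup v y" for y by (metis lookup_cscale mult_minus1)
  then show "v = 0" by (intro poly_mapping_eqI) (simp add: eq_neg_iff_add_eq_0)
qed

text \<open>If \<open>x\<close> and \<open>y\<close> share a column and \<open>g x\<close> and \<open>g y\<close> share a row, then a transposition can be moved
  through \<open>g\<close>: on one side it acts trivially, on the other side by a sign.\<close>

lemma bsym_asym_clash:
  assumes g: "g permutes X" and xy: "x \<in> X" "y \<in> X" "x \<noteq> y" "cl cell x = cl cell y" "rw cell (g x) = rw cell (g y)"
  shows "bs (\<alpha> (as z) g) = 0" "as (\<alpha> (bs z) (inv g)) = 0"
proof -
  let ?s = "Transposition.transpose x y" and ?r = "Transposition.transpose (g x) (g y)"
  have s: "?s \<in> C" by (rule stab_transpose[OF xy(1,2,4)])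
  have r: "?r \<in> R" by (rule stab_transpose[OF perm_in[OF g xy(1)] perm_in[OF g xy(2)] xy(5)])
  have gs: "g \<circ> ?s = ?r \<circ> g"
    using permutes_inj[OF g] by (auto simp: fun_eq_iff Transposition.transpose_def inj_eq)
  have sign: "sign ?s = - 1" using xy(3) by (simp add: sign_swap_id)
  have "bs (\<alpha> (as z) g) = bs (\<alpha> (\<alpha> (as z) ?r) g)" using r by (simp add: \<alpha>_asym)
  also have "\<dots> = bs (\<alpha> (\<alpha> (as z) g) ?s)"
    using g stab_permutes[OF r] stab_permutes[OF s] by (simp add: \<alpha>_comp gs)
  also have "\<dots> = cscale (- 1) (bs (\<alpha> (as z) g))" by (simp only: bsym_\<alpha>[OF s] sign of_int_minus of_int_1)
  finally show "bs (\<alpha> (as z) g) = 0" by (rule eq_neg_imp_0)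
  have "inv g \<circ> ?r = inv g \<circ> (?r \<circ> g) \<circ> inv g"
    using g by (simp add: o_assoc[symmetric] permutes_inv_o)
  also have "\<dots> = ?s \<circ> inv g"
    using g by (simp add: gs[symmetric] o_assoc permutes_inv_o)
  finally have sg: "inv g \<circ> ?r = ?s \<circ> inv g" .
  have "as (\<alpha> (bs z) (inv g)) = as (\<alpha> (\<alpha> (bs z) (inv g)) ?r)" using r by (simp add: asym_\<alpha>)
  also have "\<dots> = as (\<alpha> (\<alpha> (bs z) ?s) (inv g))"
    using permutes_inv[OF g] stab_permutes[OF r] stab_permutes[OF s] by (simp add: \<alpha>_comp sg)
  also have "\<dots> = cscale (- 1) (as (\<alpha> (bs z) (inv g)))"
    by (simp only: \<alpha>_bsym[OF s] sign of_int_minus of_int_1 \<alpha>_scale module_hom.scale[OF lin_asym])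
  finally show "as (\<alpha> (bs z) (inv g)) = 0" by (rule eq_neg_imp_0)
qed

text \<open>Von Neumann's lemma: between a row sum and a column sum only the coefficient of \<open>g\<close> in \<open>e\<close> survives.\<close>

lemma bsym_\<alpha>_asym:
  assumes g: "g permutes X"
  shows "bs (\<alpha> (as x) g) = cscale (lookup e g) (es x)"
proof (rule row_col_dichotomy[OF g])
  fix r h assume factor: "r \<in> R" "h \<in> C" "g = r \<circ> h"
  then have "bs (\<alpha> (as x) g) = bs (\<alpha> (\<alpha> (as x) r) h)" by (simp add: \<alpha>_comp stab_permutes)
  then show ?thesis using factor by (simp add: \<alpha>_asym bsym_\<alpha> lookup_symmetrizer_comp esym_def)
next
  fix y z assume clash: "y \<in> X" "z \<in> X" "y \<noteq> z" "cl cell y = cl cell z" "rw cell (g y) = rw cell (g z)"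
  have "g \<noteq> r \<circ> h" if "r \<in> R" "h \<in> C" for r h
  proof
    assume "g = r \<circ> h"
    have hX: "h y \<in> X" "h z \<in> X" using clash(1,2) by (auto intro!: perm_in[OF stab_permutes[OF that(2)]] simp del: atLeastAtMost_iff)
    then have "rw cell (h y) = rw cell (h z)" "cl cell (h y) = cl cell (h z)"
      using clash that \<open>g = r \<circ> h\<close> by (auto simp: stab_def)
    then have "h y = h z" by (rule cell_eqD[OF hX])
    then show False using clash permutes_inj[OF stab_permutes[OF that(2)]] by (auto dest: injD)
  qed
  then have "lookup e g = 0" by (intro lookup_symmetrizer_outside)
  then show ?thesis using bsym_asym_clash(1)[OF g clash] by simp
qed

lemma esym_esym: "es (es x) = cscale (esym_const k cell) (es x)"
proof -
  have "es (es x) = bs (as (\<Sum>h\<in>C. cscale (of_int (sign h)) (\<alpha> (as x) h)))"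
    by (simp add: esym_def bsym_def)
  also have "\<dots> = (\<Sum>h\<in>C. cscale (of_int (sign h)) (\<Sum>r\<in>R. bs (\<alpha> (as x) (h \<circ> r))))"
    by (simp add: module_hom.sum[OF lin_asym] module_hom.scale[OF lin_asym] module_hom.sum[OF lin_bsym]
      module_hom.scale[OF lin_bsym] asym_def[of k cell \<alpha> "\<alpha> _ _"] \<alpha>_comp stab_permutes)
  also have "\<dots> = (\<Sum>h\<in>C. cscale (of_int (sign h)) (\<Sum>r\<in>R. cscale (lookup e (h \<circ> r)) (es x)))"
    by (simp add: bsym_\<alpha>_asym permutes_compose stab_permutes)
  also have "\<dots> = cscale (esym_const k cell) (es x)"
    by (simp add: esym_const_def cvs.scale_sum_left cvs.scale_sum_right)
  finally show ?thesis .
qed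

text \<open>So \<open>e\<close> can be recovered from the products \<open>e g\<inverse> e\<close>. This is what inverts multiplication on the
  tensor product below.\<close>

lemma esym_\<alpha>_esym:
  assumes g: "g permutes X"
  shows "es (\<alpha> (es x) (inv g)) = cscale (esym_const k cell * lookup e g) (es x)"
proof (rule row_col_dichotomy[OF g])
  fix r h assume factor: "r \<in> R" "h \<in> C" "g = r \<circ> h"
  note p = stab_permutes[OF factor(1)] stab_permutes[OF factor(2)]
  have "inv g = inv h \<circ> inv r"
    using factor p by (simp add: o_inv_distrib permutes_bij)
  then have "\<alpha> (es x) (inv g) = \<alpha> (\<alpha> (es x) (inv h)) (inv r)"
    using p by (simp add: \<alpha>_comp permutes_inv)
  also have "\<alpha> (es x) (inv h) = cscale (of_int (sign h)) (es x)"
    using \<alpha>_bsym[OF stab_inv[OF factor(2)]] p by (simp add: esym_def sign_inv_permutes)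
  finally have "es (\<alpha> (es x) (inv g)) = cscale (of_int (sign h)) (bs (as (\<alpha> (es x) (inv r))))"
    by (simp add: \<alpha>_scale module_hom.scale[OF lin_esym]) (simp add: esym_def)
  also have "\<dots> = cscale (of_int (sign h)) (es (es x))"
    using asym_\<alpha>[OF stab_inv[OF factor(1)]] by (simp add: esym_def)
  finally show ?thesis using factor by (simp add: esym_esym lookup_symmetrizer_comp mult.commute)
next
  fix y z assume clash: "y \<in> X" "z \<in> X" "y \<noteq> z" "cl cell y = cl cell z" "rw cell (g y) = rw cell (g z)"
  have "es (\<alpha> (es x) (inv g)) = 0"
    using bsym_asym_clash(2)[OF g clash] by (simp add: esym_def module_hom.zero[OF lin_bsym])
  moreover have "cscale (lookup e g) (es x) = 0"
    using bsym_asym_clash(1)[OF g clash] bsym_\<alpha>_asym[OF g] by simp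
  ultimately show ?thesis by (metis cvs.scale_scale cvs.scale_zero_right)
qed

lemma rext_symmetrizer: "rext k \<alpha> x e = es x"
  unfolding symmetrizer_def module_hom.sum[OF lin_rext_right]
  by (simp add: rext_single permutes_compose stab_permutes esym_def bsym_def asym_def \<alpha>_sum \<alpha>_comp
    cvs.scale_sum_right sum.swap[of _ "stab k (cl cell)"])

text \<open>Row and column groups are closed under inverses, and inversion preserves signs.\<close>

lemma ip_asym: "ip (as x) y = ip x (as y)"
  using sum_stab_inv[of "\<lambda>g. ip x (\<alpha> y g)" k "rw cell"]
  by (simp add: asym_def ip_sum_left ip_sum_right ip_\<alpha>_left stab_permutes)

lemma ip_bsym: "ip (bs x) y = ip x (bs y)"
proof -
  have "ip (bs x) y = (\<Sum>h\<in>C. of_int (sign (inv h)) * ip x (\<alpha> y (inv h)))"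
    unfolding bsym_def ip_sum_left
    by (rule sum.cong) (simp_all add: ip_scale_left ip_\<alpha>_left stab_permutes sign_inv_permutes[OF stab_permutes])
  also have "\<dots> = (\<Sum>h\<in>C. of_int (sign h) * ip x (\<alpha> y h))"
    by (rule sum_stab_inv)
  also have "\<dots> = ip x (bs y)" by (simp add: bsym_def ip_sum_right ip_scale_right)
  finally show ?thesis .
qed

text \<open>Cancellation from positivity: if \<open>\<langle>x, y\<rangle>\<close> is definite and \<open>a\<close> is self-adjoint with \<open>a a\<close> proportional to
  \<open>a\<close>, then \<open>a y\<close> vanishes as soon as \<open>\<langle>y, a y\<rangle>\<close> does. Starting with \<open>e e = 0\<close>, the factors of
  \<open>x a b a b\<close>, where \<open>e = a b\<close>, are cancelled one after the other.\<close>

lemma esym_zero_if_const_zero: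
  assumes "esym_const k cell = 0" shows "es x = 0"
proof -
  have 0: "bs (as (bs (as x))) = 0" for x using esym_esym[of x] assms by (simp add: esym_def)
  have 1: "bs (as (bs x)) = 0" for x
  proof -
    have "ip (bs (as (bs x))) (bs (as (bs x))) = ip (bs x) (as (bs (bs (as (bs x)))))"
      by (simp only: ip_bsym[of "as (bs x)"] ip_asym)
    also have "\<dots> = cnj (of_nat (card C)) * ip x (bs (as (bs (as (bs x)))))"
      by (simp add: bsym_bsym module_hom.scale[OF lin_asym] ip_scale_right ip_bsym)
    finally show ?thesis using 0[of "bs x"] by simp
  qed
  have 2: "as (bs x) = 0" for x
  proof -
    have "ip (as (bs x)) (as (bs x)) = cnj (of_nat (card R)) * ip x (bs (as (bs x)))"
      by (simp add: ip_asym asym_asym ip_scale_right ip_bsym)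
    then show ?thesis by (simp add: 1)
  qed
  have "ip (bs (as x)) (bs (as x)) = cnj (of_nat (card C)) * ip x (as (bs (as x)))"
    by (simp add: ip_bsym bsym_bsym ip_scale_right ip_asym)
  then show ?thesis by (simp add: 2 esym_def)
qed

end

context tableau
begin

sublocale A: tableau_module \<xi> k cell act
  by (intro tableau_module.intro tableau_axioms perm_module_act)

sublocale G: tableau_module \<xi> k cell gact
  by (intro tableau_module.intro tableau_axioms perm_module_gact)

lemma symmetrizer_eq_esym: "symmetrizer k cell = esym k cell gact (single id 1)"
  by (simp add: symmetrizer_def esym_def bsym_def asym_def module_hom.sum[OF lin_gact]
    cvs.scale_sum_right sum.swap[of _ "stab k (cl cell)"] o_assoc[symmetric])

lemma lookup_symmetrizer_id: "lookup (symmetrizer k cell) id = 1"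
  using lookup_symmetrizer_comp[of id id] by simp

text \<open>Otherwise \<open>e = 1 e\<close> would vanish, but its coefficient at the identity is \<open>1\<close>.\<close>

lemma esym_const_nonzero: "esym_const k cell \<noteq> 0"
proof
  assume "esym_const k cell = 0"
  then have "symmetrizer k cell = 0" unfolding symmetrizer_eq_esym by (rule G.esym_zero_if_const_zero)
  then show False using lookup_symmetrizer_id by simp
qed

end

section \<open>A basis indexed by reverse semistandard tableaux\<close>

lemma independent_familyI:
  assumes "finite S" and "\<And>a m. (\<Sum>m\<in>S. cscale (a m) (f m)) = 0 \<Longrightarrow> m \<in> S \<Longrightarrow> a m = 0"
  shows "inj_on f S" "cvs.independent (f ` S)"
proof -
  show inj: "inj_on f S"
  proof (rule inj_onI, rule ccontr)
    fix x y assume xy: "x \<in> S" "y \<in> S" "f x = f y" "x \<noteq> y"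
    define a :: "'a \<Rightarrow> complex" where "a m = (if m = x then 1 else if m = y then - 1 else 0)" for m
    have "(\<Sum>m\<in>S. cscale (a m) (f m)) = (\<Sum>m\<in>{x, y}. cscale (a m) (f m))"
      using assms(1) xy by (intro sum.mono_neutral_right) (auto simp: a_def)
    also have "\<dots> = 0" using xy by (simp add: a_def)
    finally have "a x = 0" by (rule assms(2)) (rule xy)
    then show False by (simp add: a_def)
  qed
  show "cvs.independent (f ` S)"
  proof
    assume "cvs.dependent (f ` S)"
    then obtain u where u: "\<exists>v\<in>f ` S. u v \<noteq> 0" "(\<Sum>v\<in>f ` S. cscale (u v) v) = 0"
      using cvs.dependent_finite[of "f ` S"] assms(1) by auto
    from u(2) have "(\<Sum>m\<in>S. cscale (u (f m)) (f m)) = 0" by (simp add: sum.reindex[OF inj])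
    then show False using assms(2)[of "\<lambda>m. u (f m)"] u(1) by blast
  qed
qed

lemma rearrangement_two: "(a::nat) < b \<Longrightarrow> c < d \<Longrightarrow> a * d + b * c < a * c + b * d"
  by (auto simp: less_iff_Suc_add algebra_simps)

definition wsum :: "nat \<Rightarrow> (nat \<Rightarrow> nat) \<Rightarrow> (nat \<Rightarrow>\<^sub>0 nat) \<Rightarrow> nat" where
  "wsum k f m = (\<Sum>x=1..k. f x * lookup m x)"

lemma wsum_swap_less:
  assumes xy: "x \<in> {1..k}" "y \<in> {1..k}" and f: "f x < f y" and m: "lookup m x < lookup m y"
  shows "wsum k f (mperm m (Transposition.transpose x y)) < wsum k f m"
proof -
  have ne: "x \<noteq> y" using f by auto
  let ?t = "Transposition.transpose x y"
  have split: "(\<Sum>z=1..k. F z) = F x + (F y + (\<Sum>z\<in>{1..k} - {x} - {y}. F z))" for F :: "nat \<Rightarrow> nat"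
    using xy ne by (simp add: sum.remove[of "{1..k}" x] sum.remove[of "{1..k} - {x}" y])
  have "(\<Sum>z\<in>{1..k} - {x} - {y}. f z * lookup (mperm m ?t) z) = (\<Sum>z\<in>{1..k} - {x} - {y}. f z * lookup m z)"
    by (rule sum.cong) (auto simp: lookup_mperm Transposition.transpose_def)
  then show ?thesis
    using rearrangement_two[OF f m] unfolding wsum_def split by (simp add: lookup_mperm)
qed

text \<open>The tableaux of interest are semistandard for the reversed order of the entries. With this order
  the nonzero entries fill a smaller Young diagram, and so they can be counted by recursion.\<close>

definition row_sorted :: "nat \<Rightarrow> (nat \<Rightarrow> nat \<times> nat) \<Rightarrow> (nat \<Rightarrow>\<^sub>0 nat) \<Rightarrow> bool" where
  "row_sorted k cell m \<longleftrightarrow>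
    (\<forall>x\<in>{1..k}. \<forall>y\<in>{1..k}. rw cell x = rw cell y \<and> cl cell x < cl cell y \<longrightarrow> lookup m y \<le> lookup m x)"

definition col_sorted :: "nat \<Rightarrow> (nat \<Rightarrow> nat \<times> nat) \<Rightarrow> (nat \<Rightarrow>\<^sub>0 nat) \<Rightarrow> bool" where
  "col_sorted k cell m \<longleftrightarrow>
    (\<forall>x\<in>{1..k}. \<forall>y\<in>{1..k}. cl cell x = cl cell y \<and> rw cell x < rw cell y \<longrightarrow> lookup m y < lookup m x)"

definition rtab :: "nat \<Rightarrow> (nat \<Rightarrow> nat \<times> nat) \<Rightarrow> nat \<Rightarrow> (nat \<Rightarrow>\<^sub>0 nat) set" where
  "rtab k cell d = {m \<in> Mon k. mdeg m = d \<and> row_sorted k cell m \<and> col_sorted k cell m}"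

lemma finite_rtab [simp]: "finite (rtab k cell d)"
  by (rule finite_subset[OF _ finite_Mon_deg[of k d]]) (auto simp: rtab_def)

context tableau
begin

lemma row_le_cases:
  "x \<in> X \<Longrightarrow> y \<in> X \<Longrightarrow> rw cell x = rw cell y \<Longrightarrow> cl cell x \<le> cl cell y \<Longrightarrow> x = y \<or> cl cell x < cl cell y"
  using cell_eqD[of x y] by (metis le_neq_implies_less)

text \<open>The potential along which straightening terminates: it is small when large entries are in the
  upper rows.\<close>

abbreviation "\<rho> \<equiv> wsum k (rw cell)"

lemma \<rho>_row: assumes g: "g \<in> A.R" shows "\<rho> (mperm m g) = \<rho> m"
proof -
  have p: "g permutes X" using g by (rule stab_permutes)
  have "\<rho> (mperm m g) = (\<Sum>x\<in>X. rw cell (g x) * lookup m (g x))"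
    using g by (auto simp: wsum_def lookup_mperm permutes_bij[OF p] stab_def intro!: sum.cong)
  also have "\<dots> = \<rho> m" using sum.permute[OF p, of "\<lambda>x. rw cell x * lookup m x"] by (simp add: wsum_def comp_def)
  finally show ?thesis .
qed

text \<open>Among the rearrangements within rows, one that minimizes the sum weighted by columns is sorted.\<close>

lemma ex_row_sorted:
  assumes "m \<in> Mon k" shows "\<exists>g\<in>A.R. row_sorted k cell (mperm m g)"
proof -
  obtain g where g: "g \<in> A.R" and min: "\<And>h. h \<in> A.R \<Longrightarrow> wsum k (cl cell) (mperm m g) \<le> wsum k (cl cell) (mperm m h)"
    using ex_min_if_finite[of "(\<lambda>g. wsum k (cl cell) (mperm m g)) ` A.R"] id_in_stab
    by (auto simp: not_less simp del: id_in_stab) (metis emptyE finite_stab id_in_stab linorder_not_less)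
  have "lookup (mperm m g) y \<le> lookup (mperm m g) x"
    if xy: "x \<in> X" "y \<in> X" "rw cell x = rw cell y" "cl cell x < cl cell y" for x y
  proof (rule ccontr)
    assume "\<not> ?thesis"
    then have "wsum k (cl cell) (mperm (mperm m g) (Transposition.transpose x y)) < wsum k (cl cell) (mperm m g)"
      using xy by (intro wsum_swap_less) auto
    moreover have t: "Transposition.transpose x y \<in> A.R" by (rule stab_transpose[OF xy(1-3)])
    ultimately show False
      using min[OF stab_comp[OF g t]] stab_permutes[OF g] by (simp add: mperm_comp permutes_bij)
  qed
  then show ?thesis using g unfolding row_sorted_def by blast
qed

text \<open>Both fillings have the same multiset of entries in each row, hence, being sorted, they agree. For the
  proof, the entries that are at least the one at \<open>x\<close> are counted in the row of \<open>x\<close>.\<close>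

lemma row_sorted_le:
  assumes g: "g \<in> A.R" and s: "row_sorted k cell m" "row_sorted k cell (mperm m g)" and x: "x \<in> X"
  shows "lookup (mperm m g) x \<le> lookup m x"
proof (rule ccontr)
  assume less: "\<not> ?thesis"
  have p: "g permutes X" using g by (rule stab_permutes)
  let ?m' = "mperm m g"
  define v where "v = lookup ?m' x"
  define A where "A = {y \<in> X. rw cell y = rw cell x \<and> v \<le> lookup m y}"
  define A' where "A' = {y \<in> X. rw cell y = rw cell x \<and> v \<le> lookup ?m' y}"
  have "A \<subseteq> A'"
  proof
    fix y assume y: "y \<in> A"
    have "cl cell y < cl cell x"
    proof (rule ccontr)
      assume "\<not> ?thesis"
      then consider "cl cell x < cl cell y" | "x = y" using row_le_cases[of x y] y x by (auto simp: A_def simp del: atLeastAtMost_iff)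
      then have "lookup m y \<le> lookup m x"
        using s(1) y x by cases (auto simp: row_sorted_def A_def simp del: atLeastAtMost_iff)
      then show False using y less by (auto simp: A_def v_def)
    qed
    then have "v \<le> lookup ?m' y" using s(2) y x by (auto simp: row_sorted_def A_def v_def simp del: atLeastAtMost_iff)
    then show "y \<in> A'" using y by (simp add: A_def A'_def)
  qed
  moreover have "x \<in> A' - A" using x less by (simp add: A_def A'_def v_def)
  ultimately have "card A < card A'" by (intro psubset_card_mono) (auto simp: A'_def)
  moreover have "card A' = card (g ` A')" using permutes_inj[OF p] by (simp add: card_image inj_on_subset)
  moreover have "g ` A' \<subseteq> A"
    using g perm_in[OF p] by (auto simp: A_def A'_def stab_def lookup_mperm permutes_bij[OF p] simp del: atLeastAtMost_iff)
  then have "card (g ` A') \<le> card A" by (intro card_mono) (auto simp: A_def)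
  ultimately show False by simp
qed

lemma row_sorted_unique:
  assumes m: "m \<in> Mon k" and g: "g \<in> A.R" and s: "row_sorted k cell m" "row_sorted k cell (mperm m g)"
  shows "mperm m g = m"
proof (rule poly_mapping_eqI)
  fix x
  have p: "g permutes X" using g by (rule stab_permutes)
  have m': "mperm (mperm m g) (inv g) = m"
    using p by (simp add: mperm_comp permutes_bij bij_imp_bij_inv permutes_inv_o)
  show "lookup (mperm m g) x = lookup m x"
  proof (cases "x \<in> X")
    case True
    then show ?thesis
      using row_sorted_le[OF g s] row_sorted_le[OF stab_inv[OF g] s(2)] s(1)
      by (intro antisym) (simp_all add: m')
  next
    case False
    then have "lookup m x = 0" "g x = x" using m p by (auto simp: Mon_def in_keys_iff permutes_def)
    then show ?thesis by (simp add: lookup_mperm permutes_bij[OF p])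
  qed
qed

text \<open>Rearrangement inequality: undoing one misplaced entry after the other decreases the potential.\<close>

lemma \<rho>_column:
  assumes "h \<in> A.C" "h \<noteq> id" "col_sorted k cell m"
  shows "\<rho> m < \<rho> (mperm m h)"
  using assms
proof (induction "card {x \<in> X. h x \<noteq> x}" arbitrary: h rule: less_induct)
  case less
  have p: "h permutes X" using less.prems(1) by (rule stab_permutes)
  let ?M = "{x \<in> X. h x \<noteq> x}"
  have "?M \<noteq> {}"
  proof
    assume "?M = {}"
    then have "h x = x" for x using p by (cases "x \<in> X") (auto simp: permutes_def simp del: atLeastAtMost_iff)
    then show False using less.prems(2) by (auto simp: fun_eq_iff)
  qed
  \<comment> \<open>The uppermost misplaced entry \<open>x\<close> and the place \<open>y\<close> that \<open>h\<close> moves to \<open>x\<close>; swapping the two repairs \<open>x\<close>.\<close>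
  then obtain x where x: "x \<in> ?M" and min: "\<And>y. y \<in> ?M \<Longrightarrow> rw cell x \<le> rw cell y"
    using ex_min_if_finite[of "rw cell ` ?M"] by (auto simp: not_less)
  define y where "y = inv h x"
  have hy: "h y = x" unfolding y_def using p by (simp add: permutes_inverses)
  have yX: "y \<in> X" unfolding y_def using x by (intro perm_in[OF permutes_inv[OF p]]) simp
  have hxX: "h x \<in> X" using x by (intro perm_in[OF p]) simp
  have injh: "h a = h b \<longleftrightarrow> a = b" for a b using permutes_inj[OF p] by (auto dest: injD)
  have yx: "y \<noteq> x" using hy x by auto
  have yM: "y \<in> ?M" using yX hy yx by auto
  have hxM: "h x \<in> ?M" using x hxX injh[of "h x" x] by auto
  have col: "cl cell (h a) = cl cell a" if "a \<in> X" for a using less.prems(1) that by (auto simp: stab_def)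
  have cly: "cl cell y = cl cell x" using col[OF yX] hy by simp
  have clhx: "cl cell (h x) = cl cell x" using col x by simp
  have rwy: "rw cell x < rw cell y" using min[OF yM] cell_eqD[OF yX _ _ cly] x yx by fastforce
  have rwhx: "rw cell x < rw cell (h x)" using min[OF hxM] cell_eqD[OF hxX _ _ clhx] x by fastforce
  have lt: "lookup (mperm m h) x < lookup (mperm m h) y"
    using less.prems(3) rwhx clhx x hxX unfolding col_sorted_def
    by (simp add: lookup_mperm permutes_bij[OF p] hy)
  let ?t = "Transposition.transpose x y"
  have xX: "x \<in> X" using x by blast
  have t: "?t \<in> A.C" by (rule stab_transpose[OF xX yX]) (simp add: cly)
  have h': "h \<circ> ?t \<in> A.C" by (rule stab_comp[OF less.prems(1) t])
  have "\<rho> (mperm (mperm m h) ?t) < \<rho> (mperm m h)"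
    by (rule wsum_swap_less[OF xX yX rwy lt])
  then have lt': "\<rho> (mperm m (h \<circ> ?t)) < \<rho> (mperm m h)" by (simp add: mperm_comp permutes_bij[OF p])
  show ?case
  proof (cases "h \<circ> ?t = id")
    case True
    then show ?thesis using lt' by simp
  next
    case False
    have "{z \<in> X. (h \<circ> ?t) z \<noteq> z} \<subset> ?M"
    proof
      show "{z \<in> X. (h \<circ> ?t) z \<noteq> z} \<subseteq> ?M"
        using yM x hy by (auto simp: Transposition.transpose_def simp del: atLeastAtMost_iff split: if_splits)
      have "x \<notin> {z \<in> X. (h \<circ> ?t) z \<noteq> z}" using hy by simp
      then show "{z \<in> X. (h \<circ> ?t) z \<noteq> z} \<noteq> ?M" using x by blast
    qed
    then have "card {z \<in> X. (h \<circ> ?t) z \<noteq> z} < card ?M" by (intro psubset_card_mono) auto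
    from less.hyps[OF this h' False less.prems(3)] lt' show ?thesis by simp
  qed
qed

lemma esym_mon: "esym k cell act (mon m)
  = (\<Sum>h\<in>A.C. \<Sum>g\<in>A.R. single (mperm m (g \<circ> h)) (of_int (sign h)))"
proof -
  have "esym k cell act (mon m) = (\<Sum>h\<in>A.C. \<Sum>g\<in>A.R. single (mperm (mperm m g) h) (of_int (sign h)))"
    by (simp add: esym_def bsym_def asym_def act_sum cvs.scale_sum_right)
  also have "\<dots> = (\<Sum>h\<in>A.C. \<Sum>g\<in>A.R. single (mperm m (g \<circ> h)) (of_int (sign h)))"
    by (intro sum.cong refl) (simp add: mperm_comp permutes_bij[OF stab_permutes])
  finally show ?thesis .
qed

text \<open>Coefficients of symmetrized tableaux at tableaux are unitriangular for the potential, up to scaling.\<close>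

lemma lookup_esym_mon:
  assumes m: "m \<in> rtab k cell d" and m': "m' \<in> rtab k cell d"
  shows "m = m' \<Longrightarrow> lookup (esym k cell act (mon m)) m' \<noteq> 0"
    and "m \<noteq> m' \<Longrightarrow> \<rho> m \<le> \<rho> m' \<Longrightarrow> lookup (esym k cell act (mon m)) m' = 0"
proof -
  \<comment> \<open>Here \<open>m' h\<inverse> = m g\<close> has the potential of \<open>m\<close>; unless \<open>h\<close> is the identity, it exceeds that of \<open>m'\<close>.\<close>
  have *: "h = id \<and> mperm m g = m' \<and> m = m'"
    if "h \<in> A.C" "g \<in> A.R" "mperm m (g \<circ> h) = m'" "\<rho> m \<le> \<rho> m'" for g h
  proof -
    note p = stab_permutes[OF that(1)] stab_permutes[OF that(2)]
    have "mperm m' (inv h) = mperm m ((g \<circ> h) \<circ> inv h)"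
      unfolding that(3)[symmetric] using p by (intro mperm_comp) (simp_all add: permutes_bij bij_comp bij_imp_bij_inv)
    also have "(g \<circ> h) \<circ> inv h = g" using p by (simp add: o_assoc[symmetric] permutes_inv_o)
    finally have eq: "mperm m' (inv h) = mperm m g" .
    then have "\<rho> (mperm m' (inv h)) \<le> \<rho> m'" using \<rho>_row[OF that(2), of m] that(4) by simp
    moreover have "col_sorted k cell m'" using m' by (simp add: rtab_def)
    ultimately have "inv h = id" using \<rho>_column[OF stab_inv[OF that(1)], of m'] by fastforce
    then have h: "h = id" using p by (metis inv_id inv_inv_eq permutes_bij)
    then have mg: "mperm m g = m'" using that(3) by simp
    then have "mperm m g = m" using m m' that(2) by (intro row_sorted_unique) (auto simp: rtab_def)
    with mg h show ?thesis by simp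
  qed
  have coeff: "lookup (esym k cell act (mon m)) m' = (\<Sum>h\<in>A.C. \<Sum>g\<in>A.R. if mperm m (g \<circ> h) = m' then of_int (sign h) else 0)"
    by (simp add: esym_mon lookup_sum lookup_single when_def)
  {
    assume eq: "m = m'"
    have "lookup (esym k cell act (mon m)) m' = (\<Sum>h\<in>A.C. \<Sum>g\<in>A.R. if h = id \<and> mperm m g = m' then 1 else 0)"
      unfolding coeff using *[unfolded eq] eq by (intro sum.cong refl) auto
    also have "\<dots> = (\<Sum>h\<in>A.C. if h = id then \<Sum>g\<in>A.R. if mperm m g = m' then 1 else 0 else 0)"
      by (intro sum.cong) auto
    also have "\<dots> = of_nat (card {g \<in> A.R. mperm m g = m'})" by (simp add: sum.If_cases Int_def)
    finally have 1: "lookup (esym k cell act (mon m)) m' = of_nat (card {g \<in> A.R. mperm m g = m'})" .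
    have "id \<in> {g \<in> A.R. mperm m g = m'}" using eq by simp
    then have "card {g \<in> A.R. mperm m g = m'} \<noteq> 0" by (metis (no_types, lifting) card_0_eq empty_iff finite_subset finite_stab mem_Collect_eq subsetI)
    then show "lookup (esym k cell act (mon m)) m' \<noteq> 0" by (simp add: 1)
  }
  assume "m \<noteq> m'" "\<rho> m \<le> \<rho> m'"
  then show "lookup (esym k cell act (mon m)) m' = 0"
    unfolding coeff using * by (intro sum.neutral ballI) auto
qed

text \<open>In a linear relation, the coefficient of a tableau with the largest potential would have to vanish.\<close>

lemma esym_rtab_independent:
  shows "inj_on (\<lambda>m. esym k cell act (mon m)) (rtab k cell d)"
    and "cvs.independent ((\<lambda>m. esym k cell act (mon m)) ` rtab k cell d)"
proof -
  have "a m = 0" if sum: "(\<Sum>m\<in>rtab k cell d. cscale (a m) (esym k cell act (mon m))) = 0"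
    and m: "m \<in> rtab k cell d" for a m
  proof (rule ccontr)
    assume "a m \<noteq> 0"
    define T where "T = {m \<in> rtab k cell d. a m \<noteq> 0}"
    have T: "finite T" "T \<noteq> {}" using m \<open>a m \<noteq> 0\<close> by (auto simp: T_def)
    have "Max (\<rho> ` T) \<in> \<rho> ` T" using T by (intro Max_in) auto
    then obtain m' where m': "m' \<in> T" "\<rho> m' = Max (\<rho> ` T)" by (metis imageE)
    have max: "\<rho> m \<le> \<rho> m'" if "m \<in> T" for m using T m' that by simp
    have "0 = lookup (\<Sum>m\<in>rtab k cell d. cscale (a m) (esym k cell act (mon m))) m'" using sum by simp
    also have "\<dots> = (\<Sum>m\<in>rtab k cell d. a m * lookup (esym k cell act (mon m)) m')"
      by (simp add: lookup_sum lookup_cscale)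
    also have "\<dots> = (\<Sum>m\<in>rtab k cell d. if m = m' then a m' * lookup (esym k cell act (mon m')) m' else 0)"
    proof (rule sum.cong[OF refl])
      fix m assume m: "m \<in> rtab k cell d"
      show "a m * lookup (esym k cell act (mon m)) m' = (if m = m' then a m' * lookup (esym k cell act (mon m')) m' else 0)"
      proof (cases "m = m' \<or> a m = 0")
        case False
        then have "lookup (esym k cell act (mon m)) m' = 0"
          using m m'(1) max[of m] by (intro lookup_esym_mon(2)[of m d m']) (auto simp: T_def)
        then show ?thesis using False by simp
      qed auto
    qed
    also have "\<dots> = a m' * lookup (esym k cell act (mon m')) m'" using m' by (simp add: T_def)
    finally show False using m' lookup_esym_mon(1)[of m' d m'] by (auto simp: T_def)
  qed
  then show "inj_on (\<lambda>m. esym k cell act (mon m)) (rtab k cell d)"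
    "cvs.independent ((\<lambda>m. esym k cell act (mon m)) ` rtab k cell d)"
    using independent_familyI[of "rtab k cell d" "\<lambda>m. esym k cell act (mon m)"] by auto
qed

text \<open>Garnir relations. Transposing two entries that end up in the same column changes the sign of the
  column sum, but only rearranges the sum over all permutations of \<open>Z\<close>, which therefore vanishes.\<close>

lemma garnir:
  assumes Z: "Z \<subseteq> X" and col: "\<And>g. g \<in> A.R \<Longrightarrow> \<exists>z\<in>Z. \<exists>z'\<in>Z. z \<noteq> z' \<and> cl cell (inv g z) = cl cell (inv g z')"
  shows "(\<Sum>w | w permutes Z. esym k cell act (act p w)) = 0"
proof -
  have fZ: "finite Z" using Z finite_subset by blast
  have WX: "w permutes X" if "w permutes Z" for w using that Z by (rule permutes_subset)
  have zero: "(\<Sum>w | w permutes Z. bsym k cell act (act p (w \<circ> g))) = 0" if g: "g \<in> A.R" for g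
  proof -
    from col[OF g] obtain z z' where z: "z \<in> Z" "z' \<in> Z" "z \<noteq> z'" "cl cell (inv g z) = cl cell (inv g z')" by blast
    have pg: "g permutes X" using g by (rule stab_permutes)
    let ?s = "Transposition.transpose (inv g z) (inv g z')" and ?t = "Transposition.transpose z z'"
    have zX: "inv g z \<in> X" "inv g z' \<in> X" using z Z by (auto intro!: perm_in[OF permutes_inv[OF pg]] simp del: atLeastAtMost_iff)
    have s: "?s \<in> A.C" by (rule stab_transpose[OF zX z(4)])
    have ne: "inv g z \<noteq> inv g z'" using z(3) permutes_inj[OF permutes_inv[OF pg]] by (auto dest: injD)
    have t: "?t permutes Z" using z by (simp add: permutes_swap_id)
    have tg: "?t \<circ> g = g \<circ> ?s"
      using permutes_inverses[OF pg] by (auto simp: fun_eq_iff Transposition.transpose_def)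
    have "(\<Sum>w | w permutes Z. bsym k cell act (act p (w \<circ> g)))
      = (\<Sum>w | w permutes Z. bsym k cell act (act p ((w \<circ> ?t) \<circ> g)))"
      by (rule sum.reindex_bij_witness[of _ "\<lambda>w. w \<circ> ?t" "\<lambda>w. w \<circ> ?t"])
        (use t in \<open>auto simp: permutes_compose o_assoc[symmetric]\<close>)
    also have "\<dots> = (\<Sum>w | w permutes Z. cscale (- 1) (bsym k cell act (act p (w \<circ> g))))"
    proof (rule sum.cong[OF refl])
      fix w assume "w \<in> {w. w permutes Z}"
      then have w: "w permutes X" using WX by blast
      have "act p ((w \<circ> ?t) \<circ> g) = act p ((w \<circ> g) \<circ> ?s)" by (simp only: o_assoc[symmetric] tg)
      also have "\<dots> = act (act p (w \<circ> g)) ?s"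
        using w pg stab_permutes[OF s] by (simp add: act_comp permutes_bij bij_comp)
      finally show "bsym k cell act (act p ((w \<circ> ?t) \<circ> g)) = cscale (- 1) (bsym k cell act (act p (w \<circ> g)))"
        using ne by (simp only: A.bsym_\<alpha>[OF s] sign_swap_id if_False of_int_minus of_int_1)
    qed
    also have "\<dots> = cscale (- 1) (\<Sum>w | w permutes Z. bsym k cell act (act p (w \<circ> g)))"
      by (simp only: cvs.scale_sum_right)
    finally show ?thesis by (rule A.eq_neg_imp_0)
  qed
  have "(\<Sum>w | w permutes Z. esym k cell act (act p w))
    = (\<Sum>w | w permutes Z. \<Sum>g\<in>A.R. bsym k cell act (act p (w \<circ> g)))"
  proof (rule sum.cong[OF refl])
    fix w assume "w \<in> {w. w permutes Z}"
    then have "w permutes X" using WX by blast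
    then show "esym k cell act (act p w) = (\<Sum>g\<in>A.R. bsym k cell act (act p (w \<circ> g)))"
      unfolding esym_def asym_def module_hom.sum[OF A.lin_bsym]
      by (intro sum.cong refl) (simp add: act_comp permutes_bij permutes_bij[OF stab_permutes])
  qed
  also have "\<dots> = (\<Sum>g\<in>A.R. \<Sum>w | w permutes Z. bsym k cell act (act p (w \<circ> g)))" by (rule sum.swap)
  also have "\<dots> = 0" using zero by simp
  finally show ?thesis .
qed

text \<open>Exchanging entries between the end of an upper row and the beginning of a lower row, where the
  former are not larger than the latter, either lowers the potential or permutes entries within rows.\<close>

lemma exchange_decreases:
  assumes U: "U \<subseteq> X" "\<And>x. x \<in> U \<Longrightarrow> rw cell x = i" "\<And>x. x \<in> U \<Longrightarrow> lookup m x \<le> c"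
    and L: "L \<subseteq> X" "\<And>x. x \<in> L \<Longrightarrow> rw cell x = i'" "\<And>x. x \<in> L \<Longrightarrow> c \<le> lookup m x"
    and i: "i < i'" and w: "w permutes (U \<union> L)"
  shows "\<rho> (mperm m w) < \<rho> m \<or> \<rho> (mperm m w) = \<rho> m \<and> esym k cell act (mon (mperm m w)) = esym k cell act (mon m)"
  using w
proof (induction "card {x \<in> U. w x \<in> L}" arbitrary: w rule: less_induct)
  case less
  have fin: "finite U" "finite L" using U(1) L(1) finite_subset by blast+
  have disj: "U \<inter> L = {}" using U(2) L(2) i by force
  have wX: "w permutes X" using less.prems U(1) L(1) by (intro permutes_subset[OF less.prems]) auto
  have wUL: "w x \<in> U \<union> L" if "x \<in> U \<union> L" for x using that less.prems by (simp only: permutes_in_image)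
  show ?case
  proof (cases "{x \<in> U. w x \<in> L} = {}")
    case True
    then have "w ` U \<subseteq> U" using wUL by blast
    then have wU: "w ` U = U" using fin permutes_inj[OF less.prems] by (intro endo_inj_surj) (auto intro: inj_on_subset)
    have wL: "w x \<in> L" if "x \<in> L" for x
    proof (rule ccontr)
      assume "w x \<notin> L"
      then have "w x \<in> U" using wUL that by blast
      then obtain y where "y \<in> U" "w y = w x" using wU by (metis imageE)
      then show False using permutes_inj[OF less.prems] that disj by (auto dest: injD)
    qed
    have "rw cell (w x) = rw cell x" for x
    proof (cases "x \<in> U \<union> L")
      case True
      then show ?thesis using wL wU U(2) L(2) by blast
    qed (use less.prems in \<open>auto simp: permutes_def\<close>)
    then have wR: "w \<in> A.R" using wX by (simp add: stab_def)
    then show ?thesis using \<rho>_row[OF wR, of m] A.asym_\<alpha>[OF wR, of "mon m"] by (simp add: esym_def)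
  next
    case False
    \<comment> \<open>If some entry moves up then some other entry moves down. Undoing both gives a permutation with
      fewer exchanges.\<close>
    then obtain z where z: "z \<in> U" "w z \<in> L" by blast
    have "\<exists>z'\<in>L. w z' \<in> U"
    proof (rule ccontr)
      assume "\<not> ?thesis"
      then have "w ` L \<subseteq> L" using wUL by blast
      then have "w ` L = L" using fin permutes_inj[OF less.prems] by (intro endo_inj_surj) (auto intro: inj_on_subset)
      then obtain y where "y \<in> L" "w y = w z" using z by (metis imageE)
      then show False using permutes_inj[OF less.prems] z disj by (auto dest: injD)
    qed
    then obtain z' where z': "z' \<in> L" "w z' \<in> U" by blast
    let ?t = "Transposition.transpose z z'"
    have t: "?t permutes (U \<union> L)" using z z' by (simp add: permutes_swap_id)
    have wt: "w \<circ> ?t permutes (U \<union> L)" using less.prems t by (simp add: permutes_compose)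
    have "{x \<in> U. (w \<circ> ?t) x \<in> L} \<subset> {x \<in> U. w x \<in> L}"
    proof
      show "{x \<in> U. (w \<circ> ?t) x \<in> L} \<subseteq> {x \<in> U. w x \<in> L}"
        using z z' disj by (auto simp: Transposition.transpose_def split: if_splits)
      have "z \<notin> {x \<in> U. (w \<circ> ?t) x \<in> L}" using z' disj by auto
      then show "{x \<in> U. (w \<circ> ?t) x \<in> L} \<noteq> {x \<in> U. w x \<in> L}" using z by blast
    qed
    then have "card {x \<in> U. (w \<circ> ?t) x \<in> L} < card {x \<in> U. w x \<in> L}" using fin by (intro psubset_card_mono) auto
    from less.hyps[OF this wt] have IH: "\<rho> (mperm m (w \<circ> ?t)) < \<rho> m \<or>
      \<rho> (mperm m (w \<circ> ?t)) = \<rho> m \<and> esym k cell act (mon (mperm m (w \<circ> ?t))) = esym k cell act (mon m)" .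
    have zX: "z \<in> X" "z' \<in> X" using z z' U(1) L(1) by auto
    have undo: "mperm (mperm m (w \<circ> ?t)) ?t = mperm m w"
      by (simp add: mperm_comp bij_comp permutes_bij[OF wX] o_assoc[symmetric])
    have vals: "lookup (mperm m (w \<circ> ?t)) z \<le> c" "c \<le> lookup (mperm m (w \<circ> ?t)) z'"
      using U(3)[OF z'(2)] L(3)[OF z(2)] by (simp_all add: lookup_mperm bij_comp permutes_bij[OF wX])
    show ?thesis
    proof (cases "lookup (mperm m (w \<circ> ?t)) z = lookup (mperm m (w \<circ> ?t)) z'")
      case True
      then have "mperm (mperm m (w \<circ> ?t)) ?t = mperm m (w \<circ> ?t)"
        by (intro poly_mapping_eqI) (auto simp: lookup_mperm[of ?t] Transposition.transpose_def)
      then show ?thesis using IH undo by simp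
    next
      case False
      then have "\<rho> (mperm (mperm m (w \<circ> ?t)) ?t) < \<rho> (mperm m (w \<circ> ?t))"
        using vals zX z z' U(2) L(2) i by (intro wsum_swap_less) auto
      then show ?thesis using IH undo by auto
    qed
  qed
qed

text \<open>Straightening. At a pair of cells violating column strictness, take the end of the upper row and the
  beginning of the lower row: one cell more than the upper row has. The Garnir relation for these cells
  expresses the filling through fillings of smaller potential.\<close>

lemma esym_mon_in_span_rtab:
  assumes "m \<in> Mon k" "mdeg m = d"
  shows "esym k cell act (mon m) \<in> cvs.span ((\<lambda>m. esym k cell act (mon m)) ` rtab k cell d)" (is "_ \<in> ?N")
  using assms
proof (induction "\<rho> m" arbitrary: m rule: less_induct)
  case (less m0)
  obtain g where g: "g \<in> A.R" "row_sorted k cell (mperm m0 g)" using ex_row_sorted[OF less.prems(1)] by blast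
  define m where "m = mperm m0 g"
  have pg: "g permutes X" using g(1) by (rule stab_permutes)
  have m: "m \<in> Mon k" "mdeg m = d" "row_sorted k cell m" "\<rho> m = \<rho> m0"
    using less.prems g mperm_Mon[OF pg] \<rho>_row[OF g(1)] by (simp_all add: m_def mdeg_mperm permutes_bij[OF pg])
  have "esym k cell act (mon m) = esym k cell act (mon m0)"
    using A.asym_\<alpha>[OF g(1), of "mon m0"] by (simp add: m_def esym_def)
  moreover have "esym k cell act (mon m) \<in> ?N"
  proof (cases "col_sorted k cell m")
    case True
    then have "m \<in> rtab k cell d" using m by (simp add: rtab_def)
    then show ?thesis by (intro cvs.span_base) blast
  next
    case False
    then obtain x y where xy: "x \<in> X" "y \<in> X" "cl cell x = cl cell y" "rw cell x < rw cell y" "lookup m x \<le> lookup m y"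
      unfolding col_sorted_def by (meson not_less)
    define U where "U = {z \<in> X. rw cell z = rw cell x \<and> cl cell x \<le> cl cell z}"
    define L where "L = {z \<in> X. rw cell z = rw cell y \<and> cl cell z \<le> cl cell y}"
    have fin: "finite U" "finite L" by (simp_all add: U_def L_def)
    have U: "U \<subseteq> X" "\<And>z. z \<in> U \<Longrightarrow> rw cell z = rw cell x" "\<And>z. z \<in> U \<Longrightarrow> lookup m z \<le> lookup m x"
    proof -
      fix z assume z: "z \<in> U"
      consider "z = x" | "cl cell x < cl cell z" using row_le_cases[of x z] z xy(1) by (auto simp: U_def simp del: atLeastAtMost_iff)
      then show "lookup m z \<le> lookup m x"
        using m(3) z xy(1) by cases (auto simp: U_def row_sorted_def simp del: atLeastAtMost_iff)
    qed (auto simp: U_def)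
    have L: "L \<subseteq> X" "\<And>z. z \<in> L \<Longrightarrow> rw cell z = rw cell y" "\<And>z. z \<in> L \<Longrightarrow> lookup m x \<le> lookup m z"
    proof -
      fix z assume z: "z \<in> L"
      consider "z = y" | "cl cell z < cl cell y" using row_le_cases[of z y] z xy(2) by (auto simp: L_def simp del: atLeastAtMost_iff)
      then have "lookup m y \<le> lookup m z"
        using m(3) z xy(2) by cases (auto simp: L_def row_sorted_def simp del: atLeastAtMost_iff)
      then show "lookup m x \<le> lookup m z" using xy(5) by simp
    qed (auto simp: L_def)
    have disj: "U \<inter> L = {}" using xy(4) by (auto simp: U_def L_def)
    let ?Z = "U \<union> L"
    have cUL: "card ?Z = Suc (part \<xi> (rw cell x))"
    proof -
      have b: "(rw cell x, cl cell x) \<in> boxes \<xi>" "(rw cell y, cl cell y) \<in> boxes \<xi>"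
        using cell_boxes[OF xy(1)] cell_boxes[OF xy(2)] by simp_all
      have inj: "inj_on (cl cell) U" "inj_on (cl cell) L"
        by (rule inj_onI, rule cell_eqD; simp add: U_def L_def)+
      have "cl cell ` U = {cl cell x..part \<xi> (rw cell x)}"
      proof (intro equalityI subsetI)
        fix j assume j: "j \<in> {cl cell x..part \<xi> (rw cell x)}"
        then have "(rw cell x, j) \<in> boxes \<xi>" using b by (auto simp: boxes_alt)
        from ex_cell[OF this] obtain z where "z \<in> X" "cell z = (rw cell x, j)" by blast
        then show "j \<in> cl cell ` U" using j by (intro image_eqI[of _ _ z]) (auto simp: U_def)
      next
        fix j assume "j \<in> cl cell ` U"
        then obtain z where "z \<in> U" "j = cl cell z" by blast
        then show "j \<in> {cl cell x..part \<xi> (rw cell x)}" using cell_boxes[of z] by (cases "cell z") (auto simp: U_def boxes_alt)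
      qed
      then have cU: "card U = Suc (part \<xi> (rw cell x)) - cl cell x" using card_image[OF inj(1)] by simp
      have "cl cell ` L = {1..cl cell y}"
      proof (intro equalityI subsetI)
        fix j assume j: "j \<in> {1..cl cell y}"
        then have "(rw cell y, j) \<in> boxes \<xi>" using b(2) by (auto simp: boxes_alt)
        from ex_cell[OF this] obtain z where "z \<in> X" "cell z = (rw cell y, j)" by blast
        then show "j \<in> cl cell ` L" using j by (intro image_eqI[of _ _ z]) (auto simp: L_def)
      next
        fix j assume "j \<in> cl cell ` L"
        then obtain z where "z \<in> L" "j = cl cell z" by blast
        then show "j \<in> {1..cl cell y}" using cl_pos[of z] by (simp add: L_def)
      qed
      then have cL: "card L = cl cell y" using card_image[OF inj(2)] by simp
      have "cl cell x \<le> part \<xi> (rw cell x)" using b by (auto simp: boxes_alt)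
      then show ?thesis using cU cL xy(3) by (simp add: card_Un_disjoint fin disj)
    qed
    have ZX: "?Z \<subseteq> X" using U(1) L(1) by blast
    have garn: "(\<Sum>w | w permutes ?Z. esym k cell act (act (mon m) w)) = 0"
    proof (rule garnir[OF ZX])
      fix g assume g: "g \<in> A.R"
      have g': "inv g \<in> A.R" using g by (rule stab_inv)
      \<comment> \<open>Rows get shorter downwards, so all cells involved lie in the columns that meet the upper row.\<close>
      have "(cl cell \<circ> inv g) ` ?Z \<subseteq> {1..part \<xi> (rw cell x)}"
      proof
        fix j assume "j \<in> (cl cell \<circ> inv g) ` ?Z"
        then obtain z where z: "z \<in> ?Z" "j = cl cell (inv g z)" by auto
        have zX: "inv g z \<in> X" using z ZX by (intro perm_in[OF stab_permutes[OF g']]) blast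
        have "rw cell (inv g z) = rw cell z" using g' z(1) ZX by (auto simp: stab_def simp del: atLeastAtMost_iff)
        then have "(rw cell z, j) \<in> boxes \<xi>" using cell_boxes[OF zX] z(2) by (metis prod.collapse)
        moreover have "rw cell x \<le> rw cell z" using z U(2) L(2) xy(4) by force
        ultimately have "(rw cell x, j) \<in> boxes \<xi>" using boxes_up[OF partition] rw_pos[OF xy(1)] by blast
        then show "j \<in> {1..part \<xi> (rw cell x)}" by (simp add: boxes_alt)
      qed
      then have "card ((cl cell \<circ> inv g) ` ?Z) \<le> card {1..part \<xi> (rw cell x)}" by (intro card_mono) auto
      then have "card ((cl cell \<circ> inv g) ` ?Z) < card ?Z" by (simp add: cUL)
      then have "\<not> inj_on (cl cell \<circ> inv g) ?Z" by (rule pigeonhole)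
      then show "\<exists>z\<in>?Z. \<exists>z'\<in>?Z. z \<noteq> z' \<and> cl cell (inv g z) = cl cell (inv g z')"
        unfolding inj_on_def comp_def by blast
    qed
    define W where "W = {w. w permutes ?Z}"
    \<comment> \<open>The terms that are equal to the one to be straightened. They all occur with
      sign \<open>+\<close>, so they do not cancel.\<close>
    define W1 where "W1 = {w \<in> W. esym k cell act (mon (mperm m w)) = esym k cell act (mon m)}"
    have fW: "finite W" unfolding W_def using fin by (simp add: finite_permutations)
    have "id \<in> W1" by (simp add: W1_def W_def permutes_id)
    then have c0: "card W1 \<noteq> 0" using fW by (subst card_0_eq) (auto simp: W1_def)
    have rest: "esym k cell act (mon (mperm m w)) \<in> ?N" if "w \<in> W - W1" for w
    proof (rule less.hyps)
      have w: "w permutes ?Z" using that by (simp add: W_def)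
      then have wX: "w permutes X" using ZX by (rule permutes_subset)
      show "\<rho> (mperm m w) < \<rho> m0"
        using exchange_decreases[OF U L xy(4) w] that m(4) by (auto simp: W1_def)
      show "mperm m w \<in> Mon k" by (rule mperm_Mon[OF wX m(1)])
      show "mdeg (mperm m w) = d" using m(2) by (simp add: mdeg_mperm permutes_bij[OF wX])
    qed
    have "0 = (\<Sum>w\<in>W. esym k cell act (mon (mperm m w)))" using garn by (simp add: W_def)
    also have "\<dots> = (\<Sum>w\<in>W - W1. esym k cell act (mon (mperm m w))) + (\<Sum>w\<in>W1. esym k cell act (mon (mperm m w)))"
      by (rule sum.subset_diff) (auto simp: W1_def fW)
    also have "(\<Sum>w\<in>W1. esym k cell act (mon (mperm m w))) = (\<Sum>w\<in>W1. esym k cell act (mon m))"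
      by (rule sum.cong) (auto simp: W1_def)
    also have "\<dots> = cscale (of_nat (card W1)) (esym k cell act (mon m))"
      by (rule cvs.sum_constant_scale)
    finally have "cscale (of_nat (card W1)) (esym k cell act (mon m)) = - (\<Sum>w\<in>W - W1. esym k cell act (mon (mperm m w)))"
      by (simp add: eq_neg_iff_add_eq_0 add.commute)
    also have "\<dots> \<in> ?N" by (intro cvs.span_neg cvs.span_sum rest)
    finally have "cscale (inverse (of_nat (card W1))) (cscale (of_nat (card W1)) (esym k cell act (mon m))) \<in> ?N"
      by (rule cvs.span_scale)
    then show ?thesis using c0 by simp
  qed
  ultimately show ?case by simp
qed

lemma span_esym_rtab:
  "cvs.span ((\<lambda>m. esym k cell act (mon m)) ` rtab k cell d) = esym k cell act ` polys_deg k d"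
proof -
  have "esym k cell act ` polys_deg k d = cvs.span (esym k cell act ` mon ` {m \<in> Mon k. mdeg m = d})"
    by (simp add: polys_deg_alt lin_span_image A.lin_esym)
  also have "\<dots> = cvs.span ((\<lambda>m. esym k cell act (mon m)) ` rtab k cell d)"
  proof (intro equalityI span_subset_subspaceI cvs.subspace_span)
    show "esym k cell act ` mon ` {m \<in> Mon k. mdeg m = d} \<subseteq> cvs.span ((\<lambda>m. esym k cell act (mon m)) ` rtab k cell d)"
      using esym_mon_in_span_rtab by auto
    show "(\<lambda>m. esym k cell act (mon m)) ` rtab k cell d \<subseteq> cvs.span (esym k cell act ` mon ` {m \<in> Mon k. mdeg m = d})"
      by (auto simp: rtab_def intro!: cvs.span_base imageI)
  qed
  finally show ?thesis ..
qed

end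

section \<open>The hook formula for the number of tableaux\<close>

subsection \<open>A Jacobi-Trudi determinant\<close>

definition qfac :: "nat \<Rightarrow> rat fps" where "qfac m = (\<Prod>i=1..m. 1 - fps_X ^ i)"

text \<open>The generating function of the symmetric polynomials in \<open>a\<close> variables; it vanishes for negative \<open>a\<close>.\<close>

definition hgen :: "int \<Rightarrow> rat fps" where "hgen a = (if a < 0 then 0 else inverse (qfac (nat a)))"

lemma qfac_Suc: "qfac (Suc m) = qfac m * (1 - fps_X ^ Suc m)"
  by (simp add: qfac_def)

lemma one_minus_X_power_nth_0 [simp]: "m > 0 \<Longrightarrow> fps_nth (1 - fps_X ^ m :: rat fps) 0 = 1"
  by simp

lemma one_minus_X_power_nonzero: "m > 0 \<Longrightarrow> (1 - fps_X ^ m :: rat fps) \<noteq> 0"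
  using one_minus_X_power_nth_0[of m] by (metis fps_zero_nth zero_neq_one)

lemma qfac_nth_0 [simp]: "fps_nth (qfac m) 0 = 1"
  by (induction m) (simp_all add: qfac_Suc, simp add: qfac_def)

lemma qfac_nonzero [simp]: "qfac m \<noteq> 0"
  using qfac_nth_0[of m] by (metis fps_zero_nth zero_neq_one)

lemma qfac_hgen [simp]: "qfac m * hgen (int m) = 1"
  by (simp add: hgen_def inverse_mult_eq_1')

lemma hgen_neg: "a < 0 \<Longrightarrow> hgen a = 0"
  by (simp add: hgen_def)

lemma hgen_diff:
  assumes "a \<ge> 0" shows "fps_X ^ nat a * hgen a = hgen a - hgen (a - 1)"
proof (cases "a = 0")
  case False
  define m where "m = nat (a - 1)"
  have a: "a = int (Suc m)" using assms False by (simp add: m_def)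
  have "qfac (Suc m) * (hgen a - fps_X ^ nat a * hgen a) = (qfac (Suc m) * hgen a) * (1 - fps_X ^ Suc m)"
    by (simp only: a nat_int) (simp only: right_diff_distrib left_diff_distrib mult_1_right mult_1_left mult_ac)
  also have "\<dots> = (1 - fps_X ^ Suc m) * (qfac m * hgen (int m))"
    by (simp only: a qfac_hgen mult_1 mult_1_right)
  also have "\<dots> = qfac (Suc m) * hgen (a - 1)" by (simp only: qfac_Suc a) (simp add: mult_ac)
  finally have "hgen a - fps_X ^ nat a * hgen a = hgen (a - 1)" by simp
  then show ?thesis by (simp add: algebra_simps)
qed (simp add: hgen_def)

definition jt_mat :: "nat \<Rightarrow> (nat \<Rightarrow> nat) \<Rightarrow> rat fps mat" where
  "jt_mat n lam = mat n n (\<lambda>(i, j). hgen (int (lam i) - int i + int j))"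

definition jt :: "nat \<Rightarrow> (nat \<Rightarrow> nat) \<Rightarrow> rat fps" where "jt n lam = det (jt_mat n lam)"

lemma det_mat: "det (mat n n f) = (\<Sum>p | p permutes {0..<n}. signof p * (\<Prod>i=0..<n. f (i, p i)))"
  unfolding det_def'[OF mat_carrier]
proof (intro sum.cong refl)
  fix p assume "p \<in> {p. p permutes {0..<n}}"
  then have "p i < n" if "i < n" for i using that permutes_in_image[of p "{0..<n}" i] by auto
  then show "signof p * (\<Prod>i=0..<n. mat n n f $$ (i, p i)) = signof p * (\<Prod>i=0..<n. f (i, p i))" by simp
qed

text \<open>The matrix is multiplied by a unitriangular one.\<close>

lemma det_row_differences:
  "det (mat n n (\<lambda>(i, j). R i j - (if Suc i < n then R (Suc i) j else 0))) = det (mat n n (\<lambda>(i, j). R i j :: 'a :: comm_ring_1))"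
proof -
  define U where "U = mat n n (\<lambda>(i, j). if i = j then 1 else if j = Suc i then - 1 else (0::'a))"
  have "mat n n (\<lambda>(i, j). R i j - (if Suc i < n then R (Suc i) j else 0)) = U * mat n n (\<lambda>(i, j). R i j)"
  proof (rule eq_matI)
    fix i j assume "i < dim_row (U * mat n n (\<lambda>(i, j). R i j))" "j < dim_col (U * mat n n (\<lambda>(i, j). R i j))"
    then have ij: "i < n" "j < n" by (simp_all add: U_def)
    have "(U * mat n n (\<lambda>(i, j). R i j)) $$ (i, j)
      = (\<Sum>t=0..<n. (if i = t then R t j else 0) + (if t = Suc i then - R t j else 0))"
      using ij by (auto simp: U_def scalar_prod_def intro!: sum.cong)
    also have "\<dots> = R i j - (if Suc i < n then R (Suc i) j else 0)"
      using ij by (simp add: sum.distrib)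
    finally show "mat n n (\<lambda>(i, j). R i j - (if Suc i < n then R (Suc i) j else 0)) $$ (i, j) = (U * mat n n (\<lambda>(i, j). R i j)) $$ (i, j)"
      using ij by simp
  qed (simp_all add: U_def)
  moreover have "det U = 1"
  proof -
    have "det U = prod_list (diag_mat U)"
      by (rule det_upper_triangular[of _ n]) (auto simp: U_def upper_triangular_def)
    also have "diag_mat U = replicate n 1" by (auto simp: U_def diag_mat_def intro!: nth_equalityI)
    finally show ?thesis by simp
  qed
  ultimately show ?thesis by (simp add: det_mult[of _ n] U_def)
qed

text \<open>The interlacing condition says that \<open>nu\<close> arises from \<open>lam\<close> by removing a horizontal strip.\<close>

definition strip :: "(nat \<Rightarrow> nat) \<Rightarrow> (nat \<Rightarrow> nat) set" where
  "strip lam = {nu. \<forall>i. lam (Suc i) \<le> nu i \<and> nu i \<le> lam i}"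

lemma jt_cong: "(\<And>i. i < n \<Longrightarrow> lam i = nu i) \<Longrightarrow> jt n lam = jt n nu"
  by (auto simp: jt_def jt_mat_def intro!: arg_cong[where f = det] eq_matI)

lemma sum_strip:
  assumes "\<And>i. i \<ge> n \<Longrightarrow> lam i = 0" and "\<And>nu nu'. (\<And>i. i < n \<Longrightarrow> nu i = nu' i) \<Longrightarrow> F nu = F nu'"
  shows "(\<Sum>nu\<in>strip lam. F nu) = (\<Sum>nu\<in>(\<Pi>\<^sub>E i\<in>{0..<n}. {lam (Suc i)..lam i}). F nu)"
proof (rule sum.reindex_bij_witness[of _ "\<lambda>nu i. if i < n then nu i else 0" "\<lambda>nu. restrict nu {0..<n}"])
  fix nu assume nu: "nu \<in> strip lam"
  then have "nu i \<le> lam i" for i by (simp add: strip_def)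
  then have "nu i = 0" if "i \<ge> n" for i using assms(1)[OF that] by (metis le_zero_eq)
  then show "(\<lambda>i. if i < n then restrict nu {0..<n} i else 0) = nu" by auto
  show "restrict nu {0..<n} \<in> (\<Pi>\<^sub>E i\<in>{0..<n}. {lam (Suc i)..lam i})"
    using nu by (intro restrict_PiE_iff[THEN iffD2]) (simp add: strip_def)
  show "F (restrict nu {0..<n}) = F nu" by (rule assms(2)) simp
next
  fix nu assume nu: "nu \<in> (\<Pi>\<^sub>E i\<in>{0..<n}. {lam (Suc i)..lam i})"
  show "restrict (\<lambda>i. if i < n then nu i else 0) {0..<n} = nu"
    using PiE_arb[OF nu] by (auto simp: restrict_def)
  have "lam (Suc i) \<le> nu i \<and> nu i \<le> lam i" if "i < n" for i using PiE_mem[OF nu, of i] that by simp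
  then show "(\<lambda>i. if i < n then nu i else 0) \<in> strip lam"
    using assms(1) by (simp add: strip_def)
qed

lemma finite_strip:
  assumes "\<And>i. i \<ge> n \<Longrightarrow> lam i = 0" shows "finite (strip lam)"
proof (rule inj_on_finite[of "\<lambda>nu. restrict nu {0..<n}" _ "\<Pi>\<^sub>E i\<in>{0..<n}. {lam (Suc i)..lam i}"])
  show "inj_on (\<lambda>nu. restrict nu {0..<n}) (strip lam)"
  proof (rule inj_onI, rule ext)
    fix nu nu' i assume nu: "nu \<in> strip lam" "nu' \<in> strip lam" and eq: "restrict nu {0..<n} = restrict nu' {0..<n}"
    show "nu i = nu' i"
    proof (cases "i < n")
      case True
      then show ?thesis using fun_cong[OF eq, of i] by simp
    next
      case False
      then have "lam i = 0" using assms by simp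
      then show ?thesis using nu by (simp add: strip_def) (metis le_zero_eq)
    qed
  qed
  show "(\<lambda>nu. restrict nu {0..<n}) ` strip lam \<subseteq> (\<Pi>\<^sub>E i\<in>{0..<n}. {lam (Suc i)..lam i})"
    by (intro image_subsetI PiE_I) (simp_all add: strip_def)
  show "finite (\<Pi>\<^sub>E i\<in>{0..<n}. {lam (Suc i)..lam i})" by (intro finite_PiE) simp_all
qed

text \<open>Summing over strips row by row telescopes each entry of the determinant to a difference of two
  consecutive rows, and row differences do not change a determinant.\<close>

lemma jt_recursion:
  assumes zero: "\<And>i. i \<ge> n \<Longrightarrow> lam i = 0" and mono: "\<And>i. lam (Suc i) \<le> lam i"
  shows "jt n lam = (\<Sum>nu\<in>strip lam. fps_X ^ (\<Sum>i<n. nu i) * jt n nu)"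
proof -
  let ?P = "{p. p permutes {0..<n}}" and ?V = "\<Pi>\<^sub>E i\<in>{0..<n}. {lam (Suc i)..lam i}"
  let ?T = "\<Sum>i=0..<n. i"
  \<comment> \<open>The factor \<open>q\<close> raised to the sum of all indices makes the exponents nonnegative; it is cancelled in
    the end.\<close>
  have entry: "fps_X ^ (v + j) * hgen (int v - int i + int j) =
      fps_X ^ i * (hgen (int v - int i + int j) - hgen (int v - int i + int j - 1))" for v i j
  proof (cases "int v - int i + int j < 0")
    case False
    then have "v + j = i + nat (int v - int i + int j)" by simp
    then have "fps_X ^ (v + j) * hgen (int v - int i + int j)
      = fps_X ^ i * (fps_X ^ nat (int v - int i + int j) * hgen (int v - int i + int j))"
      by (metis power_add mult.assoc)
    then show ?thesis using False by (simp only: hgen_diff not_less)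
  qed (simp add: hgen_neg)
  have tele: "(\<Sum>v\<in>{lam (Suc i)..lam i}. hgen (int v - int i + int j) - hgen (int v - int i + int j - 1))
    = hgen (int (lam i) - int i + int j) - hgen (int (lam (Suc i)) - int (Suc i) + int j)" for i j
  proof -
    have "lam (Suc i) \<le> Suc (lam i)" using mono[of i] by simp
    have "(\<Sum>v\<in>{lam (Suc i)..<Suc (lam i)}. hgen (int (Suc v) - 1 - int i + int j) - hgen (int v - 1 - int i + int j))
      = hgen (int (Suc (lam i)) - 1 - int i + int j) - hgen (int (lam (Suc i)) - 1 - int i + int j)"
      by (rule sum_Suc_diff') fact
    then show ?thesis by (simp add: atLeastLessThanSuc_atLeastAtMost algebra_simps)
  qed
  have "fps_X ^ ?T * (\<Sum>nu\<in>strip lam. fps_X ^ (\<Sum>i<n. nu i) * jt n nu)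
    = fps_X ^ ?T * (\<Sum>nu\<in>?V. fps_X ^ (\<Sum>i<n. nu i) * jt n nu)"
    using zero by (subst sum_strip[where n = n]) (auto intro!: arg_cong2[where f = "(*)"] jt_cong sum.cong arg_cong[where f = "(^) fps_X"])
  also have "\<dots> = (\<Sum>nu\<in>?V. \<Sum>p\<in>?P. signof p * (\<Prod>i=0..<n. fps_X ^ (nu i + p i) * hgen (int (nu i) - int i + int (p i))))"
  proof -
    have *: "fps_X ^ ?T = (\<Prod>i=0..<n. fps_X ^ p i :: rat fps)" if "p permutes {0..<n}" for p
      using sum.permute[OF that, of "\<lambda>i. i"] by (simp add: power_sum comp_def)
    have e: "fps_X ^ (\<Sum>i<n. nu i) = (\<Prod>i=0..<n. fps_X ^ nu i :: rat fps)" for nu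
      by (simp add: power_sum atLeast0LessThan)
    have main: "fps_X ^ ?T * (fps_X ^ (\<Sum>i<n. nu i) * (signof p * (\<Prod>i=0..<n. hgen (int (nu i) - int i + int (p i)))))
      = signof p * (\<Prod>i=0..<n. fps_X ^ (nu i + p i) * hgen (int (nu i) - int i + int (p i)))"
      if "p permutes {0..<n}" for p nu
      unfolding *[OF that] e power_add prod.distrib by (simp only: mult_ac)
    show ?thesis
      unfolding jt_def jt_mat_def det_mat case_prod_conv sum_distrib_left
      by (intro sum.cong refl main) simp
  qed
  also have "\<dots> = (\<Sum>p\<in>?P. signof p * (\<Sum>nu\<in>?V. \<Prod>i=0..<n. fps_X ^ (nu i + p i) * hgen (int (nu i) - int i + int (p i))))"
    by (subst sum.swap) (simp add: sum_distrib_left)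
  also have "\<dots> = (\<Sum>p\<in>?P. signof p * (\<Prod>i=0..<n. \<Sum>v\<in>{lam (Suc i)..lam i}. fps_X ^ (v + p i) * hgen (int v - int i + int (p i))))"
    by (subst prod_sum_PiE) auto
  also have "\<dots> = (\<Sum>p\<in>?P. signof p * (\<Prod>i=0..<n. fps_X ^ i *
      (hgen (int (lam i) - int i + int (p i)) - hgen (int (lam (Suc i)) - int (Suc i) + int (p i)))))"
    by (simp only: entry sum_distrib_left[symmetric] tele)
  also have "\<dots> = fps_X ^ ?T * (\<Sum>p\<in>?P. signof p * (\<Prod>i=0..<n.
      (hgen (int (lam i) - int i + int (p i)) - hgen (int (lam (Suc i)) - int (Suc i) + int (p i)))))"
    by (simp add: prod.distrib power_sum sum_distrib_left mult_ac)
  also have "(\<Sum>p\<in>?P. signof p * (\<Prod>i=0..<n.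
      (hgen (int (lam i) - int i + int (p i)) - hgen (int (lam (Suc i)) - int (Suc i) + int (p i)))))
    = det (mat n n (\<lambda>(i, j). hgen (int (lam i) - int i + int j) - (if Suc i < n then hgen (int (lam (Suc i)) - int (Suc i) + int j) else 0)))"
    unfolding det_mat
  proof (intro sum.cong refl arg_cong2[where f = "(*)"] prod.cong)
    fix p i assume p: "p \<in> ?P" and i: "i \<in> {0..<n}"
    have "p i < n" using p i permutes_in_image[of p "{0..<n}" i] by auto
    then show "hgen (int (lam i) - int i + int (p i)) - hgen (int (lam (Suc i)) - int (Suc i) + int (p i))
      = (case (i, p i) of (i, j) \<Rightarrow> hgen (int (lam i) - int i + int j) - (if Suc i < n then hgen (int (lam (Suc i)) - int (Suc i) + int j) else 0))"
      using zero[of "Suc i"] i by (auto simp: hgen_neg)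
  qed
  also have "\<dots> = jt n lam"
    unfolding det_row_differences[of n "\<lambda>i j. hgen (int (lam i) - int i + int j)"] by (simp add: jt_def jt_mat_def)
  finally have "fps_X ^ ?T * (\<Sum>nu\<in>strip lam. fps_X ^ (\<Sum>i<n. nu i) * jt n nu) = fps_X ^ ?T * jt n lam" .
  then show ?thesis by simp
qed

lemma jt_zero: assumes "\<And>i. i < n \<Longrightarrow> lam i = 0" shows "jt n lam = 1"
proof -
  have "jt n lam = prod_list (diag_mat (jt_mat n lam))" unfolding jt_def
    by (rule det_upper_triangular[of _ n]) (use assms in \<open>auto simp: jt_mat_def upper_triangular_def hgen_neg\<close>)
  also have "diag_mat (jt_mat n lam) = replicate n 1"
    using assms by (auto simp: jt_mat_def diag_mat_def hgen_def qfac_def intro!: nth_equalityI)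
  finally show ?thesis by simp
qed

subsection \<open>Evaluation of the determinant\<close>

text \<open>Coefficients expressing the Newton polynomials for the nodes \<open>a\<close> through those for the nodes \<open>b\<close>.\<close>

fun newton_coeff :: "(nat \<Rightarrow> 'a::comm_ring_1) \<Rightarrow> (nat \<Rightarrow> 'a) \<Rightarrow> nat \<Rightarrow> nat \<Rightarrow> 'a" where
  "newton_coeff a b 0 s = (if s = 0 then 1 else 0)"
| "newton_coeff a b (Suc m) s = newton_coeff a b m s * (a m - b s) + (case s of 0 \<Rightarrow> 0 | Suc s' \<Rightarrow> newton_coeff a b m s')"

lemma newton_coeff_above: "s > m \<Longrightarrow> newton_coeff a b m s = 0"
  by (induction m arbitrary: s) (auto split: nat.split)

lemma newton_coeff_diag: "newton_coeff a b m m = 1"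
  by (induction m) (auto simp: newton_coeff_above)

lemma newton_expansion:
  "(\<Prod>t<m. a t - x) = (\<Sum>s\<le>m. newton_coeff a b m s * (\<Prod>t<s. b t - x))"
proof (induction m)
  case (Suc m)
  let ?P = "\<lambda>s. \<Prod>t<s. b t - x" and ?c = "newton_coeff a b m"
  have "(\<Prod>t<Suc m. a t - x) = (\<Sum>s\<le>m. ?c s * ?P s * (a m - x))"
    by (simp add: Suc sum_distrib_right)
  also have "\<dots> = (\<Sum>s\<le>m. ?c s * (a m - b s) * ?P s) + (\<Sum>s\<le>m. ?c s * ?P (Suc s))"
    unfolding sum.distrib[symmetric] by (intro sum.cong refl) (simp add: algebra_simps)
  also have "(\<Sum>s\<le>m. ?c s * (a m - b s) * ?P s) = (\<Sum>s\<le>Suc m. ?c s * (a m - b s) * ?P s)"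
    by (simp add: newton_coeff_above)
  also have "(\<Sum>s\<le>m. ?c s * ?P (Suc s)) = (\<Sum>s\<le>Suc m. (case s of 0 \<Rightarrow> 0 | Suc s' \<Rightarrow> ?c s') * ?P s)"
    by (simp only: sum.atMost_Suc_shift nat.case mult_zero_left add_0_left)
  finally show ?case by (simp only: newton_coeff.simps distrib_right sum.distrib)
qed simp

text \<open>Changing the nodes is a unitriangular change of columns. With the points themselves as nodes the
  matrix becomes triangular.\<close>

lemma det_newton:
  fixes x :: "nat \<Rightarrow> 'a::idom"
  shows "det (mat n n (\<lambda>(i, j). \<Prod>t<n - 1 - j. a t - x i)) = (\<Prod>i=0..<n. \<Prod>i'=Suc i..<n. x i' - x i)"
proof -
  \<comment> \<open>The points themselves, in reverse order, as new nodes.\<close>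
  define b where "b t = x (n - 1 - t)" for t
  define M where "M = mat n n (\<lambda>(i, j). \<Prod>t<n - 1 - j. b t - x i)"
  define N where "N = mat n n (\<lambda>(i, j). newton_coeff a b (n - 1 - j) (n - 1 - i))"
  have "mat n n (\<lambda>(i, j). \<Prod>t<n - 1 - j. a t - x i) = M * N"
  proof (rule eq_matI)
    fix i j assume "i < dim_row (M * N)" "j < dim_col (M * N)"
    then have ij: "i < n" "j < n" by (simp_all add: M_def N_def)
    have "(M * N) $$ (i, j) = (\<Sum>s=0..<n. (\<Prod>t<n - 1 - s. b t - x i) * newton_coeff a b (n - 1 - j) (n - 1 - s))"
      using ij by (simp add: M_def N_def scalar_prod_def)
    also have "\<dots> = (\<Sum>s<n. newton_coeff a b (n - 1 - j) s * (\<Prod>t<s. b t - x i))"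
      by (rule sum.reindex_bij_witness[of _ "\<lambda>s. n - 1 - s" "\<lambda>s. n - 1 - s"]) (auto simp: mult.commute)
    also have "\<dots> = (\<Sum>s\<le>n - 1 - j. newton_coeff a b (n - 1 - j) s * (\<Prod>t<s. b t - x i))"
      using ij by (intro sum.mono_neutral_right) (auto simp: newton_coeff_above)
    finally show "mat n n (\<lambda>(i, j). \<Prod>t<n - 1 - j. a t - x i) $$ (i, j) = (M * N) $$ (i, j)"
      using ij by (simp add: newton_expansion[of a _ _ b])
  qed (simp_all add: M_def N_def)
  moreover have "det N = 1"
  proof -
    have "det N = prod_list (diag_mat N)"
      by (rule det_lower_triangular[of n]) (auto simp: N_def newton_coeff_above)
    also have "diag_mat N = replicate n 1" by (auto simp: N_def diag_mat_def newton_coeff_diag intro!: nth_equalityI)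
    finally show ?thesis by simp
  qed
  moreover have "det M = (\<Prod>i=0..<n. \<Prod>i'=Suc i..<n. x i' - x i)"
  proof -
    have "det M = prod_list (diag_mat M)"
    proof (rule det_upper_triangular[of _ n])
      show "upper_triangular M"
      proof
        fix i j assume ij: "j < i" "i < dim_row M"
        then have "n - 1 - i < n - 1 - j" "b (n - 1 - i) - x i = 0" by (auto simp: M_def b_def)
        then show "M $$ (i, j) = 0" using ij by (auto simp: M_def intro!: prod_zero)
      qed
    qed (simp add: M_def)
    also have "\<dots> = (\<Prod>i=0..<n. \<Prod>t<n - 1 - i. b t - x i)"
      by (auto simp: prod_list_diag_prod M_def)
    also have "\<dots> = (\<Prod>i=0..<n. \<Prod>i'=Suc i..<n. x i' - x i)"
      by (rule prod.cong[OF refl], rule prod.reindex_bij_witness[of _ "\<lambda>t. n - 1 - t" "\<lambda>t. n - 1 - t"])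
        (auto simp: b_def)
    finally show ?thesis .
  qed
  ultimately show ?thesis by (simp add: det_mult[of _ n] M_def N_def)
qed

lemma qfac_falling:
  "fps_X ^ (\<Sum>t<m. t) * (qfac l * hgen (int l - int m)) = (\<Prod>t<m. fps_X ^ t - fps_X ^ l)"
proof (induction m)
  case (Suc m)
  have "fps_X ^ (\<Sum>t<Suc m. t) * (qfac l * hgen (int l - int (Suc m)))
    = fps_X ^ m * (fps_X ^ (\<Sum>t<m. t) * (qfac l * hgen (int l - int m - 1)))"
    by (simp add: power_add mult_ac algebra_simps)
  also have "hgen (int l - int m - 1) = hgen (int l - int m) * (if m \<le> l then 1 - fps_X ^ (l - m) else 1)"
  proof (cases "m \<le> l")
    case True
    then have "fps_X ^ nat (int l - int m) * hgen (int l - int m) = hgen (int l - int m) - hgen (int l - int m - 1)"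
      by (intro hgen_diff) simp
    then show ?thesis using True by (simp add: algebra_simps nat_diff_distrib)
  qed (simp add: hgen_neg)
  also have "fps_X ^ m * (fps_X ^ (\<Sum>t<m. t) * (qfac l * (hgen (int l - int m) * (if m \<le> l then 1 - fps_X ^ (l - m) else 1))))
    = (\<Prod>t<m. fps_X ^ t - fps_X ^ l) * (fps_X ^ m * (if m \<le> l then 1 - fps_X ^ (l - m) else 1))"
    unfolding Suc[symmetric] by (simp only: mult_ac)
  also have "\<dots> = (\<Prod>t<m. fps_X ^ t - fps_X ^ l) * (fps_X ^ m - fps_X ^ l)"
  proof (cases "m \<le> l")
    case True
    have "fps_X ^ m * (1 - fps_X ^ (l - m)) = fps_X ^ m - (fps_X ^ l :: rat fps)"
      using True by (simp add: right_diff_distrib power_add[symmetric])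
    then show ?thesis using True by simp
  next
    case False
    then have "(\<Prod>t<m. fps_X ^ t - fps_X ^ l :: rat fps) = 0" by (intro prod_zero) auto
    then show ?thesis by simp
  qed
  finally show ?case by simp
qed simp

lemma sum_triangle_swap:
  "(\<Sum>i=0..<n::nat. \<Sum>i'=Suc i..<n. f i i') = (\<Sum>i'=0..<n. \<Sum>i=0..<i'. f i i')"
proof -
  have "(\<Sum>(i, i')\<in>(SIGMA i:{0..<n}. {Suc i..<n}). f i i') = (\<Sum>(i', i)\<in>(SIGMA i':{0..<n}. {0..<i'}). f i i')"
    by (rule sum.reindex_bij_witness[of _ prod.swap prod.swap]) auto
  then show ?thesis by (simp add: sum.Sigma)
qed

text \<open>Multiplying row \<open>i\<close> by \<open>qfac (len i)\<close> and the columns by suitable powers of \<open>q\<close> turns the entries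
  into the Newton polynomials for the nodes \<open>q\<^sup>t\<close>, evaluated at \<open>q\<close> to the power \<open>len i\<close>; the determinant is
  then a Vandermonde determinant.\<close>

lemma jt_product:
  fixes lam :: "nat \<Rightarrow> nat" and n :: nat
  assumes mono: "\<And>i. lam (Suc i) \<le> lam i"
  defines "len \<equiv> \<lambda>i. lam i + (n - 1 - i)"
  shows "jt n lam * (\<Prod>i=0..<n. qfac (len i)) =
    fps_X ^ (\<Sum>i=0..<n. i * lam i) * (\<Prod>i=0..<n. \<Prod>i'=Suc i..<n. 1 - fps_X ^ (len i - len i'))"
proof -
  \<comment> \<open>These powers of \<open>q\<close> clear the negative exponents of the falling products; their product over
    all columns is the same for every permutation.\<close>
  let ?b = "\<lambda>j. \<Sum>t<n - 1 - j. t"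
  let ?B = "\<Sum>j=0..<n. ?b j"
  have "fps_X ^ ?B * (jt n lam * (\<Prod>i=0..<n. qfac (len i)))
    = (\<Sum>p | p permutes {0..<n}. signof p * (\<Prod>i=0..<n. fps_X ^ ?b (p i) * (qfac (len i) * hgen (int (lam i) - int i + int (p i)))))"
  proof -
    have *: "fps_X ^ ?B = (\<Prod>i=0..<n. fps_X ^ ?b (p i) :: rat fps)" if "p permutes {0..<n}" for p
      using sum.permute[OF that, of ?b] by (simp add: power_sum comp_def)
    have main: "fps_X ^ ?B * ((signof p * (\<Prod>i=0..<n. hgen (int (lam i) - int i + int (p i)))) * (\<Prod>i=0..<n. qfac (len i)))
      = signof p * (\<Prod>i=0..<n. fps_X ^ ?b (p i) * (qfac (len i) * hgen (int (lam i) - int i + int (p i))))"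
      if "p permutes {0..<n}" for p
      unfolding *[OF that] prod.distrib by (simp only: mult_ac)
    show ?thesis
      unfolding jt_def jt_mat_def det_mat case_prod_conv sum_distrib_left sum_distrib_right
      by (intro sum.cong refl main) simp
  qed
  also have "\<dots> = det (mat n n (\<lambda>(i, j). \<Prod>t<n - 1 - j. fps_X ^ t - fps_X ^ len i))"
    unfolding det_mat
  proof (intro sum.cong refl arg_cong2[where f = "(*)"] prod.cong)
    fix p i assume "p \<in> {p. p permutes {0..<n}}" and i: "i \<in> {0..<n}"
    then have "p i < n" using permutes_in_image[of p "{0..<n}" i] by auto
    then have "int (lam i) - int i + int (p i) = int (len i) - int (n - 1 - p i)"
      using i by (auto simp: len_def)
    then show "fps_X ^ ?b (p i) * (qfac (len i) * hgen (int (lam i) - int i + int (p i)))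
      = (case (i, p i) of (i, j) \<Rightarrow> \<Prod>t<n - 1 - j. fps_X ^ t - fps_X ^ len i)"
      by (simp only: qfac_falling prod.case)
  qed
  also have "\<dots> = (\<Prod>i=0..<n. \<Prod>i'=Suc i..<n. fps_X ^ len i' - fps_X ^ len i)"
    by (rule det_newton)
  also have "\<dots> = (\<Prod>i=0..<n. \<Prod>i'=Suc i..<n. fps_X ^ len i' * (1 - fps_X ^ (len i - len i')))"
  proof (intro prod.cong refl)
    fix i i' assume "i \<in> {0..<n}" "i' \<in> {Suc i..<n}"
    moreover from this have "lam i' \<le> lam i" by (intro lift_Suc_antimono_le[of lam, OF mono]) simp
    ultimately have "len i' \<le> len i" unfolding len_def by (intro add_mono) auto
    then show "fps_X ^ len i' - fps_X ^ len i = fps_X ^ len i' * (1 - fps_X ^ (len i - len i') :: rat fps)"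
      by (simp add: right_diff_distrib power_add[symmetric])
  qed
  also have "\<dots> = fps_X ^ (\<Sum>i=0..<n. \<Sum>i'=Suc i..<n. len i') * (\<Prod>i=0..<n. \<Prod>i'=Suc i..<n. 1 - fps_X ^ (len i - len i'))"
    by (simp add: prod.distrib power_sum)
  also have "(\<Sum>i=0..<n. \<Sum>i'=Suc i..<n. len i') = ?B + (\<Sum>i=0..<n. i * lam i)"
  proof -
    have "(\<Sum>i=0..<n. \<Sum>i'=Suc i..<n. len i') = (\<Sum>i'=0..<n. \<Sum>i=0..<i'. len i')"
      by (rule sum_triangle_swap)
    also have "\<dots> = (\<Sum>i'=0..<n. i' * (n - 1 - i')) + (\<Sum>i'=0..<n. i' * lam i')"
      unfolding sum.distrib[symmetric] len_def
      by (simp only: sum_constant card_atLeastLessThan distrib_left minus_nat.diff_0 of_nat_id add.commute)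
    also have "(\<Sum>i'=0..<n. i' * (n - 1 - i')) = ?B"
    proof -
      have "?B = (\<Sum>j<n. \<Sum>t<j. t)"
        by (rule sum.reindex_bij_witness[of _ "\<lambda>j. n - 1 - j" "\<lambda>j. n - 1 - j"]) auto
      also have "\<dots> = (\<Sum>t=0..<n. \<Sum>j=Suc t..<n. t)"
        by (simp only: sum_triangle_swap lessThan_atLeast0)
      finally show ?thesis by (simp add: mult.commute Suc_eq_plus1_left)
    qed
    finally show ?thesis .
  qed
  finally have "fps_X ^ ?B * (jt n lam * (\<Prod>i=0..<n. qfac (len i))) = fps_X ^ ?B *
     (fps_X ^ (\<Sum>i=0..<n. i * lam i) * (\<Prod>i=0..<n. \<Prod>i'=Suc i..<n. 1 - fps_X ^ (len i - len i')))"
    by (simp add: power_add mult.assoc)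
  then show ?thesis by simp
qed

subsection \<open>Hook lengths\<close>

definition col_len :: "nat list \<Rightarrow> nat \<Rightarrow> nat" where
  "col_len \<xi> j = card {i. (i, j) \<in> boxes \<xi>}"

lemma finite_boxes_col: "finite {i. (i, j) \<in> boxes \<xi>}"
  by (rule finite_subset[of _ "{1..length \<xi>}"]) (auto simp: boxes_def)

lemma boxes_col:
  assumes "is_partition \<xi>" shows "{i. (i, j) \<in> boxes \<xi>} = {1..col_len \<xi> j}"
  unfolding col_len_def
  by (rule down_closed_eq_initial_segment[OF finite_boxes_col])
    (use boxes_up[OF assms] in \<open>auto simp: boxes_def\<close>)

lemma boxes_iff_col_len:
  assumes "is_partition \<xi>" "1 \<le> i" "1 \<le> j"
  shows "i \<le> col_len \<xi> j \<longleftrightarrow> j \<le> part \<xi> i"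
  using boxes_col[OF assms(1), of j] assms(2,3) by (auto simp: boxes_alt set_eq_iff)

lemma col_len_le: "is_partition \<xi> \<Longrightarrow> 1 \<le> j \<Longrightarrow> col_len \<xi> j \<le> length \<xi>"
  unfolding col_len_def by (rule order_trans[OF card_mono[of "{1..length \<xi>}"]]) (auto simp: boxes_def)

lemma hook_eq:
  assumes p: "is_partition \<xi>" and b: "(i, j) \<in> boxes \<xi>"
  shows "hook \<xi> (i, j) = (part \<xi> i - j) + (col_len \<xi> j - i) + 1"
proof -
  have ij: "1 \<le> i" "1 \<le> j" "j \<le> part \<xi> i" using b by (auto simp: boxes_alt)
  have "{(i', j') \<in> boxes \<xi>. (i' = i \<and> j \<le> j') \<or> (j' = j \<and> i \<le> i')}
    = Pair i ` {j..part \<xi> i} \<union> (\<lambda>i'. (i', j)) ` {i<..col_len \<xi> j}" (is "?A = ?B")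
  proof (rule Set.set_eqI)
    fix x :: "nat \<times> nat"
    obtain a c where x: "x = (a, c)" by (cases x)
    show "x \<in> ?A \<longleftrightarrow> x \<in> ?B"
      using ij boxes_iff_col_len[OF p, of a j] unfolding x by (cases "a = i") (auto simp: boxes_alt image_iff)
  qed
  then have "hook \<xi> (i, j) = card (Pair i ` {j..part \<xi> i} \<union> (\<lambda>i'. (i', j)) ` {i<..col_len \<xi> j})"
    by (simp add: hook_def)
  also have "\<dots> = card {j..part \<xi> i} + card {i<..col_len \<xi> j}"
    by (subst card_Un_disjoint) (auto simp: card_image inj_on_def)
  also have "\<dots> = (part \<xi> i - j) + (col_len \<xi> j - i) + 1" using ij by simp
  finally show ?thesis .
qed

text \<open>Frobenius' observation on beta numbers \<open>len i\<close>: the hook lengths of row \<open>i\<close> and the differences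
  \<open>len i - len r\<close> for later rows \<open>r\<close> are distinct and together exhaust \<open>{1..len i}\<close>.\<close>

lemma row_hook_product:
  assumes p: "is_partition \<xi>" and i: "1 \<le> i" "i \<le> length \<xi>"
  defines "len \<equiv> \<lambda>i. part \<xi> i + (length \<xi> - i)"
  shows "(\<Prod>j=1..part \<xi> i. 1 - fps_X ^ hook \<xi> (i, j)) * (\<Prod>r\<in>{i<..length \<xi>}. 1 - fps_X ^ (len i - len r)) = qfac (len i)"
proof -
  let ?n = "length \<xi>"
  define f where "f j = hook \<xi> (i, j)" for j
  define g where "g r = len i - len r" for r
  have f: "int (f j) = int (part \<xi> i) - int j + int (col_len \<xi> j) - int i + 1" "i \<le> col_len \<xi> j" "col_len \<xi> j \<le> ?n"
    if "j \<in> {1..part \<xi> i}" for j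
  proof -
    have b: "(i, j) \<in> boxes \<xi>" using that i by (auto simp: boxes_alt)
    show "i \<le> col_len \<xi> j" using boxes_iff_col_len[OF p, of i j] i that by simp
    then show "int (f j) = int (part \<xi> i) - int j + int (col_len \<xi> j) - int i + 1"
      using that by (simp add: f_def hook_eq[OF p b])
    show "col_len \<xi> j \<le> ?n" using col_len_le[OF p] that by simp
  qed
  have g: "int (g r) = int (part \<xi> i) - int i - int (part \<xi> r) + int r" "part \<xi> r \<le> part \<xi> i"
    if "r \<in> {i<..?n}" for r
  proof -
    show "part \<xi> r \<le> part \<xi> i" using part_antimono[OF p i(1), of r] that by simp
    then show "int (g r) = int (part \<xi> i) - int i - int (part \<xi> r) + int r"
      using that by (simp add: g_def len_def)
  qed
  have leni: "int (len i) = int (part \<xi> i) + int ?n - int i" using i by (simp add: len_def of_nat_diff)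
  have col_mono: "col_len \<xi> j' \<le> col_len \<xi> j" if "1 \<le> j" "j \<le> j'" for j j'
  proof (cases "1 \<le> col_len \<xi> j'")
    case True
    then show ?thesis using boxes_iff_col_len[OF p True, of j'] boxes_iff_col_len[OF p True, of j] that by simp
  qed simp
  have "f j' < f j" if "1 \<le> j" "j < j'" "j' \<le> part \<xi> i" for j j'
    using f(1)[of j] f(1)[of j'] col_mono[of j j'] that by simp
  then have injf: "inj_on f {1..part \<xi> i}" by (intro linorder_inj_onI) (force+)
  have "g r < g r'" if "i < r" "r < r'" "r' \<le> ?n" for r r'
    using g(1)[of r] g(1)[of r'] part_antimono[OF p, of r r'] that i by simp
  then have injg: "inj_on g {i<..?n}" by (intro linorder_inj_onI) (force+)
  \<comment> \<open>Whether row \<open>r\<close> reaches column \<open>j\<close> decides which of the two numbers is larger.\<close>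
  have ne: "f j \<noteq> g r" if j: "j \<in> {1..part \<xi> i}" and r: "r \<in> {i<..?n}" for j r
  proof -
    have "r \<le> col_len \<xi> j \<longleftrightarrow> j \<le> part \<xi> r" using boxes_iff_col_len[OF p, of r j] j r by simp
    then show ?thesis using f(1)[OF j] g(1)[OF r] by (cases "r \<le> col_len \<xi> j") auto
  qed
  have disj: "f ` {1..part \<xi> i} \<inter> g ` {i<..?n} = {}" using ne by blast
  have sub: "f ` {1..part \<xi> i} \<union> g ` {i<..?n} \<subseteq> {1..len i}"
  proof
    fix x assume "x \<in> f ` {1..part \<xi> i} \<union> g ` {i<..?n}"
    then consider j where "j \<in> {1..part \<xi> i}" "x = f j" | r where "r \<in> {i<..?n}" "x = g r" by blast
    then show "x \<in> {1..len i}"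
    proof cases
      case 1
      then have "1 \<le> int (f j) \<and> int (f j) \<le> int (len i)" using f[of j] leni by simp
      then show ?thesis using 1 by simp
    next
      case 2
      then have "1 \<le> int (g r) \<and> int (g r) \<le> int (len i)" using g[of r] leni by simp
      then show ?thesis using 2 by simp
    qed
  qed
  have "card (f ` {1..part \<xi> i} \<union> g ` {i<..?n}) = len i"
    using i by (subst card_Un_disjoint) (simp_all add: disj card_image injf injg len_def)
  then have "f ` {1..part \<xi> i} \<union> g ` {i<..?n} = {1..len i}"
    using sub by (intro card_subset_eq) auto
  then have "qfac (len i) = (\<Prod>x\<in>f ` {1..part \<xi> i} \<union> g ` {i<..?n}. 1 - fps_X ^ x)" by (simp add: qfac_def)
  also have "\<dots> = (\<Prod>x\<in>f ` {1..part \<xi> i}. 1 - fps_X ^ x) * (\<Prod>x\<in>g ` {i<..?n}. 1 - fps_X ^ x)"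
    by (rule prod.union_disjoint) (simp_all add: disj)
  finally show ?thesis by (simp only: prod.reindex[OF injf] prod.reindex[OF injg] comp_def f_def g_def)
qed

lemma jt_hooks:
  assumes p: "is_partition \<xi>"
  shows "jt (length \<xi>) (\<lambda>i. part \<xi> (Suc i)) * (\<Prod>x\<in>boxes \<xi>. 1 - fps_X ^ hook \<xi> x)
    = fps_X ^ (\<Sum>i\<in>{1..length \<xi>}. (i - 1) * part \<xi> i)"
proof -
  let ?n = "length \<xi>"
  let ?lam = "\<lambda>i. part \<xi> (Suc i)"
  define len where "len i = ?lam i + (?n - 1 - i)" for i
  let ?V = "\<Prod>i=0..<?n. \<Prod>i'=Suc i..<?n. 1 - fps_X ^ (len i - len i') :: rat fps"
  have shift: "(\<Sum>i\<in>{1..?n}. (i - 1) * part \<xi> i) = (\<Sum>i=0..<?n. i * ?lam i)"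
    by (rule sum.reindex_bij_witness[of _ Suc "\<lambda>i. i - 1"]) auto
  have row: "(\<Prod>j=1..?lam i. 1 - fps_X ^ hook \<xi> (Suc i, j)) * (\<Prod>i'=Suc i..<?n. 1 - fps_X ^ (len i - len i')) = qfac (len i)"
    if "i \<in> {0..<?n}" for i
  proof -
    have "(\<Prod>i'=Suc i..<?n. 1 - fps_X ^ (len i - len i')) = (\<Prod>r\<in>{Suc i<..?n}. 1 - fps_X ^ (part \<xi> (Suc i) + (?n - Suc i) - (part \<xi> r + (?n - r))) :: rat fps)"
      by (rule prod.reindex_bij_witness[of _ "\<lambda>r. r - 1" Suc]) (auto simp: len_def)
    then show ?thesis using row_hook_product[OF p, of "Suc i"] that by (simp add: len_def Suc_eq_plus1_left)
  qed
  have "(\<Prod>i=0..<?n. qfac (len i)) = (\<Prod>i=0..<?n. \<Prod>j=1..?lam i. 1 - fps_X ^ hook \<xi> (Suc i, j)) * ?V"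
    unfolding prod.distrib[symmetric] by (rule prod.cong[OF refl]) (rule row[symmetric])
  also have "(\<Prod>i=0..<?n. \<Prod>j=1..?lam i. 1 - fps_X ^ hook \<xi> (Suc i, j)) = (\<Prod>i=1..?n. \<Prod>j=1..part \<xi> i. 1 - fps_X ^ hook \<xi> (i, j) :: rat fps)"
    by (rule prod.reindex_bij_witness[of _ "\<lambda>i. i - 1" Suc]) auto
  also have "\<dots> = (\<Prod>x\<in>boxes \<xi>. 1 - fps_X ^ hook \<xi> x)"
    by (simp add: boxes_Sigma prod.Sigma)
  finally have q: "(\<Prod>i=0..<?n. qfac (len i)) = (\<Prod>x\<in>boxes \<xi>. 1 - fps_X ^ hook \<xi> x) * ?V" .
  have "jt ?n ?lam * (\<Prod>i=0..<?n. qfac (len i)) = fps_X ^ (\<Sum>i=0..<?n. i * ?lam i) * ?V"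
    unfolding len_def by (rule jt_product) (rule part_antimono[OF p], simp_all)
  then have "(jt ?n ?lam * (\<Prod>x\<in>boxes \<xi>. 1 - fps_X ^ hook \<xi> x)) * ?V = fps_X ^ (\<Sum>i=0..<?n. i * ?lam i) * ?V"
    by (simp only: q mult.assoc)
  moreover have "?V \<noteq> 0"
  proof -
    have "1 - fps_X ^ (len i - len i') \<noteq> (0 :: rat fps)" if "i \<in> {0..<?n}" "i' \<in> {Suc i..<?n}" for i i'
    proof (rule one_minus_X_power_nonzero)
      have "part \<xi> (Suc i') \<le> part \<xi> (Suc i)" using that by (intro part_antimono[OF p]) auto
      then show "0 < len i - len i'" using that by (simp add: len_def)
    qed
    then show ?thesis by (simp add: prod_zero_iff)
  qed
  ultimately show ?thesis unfolding shift by simp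
qed

lemma kostka_transpose_eq_jt:
  assumes p: "is_partition \<xi>"
  shows "kostka_transpose \<xi> = jt (length \<xi>) (\<lambda>i. part \<xi> (Suc i)) * qfac (sum_list \<xi>)"
proof -
  let ?H = "\<Prod>x\<in>boxes \<xi>. 1 - fps_X ^ hook \<xi> x :: rat fps"
  have "1 - fps_X ^ hook \<xi> x \<noteq> (0 :: rat fps)" if "x \<in> boxes \<xi>" for x
  proof (rule one_minus_X_power_nonzero)
    show "0 < hook \<xi> x" using hook_eq[OF p, of "fst x" "snd x"] that by simp
  qed
  then have H: "?H \<noteq> 0" by (simp add: prod_zero_iff)
  have "kostka_transpose \<xi> = jt (length \<xi>) (\<lambda>i. part \<xi> (Suc i)) * qfac (sum_list \<xi>) * ?H / ?H"
    unfolding kostka_transpose_def jt_hooks[OF p, symmetric] qfac_def by (simp only: mult_ac)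
  also have "\<dots> = jt (length \<xi>) (\<lambda>i. part \<xi> (Suc i)) * qfac (sum_list \<xi>)"
    by (rule nonzero_mult_div_cancel_right[OF H])
  finally show ?thesis .
qed

subsection \<open>Counting reverse semistandard tableaux\<close>

definition shape_size :: "nat \<Rightarrow> (nat \<Rightarrow> nat) \<Rightarrow> nat" where "shape_size n lam = (\<Sum>i<n. lam i)"

text \<open>Rows and columns are numbered from \<open>0\<close> here, and entries outside the shape are \<open>0\<close>.\<close>

definition rssyt :: "nat \<Rightarrow> (nat \<Rightarrow> nat) \<Rightarrow> nat \<Rightarrow> (nat \<Rightarrow> nat \<Rightarrow> nat) set" where
  "rssyt n lam d = {T. (\<forall>i j. lam i \<le> j \<longrightarrow> T i j = 0) \<and> (\<forall>i j. T i (Suc j) \<le> T i j) \<and>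
     (\<forall>i j. j < lam (Suc i) \<longrightarrow> T (Suc i) j < T i j) \<and> (\<Sum>i<n. \<Sum>j<lam i. T i j) = d}"

definition is_shape :: "nat \<Rightarrow> (nat \<Rightarrow> nat) \<Rightarrow> bool" where
  "is_shape n lam \<longleftrightarrow> (\<forall>i\<ge>n. lam i = 0) \<and> (\<forall>i. lam (Suc i) \<le> lam i)"

lemma strip_is_shape: "is_shape n lam \<Longrightarrow> nu \<in> strip lam \<Longrightarrow> is_shape n nu"
  unfolding is_shape_def strip_def by (metis (mono_tags, lifting) le_zero_eq mem_Collect_eq order_trans)

lemma rssyt_row_mono: "T \<in> rssyt n lam d \<Longrightarrow> j \<le> j' \<Longrightarrow> T i j' \<le> T i j"
  by (rule lift_Suc_antimono_le[of "T i"]) (simp_all add: rssyt_def)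

lemma finite_rssyt:
  assumes "is_shape n lam" shows "finite (rssyt n lam d)"
proof (rule inj_on_finite[of "\<lambda>T. restrict (\<lambda>(i, j). T i j) (SIGMA i:{..<n}. {..<lam i})" _ "\<Pi>\<^sub>E b\<in>(SIGMA i:{..<n}. {..<lam i}). {..d}"])
  let ?r = "\<lambda>T. restrict (\<lambda>(i, j). T i j) (SIGMA i:{..<n}. {..<lam i})"
  show "inj_on ?r (rssyt n lam d)"
  proof (rule inj_onI, intro ext)
    fix T T' i j assume T: "T \<in> rssyt n lam d" "T' \<in> rssyt n lam d" and eq: "?r T = ?r T'"
    show "T i j = T' i j"
    proof (cases "i < n \<and> j < lam i")
      case True
      then show ?thesis using fun_cong[OF eq, of "(i, j)"] by simp
    next
      case False
      then have "lam i \<le> j" using assms by (auto simp: is_shape_def not_less)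
      then show ?thesis using T by (simp add: rssyt_def)
    qed
  qed
  show "?r ` rssyt n lam d \<subseteq> (\<Pi>\<^sub>E b\<in>(SIGMA i:{..<n}. {..<lam i}). {..d})"
  proof (intro image_subsetI restrict_PiE_iff[THEN iffD2] ballI)
    fix T b assume T: "T \<in> rssyt n lam d" and b: "b \<in> (SIGMA i:{..<n}. {..<lam i})"
    have "(case b of (i, j) \<Rightarrow> T i j) \<le> (\<Sum>(i, j)\<in>(SIGMA i:{..<n}. {..<lam i}). T i j)"
      using b by (intro member_le_sum) auto
    also have "\<dots> = d" using T by (simp add: rssyt_def sum.Sigma)
    finally show "(case b of (i, j) \<Rightarrow> T i j) \<in> {..d}" by simp
  qed
  show "finite (\<Pi>\<^sub>E b\<in>(SIGMA i:{..<n}. {..<lam i}). {..d})" by (intro finite_PiE) auto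
qed

text \<open>The inverse of decreasing all nonzero entries: every tableau is raised from exactly one, whose
  shape is formed by the nonzero entries. Strictness of the columns says that the zeros form a
  horizontal strip.\<close>

definition raise :: "(nat \<Rightarrow> nat) \<Rightarrow> (nat \<Rightarrow> nat \<Rightarrow> nat) \<Rightarrow> nat \<Rightarrow> nat \<Rightarrow> nat" where
  "raise nu T = (\<lambda>i j. if j < nu i then Suc (T i j) else 0)"

lemma sum_raise:
  assumes "\<And>i. nu i \<le> lam i"
  shows "(\<Sum>i<n. \<Sum>j<lam i. raise nu T i j) = shape_size n nu + (\<Sum>i<n. \<Sum>j<nu i. T i j)"
proof -
  have "(\<Sum>j<lam i. raise nu T i j) = nu i + (\<Sum>j<nu i. T i j)" for i
  proof -
    have "(\<Sum>j<lam i. raise nu T i j) = (\<Sum>j<nu i. raise nu T i j)"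
      using assms[of i] by (intro sum.mono_neutral_right) (auto simp: raise_def)
    also have "\<dots> = (\<Sum>j<nu i. 1 + T i j)" by (rule sum.cong) (simp_all add: raise_def)
    finally show ?thesis by (simp add: sum.distrib)
  qed
  then show ?thesis by (simp add: shape_size_def sum.distrib)
qed

lemma raise_in_rssyt:
  assumes nu: "nu \<in> strip lam" and T: "T \<in> rssyt n nu e"
  shows "raise nu T \<in> rssyt n lam (shape_size n nu + e)"
proof -
  have le: "lam (Suc i) \<le> nu i" "nu i \<le> lam i" for i using nu by (auto simp: strip_def)
  have 1: "\<forall>i j. lam i \<le> j \<longrightarrow> raise nu T i j = 0"
    using le(2) by (auto simp: raise_def) (meson leD order_trans)
  have 2: "\<forall>i j. raise nu T i (Suc j) \<le> raise nu T i j" using T by (simp add: raise_def rssyt_def)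
  have 3: "\<forall>i j. j < lam (Suc i) \<longrightarrow> raise nu T (Suc i) j < raise nu T i j"
  proof (intro allI impI)
    fix i j assume "j < lam (Suc i)"
    then have "j < nu i" using le(1)[of i] by simp
    then show "raise nu T (Suc i) j < raise nu T i j" using T by (simp add: raise_def rssyt_def)
  qed
  have "(\<Sum>i<n. \<Sum>j<lam i. raise nu T i j) = shape_size n nu + e"
    using T by (simp add: sum_raise[OF le(2)] rssyt_def)
  with 1 2 3 show ?thesis unfolding rssyt_def by blast
qed

lemma rssyt_cases:
  assumes T: "T \<in> rssyt n lam d"
  obtains nu T' where "nu \<in> strip lam" "shape_size n nu \<le> d" "T' \<in> rssyt n nu (d - shape_size n nu)" "T = raise nu T'"
proof -
  define nu where "nu i = (LEAST j. T i j = 0)" for i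
  define T' where "T' i j = T i j - 1" for i j
  have T0: "T i (lam i) = 0" for i using T by (simp add: rssyt_def)
  have nu0: "T i (nu i) = 0" for i unfolding nu_def by (rule LeastI[where P = "\<lambda>j. T i j = 0", OF T0])
  have pos: "0 < T i j \<longleftrightarrow> j < nu i" for i j
  proof
    assume "0 < T i j"
    then show "j < nu i" using rssyt_row_mono[OF T, of "nu i" j i] nu0[of i] by (cases "j < nu i") auto
  next
    assume "j < nu i"
    then show "0 < T i j" unfolding nu_def using not_less_Least by blast
  qed
  have le2: "nu i \<le> lam i" for i unfolding nu_def by (rule Least_le) (rule T0)
  have le1: "lam (Suc i) \<le> nu i" for i
  proof (rule ccontr)
    assume "\<not> ?thesis"
    then have "T (Suc i) (nu i) < T i (nu i)" using T by (simp add: rssyt_def)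
    then show False using nu0[of i] by simp
  qed
  have nu: "nu \<in> strip lam" using le1 le2 by (simp add: strip_def)
  have raise: "T = raise nu T'"
    using pos by (auto simp: fun_eq_iff raise_def T'_def)
  have d: "d = shape_size n nu + (\<Sum>i<n. \<Sum>j<nu i. T' i j)"
    using T sum_raise[where nu = nu and lam = lam and n = n and T = T', OF le2] by (simp add: rssyt_def raise[symmetric])
  have "T' \<in> rssyt n nu (d - shape_size n nu)"
    unfolding rssyt_def
  proof (intro CollectI conjI allI impI)
    fix i j
    show "T' i j = 0" if "nu i \<le> j" using pos[of i j] that by (simp add: T'_def)
    show "T' i (Suc j) \<le> T' i j" using T by (simp add: T'_def rssyt_def diff_le_mono)
    show "T' (Suc i) j < T' i j" if "j < nu (Suc i)"
    proof -
      have "j < lam (Suc i)" using that le2[of "Suc i"] by simp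
      then have "T (Suc i) j < T i j" using T by (simp add: rssyt_def)
      then show ?thesis using pos[of "Suc i" j] that by (simp add: T'_def diff_less_mono)
    qed
  qed (use d in simp)
  then show ?thesis using that[OF nu _ _ raise] d by simp
qed

definition rssyt_gf :: "nat \<Rightarrow> (nat \<Rightarrow> nat) \<Rightarrow> rat fps" where
  "rssyt_gf n lam = Abs_fps (\<lambda>d. of_nat (card (rssyt n lam d)))"

lemma raise_inj:
  assumes "T \<in> rssyt n nu e" "T' \<in> rssyt n nu' e'" "raise nu T = raise nu' T'"
  shows "nu = nu' \<and> T = T'"
proof -
  have iff: "j < nu i \<longleftrightarrow> j < nu' i" for i j
    using fun_cong[OF fun_cong[OF assms(3)], of i j] by (simp add: raise_def split: if_splits)
  have "nu i = nu' i" for i using iff[of "nu i" i] iff[of "nu' i" i] by simp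
  then have nu: "nu = nu'" ..
  have "T i j = T' i j" for i j
  proof (cases "j < nu i")
    case True
    then show ?thesis using fun_cong[OF fun_cong[OF assms(3)], of i j] nu by (simp add: raise_def)
  next
    case False
    then show ?thesis using assms(1,2) nu by (simp add: rssyt_def)
  qed
  with nu show ?thesis by blast
qed

lemma rssyt_recursion:
  assumes shape: "is_shape n lam"
  shows "rssyt_gf n lam = (\<Sum>nu\<in>strip lam. fps_X ^ shape_size n nu * rssyt_gf n nu)"
proof (rule fps_ext)
  fix d
  let ?N = "{nu \<in> strip lam. shape_size n nu \<le> d}"
  have fin: "finite (strip lam)" using shape by (intro finite_strip[of n]) (simp add: is_shape_def)
  have "rssyt n lam d = (\<Union>nu\<in>?N. raise nu ` rssyt n nu (d - shape_size n nu))"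
  proof (intro equalityI subsetI)
    fix T assume "T \<in> rssyt n lam d"
    then show "T \<in> (\<Union>nu\<in>?N. raise nu ` rssyt n nu (d - shape_size n nu))"
      by (rule rssyt_cases) blast
  next
    fix T assume "T \<in> (\<Union>nu\<in>?N. raise nu ` rssyt n nu (d - shape_size n nu))"
    then show "T \<in> rssyt n lam d" using raise_in_rssyt by fastforce
  qed
  then have "card (rssyt n lam d) = (\<Sum>nu\<in>?N. card (raise nu ` rssyt n nu (d - shape_size n nu)))"
  proof (simp only:, intro card_UN_disjoint ballI impI)
    fix nu assume "nu \<in> ?N"
    then show "finite (raise nu ` rssyt n nu (d - shape_size n nu))"
      using strip_is_shape[OF shape] by (intro finite_imageI finite_rssyt) auto
  next
    fix nu nu' assume "nu \<in> ?N" "nu' \<in> ?N" "nu \<noteq> nu'"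
    then show "raise nu ` rssyt n nu (d - shape_size n nu) \<inter> raise nu' ` rssyt n nu' (d - shape_size n nu') = {}"
      using raise_inj by fast
  qed (use fin in simp)
  also have "\<dots> = (\<Sum>nu\<in>?N. card (rssyt n nu (d - shape_size n nu)))"
    by (intro sum.cong refl card_image inj_onI) (use raise_inj in blast)
  finally have "of_nat (card (rssyt n lam d)) = (\<Sum>nu\<in>?N. of_nat (card (rssyt n nu (d - shape_size n nu))) :: rat)" by simp
  also have "\<dots> = (\<Sum>nu\<in>strip lam. if d < shape_size n nu then 0 else of_nat (card (rssyt n nu (d - shape_size n nu))))"
    using fin by (intro sum.mono_neutral_cong_left) auto
  finally show "fps_nth (rssyt_gf n lam) d = fps_nth (\<Sum>nu\<in>strip lam. fps_X ^ shape_size n nu * rssyt_gf n nu) d"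
    by (simp add: fps_sum_nth rssyt_gf_def fps_X_power_mult_nth cong: if_cong)
qed

lemma rssyt_gf_zero: "rssyt_gf n (\<lambda>i. 0) = 1"
proof (rule fps_ext)
  fix d
  have "rssyt n (\<lambda>i. 0) d = (if d = 0 then {\<lambda>i j. 0} else {})"
    by (auto simp: rssyt_def fun_eq_iff)
  then show "fps_nth (rssyt_gf n (\<lambda>i. 0)) d = fps_nth 1 d" by (simp add: rssyt_gf_def)
qed

text \<open>The recursion expresses the function for \<open>lam\<close> through itself and smaller shapes; the factor of its own
  term is a power of \<open>q\<close>, different from \<open>1\<close> unless the shape is empty, so the equation can be solved.\<close>

lemma rssyt_gf_eq_jt:
  assumes "is_shape n lam" shows "rssyt_gf n lam = jt n lam"
  using assms
proof (induction "shape_size n lam" arbitrary: lam rule: less_induct)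
  case less
  have zero: "lam i = 0" if "i \<ge> n" for i using less.prems that by (simp add: is_shape_def)
  show ?case
  proof (cases "shape_size n lam = 0")
    case True
    then have "lam i = 0" if "i < n" for i using that by (simp add: shape_size_def)
    then have "lam = (\<lambda>i. 0)" using zero by (auto simp: fun_eq_iff) (metis not_less)
    then show ?thesis by (simp add: rssyt_gf_zero jt_zero)
  next
    case False
    have fin: "finite (strip lam)" by (rule finite_strip[of n]) (rule zero)
    have mem: "lam \<in> strip lam" using less.prems by (simp add: strip_def is_shape_def)
    have small: "rssyt_gf n nu = jt n nu" if "nu \<in> strip lam - {lam}" for nu
    proof (rule less.hyps)
      have le: "nu i \<le> lam i" for i using that by (simp add: strip_def)
      from that obtain i where i: "nu i \<noteq> lam i" by (auto simp: fun_eq_iff)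
      have "i < n" using i le[of i] zero[of i] by (cases "i < n") auto
      then show "shape_size n nu < shape_size n lam"
        unfolding shape_size_def using le i by (intro sum_strict_mono_ex1) (auto simp: nat_less_le)
      show "is_shape n nu" using strip_is_shape[OF less.prems] that by blast
    qed
    let ?S = "\<Sum>nu\<in>strip lam - {lam}. fps_X ^ shape_size n nu * jt n nu"
    have "rssyt_gf n lam = fps_X ^ shape_size n lam * rssyt_gf n lam + ?S"
      using rssyt_recursion[OF less.prems] small by (simp add: sum.remove[OF fin mem])
    moreover have "jt n lam = fps_X ^ shape_size n lam * jt n lam + ?S"
      using jt_recursion[of n lam] less.prems zero
      by (simp add: sum.remove[OF fin mem] is_shape_def shape_size_def)
    ultimately have "rssyt_gf n lam - fps_X ^ shape_size n lam * rssyt_gf n lam = jt n lam - fps_X ^ shape_size n lam * jt n lam"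
      by (metis add_diff_cancel_left')
    then have "(1 - fps_X ^ shape_size n lam) * rssyt_gf n lam = (1 - fps_X ^ shape_size n lam) * jt n lam"
      by (simp add: left_diff_distrib)
    then show ?thesis using False one_minus_X_power_nonzero[of "shape_size n lam"] by simp
  qed
qed

subsection \<open>Fillings as monomials\<close>

lemma lookup_sum_single: "finite S \<Longrightarrow> lookup (\<Sum>x\<in>S. single x (f x)) y = (if y \<in> S then f y else 0)"
  by (simp add: lookup_sum lookup_single when_def)

context tableau
begin

abbreviation "lam \<equiv> \<lambda>i. part \<xi> (Suc i)"

lemma is_shape_lam: "is_shape (length \<xi>) lam"
  unfolding is_shape_def using part_antimono[OF partition] by (auto simp: part_def)

lemma card_rtab: "card (rtab k cell d) = card (rssyt (length \<xi>) lam d)"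
proof -
  define pos where "pos = the_inv_into X cell"
  have pos: "pos b \<in> X" "cell (pos b) = b" if "b \<in> boxes \<xi>" for b
    using that bij_betw_the_inv_into[OF cell] f_the_inv_into_f_bij_betw[OF cell]
    by (auto simp: pos_def bij_betw_def)
  have pos_cell: "pos (cell x) = x" if "x \<in> X" for x
    using that cell by (simp add: pos_def the_inv_into_f_f bij_betw_def)
  define toT where "toT m = (\<lambda>i j. if j < lam i then lookup m (pos (Suc i, Suc j)) else (0::nat))" for m
  define fromT where "fromT T = (\<Sum>x\<in>X. single x (T (rw cell x - 1) (cl cell x - 1) :: nat))" for T
  have box: "(Suc i, Suc j) \<in> boxes \<xi>" if "j < lam i" for i j using that by (simp add: boxes_alt)
  have cellx: "cl cell x - 1 < lam (rw cell x - 1)" "Suc (rw cell x - 1) = rw cell x" "Suc (cl cell x - 1) = cl cell x"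
    if "x \<in> X" for x
    using cell_boxes[OF that] by (cases "cell x"; auto simp: boxes_alt)+
  have lookup_from: "lookup (fromT T) x = (if x \<in> X then T (rw cell x - 1) (cl cell x - 1) else 0)" for T x
    unfolding fromT_def by (rule lookup_sum_single) simp
  have total: "(\<Sum>i<length \<xi>. \<Sum>j<lam i. F (Suc i, Suc j)) = (\<Sum>x\<in>X. F (cell x))" for F :: "nat \<times> nat \<Rightarrow> nat"
  proof -
    have "(\<Sum>x\<in>X. F (cell x)) = (\<Sum>b\<in>boxes \<xi>. F b)" using sum.reindex_bij_betw[OF cell] .
    also have "\<dots> = (\<Sum>b\<in>(SIGMA i:{..<length \<xi>}. {..<lam i}). F (Suc (fst b), Suc (snd b)))"
      by (rule sum.reindex_bij_witness[of _ "\<lambda>b. (Suc (fst b), Suc (snd b))" "\<lambda>b. (fst b - 1, snd b - 1)"])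
        (auto simp: boxes_Sigma)
    finally show ?thesis by (simp add: sum.Sigma split_def)
  qed
  have "bij_betw toT (rtab k cell d) (rssyt (length \<xi>) lam d)"
  proof (rule bij_betw_byWitness[where f' = fromT])
    show "\<forall>m\<in>rtab k cell d. fromT (toT m) = m"
    proof (intro ballI poly_mapping_eqI)
      fix m x assume m: "m \<in> rtab k cell d"
      show "lookup (fromT (toT m)) x = lookup m x"
      proof (cases "x \<in> X")
        case True
        then show ?thesis using cellx[OF True] pos_cell[OF True] by (simp add: lookup_from toT_def)
      next
        case False
        then show ?thesis using m by (auto simp: lookup_from rtab_def Mon_def in_keys_iff)
      qed
    qed
    show "\<forall>T\<in>rssyt (length \<xi>) lam d. toT (fromT T) = T"
    proof (intro ballI ext)
      fix T i j assume T: "T \<in> rssyt (length \<xi>) lam d"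
      show "toT (fromT T) i j = T i j"
      proof (cases "j < lam i")
        case True
        then show ?thesis using pos[OF box[OF True]] by (simp add: toT_def lookup_from)
      next
        case False
        then show ?thesis using T by (simp add: toT_def rssyt_def)
      qed
    qed
    show "toT ` rtab k cell d \<subseteq> rssyt (length \<xi>) lam d"
    proof
      fix T assume "T \<in> toT ` rtab k cell d"
      then obtain m where m: "m \<in> rtab k cell d" and T: "T = toT m" by blast
      have "(\<Sum>i<length \<xi>. \<Sum>j<lam i. T i j) = (\<Sum>i<length \<xi>. \<Sum>j<lam i. lookup m (pos (Suc i, Suc j)))"
        by (intro sum.cong refl) (simp add: T toT_def)
      also have "\<dots> = (\<Sum>x\<in>X. lookup m (pos (cell x)))" by (rule total)
      also have "\<dots> = (\<Sum>x\<in>X. lookup m x)" by (rule sum.cong) (simp_all add: pos_cell)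
      also have "\<dots> = d" using m mdeg_Mon[of m k] by (simp add: rtab_def)
      finally have sum: "(\<Sum>i<length \<xi>. \<Sum>j<lam i. T i j) = d" .
      have row: "T i (Suc j) \<le> T i j" for i j
      proof (cases "Suc j < lam i")
        case True
        then show ?thesis
          using m pos[OF box[of "Suc j" i]] pos[OF box[of j i]] by (simp add: T toT_def rtab_def row_sorted_def)
      qed (simp add: T toT_def)
      have col: "T (Suc i) j < T i j" if j: "j < lam (Suc i)" for i j
      proof -
        have j': "j < lam i" using j part_antimono[OF partition, of "Suc i" "Suc (Suc i)"] by simp
        then show ?thesis
          using m j pos[OF box[OF j]] pos[OF box[OF j']] by (simp add: T toT_def rtab_def col_sorted_def)
      qed
      show "T \<in> rssyt (length \<xi>) lam d" unfolding rssyt_def using sum row col by (auto simp: T toT_def)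
    qed
    show "fromT ` rssyt (length \<xi>) lam d \<subseteq> rtab k cell d"
    proof
      fix m assume "m \<in> fromT ` rssyt (length \<xi>) lam d"
      then obtain T where T: "T \<in> rssyt (length \<xi>) lam d" and m: "m = fromT T" by blast
      have Mon: "m \<in> Mon k" using lookup_from[of T] by (auto simp: m Mon_def in_keys_iff split: if_splits)
      have "mdeg m = (\<Sum>x\<in>X. T (rw cell x - 1) (cl cell x - 1))"
        by (simp add: mdeg_Mon[OF Mon]) (simp add: m lookup_from)
      also have "\<dots> = (\<Sum>i<length \<xi>. \<Sum>j<lam i. T i j)"
        using total[of "\<lambda>b. T (fst b - 1) (snd b - 1)"] by simp
      finally have deg: "mdeg m = d" using T by (simp add: rssyt_def)
      have "row_sorted k cell m"
        using rssyt_row_mono[OF T] by (auto simp: row_sorted_def m lookup_from intro!: diff_le_mono simp del: atLeastAtMost_iff)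
      moreover have col: "T i' j < T i j" if "i < i'" "j < lam i'" for i i' j
        using that
      proof (induction i')
        case (Suc i')
        have step: "T (Suc i') j < T i' j" using T Suc.prems(2) by (simp add: rssyt_def)
        have "j < lam i'" using Suc.prems(2) part_antimono[OF partition, of "Suc i'" "Suc (Suc i')"] by simp
        then show ?case using Suc step by (cases "i = i'") auto
      qed simp
      have "col_sorted k cell m" unfolding col_sorted_def
      proof (intro ballI impI)
        fix x y assume xy: "x \<in> X" "y \<in> X" "cl cell x = cl cell y \<and> rw cell x < rw cell y"
        then have "T (rw cell y - 1) (cl cell y - 1) < T (rw cell x - 1) (cl cell y - 1)"
          using cellx[OF xy(1)] cellx[OF xy(2)] by (intro col) linarith+
        then show "lookup m y < lookup m x" using xy by (simp add: m lookup_from)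
      qed
      ultimately show "m \<in> rtab k cell d" using Mon deg by (simp add: rtab_def)
    qed
  qed
  then show ?thesis by (rule bij_betw_same_card)
qed

theorem rtab_gf:
  "Abs_fps (\<lambda>d. of_nat (card (rtab k cell d))) * qfac k = kostka_transpose \<xi>"
  by (simp only: card_rtab rssyt_gf_def[symmetric] rssyt_gf_eq_jt[OF is_shape_lam]
    kostka_transpose_eq_jt[OF partition] k_eq[symmetric])

end

section \<open>Coinvariants and harmonic polynomials\<close>

subsection \<open>The ideal generated by the augmentation ideal\<close>

definition coinv_ideal :: "nat \<Rightarrow> mpol set" where "coinv_ideal k = augm_mult k (polys k)"

lemma coinv_ideal_eq_span: "coinv_ideal k = cvs.span {f * p | f p. f \<in> augm k \<and> p \<in> polys k}"
  unfolding coinv_ideal_def by (rule augm_mult_eq_span[OF submod_polys])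

lemma subspace_coinv_ideal: "cvs.subspace (coinv_ideal k)"
  by (simp add: coinv_ideal_eq_span)

lemma augm_sympolys: "f \<in> augm k \<Longrightarrow> f \<in> sympolys k"
  by (simp add: augm_def)

lemma augm_polys: "f \<in> augm k \<Longrightarrow> f \<in> polys k"
  by (simp add: augm_def sympolys_def)

lemma coinv_ideal_polys: "coinv_ideal k \<subseteq> polys k"
  unfolding coinv_ideal_eq_span
  by (intro span_subset_subspaceI subspace_polys) (auto intro: polys_mult[OF augm_polys])

lemma span_image_subset:
  assumes "x \<in> cvs.span S" "lin f" "\<And>s. s \<in> S \<Longrightarrow> f s \<in> cvs.span T"
  shows "f x \<in> cvs.span T"
proof -
  have "f x \<in> cvs.span (f ` S)" using assms(1) lin_span_image[OF assms(2), of S] by blast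
  also have "\<dots> \<subseteq> cvs.span T" using assms(3) by (intro span_subset_subspaceI) auto
  finally show ?thesis .
qed

lemma coinv_ideal_mult: assumes "q \<in> polys k" "p \<in> coinv_ideal k" shows "q * p \<in> coinv_ideal k"
  using assms(2) unfolding coinv_ideal_eq_span
proof (rule span_image_subset[OF _ lin_mult_left])
  fix s assume "s \<in> {f * p | f p. f \<in> augm k \<and> p \<in> polys k}"
  then obtain f p where fp: "f \<in> augm k" "p \<in> polys k" "q * s = f * (q * p)" by (auto simp: mult.left_commute)
  then have "q * p \<in> polys k" using assms(1) by (intro polys_mult)
  then show "q * s \<in> cvs.span {f * p | f p. f \<in> augm k \<and> p \<in> polys k}" using fp by (intro cvs.span_base) blast
qed

lemma coinv_ideal_act: assumes "\<sigma> permutes {1..k}" "p \<in> coinv_ideal k" shows "act p \<sigma> \<in> coinv_ideal k"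
  using assms(2) unfolding coinv_ideal_eq_span
proof (rule span_image_subset[OF _ lin_act])
  fix s assume "s \<in> {f * p | f p. f \<in> augm k \<and> p \<in> polys k}"
  then obtain f p where fp: "f \<in> augm k" "p \<in> polys k" "act s \<sigma> = f * act p \<sigma>"
    using assms(1) by (auto simp: act_mult augm_def sympolys_act)
  then have "act p \<sigma> \<in> polys k" using assms(1) by (intro act_polys)
  then show "act s \<sigma> \<in> cvs.span {f * p | f p. f \<in> augm k \<and> p \<in> polys k}" using fp by (intro cvs.span_base) blast
qed

lemma hom_part_0_eq: "hom_part 0 f = single 0 (lookup f 0)"
  by (rule poly_mapping_eqI) (auto simp: lookup_hom_part lookup_single when_def)

lemma augm_hom_part: "f \<in> augm k \<Longrightarrow> hom_part s f \<in> augm k"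
  by (auto simp: augm_def sympolys_hom_part lookup_hom_part)

lemma augm_hom_part_0: "f \<in> augm k \<Longrightarrow> hom_part 0 f = 0"
  by (simp add: augm_def hom_part_0_eq)

lemma polys_deg_polys: "p \<in> polys_deg k d \<Longrightarrow> p \<in> polys k"
  by (simp add: polys_deg_def)

lemma coinv_ideal_hom_part: assumes "p \<in> coinv_ideal k" shows "hom_part d p \<in> coinv_ideal k"
  using assms unfolding coinv_ideal_eq_span
proof (rule span_image_subset[OF _ lin_hom_part])
  fix s assume "s \<in> {f * p | f p. f \<in> augm k \<and> p \<in> polys k}"
  then obtain f p where fp: "f \<in> augm k" "p \<in> polys k" "s = f * p" by auto
  show "hom_part d s \<in> cvs.span {f * p | f p. f \<in> augm k \<and> p \<in> polys k}"
    unfolding fp(3) hom_part_mult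
    using augm_hom_part[OF fp(1)] hom_part_polys[OF fp(2), THEN polys_deg_polys]
    by (intro cvs.span_sum cvs.span_base) blast
qed

subsection \<open>Harmonic polynomials\<close>

text \<open>The orthogonal complement of the ideal is graded and invariant under permutations, which an
  arbitrary complement need not be.\<close>

definition harmonic :: "nat \<Rightarrow> mpol set" where
  "harmonic k = {p \<in> polys k. \<forall>q\<in>coinv_ideal k. ip p q = 0}"

lemma subspace_harmonic: "cvs.subspace (harmonic k)"
proof -
  have "harmonic k = polys k \<inter> {p. \<forall>q\<in>coinv_ideal k. ip p q = 0}" by (auto simp: harmonic_def)
  then show ?thesis by (simp add: cvs.subspace_inter subspace_polys subspace_orthogonal)
qed

lemma harmonic_polys: "p \<in> harmonic k \<Longrightarrow> p \<in> polys k"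
  by (simp add: harmonic_def)

lemma ip_hom_part: "ip (hom_part s p) q = ip p (hom_part s q)"
proof -
  have "keys (hom_part s p) \<subseteq> keys p" by (auto simp: in_keys_iff lookup_hom_part split: if_splits)
  then have "ip (hom_part s p) q = (\<Sum>m\<in>keys p. lookup (hom_part s p) m * cnj (lookup q m))"
    by (intro ip_superset) auto
  also have "\<dots> = ip p (hom_part s q)" unfolding ip_def by (intro sum.cong) (auto simp: lookup_hom_part)
  finally show ?thesis .
qed

lemma harmonic_hom_part: "p \<in> harmonic k \<Longrightarrow> hom_part s p \<in> harmonic k"
  using hom_part_polys[of p k s] by (auto simp: harmonic_def ip_hom_part coinv_ideal_hom_part polys_deg_def)

lemma harmonic_act: "\<sigma> permutes {1..k} \<Longrightarrow> p \<in> harmonic k \<Longrightarrow> act p \<sigma> \<in> harmonic k"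
  by (auto simp: harmonic_def act_polys perm_module.ip_\<alpha>_left[OF perm_module_act] coinv_ideal_act permutes_inv)

lemma harmonic_coinv_ideal: "p \<in> harmonic k \<Longrightarrow> p \<in> coinv_ideal k \<Longrightarrow> p = 0"
  using ip_eq_0_iff[of p] by (auto simp: harmonic_def)

text \<open>Orthogonal projections exist for finite-dimensional spaces, so the projection is made in one degree;
  there it is orthogonal to the whole ideal, which is graded.\<close>

lemma ex_harmonic_homog:
  assumes "p \<in> polys_deg k d" shows "\<exists>h\<in>harmonic k. p - h \<in> coinv_ideal k"
proof -
  let ?J = "coinv_ideal k \<inter> polys_deg k d"
  obtain B where B: "B \<subseteq> ?J" "cvs.independent B" "?J \<subseteq> cvs.span B"
    using cvs.maximal_independent_subset by blast
  have "B \<subseteq> cvs.span (mon ` {m \<in> Mon k. mdeg m = d})" using B(1) by (auto simp: polys_deg_alt)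
  then have "finite B" using cvs.independent_span_bound[OF _ B(2)] finite_Mon_deg by blast
  then obtain w where w: "w \<in> cvs.span B" "\<forall>s\<in>cvs.span B. ip (p - w) s = 0"
    using ex_orthogonal_projection by blast
  have "cvs.span B \<subseteq> ?J"
    using B(1) by (intro span_subset_subspaceI cvs.subspace_inter subspace_coinv_ideal subspace_polys_deg)
  then have wJ: "w \<in> coinv_ideal k" "w \<in> polys_deg k d" using w(1) by auto
  have pw: "p - w \<in> polys_deg k d" using assms wJ(2) by (rule cvs.subspace_diff[OF subspace_polys_deg])
  have "ip (p - w) q = 0" if "q \<in> coinv_ideal k" for q
  proof -
    have "ip (p - w) q = ip (hom_part d (p - w)) q" using pw by (simp add: polys_deg_def homog_iff_hom_part)
    also have "\<dots> = ip (p - w) (hom_part d q)" by (rule ip_hom_part)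
    also have "hom_part d q \<in> ?J"
      using that coinv_ideal_polys[of k] hom_part_polys[of q k d] coinv_ideal_hom_part[OF that, of d] by blast
    then have "ip (p - w) (hom_part d q) = 0" using w(2) B(3) by blast
    finally show ?thesis .
  qed
  then have "p - w \<in> harmonic k" using pw by (simp add: harmonic_def polys_deg_def)
  then show ?thesis using wJ(1) by (intro bexI[of _ "p - w"]) simp_all
qed

lemma ex_harmonic: assumes "p \<in> polys k" shows "\<exists>h\<in>harmonic k. p - h \<in> coinv_ideal k"
proof -
  obtain N where N: "(\<Sum>s\<le>N. hom_part s p) = p" using ex_sum_hom_part by blast
  have "\<forall>s. \<exists>h. h \<in> harmonic k \<and> hom_part s p - h \<in> coinv_ideal k"
    using ex_harmonic_homog[OF hom_part_polys[OF assms]] by blast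
  then obtain h where h: "\<And>s. h s \<in> harmonic k" "\<And>s. hom_part s p - h s \<in> coinv_ideal k" by metis
  have "(\<Sum>s\<le>N. h s) \<in> harmonic k" using h(1) by (intro cvs.subspace_sum[OF subspace_harmonic])
  moreover have "p - (\<Sum>s\<le>N. h s) = (\<Sum>s\<le>N. hom_part s p - h s)" by (simp add: sum_subtractf N)
  moreover have "\<dots> \<in> coinv_ideal k" using h(2) by (intro cvs.subspace_sum[OF subspace_coinv_ideal])
  ultimately show ?thesis by metis
qed

text \<open>Nakayama's lemma in its graded form: a symmetric factor without constant term raises the degree.\<close>

lemma polys_deg_subset_gen_harmonic: "polys_deg k d \<subseteq> gen_submod (sympolys k) (harmonic k)"
proof (induction d rule: less_induct)
  case (less d)
  let ?N = "gen_submod (sympolys k) (harmonic k)"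
  show ?case
  proof
    fix p assume p: "p \<in> polys_deg k d"
    then obtain h where h: "h \<in> harmonic k" "p - h \<in> coinv_ideal k" using ex_harmonic[of p k] by (auto simp: polys_deg_def)
    have "hom_part d q \<in> ?N" if "q \<in> coinv_ideal k" for q
      using that unfolding coinv_ideal_eq_span gen_submod_eq_span
    proof (rule span_image_subset[OF _ lin_hom_part])
      fix s assume "s \<in> {f * p | f p. f \<in> augm k \<and> p \<in> polys k}"
      then obtain f q where fq: "f \<in> augm k" "q \<in> polys k" "s = f * q" by auto
      have "hom_part t f * hom_part (d - t) q \<in> ?N" if "t \<le> d" for t
      proof (cases "t = 0")
        case True
        then show ?thesis using augm_hom_part_0[OF fq(1)] by (simp add: cvs.subspace_0[OF subspace_gen_submod])
      next
        case False
        then have "hom_part (d - t) q \<in> ?N" using that less.IH[of "d - t"] hom_part_polys[OF fq(2)] by auto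
        then show ?thesis using augm_hom_part[OF fq(1)] by (intro gen_submod_mult) (auto simp: augm_def)
      qed
      then have "hom_part d s \<in> ?N" unfolding fq(3) hom_part_mult by (intro cvs.subspace_sum[OF subspace_gen_submod]) auto
      then show "hom_part d s \<in> cvs.span {f * g | f g. f \<in> sympolys k \<and> g \<in> harmonic k}"
        by (simp add: gen_submod_eq_span)
    qed
    then have "hom_part d (p - h) \<in> ?N" using h(2) by blast
    moreover have "hom_part d h \<in> ?N" by (intro gen_submod_base harmonic_hom_part h(1))
    ultimately have "hom_part d (p - h) + hom_part d h \<in> ?N" by (rule cvs.subspace_add[OF subspace_gen_submod])
    then show "p \<in> ?N" using p by (simp add: hom_part_add[symmetric] polys_deg_def homog_iff_hom_part)
  qed
qed

lemma polys_eq_gen_harmonic: "polys k = gen_submod (sympolys k) (harmonic k)"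
proof
  show "polys k \<subseteq> gen_submod (sympolys k) (harmonic k)"
  proof
    fix p assume p: "p \<in> polys k"
    obtain N where N: "(\<Sum>s\<le>N. hom_part s p) = p" using ex_sum_hom_part by blast
    have "(\<Sum>s\<le>N. hom_part s p) \<in> gen_submod (sympolys k) (harmonic k)"
      using hom_part_polys[OF p] polys_deg_subset_gen_harmonic by (intro cvs.subspace_sum[OF subspace_gen_submod]) blast
    then show "p \<in> gen_submod (sympolys k) (harmonic k)" by (simp add: N)
  qed
  show "gen_submod (sympolys k) (harmonic k) \<subseteq> polys k"
    by (intro gen_submod_minimal submod_polys) (auto dest: harmonic_polys)
qed

subsection \<open>Artin monomials\<close>

text \<open>The complete homogeneous symmetric polynomial of degree \<open>j\<close> in the first \<open>i\<close> variables.\<close>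

definition hpoly :: "nat \<Rightarrow> nat \<Rightarrow> mpol" where
  "hpoly i j = (\<Sum>m | m \<in> Mon i \<and> mdeg m = j. mon m)"

lemma Mon_mono: "i \<le> k \<Longrightarrow> m \<in> Mon i \<Longrightarrow> m \<in> Mon k"
  by (auto simp: Mon_def)

lemma hpoly_polys: "i \<le> k \<Longrightarrow> hpoly i j \<in> polys k"
  unfolding hpoly_def by (intro polys_sum mon_in_polys) (auto intro: Mon_mono)

lemma hpoly_recursion: "hpoly (Suc i) (Suc j) = hpoly i (Suc j) + tvar (Suc i) * hpoly (Suc i) j"
proof -
  let ?e = "single (Suc i) 1 :: nat \<Rightarrow>\<^sub>0 nat"
  let ?A = "{m. m \<in> Mon i \<and> mdeg m = Suc j}" and ?B = "{m. m \<in> Mon (Suc i) \<and> mdeg m = j}"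
  have e: "?e \<in> Mon (Suc i)" "mdeg ?e = 1" by (simp_all add: Mon_def mdeg_def)
  have "{m. m \<in> Mon (Suc i) \<and> mdeg m = Suc j} = ?A \<union> (\<lambda>m. ?e + m) ` ?B"
  proof (intro equalityI subsetI)
    fix m assume m: "m \<in> {m. m \<in> Mon (Suc i) \<and> mdeg m = Suc j}"
    show "m \<in> ?A \<union> (\<lambda>m. ?e + m) ` ?B"
    proof (cases "lookup m (Suc i) = 0")
      case True
      then have "Suc i \<notin> keys m" by (simp add: in_keys_iff)
      then have "keys m \<subseteq> {1..Suc i} - {Suc i}" using m by (auto simp: Mon_def)
      also have "\<dots> = {1..i}" by auto
      finally have "m \<in> Mon i" by (simp add: Mon_def)
      then show ?thesis using m by blast
    next
      case False
      have eq: "m = ?e + (m - ?e)"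
        using False by (intro poly_mapping_eqI) (auto simp: lookup_add lookup_minus lookup_single when_def)
      have "keys (m - ?e) \<subseteq> keys m" by (auto simp: in_keys_iff lookup_minus)
      then have "m - ?e \<in> Mon (Suc i)" using m by (auto simp: Mon_def)
      moreover have "mdeg m = 1 + mdeg (m - ?e)" using mdeg_add[of ?e "m - ?e"] e(2) eq by simp
      ultimately have "m - ?e \<in> ?B" using m by simp
      then show ?thesis using eq by blast
    qed
  next
    fix m assume "m \<in> ?A \<union> (\<lambda>m. ?e + m) ` ?B"
    then show "m \<in> {m. m \<in> Mon (Suc i) \<and> mdeg m = Suc j}"
      using Mon_add[OF e(1)] e(2) by (auto simp: mdeg_add intro: Mon_mono[of i "Suc i"])
  qed
  moreover have "?A \<inter> (\<lambda>m. ?e + m) ` ?B = {}"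
  proof -
    have "lookup m (Suc i) = 0" if "m \<in> Mon i" for m using that by (force simp: Mon_def in_keys_iff)
    then show ?thesis by (fastforce simp: lookup_add lookup_single)
  qed
  moreover have "inj_on (\<lambda>m. ?e + m) ?B" by (simp add: inj_on_def)
  ultimately have "hpoly (Suc i) (Suc j) = (\<Sum>m\<in>?A. mon m) + (\<Sum>m\<in>?B. mon (?e + m))"
    unfolding hpoly_def using finite_Mon_deg[of i "Suc j"] finite_Mon_deg[of "Suc i" j]
    by (simp add: sum.union_disjoint sum.reindex)
  also have "(\<Sum>m\<in>?B. mon (?e + m)) = tvar (Suc i) * hpoly (Suc i) j"
    by (simp add: hpoly_def sum_distrib_left tvar_def mult_single)
  finally show ?thesis by (simp add: hpoly_def)
qed

lemma hpoly_augm: "hpoly k (Suc j) \<in> augm k"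
proof -
  have "act (hpoly k (Suc j)) \<sigma> = hpoly k (Suc j)" if s: "\<sigma> permutes {1..k}" for \<sigma>
  proof -
    note b = permutes_bij[OF s] permutes_bij[OF permutes_inv[OF s]]
    have "act (hpoly k (Suc j)) \<sigma> = (\<Sum>m | m \<in> Mon k \<and> mdeg m = Suc j. mon (mperm m \<sigma>))"
      by (simp add: hpoly_def act_sum)
    also have "\<dots> = hpoly k (Suc j)" unfolding hpoly_def
      by (rule sum.reindex_bij_witness[of _ "\<lambda>m. mperm m (inv \<sigma>)" "\<lambda>m. mperm m \<sigma>"])
        (auto simp: mperm_comp b mdeg_mperm permutes_inv_o[OF s] intro: mperm_Mon[OF s] mperm_Mon[OF permutes_inv[OF s]])
    finally show ?thesis .
  qed
  moreover have "lookup (hpoly k (Suc j)) 0 = 0"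
    by (auto simp: hpoly_def lookup_sum lookup_single when_def intro!: sum.neutral)
  ultimately show ?thesis using hpoly_polys[of k k "Suc j"] by (simp add: augm_def sympolys_def)
qed

text \<open>Modulo the ideal the generating function \<open>\<Prod>\<^bsub>a\<le>i\<^esub> 1 / (1 - t\<^sub>a z)\<close> equals the polynomial
  \<open>\<Prod>\<^bsub>a>i\<^esub> (1 - t\<^sub>a z)\<close>, so its coefficients vanish beyond degree \<open>k - i\<close>.\<close>

lemma hpoly_coinv_ideal:
  "d \<le> k \<Longrightarrow> d < j \<Longrightarrow> hpoly (k - d) j \<in> coinv_ideal k"
proof (induction d arbitrary: j)
  case 0
  then obtain j' where j: "j = Suc j'" by (cases j) auto
  have "hpoly k j * 1 \<in> coinv_ideal k"
    unfolding coinv_ideal_eq_span using hpoly_augm[of k j'] one_in_polys[of k] j by (intro cvs.span_base) blast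
  then show ?case by simp
next
  case (Suc d)
  then obtain j' where j: "j = Suc j'" by (cases j) auto
  define i where "i = k - Suc d"
  have i: "Suc i = k - d" using Suc.prems by (simp add: i_def)
  have "tvar (Suc i) \<in> polys k"
    unfolding tvar_def using Suc.prems by (intro mon_in_polys) (auto simp: Mon_def i)
  then have "hpoly (Suc i) (Suc j') - tvar (Suc i) * hpoly (Suc i) j' \<in> coinv_ideal k"
    using Suc unfolding i j by (intro cvs.subspace_diff[OF subspace_coinv_ideal] coinv_ideal_mult) auto
  then show ?case by (simp add: hpoly_recursion j i_def)
qed

text \<open>The exponents are those below the staircase \<open>k - 1, k - 2, \<dots>, 0\<close>.\<close>

definition artin :: "nat \<Rightarrow> (nat \<Rightarrow>\<^sub>0 nat) set" where
  "artin k = {m \<in> Mon k. \<forall>i\<in>{1..k}. lookup m i \<le> k - i}"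

lemma card_artin: "finite (artin k)" "card (artin k) \<le> fact k"
proof -
  let ?P = "\<Pi>\<^sub>E i\<in>{1..k}. {..k - i}"
  have inj: "inj_on (\<lambda>m. restrict (lookup m) {1..k}) (artin k)"
  proof (rule inj_onI, rule poly_mapping_eqI)
    fix m m' i assume m: "m \<in> artin k" "m' \<in> artin k" and eq: "restrict (lookup m) {1..k} = restrict (lookup m') {1..k}"
    show "lookup m i = lookup m' i"
    proof (cases "i \<in> {1..k}")
      case True
      then show ?thesis using fun_cong[OF eq, of i] by simp
    next
      case False
      then have "i \<notin> keys m" "i \<notin> keys m'" using m by (auto simp: artin_def Mon_def)
      then show ?thesis by (simp add: in_keys_iff)
    qed
  qed
  have sub: "(\<lambda>m. restrict (lookup m) {1..k}) ` artin k \<subseteq> ?P"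
    by (auto simp: artin_def)
  have fin: "finite ?P" by (intro finite_PiE) auto
  show "finite (artin k)" by (rule inj_on_finite[OF inj sub fin])
  have "card (artin k) \<le> card ?P" by (rule card_inj_on_le[OF inj sub fin])
  also have "\<dots> = (\<Prod>i=1..k. Suc (k - i))" by (simp add: card_PiE)
  also have "\<dots> = (\<Prod>i=1..k. i)"
    by (rule prod.reindex_bij_witness[of _ "\<lambda>i. Suc k - i" "\<lambda>i. Suc k - i"]) auto
  finally show "card (artin k) \<le> fact k" by (simp add: fact_prod)
qed

text \<open>In the ideal there is a complete homogeneous polynomial in the first \<open>i\<close> variables whose leading term
  is a pure power of \<open>t\<^sub>i\<close>. Dividing by it reduces the exponent of \<open>t\<^sub>i\<close> and leaves those of later
  variables alone. The variables after \<open>t\<^sub>i\<close> are already reduced.\<close>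

lemma mon_reduces_to_artin:
  assumes "i \<le> k" "m \<in> Mon k" "\<And>j. i < j \<Longrightarrow> j \<le> k \<Longrightarrow> lookup m j \<le> k - j"
  shows "\<exists>u\<in>cvs.span (mon ` artin k). mon m - u \<in> coinv_ideal k"
  using assms
proof (induction i arbitrary: m)
  case 0
  then have "mon m \<in> cvs.span (mon ` artin k)" by (intro cvs.span_base) (auto simp: artin_def)
  then show ?case by (intro bexI[of _ "mon m"]) (simp_all add: cvs.subspace_0[OF subspace_coinv_ideal])
next
  case (Suc i)
  let ?G = "{p. \<exists>u\<in>cvs.span (mon ` artin k). p - u \<in> coinv_ideal k}"
  have subG: "cvs.subspace ?G"
  proof (intro cvs.subspaceI)
    show "0 \<in> ?G" by (auto intro!: bexI[of _ 0] cvs.span_zero simp: cvs.subspace_0[OF subspace_coinv_ideal])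
  next
    fix p q assume "p \<in> ?G" "q \<in> ?G"
    then obtain u v where uv: "u \<in> cvs.span (mon ` artin k)" "p - u \<in> coinv_ideal k"
      "v \<in> cvs.span (mon ` artin k)" "q - v \<in> coinv_ideal k" by blast
    have "(p + q) - (u + v) = (p - u) + (q - v)" by simp
    then show "p + q \<in> ?G"
      using uv cvs.span_add[OF uv(1,3)] cvs.subspace_add[OF subspace_coinv_ideal uv(2,4)] by (metis (mono_tags, lifting) mem_Collect_eq)
  next
    fix c p assume "p \<in> ?G"
    then obtain u where u: "u \<in> cvs.span (mon ` artin k)" "p - u \<in> coinv_ideal k" by blast
    have "cscale c p - cscale c u = cscale c (p - u)" by (simp add: cvs.scale_right_diff_distrib)
    then show "cscale c p \<in> ?G"
      using cvs.span_scale[OF u(1)] cvs.subspace_scale[OF subspace_coinv_ideal u(2)] by (metis (mono_tags, lifting) mem_Collect_eq)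
  qed
  have JG: "coinv_ideal k \<subseteq> ?G" by (auto intro!: bexI[of _ 0] cvs.span_zero)
  from Suc.prems(2,3) show ?case
  proof (induction "lookup m (Suc i)" arbitrary: m rule: less_induct)
    case (less m)
    show ?case
    proof (cases "lookup m (Suc i) \<le> k - Suc i")
      case True
      then have "lookup m j \<le> k - j" if "i < j" "j \<le> k" for j
        using less.prems(2)[of j] that by (cases "j = Suc i") auto
      then show ?thesis using Suc.IH[OF _ less.prems(1)] Suc.prems(1) by simp
    next
      case False
      define j0 where "j0 = k - i"
      let ?e = "single (Suc i) j0 :: nat \<Rightarrow>\<^sub>0 nat"
      have j0: "j0 = Suc (k - Suc i)" using Suc.prems(1) by (simp add: j0_def)
      define m0 where "m0 = m - ?e"
      have m: "m = m0 + ?e"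
        using False j0 by (intro poly_mapping_eqI) (auto simp: m0_def lookup_add lookup_minus lookup_single when_def)
      have "keys m0 \<subseteq> keys m" by (auto simp: m0_def in_keys_iff lookup_minus)
      then have m0: "m0 \<in> Mon k" using less.prems(1) by (auto simp: Mon_def)
      let ?S = "{m. m \<in> Mon (Suc i) \<and> mdeg m = j0}"
      have finS: "finite ?S" using finite_Mon_deg[of "Suc i" j0] by simp
      have eS: "?e \<in> ?S" using j0 by (simp add: Mon_def mdeg_def)
      have rest: "mon (m0 + m') \<in> ?G" if m': "m' \<in> ?S - {?e}" for m'
      proof -
        have "lookup m' (Suc i) < j0"
        proof (rule ccontr)
          assume "\<not> ?thesis"
          then have ge: "j0 \<le> lookup m' (Suc i)" by simp
          have "m' = (m' - ?e) + ?e"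
            using ge by (intro poly_mapping_eqI) (auto simp: lookup_add lookup_minus lookup_single when_def)
          then have "mdeg m' = mdeg (m' - ?e) + mdeg ?e" by (metis mdeg_add)
          then have "mdeg (m' - ?e) = 0" using m' eS by simp
          then show False using m' \<open>m' = (m' - ?e) + ?e\<close> by simp
        qed
        then have lt: "lookup (m0 + m') (Suc i) < lookup m (Suc i)" by (simp add: m lookup_add)
        have Mon: "m0 + m' \<in> Mon k"
          using m' Mon_mono[OF Suc.prems(1)] by (intro Mon_add m0) auto
        have "lookup (m0 + m') j \<le> k - j" if j: "Suc i < j" "j \<le> k" for j
        proof -
          have "j \<notin> keys m'" using m' j by (auto simp: Mon_def)
          then have "lookup (m0 + m') j = lookup m j" using j by (simp add: m lookup_add lookup_single in_keys_iff)
          then show ?thesis using less.prems(2) j by simp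
        qed
        then show ?thesis using less.hyps[OF lt Mon] by blast
      qed
      have "hpoly (Suc i) j0 \<in> coinv_ideal k"
        using hpoly_coinv_ideal[of "k - Suc i" k j0] Suc.prems(1) j0 by simp
      then have "mon m0 * hpoly (Suc i) j0 \<in> ?G" using JG coinv_ideal_mult[OF mon_in_polys[OF m0]] by blast
      moreover have "mon m0 * hpoly (Suc i) j0 = mon m + (\<Sum>m'\<in>?S - {?e}. mon (m0 + m'))"
        by (simp add: hpoly_def sum.remove[OF finS eS] distrib_left sum_distrib_left mult_single m)
      moreover have "(\<Sum>m'\<in>?S - {?e}. mon (m0 + m')) \<in> ?G" using rest by (rule cvs.subspace_sum[OF subG])
      ultimately have "mon m \<in> ?G" using cvs.subspace_diff[OF subG] by (metis (no_types, lifting) add_diff_cancel_right')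
      then show ?thesis by blast
    qed
  qed
qed

text \<open>Being a complement of the ideal, the harmonic polynomials are spanned by the projections of the
  Artin monomials.\<close>

lemma harmonic_span: "\<exists>S. finite S \<and> card S \<le> fact k \<and> harmonic k = cvs.span S"
proof -
  have "\<forall>m\<in>artin k. \<exists>h. h \<in> harmonic k \<and> mon m - h \<in> coinv_ideal k"
    using ex_harmonic[OF mon_in_polys] unfolding artin_def by blast
  then obtain h where h: "\<And>m. m \<in> artin k \<Longrightarrow> h m \<in> harmonic k \<and> mon m - h m \<in> coinv_ideal k" by metis
  let ?S = "h ` artin k"
  have sub: "cvs.span ?S \<subseteq> harmonic k" using h by (intro span_subset_subspaceI subspace_harmonic) auto
  have "\<exists>v\<in>cvs.span ?S. u - v \<in> coinv_ideal k" if "u \<in> cvs.span (mon ` artin k)" for u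
    using that
  proof (induction rule: cvs.span_induct_alt)
    case base
    show ?case by (auto intro!: bexI[of _ 0] cvs.span_zero simp: cvs.subspace_0[OF subspace_coinv_ideal])
  next
    case (step c x u)
    then obtain m v where m: "m \<in> artin k" "x = mon m" and v: "v \<in> cvs.span ?S" "u - v \<in> coinv_ideal k" by blast
    have "cscale c (h m) + v \<in> cvs.span ?S" using m v(1) by (intro cvs.span_add[OF cvs.span_scale[OF cvs.span_base]]) auto
    moreover have "cscale c x + u - (cscale c (h m) + v) = cscale c (mon m - h m) + (u - v)"
      by (simp add: m cvs.scale_right_diff_distrib del: cscale_single)
    moreover have "cscale c (mon m - h m) + (u - v) \<in> coinv_ideal k"
      using h[OF m(1)] v by (intro cvs.subspace_add[OF subspace_coinv_ideal] cvs.subspace_scale[OF subspace_coinv_ideal]) auto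
    ultimately show ?case by metis
  qed
  note artin_to_S = this
  have "p \<in> cvs.span ?S" if p: "p \<in> harmonic k" for p
  proof -
    obtain u where u: "u \<in> cvs.span (mon ` artin k)" "p - u \<in> coinv_ideal k"
    proof -
      have "\<exists>u\<in>cvs.span (mon ` artin k). q - u \<in> coinv_ideal k" if "q \<in> cvs.span (mon ` Mon k)" for q
        using that
      proof (induction rule: cvs.span_induct_alt)
        case base
        show ?case by (auto intro!: bexI[of _ 0] cvs.span_zero simp: cvs.subspace_0[OF subspace_coinv_ideal])
      next
        case (step c x q)
        then obtain m v where m: "m \<in> Mon k" "x = mon m" and v: "v \<in> cvs.span (mon ` artin k)" "q - v \<in> coinv_ideal k" by blast
        obtain w where w: "w \<in> cvs.span (mon ` artin k)" "mon m - w \<in> coinv_ideal k"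
          using mon_reduces_to_artin[OF order_refl m(1)] by auto
        have "cscale c w + v \<in> cvs.span (mon ` artin k)" using w v by (intro cvs.span_add cvs.span_scale) auto
        moreover have "cscale c x + q - (cscale c w + v) = cscale c (mon m - w) + (q - v)"
          by (simp add: m cvs.scale_right_diff_distrib del: cscale_single)
        moreover have "cscale c (mon m - w) + (q - v) \<in> coinv_ideal k"
          using w v by (intro cvs.subspace_add[OF subspace_coinv_ideal] cvs.subspace_scale[OF subspace_coinv_ideal]) auto
        ultimately show ?case by metis
      qed
      then show ?thesis using that harmonic_polys[OF p] by (auto simp: polys_alt)
    qed
    obtain v where v: "v \<in> cvs.span ?S" "u - v \<in> coinv_ideal k" using artin_to_S[OF u(1)] by blast
    have "(p - u) + (u - v) \<in> coinv_ideal k" using u v by (intro cvs.subspace_add[OF subspace_coinv_ideal])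
    then have "p - v \<in> coinv_ideal k" by simp
    moreover have "p - v \<in> harmonic k" using p v sub by (intro cvs.subspace_diff[OF subspace_harmonic]) auto
    ultimately have "p - v = 0" by (intro harmonic_coinv_ideal)
    then show ?thesis using v by simp
  qed
  then have "harmonic k = cvs.span ?S" using sub by blast
  moreover have "finite ?S" "card ?S \<le> fact k"
    using card_artin[of k] card_image_le[of "artin k" h] by auto
  ultimately show ?thesis by blast
qed

subsection \<open>Evaluation on a free orbit\<close>

definition meval :: "(nat \<Rightarrow> complex) \<Rightarrow> (nat \<Rightarrow>\<^sub>0 nat) \<Rightarrow> complex" where
  "meval x m = (\<Prod>i\<in>keys m. x i ^ lookup m i)"

definition peval :: "(nat \<Rightarrow> complex) \<Rightarrow> mpol \<Rightarrow> complex" where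
  "peval x p = (\<Sum>m\<in>keys p. lookup p m * meval x m)"

lemma meval_superset: "finite S \<Longrightarrow> keys m \<subseteq> S \<Longrightarrow> meval x m = (\<Prod>i\<in>S. x i ^ lookup m i)"
  unfolding meval_def by (intro prod.mono_neutral_left) (auto simp: in_keys_iff)

lemma meval_add: "meval x (m + m') = meval x m * meval x m'"
proof -
  let ?S = "keys m \<union> keys m'"
  have "keys (m + m') \<subseteq> ?S" by (rule keys_add)
  then show ?thesis by (simp add: meval_superset[of ?S] lookup_add power_add prod.distrib)
qed

lemma meval_mperm: "bij \<sigma> \<Longrightarrow> meval x (mperm m \<sigma>) = meval (x \<circ> inv \<sigma>) m"
proof -
  assume b: "bij \<sigma>"
  have "inj (inv \<sigma>)" using b by (simp add: bij_imp_bij_inv bij_is_inj)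
  then have "meval x (mperm m \<sigma>) = (\<Prod>i\<in>keys m. x (inv \<sigma> i) ^ lookup m (\<sigma> (inv \<sigma> i)))"
    by (simp add: meval_def keys_mperm[OF b] lookup_mperm[OF b] prod.reindex inj_on_subset)
  then show ?thesis using b by (simp add: meval_def bij_is_surj surj_f_inv_f)
qed

lemma peval_superset: "finite S \<Longrightarrow> keys p \<subseteq> S \<Longrightarrow> peval x p = (\<Sum>m\<in>S. lookup p m * meval x m)"
  unfolding peval_def by (intro sum.mono_neutral_left) (auto simp: in_keys_iff)

lemma peval_single [simp]: "peval x (single m c) = c * meval x m"
  by (cases "c = 0") (simp_all add: peval_def)

lemma peval_add: "peval x (p + q) = peval x p + peval x q"
proof -
  let ?S = "keys p \<union> keys q"
  have "keys (p + q) \<subseteq> ?S" by (rule keys_add)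
  then show ?thesis by (simp add: peval_superset[of ?S] lookup_add sum.distrib distrib_right)
qed

lemma peval_mult: "peval x (p * q) = peval x p * peval x q"
proof (induction p rule: poly_mapping_single_induct)
  case (single m c)
  show ?case
    by (induction q rule: poly_mapping_single_induct)
      (simp_all add: mult_single meval_add distrib_left peval_add mult_ac[where 'a = complex])
qed (simp add: distrib_right peval_add)

lemma peval_cscale: "peval x (cscale c p) = c * peval x p"
  by (simp add: cscale_conv_mult peval_mult meval_def)

lemma peval_diff: "peval x (p - q) = peval x p - peval x q"
  using peval_add[of x "p - q" q] by simp

lemma peval_1 [simp]: "peval x 1 = 1"
  using peval_single[of x 0 1] by (simp add: meval_def)

lemma peval_prod: "peval x (prod f I) = (\<Prod>i\<in>I. peval x (f i))"
  by (induction I rule: infinite_finite_induct) (simp_all add: peval_mult)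

lemma peval_act: "bij \<sigma> \<Longrightarrow> peval x (act p \<sigma>) = peval (x \<circ> inv \<sigma>) p"
  by (induction p rule: poly_mapping_single_induct) (simp_all add: act_add peval_add meval_mperm)

text \<open>Restriction to the orbit of the point \<open>x\<close>. Indexing the points of the orbit by \<open>g\<close> makes it an
  equivariant map to the regular representation.\<close>

definition orbit_eval :: "nat \<Rightarrow> (nat \<Rightarrow> complex) \<Rightarrow> mpol \<Rightarrow> galg" where
  "orbit_eval k x p = (\<Sum>g | g permutes {1..k}. single g (peval (x \<circ> g) p))"

lemma lookup_orbit_eval: "lookup (orbit_eval k x p) g = (if g permutes {1..k} then peval (x \<circ> g) p else 0)"
  by (simp add: orbit_eval_def lookup_sum_single)

lemma lin_orbit_eval: "lin (orbit_eval k x)"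
  by (rule linI; rule poly_mapping_eqI)
    (simp_all add: lookup_orbit_eval lookup_add lookup_cscale peval_add peval_cscale)

lemma orbit_eval_GA: "orbit_eval k x p \<in> GA k"
  by (auto simp: GA_def in_keys_iff lookup_orbit_eval split: if_splits)

lemma permutes_comp_inv_iff:
  assumes s: "\<sigma> permutes {1..k::nat}" shows "g \<circ> inv \<sigma> permutes {1..k} \<longleftrightarrow> g permutes {1..k}"
proof
  assume "g \<circ> inv \<sigma> permutes {1..k}"
  then have "(g \<circ> inv \<sigma>) \<circ> \<sigma> permutes {1..k}" by (rule permutes_compose[OF s])
  then show "g permutes {1..k}" using s by (simp add: o_assoc[symmetric] permutes_inv_o)
qed (rule permutes_compose[OF permutes_inv[OF s]])

lemma orbit_eval_act:
  assumes s: "\<sigma> permutes {1..k}" shows "orbit_eval k x (act p \<sigma>) = gact (orbit_eval k x p) \<sigma>"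
  by (rule poly_mapping_eqI)
    (simp add: lookup_gact[OF permutes_bij[OF s]] lookup_orbit_eval permutes_comp_inv_iff[OF s]
      peval_act[OF permutes_bij[OF s]] o_assoc)

lemma orbit_eval_sym_mult:
  assumes "f \<in> sympolys k" shows "orbit_eval k x (f * p) = cscale (peval x f) (orbit_eval k x p)"
proof (rule poly_mapping_eqI)
  fix g
  have "peval (x \<circ> g) f = peval x f" if g: "g permutes {1..k}"
    using peval_act[OF permutes_bij[OF permutes_inv[OF g]], of x f] sympolys_act[OF assms permutes_inv[OF g]]
    by (simp add: permutes_inv_inv[OF g])
  then show "lookup (orbit_eval k x (f * p)) g = lookup (cscale (peval x f) (orbit_eval k x p)) g"
    by (simp add: lookup_orbit_eval lookup_cscale peval_mult)
qed

text \<open>A product of linear factors, one for each coordinate and each wrong value of it.\<close>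

lemma ex_interpolation:
  assumes x: "inj_on x {1..k}" and g0: "g0 permutes {1..k}"
  shows "\<exists>p\<in>polys k. orbit_eval k x p = single g0 1"
proof -
  define F where "F i j = cscale (1 / (x (g0 i) - x j)) (tvar i - single 0 (x j))" for i j
  define p where "p = (\<Prod>i=1..k. \<Prod>j\<in>{1..k} - {g0 i}. F i j)"
  have "tvar i - single 0 (x j) \<in> polys k" if "i \<in> {1..k}" for i j
    using that unfolding tvar_def
    by (intro cvs.subspace_diff[OF subspace_polys] mon_in_polys) (auto simp: Mon_def)
  then have "F i j \<in> polys k" if "i \<in> {1..k}" for i j
    using that unfolding F_def by (intro cvs.subspace_scale[OF subspace_polys])
  then have "p \<in> polys k" unfolding p_def by (intro polys_prod)
  moreover have ev: "peval y (F i j) = (y i - x j) / (x (g0 i) - x j)" for y i j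
    by (simp add: F_def peval_cscale peval_diff tvar_def meval_def)
  have "orbit_eval k x p = single g0 1"
  proof (rule poly_mapping_eqI)
    fix g
    show "lookup (orbit_eval k x p) g = lookup (single g0 1) g"
    proof (cases "g permutes {1..k} \<and> g \<noteq> g0")
      case True
      then obtain i where i: "g i \<noteq> g0 i" by (auto simp: fun_eq_iff)
      have iX: "i \<in> {1..k}"
      proof (rule ccontr)
        assume "i \<notin> {1..k}"
        then have "g i = i" "g0 i = i" using True g0 by (auto simp: permutes_def)
        then show False using i by simp
      qed
      have "g i \<in> {1..k} - {g0 i}" using perm_in[of g k i] True iX i by blast
      moreover have "peval (x \<circ> g) (F i (g i)) = 0" by (simp add: ev)
      ultimately have "(\<Prod>j\<in>{1..k} - {g0 i}. peval (x \<circ> g) (F i j)) = 0" by (intro prod_zero) auto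
      then have "peval (x \<circ> g) p = 0" unfolding p_def peval_prod using iX by (intro prod_zero) auto
      then show ?thesis using True by (auto simp: lookup_orbit_eval lookup_single when_def)
    next
      case False
      have "peval (x \<circ> g0) (F i j) = 1" if "i \<in> {1..k}" "j \<in> {1..k} - {g0 i}" for i j
      proof -
        have "x (g0 i) \<noteq> x j" using that perm_in[OF g0 that(1)] x by (auto simp: inj_on_def simp del: atLeastAtMost_iff)
        then show ?thesis by (simp add: ev)
      qed
      then have "peval (x \<circ> g0) p = 1" unfolding p_def peval_prod by (intro prod.neutral ballI) auto
      then show ?thesis using False g0 by (auto simp: lookup_orbit_eval lookup_single when_def)
    qed
  qed
  ultimately show ?thesis by blast
qed

lemma independent_group_elements:
  "cvs.independent ((\<lambda>g. single g (1::complex)) ` {g. g permutes {1..k::nat}})"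
  "card ((\<lambda>g. single g (1::complex)) ` {g. g permutes {1..k::nat}}) = fact k"
proof -
  have *: "a g = 0" if "(\<Sum>g | g permutes {1..k}. cscale (a g) (single g 1)) = 0" "g \<in> {g. g permutes {1..k}}" for a g
  proof -
    have "lookup (\<Sum>g | g permutes {1..k}. single g (a g)) g = 0" using that(1) by simp
    then show ?thesis using that(2) by (simp add: lookup_sum_single)
  qed
  have i: "inj_on (\<lambda>g. single g (1::complex)) {g. g permutes {1..k}}"
    and "cvs.independent ((\<lambda>g. single g (1::complex)) ` {g. g permutes {1..k}})"
    using independent_familyI[of "{g. g permutes {1..k}}" "\<lambda>g. single g (1::complex)"] * by auto
  then show "cvs.independent ((\<lambda>g. single g (1::complex)) ` {g. g permutes {1..k::nat}})" by blast
  show "card ((\<lambda>g. single g (1::complex)) ` {g. g permutes {1..k::nat}}) = fact k"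
    using card_image[OF i] card_permutations[of "{1..k}" k] by simp
qed

text \<open>On a free orbit symmetric factors are scalars, so the harmonic polynomials already interpolate
  everything; being at most \<open>k!\<close>-dimensional, they do so injectively.\<close>

lemma GA_subset_orbit_eval_harmonic:
  assumes x: "inj_on x {1..k}" shows "GA k \<subseteq> orbit_eval k x ` harmonic k"
proof -
  have sub: "cvs.subspace (orbit_eval k x ` harmonic k)"
    by (rule module_hom.subspace_image[OF lin_orbit_eval subspace_harmonic])
  have "orbit_eval k x p \<in> orbit_eval k x ` harmonic k" if "p \<in> polys k" for p
  proof -
    have "p \<in> cvs.span {f * h | f h. f \<in> sympolys k \<and> h \<in> harmonic k}"
      using that by (simp add: polys_eq_gen_harmonic gen_submod_eq_span)
    then have "orbit_eval k x p \<in> cvs.span (orbit_eval k x ` harmonic k)"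
    proof (rule span_image_subset[OF _ lin_orbit_eval])
      fix s assume "s \<in> {f * h | f h. f \<in> sympolys k \<and> h \<in> harmonic k}"
      then obtain f h where "f \<in> sympolys k" "h \<in> harmonic k" "s = f * h" by blast
      then show "orbit_eval k x s \<in> cvs.span (orbit_eval k x ` harmonic k)"
        by (simp only: orbit_eval_sym_mult) (intro cvs.span_scale cvs.span_base imageI)
    qed
    then show ?thesis using sub by (metis cvs.span_eq_iff)
  qed
  then have "(\<lambda>g. single g 1) ` {g. g permutes {1..k}} \<subseteq> orbit_eval k x ` harmonic k"
    using ex_interpolation[OF x] by (metis (no_types, lifting) image_subsetI mem_Collect_eq)
  then show ?thesis unfolding GA_alt by (rule span_subset_subspaceI[OF _ sub])
qed

lemma orbit_eval_harmonic_inj: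
  assumes x: "inj_on x {1..k}" and h: "h \<in> harmonic k" "orbit_eval k x h = 0"
  shows "h = 0"
proof -
  obtain S where S: "finite S" "card S \<le> fact k" "harmonic k = cvs.span S" using harmonic_span by blast
  let ?I = "(\<lambda>g. single g (1::complex)) ` {g. g permutes {1..k::nat}}"
  have "?I \<subseteq> GA k" by (auto simp: GA_def)
  then have "?I \<subseteq> orbit_eval k x ` cvs.span S" using GA_subset_orbit_eval_harmonic[OF x] S(3) by blast
  then show ?thesis
    using lin_inj_by_count[OF lin_orbit_eval S(1), of ?I] independent_group_elements[of k] S h by simp
qed

subsection \<open>The coinvariants are the regular representation\<close>

lemma coset_eq_iff:
  assumes "cvs.subspace L" shows "coset L p = coset L q \<longleftrightarrow> p - q \<in> L"
proof
  assume "coset L p = coset L q"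
  moreover have "p + 0 \<in> coset L p" unfolding coset_def using cvs.subspace_0[OF assms] by blast
  ultimately obtain l where "l \<in> L" "p = q + l" by (auto simp: coset_def)
  then show "p - q \<in> L" by simp
next
  assume pq: "p - q \<in> L"
  have "coset L p \<subseteq> coset L q" if "p - q \<in> L" for p q
  proof
    fix y assume "y \<in> coset L p"
    then obtain l where l: "l \<in> L" "y = p + l" by (auto simp: coset_def)
    then have "y = q + ((p - q) + l)" by simp
    then show "y \<in> coset L q" unfolding coset_def using cvs.subspace_add[OF assms that l(1)] by blast
  qed
  from this[OF pq] this[of q p] cvs.subspace_neg[OF assms pq] show "coset L p = coset L q" by auto
qed

lemma mem_coset_iff: assumes "cvs.subspace L" shows "h \<in> coset L p \<longleftrightarrow> h - p \<in> L"
proof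
  assume "h - p \<in> L"
  then show "h \<in> coset L p" unfolding coset_def by (intro image_eqI[of _ _ "h - p"]) auto
qed (auto simp: coset_def)

text \<open>Every coset contains exactly one harmonic polynomial, and these are evaluated on a free orbit.\<close>

theorem ex_coinvariants_iso: "\<exists>\<psi>. coinvariants_iso k \<psi>"
proof -
  let ?J = "coinv_ideal k"
  note sJ = subspace_coinv_ideal[of k]
  define x where "x i = (of_nat i :: complex)" for i
  have x: "inj_on x {1..k}" by (simp add: x_def inj_on_def)
  define har where "har Y = (SOME h. h \<in> harmonic k \<and> h \<in> Y)" for Y
  have har: "har (coset ?J p) \<in> harmonic k" "har (coset ?J p) - p \<in> ?J" if "p \<in> polys k" for p
  proof -
    from ex_harmonic[OF that] obtain h where h: "h \<in> harmonic k" "p - h \<in> ?J" by blast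
    have "h - p \<in> ?J" using cvs.subspace_neg[OF sJ h(2)] by simp
    then have "\<exists>h. h \<in> harmonic k \<and> h \<in> coset ?J p" using h(1) by (auto simp: mem_coset_iff[OF sJ])
    from someI_ex[OF this] show "har (coset ?J p) \<in> harmonic k" "har (coset ?J p) - p \<in> ?J"
      by (simp_all add: har_def mem_coset_iff[OF sJ])
  qed
  have har_unique: "har (coset ?J p) = h" if "p \<in> polys k" "h \<in> harmonic k" "h - p \<in> ?J" for p h
  proof -
    have "(har (coset ?J p) - p) - (h - p) \<in> ?J" using har(2)[OF that(1)] that(3) by (rule cvs.subspace_diff[OF sJ])
    then have "har (coset ?J p) - h \<in> ?J" by simp
    moreover have "har (coset ?J p) - h \<in> harmonic k" using har(1)[OF that(1)] that(2) by (rule cvs.subspace_diff[OF subspace_harmonic])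
    ultimately have "har (coset ?J p) - h = 0" by (intro harmonic_coinv_ideal)
    then show ?thesis by simp
  qed
  define \<psi> where "\<psi> Y = orbit_eval k x (har Y)" for Y
  have add: "har (coset ?J (p + q)) = har (coset ?J p) + har (coset ?J q)" if "p \<in> polys k" "q \<in> polys k" for p q
  proof (rule har_unique)
    have "(har (coset ?J p) - p) + (har (coset ?J q) - q) \<in> ?J"
      using har(2) that by (intro cvs.subspace_add[OF sJ])
    then show "har (coset ?J p) + har (coset ?J q) - (p + q) \<in> ?J" by (simp add: algebra_simps)
  qed (use that har(1) in \<open>auto intro: cvs.subspace_add[OF subspace_polys] cvs.subspace_add[OF subspace_harmonic]\<close>)
  have scale: "har (coset ?J (cscale c p)) = cscale c (har (coset ?J p))" if "p \<in> polys k" for c p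
  proof (rule har_unique)
    have "cscale c (har (coset ?J p) - p) \<in> ?J"
      using har(2) that by (intro cvs.subspace_scale[OF sJ])
    then show "cscale c (har (coset ?J p)) - cscale c p \<in> ?J" by (simp add: cvs.scale_right_diff_distrib)
  qed (use that har(1) in \<open>auto intro: cvs.subspace_scale[OF subspace_polys] cvs.subspace_scale[OF subspace_harmonic]\<close>)
  have eqv: "har (coset ?J (act p \<sigma>)) = act (har (coset ?J p)) \<sigma>" if "p \<in> polys k" "\<sigma> permutes {1..k}" for p \<sigma>
  proof (rule har_unique)
    have "act (har (coset ?J p) - p) \<sigma> \<in> ?J" using har(2) that by (intro coinv_ideal_act)
    then show "act (har (coset ?J p)) \<sigma> - act p \<sigma> \<in> ?J" by (simp add: module_hom.diff[OF lin_act])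
  qed (use that har(1) in \<open>auto intro: act_polys harmonic_act\<close>)
  have "bij_betw \<psi> (quot (polys k) ?J) (GA k)"
  proof (rule bij_betw_imageI)
    show "inj_on \<psi> (quot (polys k) ?J)"
    proof (rule inj_onI)
      fix Y Z assume "Y \<in> quot (polys k) ?J" "Z \<in> quot (polys k) ?J" and eq: "\<psi> Y = \<psi> Z"
      then obtain p q where pq: "p \<in> polys k" "Y = coset ?J p" "q \<in> polys k" "Z = coset ?J q" by (auto simp: quot_def)
      have "orbit_eval k x (har Y - har Z) = 0" using eq by (simp add: \<psi>_def module_hom.diff[OF lin_orbit_eval])
      moreover have "har Y - har Z \<in> harmonic k"
        unfolding pq(2,4) by (rule cvs.subspace_diff[OF subspace_harmonic har(1)[OF pq(1)] har(1)[OF pq(3)]])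
      ultimately have "har Y - har Z = 0" by (intro orbit_eval_harmonic_inj[OF x])
      then have eq: "har (coset ?J p) = har (coset ?J q)" by (simp add: pq)
      have "(har (coset ?J q) - q) - (har (coset ?J p) - p) \<in> ?J"
        using har(2)[OF pq(3)] har(2)[OF pq(1)] by (rule cvs.subspace_diff[OF sJ])
      then show "Y = Z" unfolding pq coset_eq_iff[OF sJ] by (simp add: eq)
    qed
    have "\<psi> (coset ?J h) = orbit_eval k x h" if "h \<in> harmonic k" for h
      unfolding \<psi>_def using that harmonic_polys[OF that] by (subst har_unique) (auto simp: cvs.subspace_0[OF sJ])
    then have "orbit_eval k x h \<in> \<psi> ` quot (polys k) ?J" if "h \<in> harmonic k" for h
      using that harmonic_polys[OF that] by (metis image_eqI quot_def)
    then have "GA k \<subseteq> \<psi> ` quot (polys k) ?J" using GA_subset_orbit_eval_harmonic[OF x] by blast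
    then show "\<psi> ` quot (polys k) ?J = GA k" using orbit_eval_GA by (auto simp: \<psi>_def)
  qed
  then have "coinvariants_iso k \<psi>"
    unfolding coinvariants_iso_def Let_def coinv_ideal_def[symmetric] lin_on_def equivar_on_def
    by (simp add: \<psi>_def add scale eqv module_hom.add[OF lin_orbit_eval] module_hom.scale[OF lin_orbit_eval] orbit_eval_act)
  then show ?thesis by blast
qed

subsection \<open>Independence over the symmetric polynomials\<close>

lemma digits_sum_less:
  assumes "\<And>i. i \<in> {1..k} \<Longrightarrow> a i < (N::nat)"
  shows "(\<Sum>i=1..k. a i * N ^ i) < N ^ Suc k \<or> N = 0"
  using assms
proof (induction k)
  case (Suc k)
  show ?case
  proof (cases "N = 0")
    case False
    then have "(\<Sum>i=1..k. a i * N ^ i) < N ^ Suc k" using Suc by auto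
    moreover have "a (Suc k) * N ^ Suc k \<le> (N - 1) * N ^ Suc k" using Suc.prems[of "Suc k"] by (intro mult_right_mono) auto
    ultimately have "(\<Sum>i=1..k. a i * N ^ i) + a (Suc k) * N ^ Suc k < N ^ Suc k + (N - 1) * N ^ Suc k"
      by (rule add_less_le_mono)
    then have "(\<Sum>i=1..Suc k. a i * N ^ i) < N ^ Suc k + (N - 1) * N ^ Suc k" by simp
    also have "\<dots> = N ^ Suc (Suc k)" using False by (cases N) (simp_all add: algebra_simps)
    finally show ?thesis by blast
  qed blast
qed auto

lemma digits_unique:
  assumes "\<And>i. i \<in> {1..k} \<Longrightarrow> a i < (N::nat)" "\<And>i. i \<in> {1..k} \<Longrightarrow> b i < N"
    and "(\<Sum>i=1..k. a i * N ^ i) = (\<Sum>i=1..k. b i * N ^ i)" and "i \<in> {1..k}"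
  shows "a i = b i"
  using assms
proof (induction k arbitrary: i)
  case (Suc k)
  have N: "N \<noteq> 0" using Suc.prems(1)[of i] Suc.prems(4) by auto
  let ?A = "\<Sum>i=1..k. a i * N ^ i" and ?B = "\<Sum>i=1..k. b i * N ^ i"
  have A: "?A < N ^ Suc k" using digits_sum_less[of k a N] Suc.prems(1) N by auto
  have B: "?B < N ^ Suc k" using digits_sum_less[of k b N] Suc.prems(2) N by auto
  have eq: "?A + a (Suc k) * N ^ Suc k = ?B + b (Suc k) * N ^ Suc k" using Suc.prems(3) by simp
  from arg_cong[OF eq, of "\<lambda>y. y div N ^ Suc k"] have top: "a (Suc k) = b (Suc k)"
    using A B N by (simp add: div_mult_self1 del: power_Suc)
  with eq have "?A = ?B" by simp
  with top show ?case using Suc.IH[of i] Suc.prems by (cases "i = Suc k") auto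
qed simp

text \<open>Kronecker substitution \<open>t\<^sub>i \<mapsto> z^(N^i)\<close> separates the monomials of \<open>p\<close>, and for integers \<open>z \<ge> 2\<close> it
  gives points with distinct coordinates.\<close>

lemma peval_nonzero_point:
  assumes p: "p \<in> polys k" "p \<noteq> 0"
  shows "\<exists>x. inj_on x {1..k} \<and> peval x p \<noteq> 0"
proof -
  \<comment> \<open>\<open>N\<close> exceeds all exponents, so that they are digits in base \<open>N\<close>, and \<open>N \<ge> 2\<close>.\<close>
  define N where "N = Suc (Suc (\<Sum>m\<in>keys p. mdeg m))"
  define w where "w m = (\<Sum>i=1..k. lookup m i * N ^ i)" for m :: "nat \<Rightarrow>\<^sub>0 nat"
  have small: "lookup m i < N" if "m \<in> keys p" for m i
  proof -
    have "lookup m i \<le> mdeg m" by (rule lookup_le_mdeg)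
    also have "\<dots> \<le> (\<Sum>m\<in>keys p. mdeg m)" using that by (intro member_le_sum) auto
    finally show ?thesis by (simp add: N_def)
  qed
  have Mon: "m \<in> Mon k" if "m \<in> keys p" for m using p(1) that by (auto simp: polys_def Mon_def)
  have winj: "m = m'" if "m \<in> keys p" "m' \<in> keys p" "w m = w m'" for m m'
  proof (rule poly_mapping_eqI)
    fix i show "lookup m i = lookup m' i"
    proof (cases "i \<in> {1..k}")
      case True
      then show ?thesis using digits_unique[of k "lookup m" N "lookup m'" i] small that unfolding w_def by blast
    next
      case False
      then have "i \<notin> keys m" "i \<notin> keys m'" using Mon[OF that(1)] Mon[OF that(2)] by (auto simp: Mon_def)
      then show ?thesis by (simp add: in_keys_iff)
    qed
  qed
  define P where "P = (\<Sum>m\<in>keys p. monom (lookup p m) (w m))"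
  obtain m0 where m0: "m0 \<in> keys p" using p(2) by (metis keys_eq_empty ex_in_conv)
  have "coeff P (w m0) = (\<Sum>m\<in>keys p. if m = m0 then lookup p m0 else 0)"
    unfolding P_def coeff_sum by (intro sum.cong) (use winj m0 in auto)
  also have "\<dots> = lookup p m0" using m0 by simp
  finally have "P \<noteq> 0" using m0 by (auto simp: in_keys_iff)
  then have "finite {z. poly P z = 0}" by (rule poly_roots_finite)
  moreover have "infinite ((of_nat :: nat \<Rightarrow> complex) ` {2..})"
    by (simp add: finite_image_iff inj_on_def infinite_Ici)
  ultimately obtain z where z: "z \<ge> (2::nat)" "poly P (of_nat z) \<noteq> 0"
    by (metis (mono_tags, lifting) atLeast_iff finite_subset image_subsetI mem_Collect_eq)
  define x where "x i = (of_nat z :: complex) ^ (N ^ i)" for i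
  have "inj_on x {1..k}"
  proof (rule inj_onI)
    fix i j assume "x i = x j"
    then have "of_nat (z ^ (N ^ i)) = (of_nat (z ^ (N ^ j)) :: complex)" by (simp add: x_def)
    then have "z ^ (N ^ i) = z ^ (N ^ j)" by (simp only: of_nat_eq_iff)
    then have "N ^ i = N ^ j" using z(1) by (metis Suc_1 Suc_le_lessD power_inject_exp)
    then show "i = j" by (rule power_inject_exp[THEN iffD1, rotated]) (simp add: N_def)
  qed
  moreover have "peval x p = poly P (of_nat z)"
  proof -
    have "meval x m = of_nat z ^ w m" if "m \<in> keys p" for m
    proof -
      have "meval x m = (\<Prod>i=1..k. x i ^ lookup m i)" using Mon[OF that] by (intro meval_superset) (auto simp: Mon_def)
      also have "\<dots> = (\<Prod>i=1..k. of_nat z ^ (lookup m i * N ^ i))" by (simp add: x_def power_mult[symmetric] mult.commute)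
      finally show ?thesis by (simp add: w_def power_sum)
    qed
    then show ?thesis by (simp add: peval_def P_def poly_sum poly_monom)
  qed
  ultimately show ?thesis using z(2) by auto
qed

text \<open>Evaluating a relation on an orbit replaces the coefficients by numbers; since evaluation is injective
  on harmonic polynomials, the result is a linear relation.\<close>

lemma harmonic_independent_over_sympolys:
  assumes B: "B \<subseteq> harmonic k" "cvs.independent B"
    and F: "finite F" "F \<subseteq> B" "c ` F \<subseteq> sympolys k" "(\<Sum>b\<in>F. c b * b) = 0"
  shows "\<forall>b\<in>F. c b = 0"
proof (rule ccontr)
  assume "\<not> ?thesis"
  then obtain b0 where b0: "b0 \<in> F" "c b0 \<noteq> 0" by blast
  then obtain x where x: "inj_on x {1..k}" "peval x (c b0) \<noteq> 0"
    using peval_nonzero_point[of "c b0" k] F(3) sympolys_polys by blast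
  let ?h = "\<Sum>b\<in>F. cscale (peval x (c b)) b"
  have "orbit_eval k x ?h = (\<Sum>b\<in>F. orbit_eval k x (c b * b))"
    unfolding module_hom.sum[OF lin_orbit_eval] module_hom.scale[OF lin_orbit_eval]
    using F(3) by (intro sum.cong) (auto simp: orbit_eval_sym_mult)
  also have "\<dots> = 0" by (simp add: module_hom.sum[OF lin_orbit_eval, symmetric] F(4) module_hom.zero[OF lin_orbit_eval])
  finally have "orbit_eval k x ?h = 0" .
  moreover have "?h \<in> harmonic k"
    using B(1) F(2) by (intro cvs.subspace_sum[OF subspace_harmonic] cvs.subspace_scale[OF subspace_harmonic]) auto
  ultimately have "?h = 0" by (intro orbit_eval_harmonic_inj[OF x(1)])
  then have "peval x (c b0) = 0" using cvs.independentD[OF B(2) F(1,2), of "\<lambda>b. peval x (c b)"] b0(1) by simp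
  then show False using x(2) by simp
qed

section \<open>The module generated by the polynomials p(r)\<close>

subsection \<open>Generators vanishing on the first row\<close>

definition mrestrict :: "nat set \<Rightarrow> (nat \<Rightarrow>\<^sub>0 nat) \<Rightarrow> (nat \<Rightarrow>\<^sub>0 nat)" where
  "mrestrict S m = (\<Sum>x\<in>S. single x (lookup m x))"

lemma lookup_mrestrict: "finite S \<Longrightarrow> lookup (mrestrict S m) x = (if x \<in> S then lookup m x else 0)"
  by (simp add: mrestrict_def lookup_sum_single)

lemma sympolys_orbit_sum:
  assumes "m \<in> Mon k" shows "(\<Sum>g | g permutes {1..k}. mon (mperm m g)) \<in> sympolys k"
proof -
  have "act (\<Sum>g | g permutes {1..k}. mon (mperm m g)) \<sigma> = (\<Sum>g | g permutes {1..k}. mon (mperm m g))"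
    if s: "\<sigma> permutes {1..k}" for \<sigma>
  proof -
    have "act (\<Sum>g | g permutes {1..k}. mon (mperm m g)) \<sigma> = (\<Sum>g | g permutes {1..k}. mon (mperm m (g \<circ> \<sigma>)))"
      by (simp add: act_sum mperm_comp permutes_bij permutes_bij[OF s])
    also have "\<dots> = (\<Sum>g | g permutes {1..k}. mon (mperm m g))"
      by (rule sum.reindex_bij_witness[of _ "\<lambda>g. g \<circ> inv \<sigma>" "\<lambda>g. g \<circ> \<sigma>"])
        (auto simp: o_assoc[symmetric] permutes_inv_o[OF s] permutes_comp_inv_iff[OF s] permutes_compose[OF s])
    finally show ?thesis .
  qed
  moreover have "(\<Sum>g | g permutes {1..k}. mon (mperm m g)) \<in> polys k"
    by (intro polys_sum mon_in_polys) (simp add: mperm_Mon assms)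
  ultimately show ?thesis by (simp add: sympolys_def)
qed

context tableau
begin

lemma esym_sym_mult:
  assumes f: "f \<in> sympolys k" shows "esym k cell act (f * p) = f * esym k cell act p"
proof -
  have a: "act (f * p) g = f * act p g" if "g permutes X" for g p
    using f that by (simp add: act_mult sympolys_act)
  have "asym k cell act (f * p) = f * asym k cell act p" for p
    unfolding asym_def sum_distrib_left by (intro sum.cong refl a stab_permutes)
  moreover have "bsym k cell act (f * p) = f * bsym k cell act p" for p
    unfolding bsym_def sum_distrib_left cscale_mult_right[symmetric]
    by (intro sum.cong refl) (simp add: a stab_permutes cscale_mult_right)
  ultimately show ?thesis by (simp add: esym_def)
qed

lemma esym_polys: "p \<in> polys k \<Longrightarrow> esym k cell act p \<in> polys k"
  unfolding esym_def bsym_def asym_def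
  by (intro polys_sum cvs.subspace_scale[OF subspace_polys] act_polys stab_permutes)

lemma hom_part_esym: "hom_part s (esym k cell act p) = esym k cell act (hom_part s p)"
  unfolding esym_def bsym_def asym_def
  by (simp add: hom_part_sum hom_part_scale hom_part_act permutes_bij[OF stab_permutes] act_sum)

lemma submod_esym: "submod (sympolys k) (esym k cell act ` polys k)"
  unfolding submod_def
proof (intro conjI ballI)
  show "0 \<in> esym k cell act ` polys k"
    using cvs.subspace_0[OF subspace_polys] by (intro image_eqI[of _ _ 0]) (simp_all add: module_hom.zero[OF A.lin_esym])
next
  fix p q assume "p \<in> esym k cell act ` polys k" "q \<in> esym k cell act ` polys k"
  then show "p + q \<in> esym k cell act ` polys k"
    using cvs.subspace_add[OF module_hom.subspace_image[OF A.lin_esym subspace_polys]] by blast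
next
  fix f p assume f: "f \<in> sympolys k" and "p \<in> esym k cell act ` polys k"
  then obtain q where q: "q \<in> polys k" "p = esym k cell act q" by blast
  then show "f * p \<in> esym k cell act ` polys k"
    using polys_mult[OF sympolys_polys[OF f] q(1)] by (intro image_eqI[of _ _ "f * q"]) (simp_all add: esym_sym_mult[OF f])
qed

text \<open>The first-row part of \<open>m\<close>, moved by \<open>g\<close>, still lies in the first row, so its entries there form the
  same multiset as before.\<close>

lemma first_row_rearrangement:
  fixes g :: "nat \<Rightarrow> nat"
  defines "S \<equiv> {x \<in> X. rw cell x = 1}"
  assumes m: "m \<in> Mon k" and g: "g permutes X"
    and supp: "\<And>x. x \<in> X \<Longrightarrow> lookup (mrestrict S m) (g x) \<noteq> 0 \<Longrightarrow> x \<in> S"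
  shows "\<exists>\<rho>\<in>A.R. mperm (mrestrict S m) g + mrestrict (X - S) m = mperm m \<rho>"
proof -
  let ?m1 = "mrestrict S m"
  have fin: "finite S" "finite (X - S)" and SX: "S \<subseteq> X" by (auto simp: S_def)
  \<comment> \<open>Outside \<open>S\<close> both functions vanish, so they take the same values with multiplicity on \<open>S\<close>.\<close>
  have "image_mset (\<lambda>x. lookup ?m1 (g x)) (mset_set X) = image_mset (lookup ?m1) (image_mset g (mset_set X))"
    by (simp add: multiset.map_comp comp_def)
  also have "image_mset g (mset_set X) = mset_set X"
    using image_mset_mset_set[of g X] permutes_inj[OF g] permutes_image[OF g] by (simp add: inj_on_subset)
  finally have "image_mset (\<lambda>x. lookup ?m1 (g x)) (mset_set X) = image_mset (lookup ?m1) (mset_set X)" .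
  moreover have split: "mset_set X = mset_set S + mset_set (X - S)"
    using mset_set_Union[of S "X - S"] fin SX by (simp add: Un_absorb1 Un_Diff_cancel)
  moreover have "image_mset (\<lambda>x. lookup ?m1 (g x)) (mset_set (X - S)) = image_mset (lookup ?m1) (mset_set (X - S))"
  proof (rule image_mset_cong)
    fix x assume "x \<in># mset_set (X - S)"
    then have x: "x \<in> X" "x \<notin> S" using fin(2) by auto
    then have "lookup ?m1 (g x) = 0" using supp[OF x(1)] by blast
    then show "lookup ?m1 (g x) = lookup ?m1 x" using x(2) by (simp add: lookup_mrestrict[OF fin(1)])
  qed
  ultimately have "image_mset (\<lambda>x. lookup ?m1 (g x)) (mset_set S) = image_mset (lookup ?m1) (mset_set S)" by simp
  then obtain \<rho> where \<rho>: "\<rho> permutes S" "\<forall>x\<in>S. lookup ?m1 (g x) = lookup ?m1 (\<rho> x)"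
    using image_mset_eq_implies_permutes[OF fin(1)] by metis
  have \<rho>X: "\<rho> permutes X" using \<rho>(1) SX by (rule permutes_subset)
  have \<rho>S: "\<rho> x \<in> S \<longleftrightarrow> x \<in> S" for x using \<rho>(1) by (rule permutes_in_image)
  have "rw cell (\<rho> x) = rw cell x" for x
  proof (cases "x \<in> S")
    case True
    then show ?thesis using \<rho>S[of x] by (simp add: S_def)
  next
    case False
    then have "\<rho> x = x" using \<rho>(1) by (simp add: permutes_def)
    then show ?thesis by simp
  qed
  then have "\<rho> \<in> A.R" using \<rho>X by (simp add: stab_def)
  moreover have "mperm ?m1 g + mrestrict (X - S) m = mperm m \<rho>"
  proof (rule poly_mapping_eqI)
    fix x
    show "lookup (mperm ?m1 g + mrestrict (X - S) m) x = lookup (mperm m \<rho>) x"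
    proof (cases "x \<in> S")
      case True
      then have "lookup ?m1 (g x) = lookup m (\<rho> x)" using \<rho>(2) \<rho>S by (simp add: lookup_mrestrict[OF fin(1)])
      then show ?thesis using True
        by (simp add: lookup_add lookup_mperm permutes_bij[OF g] permutes_bij[OF \<rho>X] lookup_mrestrict[OF fin(2)])
    next
      case False
      then have \<rho>x: "\<rho> x = x" using \<rho>(1) by (simp add: permutes_def)
      have 0: "lookup ?m1 (g x) = 0"
      proof (cases "x \<in> X")
        case True
        then show ?thesis using supp False by blast
      next
        case False
        then have "g x = x" "x \<notin> S" using g SX by (auto simp: permutes_def)
        then show ?thesis by (simp add: lookup_mrestrict[OF fin(1)])
      qed
      have "lookup m x = 0" if "x \<notin> X" using m that by (auto simp: Mon_def in_keys_iff simp del: atLeastAtMost_iff)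
      then show ?thesis using 0 False \<rho>x
        by (simp add: lookup_add lookup_mperm permutes_bij[OF g] permutes_bij[OF \<rho>X] lookup_mrestrict[OF fin(2)] del: atLeastAtMost_iff)
    qed
  qed
  ultimately show ?thesis by blast
qed

text \<open>The symmetric functions of the first row are expressible through those of all variables and
  those of the other rows. Concretely: multiplying by the orbit sum of the first-row part of a filling
  spreads this part over all cells, and except for the terms where it stays in the first row, fewer
  nonzero entries remain there.\<close>

lemma esym_mon_in_first_row_zero:
  assumes "m \<in> Mon k"
  shows "esym k cell act (mon m) \<in> gen_submod (sympolys k)
    {esym k cell act (mon m) | m. m \<in> Mon k \<and> (\<forall>x\<in>X. rw cell x = 1 \<longrightarrow> lookup m x = 0)}" (is "_ \<in> ?N")
  using assms
proof (induction "card {x \<in> X. rw cell x = 1 \<and> lookup m x \<noteq> 0}" arbitrary: m rule: less_induct)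
  case (less m)
  define S where "S = {x \<in> X. rw cell x = 1}"
  have fin: "finite S" "finite (X - S)" by (simp_all add: S_def)
  define m1 m2 where "m1 = mrestrict S m" and "m2 = mrestrict (X - S) m"
  have l1: "lookup m1 x = (if x \<in> S then lookup m x else 0)" for x by (simp add: m1_def lookup_mrestrict[OF fin(1)])
  have l2: "lookup m2 x = (if x \<in> X - S then lookup m x else 0)" for x by (simp add: m2_def lookup_mrestrict[OF fin(2)])
  have Mon: "m1 \<in> Mon k" "m2 \<in> Mon k"
    unfolding Mon_def using l1 l2 by (auto simp: in_keys_iff S_def split: if_splits)
  define orb where "orb = (\<Sum>g | g permutes X. mon (mperm m1 g))"
  have orb: "orb \<in> sympolys k" unfolding orb_def by (rule sympolys_orbit_sum[OF Mon(1)])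
  define G where "G = {g. g permutes X}"
  \<comment> \<open>The permutations for which the first-row part stays in the first row.\<close>
  define G1 where "G1 = {g \<in> G. \<forall>x\<in>X. lookup m1 (g x) \<noteq> 0 \<longrightarrow> x \<in> S}"
  have finG: "finite G" by (simp add: G_def)
  have "id \<in> G1" using l1 by (auto simp: G1_def G_def permutes_id split: if_splits)
  then have c0: "card G1 \<noteq> 0" using finG by (metis (no_types, lifting) G1_def card_0_eq empty_iff finite_subset mem_Collect_eq subsetI)
  have in1: "esym k cell act (mon (mperm m1 g + m2)) = esym k cell act (mon m)" if g: "g \<in> G1" for g
  proof -
    have "\<exists>\<rho>\<in>A.R. mperm m1 g + m2 = mperm m \<rho>"
      using first_row_rearrangement[OF less.prems, of g] g unfolding m1_def m2_def S_def G1_def G_def by blast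
    then obtain \<rho> where \<rho>: "\<rho> \<in> A.R" "mperm m1 g + m2 = mperm m \<rho>" by blast
    then show ?thesis using A.asym_\<alpha>[OF \<rho>(1), of "mon m"] by (simp add: esym_def)
  qed
  have notin1: "esym k cell act (mon (mperm m1 g + m2)) \<in> ?N" if g: "g \<in> G - G1" for g
  proof (rule less.hyps)
    have gX: "g permutes X" using g by (simp add: G_def)
    show "mperm m1 g + m2 \<in> Mon k" by (intro Mon_add mperm_Mon[OF gX] Mon)
    let ?A = "{x \<in> X. rw cell x = 1 \<and> lookup (mperm m1 g + m2) x \<noteq> 0}" and ?B = "{x \<in> X. rw cell x = 1 \<and> lookup m x \<noteq> 0}"
    have A: "x \<in> S \<and> g x \<in> ?B" if "x \<in> ?A" for x
    proof -
      have xS: "x \<in> S" using that by (simp add: S_def)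
      then have "lookup m1 (g x) \<noteq> 0" using that l2[of x] by (auto simp: lookup_add lookup_mperm permutes_bij[OF gX])
      then show ?thesis using xS l1[of "g x"] by (auto simp: S_def split: if_splits)
    qed
    obtain y where y: "y \<in> X" "lookup m1 (g y) \<noteq> 0" "y \<notin> S" using g by (auto simp: G1_def simp del: atLeastAtMost_iff)
    have gy: "g y \<in> ?B" using y(2) l1[of "g y"] by (auto simp: S_def split: if_splits)
    have "g y \<notin> g ` ?A"
    proof
      assume "g y \<in> g ` ?A"
      then have "y \<in> ?A" using permutes_inj[OF gX] by (auto dest: injD)
      then show False using A y(3) by blast
    qed
    moreover have "g ` ?A \<subseteq> ?B" using A by blast
    ultimately have "card (g ` ?A) < card ?B" using gy by (intro psubset_card_mono) auto
    moreover have "card (g ` ?A) = card ?A" by (rule card_image[OF inj_on_subset[OF permutes_inj[OF gX]]]) simp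
    ultimately show "card ?A < card ?B" by simp
  qed
  have "esym k cell act (mon m2) \<in> ?N"
    using Mon(2) l2 by (intro gen_submod_base) (auto simp: S_def)
  then have "orb * esym k cell act (mon m2) \<in> ?N" by (rule gen_submod_mult[OF orb])
  also have "orb * esym k cell act (mon m2) = (\<Sum>g\<in>G. esym k cell act (mon (mperm m1 g + m2)))"
  proof -
    have "orb * mon m2 = (\<Sum>g\<in>G. mon (mperm m1 g + m2))" by (simp add: orb_def G_def sum_distrib_right mult_single)
    then show ?thesis by (simp only: esym_sym_mult[OF orb, symmetric] module_hom.sum[OF A.lin_esym])
  qed
  also have "\<dots> = (\<Sum>g\<in>G - G1. esym k cell act (mon (mperm m1 g + m2))) + (\<Sum>g\<in>G1. esym k cell act (mon (mperm m1 g + m2)))"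
    using finG by (intro sum.subset_diff) (auto simp: G1_def)
  also have "(\<Sum>g\<in>G1. esym k cell act (mon (mperm m1 g + m2))) = (\<Sum>g\<in>G1. esym k cell act (mon m))"
    by (rule sum.cong) (simp_all add: in1)
  also have "\<dots> = cscale (of_nat (card G1)) (esym k cell act (mon m))" by (rule cvs.sum_constant_scale)
  finally have "(\<Sum>g\<in>G - G1. esym k cell act (mon (mperm m1 g + m2))) + cscale (of_nat (card G1)) (esym k cell act (mon m)) \<in> ?N" .
  moreover have "(\<Sum>g\<in>G - G1. esym k cell act (mon (mperm m1 g + m2))) \<in> ?N"
    using notin1 by (rule cvs.subspace_sum[OF subspace_gen_submod])
  ultimately have "cscale (of_nat (card G1)) (esym k cell act (mon m)) \<in> ?N"
    using cvs.subspace_diff[OF subspace_gen_submod] by (metis (no_types, lifting) add_diff_cancel_left')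
  then have "cscale (inverse (of_nat (card G1))) (cscale (of_nat (card G1)) (esym k cell act (mon m))) \<in> ?N"
    by (rule cvs.subspace_scale[OF subspace_gen_submod])
  then show ?case using c0 by simp
qed

lemma esym_eq_gen_first_row_zero:
  "esym k cell act ` polys k = gen_submod (sympolys k)
    {esym k cell act (mon m) | m. m \<in> Mon k \<and> (\<forall>x\<in>X. rw cell x = 1 \<longrightarrow> lookup m x = 0)}" (is "_ = ?N")
proof
  have "esym k cell act ` polys k = cvs.span (esym k cell act ` mon ` Mon k)"
    by (simp add: polys_alt lin_span_image[OF A.lin_esym])
  also have "\<dots> \<subseteq> ?N"
    using esym_mon_in_first_row_zero by (intro span_subset_subspaceI subspace_gen_submod) auto
  finally show "esym k cell act ` polys k \<subseteq> ?N" .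
  show "?N \<subseteq> esym k cell act ` polys k"
    by (intro gen_submod_minimal submod_esym) (auto intro: mon_in_polys)
qed

end

subsection \<open>Products of alternants\<close>

text \<open>A signed sum over the column group factors over the columns. To prove this by adding one column at
  a time, the sums are formed for an arbitrary set \<open>K\<close> of columns; permutations fix all other positions.\<close>

definition block_perms :: "nat \<Rightarrow> (nat \<Rightarrow> nat) \<Rightarrow> nat set \<Rightarrow> (nat \<Rightarrow> nat) set" where
  "block_perms k f K = {h. h permutes {x \<in> {1..k}. f x \<in> K} \<and> (\<forall>x\<in>{1..k}. f (h x) = f x)}"

definition block_alt :: "nat \<Rightarrow> (nat \<Rightarrow> nat) \<Rightarrow> (nat \<Rightarrow>\<^sub>0 nat) \<Rightarrow> nat set \<Rightarrow> mpol" where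
  "block_alt k f m K = (\<Sum>h\<in>block_perms k f K. single (mperm (mrestrict {x \<in> {1..k}. f x \<in> K} m) h) (of_int (sign h)))"

lemma block_perms_permutes: "h \<in> block_perms k f K \<Longrightarrow> h permutes {1..k}"
  unfolding block_perms_def by (auto intro: permutes_subset)

lemma block_perms_not_in: "h \<in> block_perms k f K \<Longrightarrow> f x \<notin> K \<Longrightarrow> h x = x"
  by (auto simp: block_perms_def permutes_def)

lemma block_perms_in: "h \<in> block_perms k f K \<Longrightarrow> x \<in> {1..k} \<Longrightarrow> f (h x) = f x"
  by (simp add: block_perms_def)

lemma block_perms_mono:
  assumes "h \<in> block_perms k f K" "K \<subseteq> L" shows "h \<in> block_perms k f L"
proof -
  have "{x \<in> {1..k}. f x \<in> K} \<subseteq> {x \<in> {1..k}. f x \<in> L}" using assms(2) by blast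
  then show ?thesis using assms(1) permutes_subset unfolding block_perms_def by blast
qed

lemma block_perms_comp:
  assumes "g \<in> block_perms k f K" "h \<in> block_perms k f K" shows "g \<circ> h \<in> block_perms k f K"
proof -
  have "f (g (h x)) = f x" if "x \<in> {1..k}" for x
    using block_perms_in[OF assms(1) perm_in[OF block_perms_permutes[OF assms(2)] that]] block_perms_in[OF assms(2) that] by simp
  then show ?thesis using assms by (auto simp: block_perms_def intro: permutes_compose)
qed

lemma block_perms_restrict:
  assumes u: "u \<in> block_perms k f L" and "K \<subseteq> L"
  shows "(\<lambda>x. if f x \<in> K then u x else x) \<in> block_perms k f K"
proof -
  let ?S = "{x \<in> {1..k}. f x \<in> K}"
  let ?v = "\<lambda>x. if f x \<in> K then u x else x"
  have p: "u permutes {1..k}" using u by (rule block_perms_permutes)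
  have uS: "u x \<in> ?S" if "x \<in> ?S" for x
    using that perm_in[OF p, of x] block_perms_in[OF u, of x] by simp
  have "inj_on ?v ?S" using permutes_inj[OF p] by (auto simp: inj_on_def dest: injD)
  moreover have "?v ` ?S \<subseteq> ?S" using uS by auto
  ultimately have "bij_betw ?v ?S ?S" unfolding bij_betw_def by (simp only: endo_inj_surj finite_Collect_conjI finite_atLeastAtMost Collect_mem_eq simp_thms)
  moreover have "?v x = x" if "x \<notin> ?S" for x using that p by (auto simp: permutes_def simp del: atLeastAtMost_iff)
  ultimately have "?v permutes ?S" by (rule bij_imp_permutes)
  then show ?thesis using block_perms_in[OF u] by (simp add: block_perms_def)
qed

lemma block_perms_disjoint_decompose:
  assumes ab: "a \<in> block_perms k f K" "b \<in> block_perms k f L" and KL: "K \<inter> L = {}"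
  shows "(a \<circ> b) x = (if f x \<in> K then a x else if f x \<in> L then b x else x)"
proof (cases "x \<in> {1..k}")
  case True
  have "f x \<in> L \<Longrightarrow> f (b x) \<notin> K" using block_perms_in[OF ab(2) True] KL by auto
  then show ?thesis
    using block_perms_not_in[OF ab(1)] block_perms_not_in[OF ab(2), of x] KL by auto
next
  case False
  then have "a x = x" "b x = x" using block_perms_permutes[OF ab(1)] block_perms_permutes[OF ab(2)] by (auto simp: permutes_def)
  then show ?thesis by simp
qed

lemma block_alt_union:
  assumes KL: "K \<inter> L = {}"
  shows "block_alt k f m (K \<union> L) = block_alt k f m K * block_alt k f m L"
proof -
  let ?S = "\<lambda>K. {x \<in> {1..k}. f x \<in> K}"
  have "block_alt k f m K * block_alt k f m L = (\<Sum>(a, b)\<in>block_perms k f K \<times> block_perms k f L.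
      single (mperm (mrestrict (?S K) m) a + mperm (mrestrict (?S L) m) b) (of_int (sign a) * of_int (sign b)))"
    by (simp add: block_alt_def sum_product sum.cartesian_product mult_single)
  also have "\<dots> = block_alt k f m (K \<union> L)" unfolding block_alt_def
  proof (rule sum.reindex_bij_witness[of _ "\<lambda>u. (\<lambda>x. if f x \<in> K then u x else x, \<lambda>x. if f x \<in> L then u x else x)" "\<lambda>(a, b). a \<circ> b"])
    fix ab assume "ab \<in> block_perms k f K \<times> block_perms k f L"
    then obtain a b where ab: "ab = (a, b)" "a \<in> block_perms k f K" "b \<in> block_perms k f L" by blast
    note dec = block_perms_disjoint_decompose[OF ab(2,3) KL]
    have parts: "(\<lambda>x. if f x \<in> K then (a \<circ> b) x else x) = a" "(\<lambda>x. if f x \<in> L then (a \<circ> b) x else x) = b"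
      unfolding dec using block_perms_not_in[OF ab(2)] block_perms_not_in[OF ab(3)] KL by (auto simp: fun_eq_iff)
    show "(\<lambda>x. if f x \<in> K then (case ab of (a, b) \<Rightarrow> a \<circ> b) x else x, \<lambda>x. if f x \<in> L then (case ab of (a, b) \<Rightarrow> a \<circ> b) x else x) = ab"
      unfolding ab(1) prod.case parts by (rule refl)
    have comp: "a \<circ> b \<in> block_perms k f (K \<union> L)"
      using ab block_perms_mono by (intro block_perms_comp) blast+
    then show "(case ab of (a, b) \<Rightarrow> a \<circ> b) \<in> block_perms k f (K \<union> L)" by (simp add: ab(1))
    note p = block_perms_permutes[OF ab(2)] block_perms_permutes[OF ab(3)]
    note bij = p[THEN permutes_bij]
    have "mperm (mrestrict (?S (K \<union> L)) m) (a \<circ> b) = mperm (mrestrict (?S K) m) a + mperm (mrestrict (?S L) m) b"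
    proof (rule poly_mapping_eqI)
      fix x
      have fa: "f (a x) = f x \<and> a x \<in> {1..k}" "f (b x) = f x \<and> b x \<in> {1..k}" if "x \<in> {1..k}"
        using that block_perms_in[OF ab(2)] block_perms_in[OF ab(3)] perm_in[OF p(1)] perm_in[OF p(2)] by (auto simp del: atLeastAtMost_iff)
      have out: "a x = x" "b x = x" if "x \<notin> {1..k}" using that p by (auto simp: permutes_def)
      show "lookup (mperm (mrestrict (?S (K \<union> L)) m) (a \<circ> b)) x = lookup (mperm (mrestrict (?S K) m) a + mperm (mrestrict (?S L) m) b) x"
        unfolding lookup_mperm[OF bij_comp[OF bij(2,1)]] lookup_add lookup_mperm[OF bij(1)] lookup_mperm[OF bij(2)] dec
        using fa out KL by (cases "x \<in> {1..k}") (auto simp: lookup_mrestrict simp del: atLeastAtMost_iff)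
    qed
    then show "single (mperm (mrestrict (?S (K \<union> L)) m) (case ab of (a, b) \<Rightarrow> a \<circ> b)) (of_int (sign (case ab of (a, b) \<Rightarrow> a \<circ> b)))
      = (case ab of (a, b) \<Rightarrow> single (mperm (mrestrict (?S K) m) a + mperm (mrestrict (?S L) m) b) (of_int (sign a) * of_int (sign b)))"
      using p by (simp add: ab(1) sign_comp_permutes)
  next
    fix u assume u: "u \<in> block_perms k f (K \<union> L)"
    let ?a = "\<lambda>x. if f x \<in> K then u x else x" and ?b = "\<lambda>x. if f x \<in> L then u x else x"
    have a: "?a \<in> block_perms k f K" and b: "?b \<in> block_perms k f L"
      using u by (auto intro!: block_perms_restrict)
    then show "(?a, ?b) \<in> block_perms k f K \<times> block_perms k f L" by blast
    have "?a \<circ> ?b = u"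
      using block_perms_disjoint_decompose[OF a b KL] block_perms_not_in[OF u] by (auto simp: fun_eq_iff)
    then show "(case (?a, ?b) of (a, b) \<Rightarrow> a \<circ> b) = u" by simp
  qed
  finally show ?thesis ..
qed

lemma block_alt_empty: "block_alt k f m {} = 1"
proof -
  have "block_perms k f {} = {id}" by (auto simp: block_perms_def)
  then show ?thesis by (simp add: block_alt_def mrestrict_def)
qed

lemma block_alt_prod: "finite K \<Longrightarrow> block_alt k f m K = (\<Prod>j\<in>K. block_alt k f m {j})"
proof (induction K rule: finite_induct)
  case (insert j K)
  then have "block_alt k f m ({j} \<union> K) = block_alt k f m {j} * block_alt k f m K" by (intro block_alt_union) auto
  then show ?case using insert by simp
qed (simp add: block_alt_empty)

lemma (in tableau) bsym_mon_eq_block_alt: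
  assumes m: "m \<in> Mon k" and K: "cl cell ` X \<subseteq> K"
  shows "bsym k cell act (mon m) = block_alt k (cl cell) m K"
proof -
  have S: "{x \<in> X. cl cell x \<in> K} = X" using K by blast
  have "mrestrict X m = m"
    using m by (intro poly_mapping_eqI) (auto simp: lookup_mrestrict Mon_def in_keys_iff)
  moreover have "block_perms k (cl cell) K = A.C" unfolding block_perms_def stab_def S by (rule refl)
  ultimately show ?thesis unfolding block_alt_def bsym_def S by simp
qed

lemma rename_1 [simp]: "rename f 1 = 1"
proof -
  have "rename f (single 0 1) = single (push_keys f 0) 1" by (rule rename_single)
  then show ?thesis by simp
qed

lemma alternant_eq:
  "alternant rs = (\<Sum>\<tau> | \<tau> permutes {1..length rs + 1}.
     single (push_keys \<tau> (\<Sum>i\<in>{1..length rs}. single i (rs ! (i - 1)))) (of_int (sign \<tau>)))"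
  unfolding alternant_def
proof (rule sum.cong[OF refl])
  fix \<tau>
  have pow: "tvar x ^ e = mon (single x e)" for x e
    by (induction e) (simp_all add: tvar_def mult_single single_add[symmetric] Suc_eq_plus1_left[symmetric])
  have "(\<Prod>i\<in>I. mon (f i)) = mon (\<Sum>i\<in>I. f i)" if "finite I" for f :: "nat \<Rightarrow> nat \<Rightarrow>\<^sub>0 nat" and I
    using that by induction (simp_all add: mult_single)
  then have "(\<Prod>i\<in>{1..length rs}. tvar (\<tau> i) ^ (rs ! (i - 1))) = mon (\<Sum>i\<in>{1..length rs}. single (\<tau> i) (rs ! (i - 1)))"
    by (simp add: pow)
  then show "of_int (sign \<tau>) * (\<Prod>i\<in>{1..length rs}. tvar (\<tau> i) ^ (rs ! (i - 1)))
    = single (push_keys \<tau> (\<Sum>i\<in>{1..length rs}. single i (rs ! (i - 1)))) (of_int (sign \<tau>))"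
    by (simp add: push_keys_sum mult_single single_of_int[symmetric] del: single_of_int)
qed

text \<open>Alternants permute variables and \<open>block_alt\<close> permutes the exponents, so permutations correspond to their
  inverses, shifted by the offset of the block.\<close>

lemma rename_alternant_eq_block_alt:
  assumes block: "{x \<in> {1..k}. f x = j} = {off + 1..off + l}" and l: "l = length rs + 1"
    and m: "\<And>i. i \<in> {1..length rs} \<Longrightarrow> lookup m (off + i) = rs ! (i - 1)" "lookup m (off + l) = 0"
  shows "rename (\<lambda>i. off + i) (alternant rs) = block_alt k f m {j}"
proof -
  let ?S = "{1..l}" and ?B = "{off + 1..off + l}"
  let ?mr = "\<Sum>i\<in>{1..length rs}. single i (rs ! (i - 1))"
  have inj: "inj_on (\<lambda>i. off + i) A" for A by (simp add: inj_on_def)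
  have im: "(\<lambda>i. off + i) ` ?S = ?B" by (simp add: image_add_atLeastAtMost)
  have perms: "block_perms k f {j} = {h. h permutes ?B}"
  proof (intro equalityI subsetI)
    fix h assume h: "h \<in> {h. h permutes ?B}"
    have "f (h x) = f x" for x
    proof (cases "x \<in> ?B")
      case True
      then have "h x \<in> ?B" using h by (simp only: mem_Collect_eq permutes_in_image)
      then have "h x \<in> {x \<in> {1..k}. f x = j}" "x \<in> {x \<in> {1..k}. f x = j}" using True block by blast+
      then show ?thesis by simp
    qed (use h in \<open>auto simp: permutes_def\<close>)
    then show "h \<in> block_perms k f {j}" using h unfolding block_perms_def singleton_iff block by blast
  next
    fix h assume "h \<in> block_perms k f {j}"
    then show "h \<in> {h. h permutes ?B}" unfolding block_perms_def singleton_iff block by blast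
  qed
  have "rename (\<lambda>i. off + i) (alternant rs) = (\<Sum>\<tau> | \<tau> permutes ?S.
      single (push_keys (\<lambda>i. off + \<tau> i) ?mr) (of_int (sign \<tau>)))"
    by (simp add: alternant_eq module_hom.sum[OF lin_rename] push_keys_comp l)
  also have "\<dots> = (\<Sum>h | h permutes ?B. single (mperm (mrestrict ?B m) h) (of_int (sign h)))"
  proof (rule sum.reindex_bij_witness[of _ "\<lambda>h. map_permutation ?B (\<lambda>x. x - off) (inv h)" "\<lambda>\<tau>. inv (map_permutation ?S (\<lambda>i. off + i) \<tau>)"])
    have inj': "inj_on (\<lambda>x. x - off) ?B" by (auto simp: inj_on_def)
    have im': "(\<lambda>x. x - off) ` ?B = ?S" unfolding im[symmetric] image_image by simp
    {
      fix \<tau> assume "\<tau> \<in> {\<tau>. \<tau> permutes ?S}"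
      then have \<tau>: "\<tau> permutes ?S" by simp
      let ?h = "map_permutation ?S (\<lambda>i. off + i) \<tau>"
      have h: "?h permutes ?B" using \<tau> im inj by (intro map_permutation_permutes) (auto simp: bij_betw_def)
      have hS: "?h permutes {1..off + l}" using h by (rule permutes_subset) auto
      show "inv ?h \<in> {h. h permutes ?B}" using h by (simp add: permutes_inv)
      have "map_permutation ?B (\<lambda>x. x - off) ?h = \<tau>"
        by (rule map_permutation_compose_inv[OF _ \<tau>]) (auto simp: bij_betw_def inj im)
      then show "map_permutation ?B (\<lambda>x. x - off) (inv (inv ?h)) = \<tau>" by (simp add: permutes_inv_inv[OF h])
      have "push_keys (\<lambda>i. off + \<tau> i) ?mr = mperm (mrestrict ?B m) (inv ?h)"
      proof -
        have "push_keys (\<lambda>i. off + \<tau> i) ?mr = (\<Sum>i\<in>{1..length rs}. single (off + \<tau> i) (rs ! (i - 1)))"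
          by (simp add: push_keys_sum)
        also have "\<dots> = (\<Sum>i\<in>{1..length rs}. single (?h (off + i)) (lookup m (off + i)))"
          by (intro sum.cong refl) (auto simp: m(1) l map_permutation_apply[OF inj])
        also have "\<dots> = (\<Sum>i\<in>?S. single (?h (off + i)) (lookup m (off + i)))"
        proof (rule sum.mono_neutral_left)
          show "\<forall>i\<in>?S - {1..length rs}. single (?h (off + i)) (lookup m (off + i)) = 0"
          proof
            fix i assume "i \<in> ?S - {1..length rs}"
            then have "i = l" using l by auto
            then show "single (?h (off + i)) (lookup m (off + i)) = 0" by (simp add: m(2))
          qed
        qed (use l in auto)
        also have "\<dots> = (\<Sum>x\<in>?B. single (?h x) (lookup m x))"
          by (simp only: im[symmetric] sum.reindex[OF inj] comp_def)
        also have "\<dots> = push_keys ?h (mrestrict ?B m)" by (simp add: mrestrict_def push_keys_sum)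
        finally show ?thesis by (simp add: mperm_def permutes_inv_inv[OF h])
      qed
      moreover have "sign (inv ?h) = sign \<tau>"
        using sign_inv_permutes[OF hS] sign_map_permutation[OF inj \<tau>] by simp
      ultimately show "single (mperm (mrestrict ?B m) (inv ?h)) (of_int (sign (inv ?h))) = single (push_keys (\<lambda>i. off + \<tau> i) ?mr) (of_int (sign \<tau>))"
        by simp
    }
    fix h assume "h \<in> {h. h permutes ?B}"
    then have h: "inv h permutes ?B" and h0: "h permutes ?B" by (simp_all add: permutes_inv)
    show "map_permutation ?B (\<lambda>x. x - off) (inv h) \<in> {\<tau>. \<tau> permutes ?S}"
      using h im' inj' by (auto intro!: map_permutation_permutes simp: bij_betw_def)
    have "map_permutation ?S (\<lambda>i. off + i) (map_permutation ?B (\<lambda>x. x - off) (inv h)) = inv h"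
      by (rule map_permutation_compose_inv[OF _ h]) (auto simp: bij_betw_def inj' im')
    then show "inv (map_permutation ?S (\<lambda>i. off + i) (map_permutation ?B (\<lambda>x. x - off) (inv h))) = h"
      by (simp add: permutes_inv_inv[OF h0])
  qed
  also have "\<dots> = block_alt k f m {j}" unfolding block_alt_def perms singleton_iff block by (rule refl)
  finally show ?thesis .
qed

subsection \<open>Arrays as fillings\<close>

lemma card_stab_nonzero: "card (stab k f) \<noteq> 0"
proof -
  have "stab k f \<noteq> {}" using id_in_stab by blast
  then show ?thesis by (simp only: card_0_eq[OF finite_stab] not_False_eq_True)
qed

context tableau
begin

text \<open>The entries of row \<open>j\<close> of an array are listed from the right, so that position \<open>1\<close> belongs to the
  last cell of that row.\<close>

definition idx :: "nat \<Rightarrow> nat" where "idx x = part \<xi> (rw cell x) + 1 - cl cell x"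

definition place :: "nat \<Rightarrow> nat \<Rightarrow> nat" where "place j s = the_inv_into X cell (j, part \<xi> j + 1 - s)"

text \<open>The monomial carrying an array in the rows from the second on.\<close>

definition amon :: "(nat \<Rightarrow> nat \<Rightarrow> nat) \<Rightarrow> (nat \<Rightarrow>\<^sub>0 nat)" where
  "amon r = (\<Sum>x\<in>X. single x (if rw cell x = 1 then 0 else r (rw cell x) (idx x)))"

abbreviation "row_perms \<equiv> (\<Pi>\<^sub>E j\<in>{2..length \<xi>}. {\<pi>. \<pi> permutes {1..part \<xi> j}})"

lemma lookup_amon: "lookup (amon r) x = (if x \<in> X \<and> rw cell x \<noteq> 1 then r (rw cell x) (idx x) else 0)"
  unfolding amon_def by (simp add: lookup_sum_single del: atLeastAtMost_iff)

lemma amon_Mon: "amon r \<in> Mon k"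
  by (auto simp: Mon_def in_keys_iff lookup_amon split: if_splits)

lemma rw_le: "x \<in> X \<Longrightarrow> rw cell x \<le> length \<xi>"
  using cell_boxes[of x] by (auto simp: boxes_def)

lemma idx_bounds: "x \<in> X \<Longrightarrow> idx x \<in> {1..part \<xi> (rw cell x)}"
  using cell_boxes[of x] by (cases "cell x") (auto simp: boxes_alt idx_def)

lemma place:
  assumes "1 \<le> j" "s \<in> {1..part \<xi> j}"
  shows "place j s \<in> X" "rw cell (place j s) = j" "idx (place j s) = s"
proof -
  have b: "(j, part \<xi> j + 1 - s) \<in> boxes \<xi>" using assms by (auto simp: boxes_alt)
  have inj: "inj_on cell X" and im: "cell ` X = boxes \<xi>" using cell by (auto simp: bij_betw_def)
  show "place j s \<in> X" unfolding place_def using the_inv_into_into[OF inj, of _ X] b im by blast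
  have "cell (place j s) = (j, part \<xi> j + 1 - s)" unfolding place_def using b im by (intro f_the_inv_into_f[OF inj]) blast
  then show "rw cell (place j s) = j" "idx (place j s) = s" using assms(2) by (simp_all add: idx_def)
qed

lemma idx_eqD:
  assumes "x \<in> X" "y \<in> X" "rw cell x = rw cell y" "idx x = idx y" shows "x = y"
proof (rule cell_eqD[OF assms(1-3)])
  show "cl cell x = cl cell y"
    using assms idx_bounds[OF assms(1)] idx_bounds[OF assms(2)] cell_boxes[OF assms(1)] cell_boxes[OF assms(2)]
    by (cases "cell x"; cases "cell y") (auto simp: idx_def boxes_alt)
qed

lemma place_idx: "x \<in> X \<Longrightarrow> place (rw cell x) (idx x) = x"
  by (rule idx_eqD) (simp_all add: place[OF rw_pos idx_bounds] del: atLeastAtMost_iff)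

lemma amon_eqI:
  assumes "m \<in> Mon k" "\<And>x. x \<in> X \<Longrightarrow> lookup m x = (if rw cell x = 1 then 0 else r (rw cell x) (idx x))"
  shows "m = amon r"
proof (rule poly_mapping_eqI)
  fix x show "lookup m x = lookup (amon r) x"
    using assms by (cases "x \<in> X") (auto simp: lookup_amon Mon_def in_keys_iff simp del: atLeastAtMost_iff)
qed

lemma amon_permuted_array:
  assumes \<sigma>: "\<sigma> \<in> row_perms"
  shows "\<exists>g\<in>A.R. amon (\<lambda>j s. r j (\<sigma> j s)) = mperm (amon r) g"
proof -
  define g where "g x = (if x \<in> X \<and> rw cell x \<noteq> 1 then place (rw cell x) (\<sigma> (rw cell x) (idx x)) else x)" for x
  have \<sigma>': "\<sigma> (rw cell x) permutes {1..part \<xi> (rw cell x)}" if "x \<in> X" "rw cell x \<noteq> 1" for x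
    using PiE_mem[OF \<sigma>, of "rw cell x"] rw_pos[OF that(1)] rw_le[OF that(1)] that(2) by simp
  have in_row: "\<sigma> (rw cell x) (idx x) \<in> {1..part \<xi> (rw cell x)}" if "x \<in> X" "rw cell x \<noteq> 1" for x
    by (rule perm_in[OF \<sigma>'[OF that] idx_bounds[OF that(1)]])
  have g: "g x \<in> X" "rw cell (g x) = rw cell x" if "x \<in> X" for x
    using that place[OF rw_pos[OF that] in_row] by (auto simp: g_def simp del: atLeastAtMost_iff)
  have idxg: "idx (g x) = \<sigma> (rw cell x) (idx x)" if "x \<in> X" "rw cell x \<noteq> 1" for x
    using that place[OF rw_pos in_row] by (simp add: g_def del: atLeastAtMost_iff)
  have "inj_on g X"
  proof (rule inj_onI)
    fix x y assume xy: "x \<in> X" "y \<in> X" "g x = g y"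
    then have rw: "rw cell x = rw cell y" using g(2) by metis
    show "x = y"
    proof (cases "rw cell x = 1")
      case True
      then show ?thesis using xy rw by (simp add: g_def)
    next
      case False
      then have "\<sigma> (rw cell x) (idx x) = \<sigma> (rw cell x) (idx y)" using idxg[of x] idxg[of y] xy rw by simp
      then have "idx x = idx y" using permutes_inj[OF \<sigma>'[OF xy(1) False]] by (auto dest: injD)
      with xy(1,2) rw show ?thesis by (rule idx_eqD)
    qed
  qed
  moreover have "g ` X \<subseteq> X" using g(1) by blast
  ultimately have "bij_betw g X X" unfolding bij_betw_def by (simp add: endo_inj_surj)
  then have gX: "g permutes X" by (rule bij_imp_permutes) (auto simp: g_def)
  then have "g \<in> A.R" using g(2) by (simp add: stab_def)
  moreover have "mperm (amon r) g = amon (\<lambda>j s. r j (\<sigma> j s))"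
    using g idxg by (intro amon_eqI mperm_Mon[OF gX] amon_Mon) (auto simp: lookup_mperm permutes_bij[OF gX] lookup_amon simp del: atLeastAtMost_iff)
  ultimately show ?thesis by metis
qed

lemma row_perm_of_stab:
  assumes g: "g \<in> A.R"
  shows "\<exists>\<tau>\<in>row_perms. \<forall>r. mperm (amon r) g = amon (\<lambda>j s. r j (\<tau> j s))"
proof -
  have gX: "g permutes X" using g by (rule stab_permutes)
  define \<tau> where "\<tau> = restrict (\<lambda>j s. if s \<in> {1..part \<xi> j} then idx (g (place j s)) else s) {2..length \<xi>}"
  have rwg: "g x \<in> X" "rw cell (g x) = rw cell x" if "x \<in> X" for x
    using that g perm_in[OF gX that] by (auto simp: stab_def)
  have "\<tau> j permutes {1..part \<xi> j}" if j: "j \<in> {2..length \<xi>}" for j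
  proof -
    have \<tau>: "\<tau> j s = (if s \<in> {1..part \<xi> j} then idx (g (place j s)) else s)" for s using j by (simp add: \<tau>_def)
    have j1: "1 \<le> j" using j by simp
    have "inj_on (\<tau> j) {1..part \<xi> j}"
    proof (rule inj_onI)
      fix s t assume st: "s \<in> {1..part \<xi> j}" "t \<in> {1..part \<xi> j}" "\<tau> j s = \<tau> j t"
      then have "idx (g (place j s)) = idx (g (place j t))" by (simp add: \<tau>)
      then have "g (place j s) = g (place j t)"
        by (intro idx_eqD[OF rwg(1)[OF place(1)[OF j1 st(1)]] rwg(1)[OF place(1)[OF j1 st(2)]]])
          (simp only: rwg(2)[OF place(1)[OF j1 st(1)]] rwg(2)[OF place(1)[OF j1 st(2)]] place(2)[OF j1 st(1)] place(2)[OF j1 st(2)])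
      then have "place j s = place j t" by (rule injD[OF permutes_inj[OF gX]])
      then have "idx (place j s) = idx (place j t)" by (rule arg_cong)
      then show "s = t" by (simp only: place(3)[OF j1 st(1)] place(3)[OF j1 st(2)])
    qed
    moreover have "\<tau> j ` {1..part \<xi> j} \<subseteq> {1..part \<xi> j}"
    proof (intro image_subsetI)
      fix s assume s: "s \<in> {1..part \<xi> j}"
      show "\<tau> j s \<in> {1..part \<xi> j}"
        using idx_bounds[OF rwg(1)[OF place(1)[OF j1 s]]] rwg(2)[OF place(1)[OF j1 s]] place(2)[OF j1 s] s by (simp add: \<tau>)
    qed
    ultimately have "bij_betw (\<tau> j) {1..part \<xi> j} {1..part \<xi> j}" unfolding bij_betw_def by (simp add: endo_inj_surj)
    then show ?thesis by (rule bij_imp_permutes) (simp only: \<tau> if_False)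
  qed
  then have "\<tau> \<in> row_perms" by (auto simp: \<tau>_def intro!: PiE_I)
  moreover have "mperm (amon r) g = amon (\<lambda>j s. r j (\<tau> j s))" for r
  proof (rule amon_eqI)
    show "mperm (amon r) g \<in> Mon k" by (rule mperm_Mon[OF gX amon_Mon])
    fix x assume x: "x \<in> X"
    show "lookup (mperm (amon r) g) x = (if rw cell x = 1 then 0 else r (rw cell x) (\<tau> (rw cell x) (idx x)))"
      using rwg[OF x] place_idx[OF x] idx_bounds[OF x] rw_pos[OF x] rw_le[OF x]
      by (auto simp: lookup_mperm permutes_bij[OF gX] lookup_amon \<tau>_def)
  qed
  ultimately show ?thesis by blast
qed

lemma finite_row_perms: "finite row_perms"
  by (intro finite_PiE) (auto simp: finite_permutations)

lemma row_perms_nonempty: "row_perms \<noteq> {}"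
proof -
  have "restrict (\<lambda>j. id) {2..length \<xi>} \<in> row_perms" by (auto simp: permutes_id)
  then show ?thesis by blast
qed

lemma sum_row_perms_translate:
  assumes \<tau>: "\<tau> \<in> row_perms"
  shows "(\<Sum>\<sigma>\<in>row_perms. mon (amon (\<lambda>j s. r j (\<sigma> j (\<tau> j s))))) = (\<Sum>\<sigma>\<in>row_perms. mon (amon (\<lambda>j s. r j (\<sigma> j s))))"
proof -
  have t: "\<tau> j permutes {1..part \<xi> j}" if "j \<in> {2..length \<xi>}" for j using PiE_mem[OF \<tau> that] by simp
  have p: "\<sigma> j permutes {1..part \<xi> j}" if "\<sigma> \<in> row_perms" "j \<in> {2..length \<xi>}" for \<sigma> j using PiE_mem[OF that] by simp
  have ext: "\<sigma> j = undefined" if "\<sigma> \<in> row_perms" "j \<notin> {2..length \<xi>}" for \<sigma> j using PiE_arb[OF that] .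
  show ?thesis
  proof (rule sum.reindex_bij_witness[of _ "\<lambda>\<sigma>. restrict (\<lambda>j. \<sigma> j \<circ> inv (\<tau> j)) {2..length \<xi>}" "\<lambda>\<sigma>. restrict (\<lambda>j. \<sigma> j \<circ> \<tau> j) {2..length \<xi>}"])
    fix \<sigma> assume s: "\<sigma> \<in> row_perms"
    show "restrict (\<lambda>j. restrict (\<lambda>j. \<sigma> j \<circ> \<tau> j) {2..length \<xi>} j \<circ> inv (\<tau> j)) {2..length \<xi>} = \<sigma>"
      "restrict (\<lambda>j. restrict (\<lambda>j. \<sigma> j \<circ> inv (\<tau> j)) {2..length \<xi>} j \<circ> \<tau> j) {2..length \<xi>} = \<sigma>"
      using ext[OF s] permutes_inv_o[OF t] by (auto simp: restrict_def o_assoc[symmetric] simp del: atLeastAtMost_iff)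
    show "restrict (\<lambda>j. \<sigma> j \<circ> \<tau> j) {2..length \<xi>} \<in> row_perms" "restrict (\<lambda>j. \<sigma> j \<circ> inv (\<tau> j)) {2..length \<xi>} \<in> row_perms"
      using p[OF s] t by (auto intro!: permutes_compose permutes_inv)
    have "amon (\<lambda>j s. r j (restrict (\<lambda>j. \<sigma> j \<circ> \<tau> j) {2..length \<xi>} j s)) = amon (\<lambda>j s. r j (\<sigma> j (\<tau> j s)))"
    proof (rule amon_eqI[OF amon_Mon])
      fix x assume x: "x \<in> X"
      then show "lookup (amon (\<lambda>j s. r j (restrict (\<lambda>j. \<sigma> j \<circ> \<tau> j) {2..length \<xi>} j s))) x
        = (if rw cell x = 1 then 0 else r (rw cell x) (\<sigma> (rw cell x) (\<tau> (rw cell x) (idx x))))"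
        using rw_pos[OF x] rw_le[OF x] by (auto simp: lookup_amon)
    qed
    then show "mon (amon (\<lambda>j s. r j (restrict (\<lambda>j. \<sigma> j \<circ> \<tau> j) {2..length \<xi>} j s))) = mon (amon (\<lambda>j s. r j (\<sigma> j (\<tau> j s))))" by simp
  qed
qed

text \<open>The sum over the row permutations of an array is row symmetric, so up to a factor it is the row
  symmetrization of a single monomial.\<close>

lemma asym_array_sum:
  "cscale (of_nat (card A.R)) (\<Sum>\<sigma>\<in>row_perms. mon (amon (\<lambda>j s. r j (\<sigma> j s))))
    = cscale (of_nat (card row_perms)) (asym k cell act (mon (amon r)))"
proof -
  let ?P = "\<Sum>\<sigma>\<in>row_perms. mon (amon (\<lambda>j s. r j (\<sigma> j s)))"
  have "act ?P g = ?P" if g: "g \<in> A.R" for g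
  proof -
    from row_perm_of_stab[OF g] obtain \<tau> where \<tau>: "\<tau> \<in> row_perms"
      "\<forall>r. mperm (amon r) g = amon (\<lambda>j s. r j (\<tau> j s))" by (rule bexE)
    have "act ?P g = (\<Sum>\<sigma>\<in>row_perms. mon (amon (\<lambda>j s. r j (\<sigma> j (\<tau> j s)))))" by (simp only: act_sum act_single \<tau>(2)[rule_format])
    then show ?thesis using sum_row_perms_translate[OF \<tau>(1)] by simp
  qed
  then have "asym k cell act ?P = (\<Sum>g\<in>A.R. ?P)" unfolding asym_def by (intro sum.cong) auto
  also have "\<dots> = cscale (of_nat (card A.R)) ?P" by (rule cvs.sum_constant_scale)
  finally have 1: "asym k cell act ?P = cscale (of_nat (card A.R)) ?P" .
  have "asym k cell act ?P = (\<Sum>\<sigma>\<in>row_perms. asym k cell act (mon (amon r)))"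
    unfolding module_hom.sum[OF A.lin_asym]
  proof (rule sum.cong[OF refl])
    fix \<sigma> assume "\<sigma> \<in> row_perms"
    then obtain g where "g \<in> A.R" "amon (\<lambda>j s. r j (\<sigma> j s)) = mperm (amon r) g"
      using amon_permuted_array by blast
    then show "asym k cell act (mon (amon (\<lambda>j s. r j (\<sigma> j s)))) = asym k cell act (mon (amon r))"
      using A.asym_\<alpha>[of g "mon (amon r)"] by simp
  qed
  also have "\<dots> = cscale (of_nat (card row_perms)) (asym k cell act (mon (amon r)))" by (rule cvs.sum_constant_scale)
  finally show ?thesis using 1 by simp
qed

end

subsection \<open>The tableau filled column by column\<close>

text \<open>Columns are filled from right to left, that is, from short to long; inside a column the first row
  gets the last variable, since this is the variable that has exponent \<open>0\<close> in the identity term of an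
  alternant.\<close>

definition col_off :: "nat list \<Rightarrow> nat \<Rightarrow> nat" where
  "col_off \<xi> j = (\<Sum>j'\<in>{j<..part \<xi> 1}. col_len \<xi> j')"

definition col_pos :: "nat list \<Rightarrow> nat \<times> nat \<Rightarrow> nat" where
  "col_pos \<xi> = (\<lambda>(i, j). col_off \<xi> j + (if i = 1 then col_len \<xi> j else i - 1))"

definition col_cell :: "nat list \<Rightarrow> nat \<Rightarrow> nat \<times> nat" where
  "col_cell \<xi> = the_inv_into (boxes \<xi>) (col_pos \<xi>)"

lemma sum_col_len:
  assumes p: "is_partition \<xi>" shows "(\<Sum>j=1..part \<xi> 1. col_len \<xi> j) = sum_list \<xi>"
proof -
  have im: "snd ` boxes \<xi> \<subseteq> {1..part \<xi> 1}"
    using part_antimono[OF p, of 1] by (fastforce simp: boxes_alt)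
  have "card {b \<in> boxes \<xi>. snd b = j} = col_len \<xi> j" for j
  proof -
    have "{b \<in> boxes \<xi>. snd b = j} = (\<lambda>i. (i, j)) ` {i. (i, j) \<in> boxes \<xi>}" by force
    then show ?thesis by (simp add: col_len_def card_image inj_on_def)
  qed
  then have "(\<Sum>j=1..part \<xi> 1. col_len \<xi> j) = (\<Sum>j=1..part \<xi> 1. \<Sum>b\<in>{b \<in> boxes \<xi>. snd b = j}. 1)" by simp
  also have "\<dots> = (\<Sum>b\<in>boxes \<xi>. 1)" by (rule sum.group) (simp_all add: im)
  finally show ?thesis by (simp add: card_boxes)
qed

lemma col_off_step:
  assumes "j < j'" "j' \<le> part \<xi> 1" shows "col_off \<xi> j' + col_len \<xi> j' \<le> col_off \<xi> j"
proof -
  have "col_off \<xi> j' + col_len \<xi> j' = (\<Sum>i\<in>insert j' {j'<..part \<xi> 1}. col_len \<xi> i)" by (simp add: col_off_def)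
  also have "\<dots> \<le> col_off \<xi> j" unfolding col_off_def using assms by (intro sum_mono2) auto
  finally show ?thesis .
qed

lemma box_bounds:
  assumes p: "is_partition \<xi>" and b: "(i, j) \<in> boxes \<xi>"
  shows "1 \<le> i" "i \<le> col_len \<xi> j" "1 \<le> j" "j \<le> part \<xi> 1"
  using b boxes_iff_col_len[OF p, of i j] part_antimono[OF p, of 1 i] by (auto simp: boxes_alt)

lemma bij_col_pos:
  assumes p: "is_partition \<xi>" shows "bij_betw (col_pos \<xi>) (boxes \<xi>) {1..sum_list \<xi>}"
proof -
  let ?v = "\<lambda>i j. if i = 1 then col_len \<xi> j else i - 1"
  have v: "1 \<le> ?v i j" "?v i j \<le> col_len \<xi> j" if "(i, j) \<in> boxes \<xi>" for i j
    using box_bounds[OF p that] by auto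
  have inj: "inj_on (col_pos \<xi>) (boxes \<xi>)"
  proof (rule inj_onI)
    fix b b' assume b: "b \<in> boxes \<xi>" "b' \<in> boxes \<xi>" "col_pos \<xi> b = col_pos \<xi> b'"
    obtain i j i' j' where ij: "b = (i, j)" "b' = (i', j')" by (cases b, cases b')
    note bd = box_bounds[OF p b(1)[unfolded ij(1)]] box_bounds[OF p b(2)[unfolded ij(2)]]
    note vv = v[OF b(1)[unfolded ij(1)]] v[OF b(2)[unfolded ij(2)]]
    have eq: "col_off \<xi> j + ?v i j = col_off \<xi> j' + ?v i' j'" using b(3) by (simp add: ij col_pos_def)
    have "j = j'"
    proof (rule ccontr)
      assume "j \<noteq> j'"
      then consider "j < j'" | "j' < j" by linarith
      then show False using col_off_step[of j j' \<xi>] col_off_step[of j' j \<xi>] vv bd eq by cases linarith+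
    qed
    then show "b = b'" using eq bd by (auto simp: ij split: if_splits)
  qed
  have "col_pos \<xi> ` boxes \<xi> \<subseteq> {1..sum_list \<xi>}"
  proof (intro image_subsetI)
    fix b assume b: "b \<in> boxes \<xi>"
    obtain i j where ij: "b = (i, j)" by (cases b)
    note bd = box_bounds[OF p b[unfolded ij]]
    have "col_off \<xi> j + col_len \<xi> j \<le> col_off \<xi> 0" using bd by (intro col_off_step) auto
    also have "\<dots> = sum_list \<xi>"
      unfolding sum_col_len[OF p, symmetric] col_off_def by (rule sum.cong) auto
    finally show "col_pos \<xi> b \<in> {1..sum_list \<xi>}" using v[OF b[unfolded ij]] by (simp add: ij col_pos_def)
  qed
  then have "col_pos \<xi> ` boxes \<xi> = {1..sum_list \<xi>}"
    by (intro card_subset_eq) (simp_all add: card_image[OF inj] card_boxes)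
  with inj show ?thesis by (simp add: bij_betw_def)
qed

lemma tableau_col_cell: "is_partition \<xi> \<Longrightarrow> tableau \<xi> (sum_list \<xi>) (col_cell \<xi>)"
  unfolding col_cell_def by (intro tableau.intro bij_betw_the_inv_into bij_col_pos)

lemma col_cell_pos: "is_partition \<xi> \<Longrightarrow> b \<in> boxes \<xi> \<Longrightarrow> col_cell \<xi> (col_pos \<xi> b) = b"
  unfolding col_cell_def using bij_col_pos by (intro the_inv_into_f_f) (auto simp: bij_betw_def)

lemma col_len_eqI:
  assumes p: "is_partition \<xi>" and "1 \<le> l" "part \<xi> (Suc l) < j" "j \<le> part \<xi> l"
  shows "col_len \<xi> j = l"
  using boxes_iff_col_len[OF p, of l j] boxes_iff_col_len[OF p, of "Suc l" j] assms by simp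

lemma col_len_bounds:
  assumes p: "is_partition \<xi>" and "1 \<le> j" "j \<le> part \<xi> 1"
  shows "1 \<le> col_len \<xi> j" "j \<le> part \<xi> (col_len \<xi> j)" "part \<xi> (Suc (col_len \<xi> j)) < j" "col_len \<xi> j \<le> length \<xi>"
proof -
  show 1: "1 \<le> col_len \<xi> j" using boxes_iff_col_len[OF p, of 1 j] assms by simp
  show "j \<le> part \<xi> (col_len \<xi> j)" using boxes_iff_col_len[OF p 1 assms(2)] by simp
  show "part \<xi> (Suc (col_len \<xi> j)) < j" using boxes_iff_col_len[OF p _ assms(2), of "Suc (col_len \<xi> j)"] by simp
  show "col_len \<xi> j \<le> length \<xi>" by (rule col_len_le[OF p assms(2)])
qed

text \<open>Columns \<open>j\<close> of length \<open>l\<close> are those with \<open>part \<xi> (l + 1) < j \<le> part \<xi> l\<close>; the \<open>s\<close>-th block of size \<open>l\<close>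
  is the \<open>s\<close>-th of them from the right.\<close>

lemma block_start_eq_col_off:
  assumes p: "is_partition \<xi>" and j: "1 \<le> j" "j \<le> part \<xi> 1"
  shows "block_start \<xi> (col_len \<xi> j) (part \<xi> (col_len \<xi> j) + 1 - j) = col_off \<xi> j"
proof -
  have shorter: "(\<Sum>i\<in>{1..<l}. i * part_mult \<xi> i) = (\<Sum>j\<in>{part \<xi> l<..part \<xi> 1}. col_len \<xi> j)" if "1 \<le> l" for l
    using that
  proof (induction l rule: nat_induct_at_least)
    case (Suc l)
    have le: "part \<xi> (Suc l) \<le> part \<xi> l" "part \<xi> l \<le> part \<xi> 1"
      using Suc.hyps part_antimono[OF p, of l "Suc l"] part_antimono[OF p, of 1 l] by simp_all
    have "{part \<xi> (Suc l)<..part \<xi> 1} = {part \<xi> (Suc l)<..part \<xi> l} \<union> {part \<xi> l<..part \<xi> 1}" using le by auto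
    then have "(\<Sum>j\<in>{part \<xi> (Suc l)<..part \<xi> 1}. col_len \<xi> j)
      = (\<Sum>j\<in>{part \<xi> (Suc l)<..part \<xi> l}. col_len \<xi> j) + (\<Sum>j\<in>{part \<xi> l<..part \<xi> 1}. col_len \<xi> j)"
      by (simp add: sum.union_disjoint)
    also have "(\<Sum>j\<in>{part \<xi> (Suc l)<..part \<xi> l}. col_len \<xi> j) = (\<Sum>j\<in>{part \<xi> (Suc l)<..part \<xi> l}. l)"
      using Suc.hyps by (intro sum.cong refl col_len_eqI[OF p]) auto
    finally show ?case using Suc by (simp add: part_mult_def Suc_eq_plus1[symmetric] mult.commute)
  qed simp
  let ?l = "col_len \<xi> j"
  note b = col_len_bounds[OF p j]
  have le: "part \<xi> ?l \<le> part \<xi> 1" using b(1) by (intro part_antimono[OF p]) auto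
  have "{j<..part \<xi> 1} = {j<..part \<xi> ?l} \<union> {part \<xi> ?l<..part \<xi> 1}" using b le by auto
  then have "col_off \<xi> j = (\<Sum>j'\<in>{j<..part \<xi> ?l}. col_len \<xi> j') + (\<Sum>j'\<in>{part \<xi> ?l<..part \<xi> 1}. col_len \<xi> j')"
    by (simp add: col_off_def sum.union_disjoint)
  also have "(\<Sum>j'\<in>{j<..part \<xi> ?l}. col_len \<xi> j') = (\<Sum>j'\<in>{j<..part \<xi> ?l}. ?l)"
    using b by (intro sum.cong refl col_len_eqI[OF p]) auto
  finally show ?thesis using shorter[OF b(1)] b(2) by (simp add: block_start_def)
qed

lemma bpol_column_product:
  assumes p: "is_partition \<xi>"
  shows "bpol \<xi> r = (\<Prod>j=1..part \<xi> 1. rename (\<lambda>i. col_off \<xi> j + i)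
    (alternant (array_column \<xi> (col_len \<xi> j) (part \<xi> (col_len \<xi> j) + 1 - j) r)))"
proof -
  let ?F = "\<lambda>l s. rename (\<lambda>i. block_start \<xi> l s + i) (alternant (array_column \<xi> l s r))"
  let ?s = "\<lambda>j. part \<xi> (col_len \<xi> j) + 1 - j"
  have two: "2 \<le> col_len \<xi> j \<longleftrightarrow> j \<le> part \<xi> 2" if "1 \<le> j" for j using boxes_iff_col_len[OF p _ that, of 2] by simp
  have le21: "part \<xi> 2 \<le> part \<xi> 1" by (rule part_antimono[OF p]) auto
  have "bpol \<xi> r = (\<Prod>(l, s)\<in>(SIGMA l:{2..length \<xi>}. {1..part_mult \<xi> l}). ?F l s)"
    by (simp add: bpol_def prod.Sigma)
  also have "\<dots> = (\<Prod>j=1..part \<xi> 2. ?F (col_len \<xi> j) (?s j))"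
  proof (rule prod.reindex_bij_witness[of _ "\<lambda>j. (col_len \<xi> j, ?s j)" "\<lambda>(l, s). part \<xi> l + 1 - s"])
    fix ls assume "ls \<in> (SIGMA l:{2..length \<xi>}. {1..part_mult \<xi> l})"
    then obtain l s where ls: "ls = (l, s)" "2 \<le> l" "l \<le> length \<xi>" "1 \<le> s" "s \<le> part \<xi> l - part \<xi> (Suc l)"
      by (auto simp: part_mult_def Suc_eq_plus1)
    have j: "part \<xi> (Suc l) < part \<xi> l + 1 - s" "part \<xi> l + 1 - s \<le> part \<xi> l" using ls by auto
    have len: "col_len \<xi> (part \<xi> l + 1 - s) = l" using ls j by (intro col_len_eqI[OF p]) auto
    have "part \<xi> l \<le> part \<xi> 2" using ls(2) by (intro part_antimono[OF p]) auto
    then show "(case ls of (l, s) \<Rightarrow> part \<xi> l + 1 - s) \<in> {1..part \<xi> 2}" using j by (simp add: ls(1))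
    show eq: "(col_len \<xi> (case ls of (l, s) \<Rightarrow> part \<xi> l + 1 - s), ?s (case ls of (l, s) \<Rightarrow> part \<xi> l + 1 - s)) = ls"
      using ls len by simp
    show "?F (col_len \<xi> (case ls of (l, s) \<Rightarrow> part \<xi> l + 1 - s)) (?s (case ls of (l, s) \<Rightarrow> part \<xi> l + 1 - s)) = (case ls of (l, s) \<Rightarrow> ?F l s)"
      using ls by (simp only: ls(1) prod.case len) simp
  next
    fix j assume j: "j \<in> {1..part \<xi> 2}"
    then have j': "1 \<le> j" "j \<le> part \<xi> 1" using le21 by auto
    note b = col_len_bounds[OF p j']
    show "(case (col_len \<xi> j, ?s j) of (l, s) \<Rightarrow> part \<xi> l + 1 - s) = j" using b(2) by simp
    show "(col_len \<xi> j, ?s j) \<in> (SIGMA l:{2..length \<xi>}. {1..part_mult \<xi> l})"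
      using b two[OF j'(1)] j by (auto simp: part_mult_def Suc_eq_plus1[symmetric])
  qed
  \<comment> \<open>Columns of length \<open>1\<close> contribute the empty alternant.\<close>
  also have "\<dots> = (\<Prod>j=1..part \<xi> 1. ?F (col_len \<xi> j) (?s j))"
  proof (rule prod.mono_neutral_left)
    show "\<forall>j\<in>{1..part \<xi> 1} - {1..part \<xi> 2}. ?F (col_len \<xi> j) (?s j) = 1"
    proof
      fix j assume j: "j \<in> {1..part \<xi> 1} - {1..part \<xi> 2}"
      then have "col_len \<xi> j = 1" using col_len_bounds[OF p, of j] two[of j] by auto
      then have "array_column \<xi> (col_len \<xi> j) (?s j) r = []" by (simp add: array_column_def)
      moreover have "alternant [] = 1"
      proof -
        have "{\<tau>. \<tau> permutes {1::nat}} = {id}" by (simp add: permutes_sing)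
        then show ?thesis by (simp add: alternant_eq)
      qed
      ultimately show "?F (col_len \<xi> j) (?s j) = 1" by simp
    qed
  qed (use le21 in auto)
  also have "\<dots> = (\<Prod>j=1..part \<xi> 1. rename (\<lambda>i. col_off \<xi> j + i) (alternant (array_column \<xi> (col_len \<xi> j) (?s j) r)))"
    by (intro prod.cong refl) (simp add: block_start_eq_col_off[OF p])
  finally show ?thesis .
qed

context
  fixes \<xi> assumes p: "is_partition \<xi>"
begin

interpretation T: tableau \<xi> "sum_list \<xi>" "col_cell \<xi>"
  by (rule tableau_col_cell[OF p])

text \<open>For the column-by-column tableau the blocks are the columns, and column \<open>j\<close> of the diagram carries the
  column of the array that belongs to its block.\<close>

lemma bpol_eq_bsym: "bpol \<xi> r = bsym (sum_list \<xi>) (col_cell \<xi>) act (mon (T.amon r))"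
proof -
  let ?k = "sum_list \<xi>" and ?cl = "\<lambda>x. snd (col_cell \<xi> x)"
  have "rename (\<lambda>i. col_off \<xi> j + i) (alternant (array_column \<xi> (col_len \<xi> j) (part \<xi> (col_len \<xi> j) + 1 - j) r))
    = block_alt ?k ?cl (T.amon r) {j}" if j: "j \<in> {1..part \<xi> 1}" for j
  proof -
    let ?l = "col_len \<xi> j" and ?o = "col_off \<xi> j"
    let ?rs = "array_column \<xi> ?l (part \<xi> ?l + 1 - j) r"
    from j have j': "1 \<le> j" "j \<le> part \<xi> 1" by auto
    note b = col_len_bounds[OF p j']
    have box: "(i, j) \<in> boxes \<xi>" if "1 \<le> i" "i \<le> ?l" for i
      using that boxes_col[OF p, of j] by (auto simp: set_eq_iff)
    have posX: "col_pos \<xi> b \<in> {1..?k}" if "b \<in> boxes \<xi>" for b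
      using that bij_betw_imp_surj_on[OF bij_col_pos[OF p]] by blast
    have cell_low: "col_cell \<xi> (?o + i) = (Suc i, j) \<and> ?o + i \<in> {1..?k}" if "1 \<le> i" "i < ?l" for i
    proof -
      have eq: "col_pos \<xi> (Suc i, j) = ?o + i" using that by (simp add: col_pos_def)
      have bx: "(Suc i, j) \<in> boxes \<xi>" using that by (intro box) auto
      show ?thesis using col_cell_pos[OF p bx] posX[OF bx] by (simp only: eq)
    qed
    have cell_top: "col_cell \<xi> (?o + ?l) = (1, j) \<and> ?o + ?l \<in> {1..?k}"
    proof -
      have eq: "col_pos \<xi> (1, j) = ?o + ?l" by (simp add: col_pos_def)
      have bx: "(1, j) \<in> boxes \<xi>" using b(1) by (intro box) auto
      show ?thesis using col_cell_pos[OF p bx] posX[OF bx] by (simp only: eq)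
    qed
    have len: "?l = length ?rs + 1" using b(1) by (simp add: array_column_def)
    show ?thesis
    proof (rule rename_alternant_eq_block_alt[OF _ len])
      show "{x \<in> {1..?k}. ?cl x = j} = {?o + 1..?o + ?l}"
      proof (intro equalityI subsetI)
        fix x assume x: "x \<in> {x \<in> {1..?k}. ?cl x = j}"
        then have "x \<in> col_pos \<xi> ` boxes \<xi>" using bij_betw_imp_surj_on[OF bij_col_pos[OF p]] by blast
        then obtain bx where bx: "bx \<in> boxes \<xi>" "x = col_pos \<xi> bx" by blast
        then have "snd bx = j" using x col_cell_pos[OF p bx(1)] by simp
        then obtain i where i: "bx = (i, j)" by (cases bx) auto
        show "x \<in> {?o + 1..?o + ?l}" using box_bounds[OF p bx(1)[unfolded i]] by (auto simp: bx(2) i col_pos_def)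
      next
        fix x assume x: "x \<in> {?o + 1..?o + ?l}"
        define i where "i = x - ?o"
        have i: "x = ?o + i" "1 \<le> i" "i \<le> ?l" using x by (auto simp: i_def)
        show "x \<in> {x \<in> {1..?k}. ?cl x = j}"
          using cell_low[of i] cell_top i by (cases "i = ?l") (auto simp del: atLeastAtMost_iff)
      qed
      show "lookup (T.amon r) (?o + ?l) = 0" using cell_top by (simp add: T.lookup_amon)
      fix i assume i: "i \<in> {1..length ?rs}"
      then have il: "1 \<le> i" "i < ?l" using len by auto
      have le: "part \<xi> ?l \<le> part \<xi> (Suc i)" using il by (intro part_antimono[OF p]) auto
      have "lookup (T.amon r) (?o + i) = r (Suc i) (part \<xi> (Suc i) + 1 - j)"
        using cell_low[OF il] il by (simp add: T.lookup_amon T.idx_def)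
      moreover have "?rs ! (i - 1) = r (Suc i) (part \<xi> (Suc i) - part \<xi> ?l + (part \<xi> ?l + 1 - j))"
      proof -
        have "[2..<?l + 1] ! (i - 1) = Suc i" using il by simp
        moreover have "i - 1 < length [2..<?l + 1]" using il by simp
        ultimately show ?thesis unfolding array_column_def by (simp only: nth_map)
      qed
      moreover have "part \<xi> (Suc i) - part \<xi> ?l + (part \<xi> ?l + 1 - j) = part \<xi> (Suc i) + 1 - j" using le b(2) by simp
      ultimately show "lookup (T.amon r) (?o + i) = ?rs ! (i - 1)" by simp
    qed
  qed
  then have "bpol \<xi> r = (\<Prod>j=1..part \<xi> 1. block_alt ?k ?cl (T.amon r) {j})"
    unfolding bpol_column_product[OF p] by (intro prod.cong refl)
  also have "\<dots> = block_alt ?k ?cl (T.amon r) {1..part \<xi> 1}" by (rule block_alt_prod[symmetric]) simp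
  also have "\<dots> = bsym ?k (col_cell \<xi>) act (mon (T.amon r))"
  proof (rule T.bsym_mon_eq_block_alt[symmetric, OF T.amon_Mon])
    show "?cl ` {1..?k} \<subseteq> {1..part \<xi> 1}"
    proof (rule image_subsetI)
      fix x assume "x \<in> {1..?k}"
      then have "(fst (col_cell \<xi> x), snd (col_cell \<xi> x)) \<in> boxes \<xi>" using T.cell_boxes by simp
      from box_bounds(3,4)[OF p this] show "?cl x \<in> {1..part \<xi> 1}" by simp
    qed
  qed
  finally show ?thesis .
qed

lemma ppol_eq_esym:
  "ppol \<xi> r = cscale (of_nat (card T.row_perms) / of_nat (card T.A.R)) (esym (sum_list \<xi>) (col_cell \<xi>) act (mon (T.amon r)))"
proof -
  let ?P = "\<Sum>\<sigma>\<in>T.row_perms. mon (T.amon (\<lambda>j s. r j (\<sigma> j s)))"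
  have c0: "(of_nat (card T.A.R) :: complex) \<noteq> 0" by (simp add: card_stab_nonzero)
  have "ppol \<xi> r = bsym (sum_list \<xi>) (col_cell \<xi>) act ?P"
    by (simp add: ppol_def bpol_eq_bsym module_hom.sum[OF T.A.lin_bsym])
  also have "?P = cscale (1 / of_nat (card T.A.R)) (cscale (of_nat (card T.A.R)) ?P)" using c0 by simp
  also have "\<dots> = cscale (of_nat (card T.row_perms) / of_nat (card T.A.R)) (asym (sum_list \<xi>) (col_cell \<xi>) act (mon (T.amon r)))"
    unfolding T.asym_array_sum by simp
  finally show ?thesis by (simp add: module_hom.scale[OF T.A.lin_bsym] esym_def)
qed

text \<open>The monomials with exponents \<open>0\<close> in the first row are exactly those that carry an array.\<close>

theorem Mmod_eq_esym: "Mmod (sum_list \<xi>) \<xi> = esym (sum_list \<xi>) (col_cell \<xi>) act ` polys (sum_list \<xi>)"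
proof
  let ?k = "sum_list \<xi>"
  let ?es = "esym ?k (col_cell \<xi>) act"
  have c: "(of_nat (card T.A.R) :: complex) \<noteq> 0" "(of_nat (card T.row_perms) :: complex) \<noteq> 0"
    using card_stab_nonzero T.finite_row_perms T.row_perms_nonempty by (simp_all add: card_0_eq del: One_nat_def)
  show "Mmod ?k \<xi> \<subseteq> ?es ` polys ?k" unfolding Mmod_def
  proof (rule gen_submod_minimal[OF _ T.submod_esym])
    show "range (ppol \<xi>) \<subseteq> ?es ` polys ?k"
      using cvs.subspace_scale[OF module_hom.subspace_image[OF T.A.lin_esym subspace_polys]] mon_in_polys[OF T.amon_Mon]
      by (auto simp: ppol_eq_esym)
  qed
  show "?es ` polys ?k \<subseteq> Mmod ?k \<xi>" unfolding T.esym_eq_gen_first_row_zero Mmod_def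
  proof (rule gen_submod_minimal[OF _ submod_gen_submod], safe)
    fix m assume m: "m \<in> Mon ?k" "\<forall>x\<in>{1..?k}. fst (col_cell \<xi> x) = 1 \<longrightarrow> lookup m x = 0"
    define r where "r j s = lookup m (T.place j s)" for j s
    have "m = T.amon r" using m T.place_idx by (intro T.amon_eqI) (auto simp: r_def simp del: atLeastAtMost_iff)
    then have "?es (mon m) = cscale (of_nat (card T.A.R) / of_nat (card T.row_perms)) (ppol \<xi> r)"
      using c by (simp add: ppol_eq_esym)
    then show "?es (mon m) \<in> gen_submod (sympolys ?k) (range (ppol \<xi>))"
      by (simp only: cvs.subspace_scale[OF subspace_gen_submod gen_submod_base] rangeI)
  qed
qed

end

section \<open>The isotypic component\<close>

subsection \<open>The standard tableau filled row by row\<close>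

definition std_cell :: "nat list \<Rightarrow> nat \<Rightarrow> nat \<times> nat" where
  "std_cell \<xi> = the_inv_into (boxes \<xi>) (\<lambda>(i, j). tab \<xi> i j)"

lemma tab_step: assumes "1 \<le> i" "i < i'" shows "tab \<xi> i (part \<xi> i) \<le> tab \<xi> i' 0"
proof -
  have "tab \<xi> i (part \<xi> i) = (\<Sum>a\<in>insert i {1..<i}. part \<xi> a)" by (simp add: tab_def)
  also have "\<dots> \<le> (\<Sum>a\<in>{1..<i'}. part \<xi> a)" using assms by (intro sum_mono2) auto
  finally show ?thesis by (simp add: tab_def)
qed

lemma bij_tab: "bij_betw (\<lambda>(i, j). tab \<xi> i j) (boxes \<xi>) {1..sum_list \<xi>}"
proof -
  let ?t = "\<lambda>(i, j). tab \<xi> i j"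
  have add: "tab \<xi> i j = tab \<xi> i 0 + j" for i j by (simp add: tab_def)
  have inj: "inj_on ?t (boxes \<xi>)"
  proof (rule inj_onI)
    fix b b' assume b: "b \<in> boxes \<xi>" "b' \<in> boxes \<xi>" "?t b = ?t b'"
    obtain i j i' j' where ij: "b = (i, j)" "b' = (i', j')" by (cases b, cases b')
    have bd: "1 \<le> i" "1 \<le> j" "j \<le> part \<xi> i" "1 \<le> i'" "1 \<le> j'" "j' \<le> part \<xi> i'"
      using b by (auto simp: ij boxes_alt)
    have eq: "tab \<xi> i 0 + j = tab \<xi> i' 0 + j'" using b(3) add[of i j] add[of i' j'] by (simp add: ij)
    have "i = i'"
    proof (rule ccontr)
      assume "i \<noteq> i'"
      then consider "i < i'" | "i' < i" by linarith
      then show False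
        using tab_step[of i i' \<xi>] tab_step[of i' i \<xi>] add[of i "part \<xi> i"] add[of i' "part \<xi> i'"] bd eq by cases linarith+
    qed
    then show "b = b'" using eq by (simp add: ij)
  qed
  have "?t ` boxes \<xi> \<subseteq> {1..sum_list \<xi>}"
  proof (intro image_subsetI)
    fix b assume b: "b \<in> boxes \<xi>"
    obtain i j where ij: "b = (i, j)" by (cases b)
    have bd: "1 \<le> i" "i \<le> length \<xi>" "1 \<le> j" "j \<le> part \<xi> i" using b by (auto simp: ij boxes_def)
    have "tab \<xi> i (part \<xi> i) \<le> tab \<xi> (Suc (length \<xi>)) 0" using bd by (intro tab_step) auto
    also have "\<dots> = sum_list \<xi>" using sum_part[of \<xi>] by (simp add: tab_def atLeastLessThanSuc_atLeastAtMost)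
    finally show "?t b \<in> {1..sum_list \<xi>}" using bd add[of i j] add[of i "part \<xi> i"] by (simp add: ij)
  qed
  then have "?t ` boxes \<xi> = {1..sum_list \<xi>}"
    by (intro card_subset_eq) (simp_all add: card_image[OF inj] card_boxes)
  with inj show ?thesis by (simp add: bij_betw_def)
qed

lemma tableau_std_cell: "is_partition \<xi> \<Longrightarrow> tableau \<xi> (sum_list \<xi>) (std_cell \<xi>)"
  unfolding std_cell_def by (intro tableau.intro bij_betw_the_inv_into bij_tab)

lemma stab_eq_preserves_blocks:
  assumes S: "\<And>i. S i = {x \<in> {1..k}. f x = i}"
  shows "{g. g permutes {1..k} \<and> (\<forall>i. g ` S i = S i)} = stab k f"
proof (intro equalityI subsetI)
  fix g assume g: "g \<in> {g. g permutes {1..k} \<and> (\<forall>i. g ` S i = S i)}"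
  have "f (g x) = f x" if "x \<in> {1..k}" for x
  proof -
    have "g x \<in> g ` S (f x)" using that by (intro imageI) (simp add: S)
    then have "g x \<in> S (f x)" using g by blast
    then show ?thesis by (simp add: S)
  qed
  then show "g \<in> stab k f" using g by (simp add: stab_def)
next
  fix g assume g: "g \<in> stab k f"
  have p: "g permutes {1..k}" using g by (rule stab_permutes)
  have sub: "h ` S i \<subseteq> S i" if "h \<in> stab k f" for h i
    unfolding S using that perm_in[OF stab_permutes[OF that]] by (auto simp: stab_def simp del: atLeastAtMost_iff)
  have "S i \<subseteq> g ` S i" for i
  proof
    fix x assume "x \<in> S i"
    then have "inv g x \<in> S i" using sub[OF stab_inv[OF g]] by blast
    then have "g (inv g x) \<in> g ` S i" by (rule imageI)
    then show "x \<in> g ` S i" by (simp add: permutes_inverses[OF p])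
  qed
  then show "g \<in> {g. g permutes {1..k} \<and> (\<forall>i. g ` S i = S i)}" using p sub[OF g] by blast
qed

lemma young_symmetrizer_eq: "young_symmetrizer \<xi> = symmetrizer (sum_list \<xi>) (std_cell \<xi>)"
proof -
  let ?k = "sum_list \<xi>"
  have cell: "std_cell \<xi> (tab \<xi> i j) = (i, j)" if "(i, j) \<in> boxes \<xi>" for i j
    unfolding std_cell_def using the_inv_into_f_f[OF bij_betw_imp_inj_on[OF bij_tab] that] by simp
  have tab: "tab \<xi> i j \<in> {1..?k}" if "(i, j) \<in> boxes \<xi>" for i j
    using bij_betw_imp_surj_on[OF bij_tab, of \<xi>] that by force
  have ex: "\<exists>i j. (i, j) \<in> boxes \<xi> \<and> x = tab \<xi> i j" if "x \<in> {1..?k}" for x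
    using bij_betw_imp_surj_on[OF bij_tab, of \<xi>] that by force
  have row: "{tab \<xi> i j | j. (i, j) \<in> boxes \<xi>} = {x \<in> {1..?k}. rw (std_cell \<xi>) x = i}" for i
    using cell tab ex by (force simp del: atLeastAtMost_iff)
  have col: "{tab \<xi> i j | i. (i, j) \<in> boxes \<xi>} = {x \<in> {1..?k}. cl (std_cell \<xi>) x = j}" for j
    using cell tab ex by (force simp del: atLeastAtMost_iff)
  have "row_group \<xi> = stab ?k (rw (std_cell \<xi>))"
    unfolding row_group_def by (rule stab_eq_preserves_blocks) (rule row)
  moreover have "col_group \<xi> = stab ?k (cl (std_cell \<xi>))"
    unfolding col_group_def by (rule stab_eq_preserves_blocks) (rule col)
  ultimately show ?thesis by (simp add: young_symmetrizer_def symmetrizer_def)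
qed

subsection \<open>Changing the tableau\<close>

lemma sum_stab_conj:
  assumes \<pi>: "\<pi> permutes {1..k}" and f: "\<And>x. x \<in> {1..k} \<Longrightarrow> f' x = f (\<pi> x)"
  shows "(\<Sum>g\<in>stab k f'. F g) = (\<Sum>g\<in>stab k f. F (inv \<pi> \<circ> g \<circ> \<pi>))"
proof (rule sum.reindex_bij_witness[of _ "\<lambda>g. inv \<pi> \<circ> g \<circ> \<pi>" "\<lambda>g. \<pi> \<circ> g \<circ> inv \<pi>"])
  note in\<pi> = perm_in[OF \<pi>] and inv\<pi> = perm_in[OF permutes_inv[OF \<pi>]]
  have cancel: "inv \<pi> \<circ> (\<pi> \<circ> g \<circ> inv \<pi>) \<circ> \<pi> = g" "\<pi> \<circ> (inv \<pi> \<circ> g \<circ> \<pi>) \<circ> inv \<pi> = g" for g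
    by (simp_all add: fun_eq_iff permutes_inverses[OF \<pi>])
  show "\<pi> \<circ> (inv \<pi> \<circ> g \<circ> \<pi>) \<circ> inv \<pi> = g" for g by (rule cancel)
  show "inv \<pi> \<circ> (\<pi> \<circ> g \<circ> inv \<pi>) \<circ> \<pi> = g" for g by (rule cancel)
  then show "F (inv \<pi> \<circ> (\<pi> \<circ> g \<circ> inv \<pi>) \<circ> \<pi>) = F g" for g by simp
  fix g assume g: "g \<in> stab k f'"
  have p: "g permutes {1..k}" using g by (rule stab_permutes)
  have "f (\<pi> (g (inv \<pi> x))) = f x" if x: "x \<in> {1..k}" for x
  proof -
    have "f (\<pi> (g (inv \<pi> x))) = f' (g (inv \<pi> x))" by (rule f[symmetric]) (rule perm_in[OF p inv\<pi>[OF x]])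
    also have "\<dots> = f' (inv \<pi> x)" using g inv\<pi>[OF x] by (simp add: stab_def del: atLeastAtMost_iff)
    also have "\<dots> = f x" by (simp only: f[OF inv\<pi>[OF x]] permutes_inverses[OF \<pi>])
    finally show ?thesis .
  qed
  then show "\<pi> \<circ> g \<circ> inv \<pi> \<in> stab k f" using \<pi> p by (simp add: stab_def permutes_compose permutes_inv)
next
  note in\<pi> = perm_in[OF \<pi>] and inv\<pi> = perm_in[OF permutes_inv[OF \<pi>]]
  fix g assume g: "g \<in> stab k f"
  have p: "g permutes {1..k}" using g by (rule stab_permutes)
  have "f' (inv \<pi> (g (\<pi> x))) = f' x" if x: "x \<in> {1..k}" for x
  proof -
    have "f' (inv \<pi> (g (\<pi> x))) = f (g (\<pi> x))"
      by (simp only: f[OF inv\<pi>[OF perm_in[OF p in\<pi>[OF x]]]] permutes_inverses[OF \<pi>])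
    also have "\<dots> = f (\<pi> x)" using g in\<pi>[OF x] by (simp add: stab_def del: atLeastAtMost_iff)
    also have "\<dots> = f' x" by (rule f[OF x, symmetric])
    finally show ?thesis .
  qed
  then show "inv \<pi> \<circ> g \<circ> \<pi> \<in> stab k f'" using \<pi> p by (simp add: stab_def permutes_compose permutes_inv)
qed

lemma sign_conj:
  assumes \<pi>: "\<pi> permutes {1..k::nat}" and g: "g permutes {1..k}" shows "sign (inv \<pi> \<circ> g \<circ> \<pi>) = sign g"
proof -
  have "sign (inv \<pi> \<circ> g \<circ> \<pi>) = sign \<pi> * sign g * sign \<pi>"
    using \<pi> g by (simp add: sign_comp_permutes[of _ k] permutes_compose permutes_inv sign_inv_permutes)
  also have "\<dots> = sign g" using sign_idempotent[of \<pi>] by (simp add: mult_ac)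
  finally show ?thesis .
qed

locale tableau_pair = tableau \<xi> k cell + T': tableau \<xi> k cell' for \<xi> k cell cell'
begin

definition \<pi> :: "nat \<Rightarrow> nat" where "\<pi> x = (if x \<in> X then the_inv_into X cell (cell' x) else x)"

lemma cell_\<pi>: "x \<in> X \<Longrightarrow> cell (\<pi> x) = cell' x"
  unfolding \<pi>_def using T'.cell_boxes[of x] bij_betw_imp_surj_on[OF cell]
  by (simp add: f_the_inv_into_f[OF bij_betw_imp_inj_on[OF cell]])

lemma \<pi>_permutes: "\<pi> permutes X"
proof (rule bij_imp_permutes)
  have "bij_betw (the_inv_into X cell \<circ> cell') X X"
    using T'.cell bij_betw_the_inv_into[OF cell] by (rule bij_betw_trans)
  then show "bij_betw \<pi> X X" by (rule bij_betw_cong[THEN iffD1, rotated]) (simp add: \<pi>_def)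
qed (simp only: \<pi>_def if_False)

text \<open>Renumbering the entries by \<open>\<pi>\<close> takes one tableau to the other, and it conjugates the row and
  column groups.\<close>

lemma esym_conj: "esym k cell' act p = act (esym k cell act (act p (inv \<pi>))) \<pi>"
proof -
  note b = permutes_bij[OF \<pi>_permutes]
  have a: "asym k cell' act p = act (asym k cell act (act p (inv \<pi>))) \<pi>" for p
  proof -
    have "asym k cell' act p = (\<Sum>g\<in>stab k (rw cell). act p (inv \<pi> \<circ> g \<circ> \<pi>))"
      unfolding asym_def by (rule sum_stab_conj[OF \<pi>_permutes]) (simp add: cell_\<pi>)
    also have "\<dots> = (\<Sum>g\<in>stab k (rw cell). act (act (act p (inv \<pi>)) g) \<pi>)"
      by (intro sum.cong refl) (simp add: act_comp bij_comp b bij_imp_bij_inv permutes_bij[OF stab_permutes])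
    finally show ?thesis by (simp add: asym_def act_sum)
  qed
  have b': "bsym k cell' act p = act (bsym k cell act (act p (inv \<pi>))) \<pi>" for p
  proof -
    have "bsym k cell' act p = (\<Sum>g\<in>stab k (cl cell). cscale (of_int (sign (inv \<pi> \<circ> g \<circ> \<pi>))) (act p (inv \<pi> \<circ> g \<circ> \<pi>)))"
      unfolding bsym_def by (rule sum_stab_conj[OF \<pi>_permutes]) (simp add: cell_\<pi>)
    also have "\<dots> = (\<Sum>g\<in>stab k (cl cell). cscale (of_int (sign g)) (act (act (act p (inv \<pi>)) g) \<pi>))"
      by (intro sum.cong refl)
        (simp add: sign_conj[OF \<pi>_permutes stab_permutes] act_comp bij_comp b bij_imp_bij_inv permutes_bij[OF stab_permutes])
    finally show ?thesis by (simp add: bsym_def act_sum act_scale)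
  qed
  show ?thesis
    unfolding esym_def[of k cell'] a b' using \<pi>_permutes by (simp add: act_comp b bij_imp_bij_inv permutes_inv_o esym_def)
qed

lemma esym_image_conj: "esym k cell' act ` polys k = (\<lambda>p. act (esym k cell act p) \<pi>) ` polys k"
proof (intro equalityI image_subsetI)
  fix p assume p: "p \<in> polys k"
  show "esym k cell' act p \<in> (\<lambda>p. act (esym k cell act p) \<pi>) ` polys k"
    unfolding esym_conj using act_polys[OF permutes_inv[OF \<pi>_permutes] p] by blast
  have "act (esym k cell act p) \<pi> = esym k cell' act (act p \<pi>)"
    unfolding esym_conj using \<pi>_permutes by (simp add: act_comp permutes_bij bij_imp_bij_inv permutes_inv_o)
  then show "act (esym k cell act p) \<pi> \<in> esym k cell' act ` polys k"
    using act_polys[OF \<pi>_permutes p] by blast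
qed

end

subsection \<open>The multiplicity space of an irreducible representation\<close>

context tableau
begin

abbreviation "e \<equiv> symmetrizer k cell"
abbreviation "E \<equiv> esym k cell act"
abbreviation "c\<^sub>e \<equiv> esym_const k cell"
abbreviation "irr \<equiv> cvs.span {gact e \<sigma> | \<sigma>. \<sigma> permutes X}"
abbreviation "rx \<equiv> rext k act"

lemma irr_GA: "irr \<subseteq> GA k"
  by (intro span_subset_subspaceI subspace_GA) (auto intro: gact_GA symmetrizer_GA)

lemma e_irr: "e \<in> irr"
proof -
  have "gact e id \<in> irr" using permutes_id by (intro cvs.span_base) blast
  then show ?thesis by simp
qed

lemma gact_irr: assumes "\<sigma> permutes X" "v \<in> irr" shows "gact v \<sigma> \<in> irr"
  using assms(2)
proof (rule span_image_subset[OF _ lin_gact])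
  fix s assume "s \<in> {gact e \<sigma> | \<sigma>. \<sigma> permutes X}"
  then obtain \<tau> where "\<tau> permutes X" "gact s \<sigma> = gact e (\<tau> \<circ> \<sigma>)" by (auto simp: gact_comp)
  then show "gact s \<sigma> \<in> irr" using permutes_compose[OF assms(1)] by (intro cvs.span_base) blast
qed

lemma rx_E_gact_e: "\<sigma> permutes X \<Longrightarrow> rx (E p) (gact e \<sigma>) = cscale c\<^sub>e (act (E p) \<sigma>)"
  by (simp add: A.rext_gact A.rext_symmetrizer A.esym_esym act_scale)

text \<open>For \<open>v = e \<sigma>\<close> this is the formula for \<open>e g\<inverse> e\<close>. It recovers the coefficients of \<open>v\<close> from the product
  \<open>p e v\<close>, and thereby inverts multiplication on the tensor product.\<close>

lemma E_act_rx:
  assumes v: "v \<in> irr" and g: "g permutes X"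
  shows "E (act (rx (E p) v) (inv g)) = cscale (c\<^sub>e\<^sup>2 * lookup v g) (E p)"
  using v
proof (induction rule: cvs.span_induct_alt)
  case base
  show ?case by (simp add: module_hom.zero[OF A.lin_rext_right] module_hom.zero[OF A.lin_esym])
next
  case (step a x y)
  then obtain \<sigma> where \<sigma>: "\<sigma> permutes X" "x = gact e \<sigma>" by blast
  note bg = permutes_bij[OF g] and bs = permutes_bij[OF \<sigma>(1)]
  have gs: "g \<circ> inv \<sigma> permutes X" using permutes_compose[OF permutes_inv[OF \<sigma>(1)] g] .
  have inv: "inv (g \<circ> inv \<sigma>) = \<sigma> \<circ> inv g"
    using bg bs by (simp add: o_inv_distrib bij_imp_bij_inv inv_inv_eq)
  have "E (act (rx (E p) x) (inv g)) = cscale c\<^sub>e (E (act (E p) (inv (g \<circ> inv \<sigma>))))"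
    unfolding \<sigma>(2) inv using bg bs
    by (simp add: rx_E_gact_e[OF \<sigma>(1)] act_scale module_hom.scale[OF A.lin_esym] act_comp bij_imp_bij_inv)
  also have "\<dots> = cscale (c\<^sub>e\<^sup>2 * lookup x g) (E p)"
    by (simp add: A.esym_\<alpha>_esym[OF gs] \<sigma>(2) lookup_gact[OF bs] power2_eq_square)
  finally show ?case using step.IH
    by (simp add: module_hom.add[OF A.lin_rext_right] module_hom.scale[OF A.lin_rext_right] act_add act_scale
      module_hom.add[OF A.lin_esym] module_hom.scale[OF A.lin_esym] lookup_add lookup_cscale distrib_left
      cvs.scale_left_distrib mult_ac)
qed

lemma rx_polys: "p \<in> polys k \<Longrightarrow> rx p v \<in> polys k"
  unfolding rext_def by (intro polys_sum cvs.subspace_scale[OF subspace_polys] act_polys) auto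

text \<open>The span of the images of all homomorphisms from the irreducible representation.\<close>

definition iso_span :: "mpol set" where
  "iso_span = cvs.span {rx (E p) v | p v. p \<in> polys k \<and> v \<in> irr}"

text \<open>Its coefficients can be recovered from the product, and they vanish.\<close>

lemma rx_inj:
  assumes "E p \<noteq> 0" "v \<in> irr" "rx (E p) v = 0" shows "v = 0"
proof (rule poly_mapping_eqI)
  fix g
  show "lookup v g = lookup 0 g"
  proof (cases "g permutes X")
    case True
    have "cscale (c\<^sub>e\<^sup>2 * lookup v g) (E p) = 0"
      using E_act_rx[OF assms(2) True, of p] by (simp add: assms(3) module_hom.zero[OF A.lin_esym])
    then show ?thesis using assms(1) esym_const_nonzero by simp
  next
    case False
    have "v \<in> GA k" using assms(2) irr_GA by blast
    then have "g \<notin> keys v" using False by (auto simp: GA_def)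
    then show ?thesis by (simp add: in_keys_iff)
  qed
qed

lemma rx_in_iso_subrep:
  assumes p: "p \<in> polys k" "E p \<noteq> 0"
  defines "N \<equiv> rx (E p) ` irr"
  shows "subrep k N \<and> (\<exists>\<phi>. bij_betw \<phi> N irr \<and> lin_on N \<phi> \<and> equivar_on k N act gact \<phi>)"
proof
  note lin = A.lin_rext_right[of "E p"]
  have inj: "inj_on (rx (E p)) irr"
  proof (rule inj_onI)
    fix u v assume uv: "u \<in> irr" "v \<in> irr" "rx (E p) u = rx (E p) v"
    then have "rx (E p) (u - v) = 0" by (simp add: module_hom.diff[OF lin])
    then have "u - v = 0" using uv by (intro rx_inj[OF p(2)] cvs.span_diff)
    then show "u = v" by simp
  qed
  let ?\<phi> = "the_inv_into irr (rx (E p))"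
  have \<phi>: "?\<phi> (rx (E p) v) = v" if "v \<in> irr" for v by (rule the_inv_into_f_f[OF inj that])
  show "subrep k N" unfolding subrep_def N_def
    using module_hom.subspace_image[OF lin cvs.subspace_span] rx_polys[OF esym_polys[OF p(1)]] gact_irr
    by (auto simp: A.rext_gact[symmetric])
  have "bij_betw ?\<phi> N irr" unfolding N_def by (rule bij_betw_the_inv_into) (simp add: bij_betw_def inj)
  moreover have "lin_on N ?\<phi>" unfolding lin_on_def N_def
    by (auto simp: \<phi> module_hom.add[OF lin, symmetric] module_hom.scale[OF lin, symmetric] cvs.span_add cvs.span_scale)
  moreover have "equivar_on k N act gact ?\<phi>" unfolding equivar_on_def N_def
    by (auto simp: \<phi> A.rext_gact[symmetric] gact_irr)
  ultimately show "\<exists>\<phi>. bij_betw \<phi> N irr \<and> lin_on N \<phi> \<and> equivar_on k N act gact \<phi>" by blast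
qed

lemma lin_on_sum:
  assumes "lin_on N \<phi>" "cvs.subspace N" "\<And>i. i \<in> I \<Longrightarrow> f i \<in> N"
  shows "\<phi> (sum f I) = (\<Sum>i\<in>I. \<phi> (f i))"
  using assms(3)
proof (induction I rule: infinite_finite_induct)
  case (insert i I)
  have "sum f I \<in> N" using insert by (intro cvs.subspace_sum[OF assms(2)]) auto
  then show ?case using insert assms(1) by (simp add: lin_on_def)
next
  case (infinite I)
  have "\<phi> (cscale 0 0) = cscale 0 (\<phi> 0)" using assms(1) cvs.subspace_0[OF assms(2)] unfolding lin_on_def by blast
  then show ?case using infinite by simp
next
  case empty
  have "\<phi> (cscale 0 0) = cscale 0 (\<phi> 0)" using assms(1) cvs.subspace_0[OF assms(2)] unfolding lin_on_def by blast
  then show ?case by simp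
qed

lemma equivar_esym:
  assumes N: "cvs.subspace N" "\<And>\<sigma> x. \<sigma> permutes X \<Longrightarrow> x \<in> N \<Longrightarrow> \<beta> x \<sigma> \<in> N"
    and \<phi>: "lin_on N \<phi>" "equivar_on k N \<beta> gact \<phi>" and x: "x \<in> N"
  shows "esym k cell \<beta> x \<in> N \<and> \<phi> (esym k cell \<beta> x) = esym k cell gact (\<phi> x)"
proof -
  have a: "asym k cell \<beta> y \<in> N \<and> \<phi> (asym k cell \<beta> y) = asym k cell gact (\<phi> y)" if "y \<in> N" for y
  proof
    show "asym k cell \<beta> y \<in> N" unfolding asym_def using that by (intro cvs.subspace_sum[OF N(1)] N(2) stab_permutes)
    show "\<phi> (asym k cell \<beta> y) = asym k cell gact (\<phi> y)"
      unfolding asym_def using that \<phi>(2)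
      by (subst lin_on_sum[OF \<phi>(1) N(1)]) (auto intro!: N(2) stab_permutes sum.cong simp: equivar_on_def dest: stab_permutes)
  qed
  have b: "bsym k cell \<beta> y \<in> N \<and> \<phi> (bsym k cell \<beta> y) = bsym k cell gact (\<phi> y)" if y: "y \<in> N" for y
  proof
    have in_N: "cscale (of_int (sign h)) (\<beta> y h) \<in> N" if "h \<in> stab k (cl cell)" for h
      using y that by (intro cvs.subspace_scale[OF N(1)] N(2) stab_permutes)
    then show "bsym k cell \<beta> y \<in> N" unfolding bsym_def by (intro cvs.subspace_sum[OF N(1)])
    have "\<phi> (cscale (of_int (sign h)) (\<beta> y h)) = cscale (of_int (sign h)) (gact (\<phi> y) h)" if "h \<in> stab k (cl cell)" for h
      using \<phi> y N(2)[OF stab_permutes[OF that] y] stab_permutes[OF that] by (simp add: lin_on_def equivar_on_def)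
    then show "\<phi> (bsym k cell \<beta> y) = bsym k cell gact (\<phi> y)"
      unfolding bsym_def using in_N by (subst lin_on_sum[OF \<phi>(1) N(1)]) (auto intro!: sum.cong)
  qed
  show ?thesis unfolding esym_def using a[OF x] b by simp
qed

lemma esym_gact_e: "esym k cell gact e = cscale c\<^sub>e e"
  unfolding symmetrizer_eq_esym by (rule G.esym_esym)

text \<open>The preimage \<open>y\<close> of \<open>e\<close> under an isomorphism satisfies \<open>y e = c y\<close>, because \<open>e e = c e\<close>. So up to a factor
  \<open>y \<sigma>\<close> is the product of \<open>y e\<close> and \<open>e \<sigma>\<close>, and these elements span the subrepresentation.\<close>

lemma iso_subrep_subset:
  assumes N: "subrep k N" and \<phi>: "bij_betw \<phi> N irr" "lin_on N \<phi>" "equivar_on k N act gact \<phi>"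
  shows "N \<subseteq> iso_span"
proof
  have sub: "cvs.subspace N" "N \<subseteq> polys k" "\<And>\<sigma> p. \<sigma> permutes X \<Longrightarrow> p \<in> N \<Longrightarrow> act p \<sigma> \<in> N"
    using N by (auto simp: subrep_def)
  have inj: "inj_on \<phi> N" and im: "\<phi> ` N = irr" using \<phi>(1) by (auto simp: bij_betw_def)
  have "e \<in> \<phi> ` N" by (simp only: im e_irr)
  then obtain y where y': "e = \<phi> y" and y: "y \<in> N" by (rule imageE)
  note y = y y'[symmetric]
  have "E y \<in> N \<and> \<phi> (E y) = esym k cell gact (\<phi> y)" by (rule equivar_esym[OF sub(1,3) \<phi>(2,3) y(1)])
  then have Ey: "E y \<in> N" "\<phi> (E y) = cscale c\<^sub>e e" by (simp_all add: y(2) esym_gact_e)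
  have cy: "cscale c\<^sub>e y \<in> N" "\<phi> (cscale c\<^sub>e y) = cscale c\<^sub>e e"
    using y \<phi>(2) by (simp_all add: cvs.subspace_scale[OF sub(1)] lin_on_def)
  have Ey_eq: "E y = cscale c\<^sub>e y" using Ey cy by (intro inj_onD[OF inj]) simp_all
  have orbit: "act y \<sigma> \<in> N \<inter> iso_span" if \<sigma>: "\<sigma> permutes X" for \<sigma>
  proof
    show "act y \<sigma> \<in> N" using sub(3)[OF \<sigma> y(1)] .
    have "rx (E y) (gact e \<sigma>) \<in> iso_span"
      unfolding iso_span_def using y(1) sub(2) gact_irr[OF \<sigma> e_irr] by (intro cvs.span_base) blast
    then have "cscale (1 / c\<^sub>e\<^sup>2) (rx (E y) (gact e \<sigma>)) \<in> iso_span" unfolding iso_span_def by (rule cvs.span_scale)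
    moreover have "cscale (1 / c\<^sub>e\<^sup>2) (rx (E y) (gact e \<sigma>)) = act y \<sigma>"
      unfolding rx_E_gact_e[OF \<sigma>] unfolding Ey_eq using esym_const_nonzero by (simp add: act_scale power2_eq_square)
    ultimately show "act y \<sigma> \<in> iso_span" by simp
  qed
  have sub': "cvs.subspace (N \<inter> iso_span)" unfolding iso_span_def by (intro cvs.subspace_inter sub(1)) simp
  have "irr \<subseteq> \<phi> ` (N \<inter> iso_span)"
  proof (rule span_subset_subspaceI)
    show "{gact e \<sigma> | \<sigma>. \<sigma> permutes X} \<subseteq> \<phi> ` (N \<inter> iso_span)"
    proof
      fix v assume "v \<in> {gact e \<sigma> | \<sigma>. \<sigma> permutes X}"
      then obtain \<sigma> where \<sigma>: "\<sigma> permutes X" "v = gact e \<sigma>" by blast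
      then have "v = \<phi> (act y \<sigma>)" using \<phi>(3) y by (simp add: equivar_on_def)
      then show "v \<in> \<phi> ` (N \<inter> iso_span)" using orbit[OF \<sigma>(1)] by blast
    qed
    show "cvs.subspace (\<phi> ` (N \<inter> iso_span))"
    proof (intro cvs.subspaceI)
      have "\<phi> (cscale 0 0) = cscale 0 (\<phi> 0)" using \<phi>(2) cvs.subspace_0[OF sub(1)] unfolding lin_on_def by blast
      then have "\<phi> 0 = 0" by simp
      then show "0 \<in> \<phi> ` (N \<inter> iso_span)" using cvs.subspace_0[OF sub'] by (metis image_eqI)
    next
      fix u v assume "u \<in> \<phi> ` (N \<inter> iso_span)" "v \<in> \<phi> ` (N \<inter> iso_span)"
      then obtain a b where ab: "a \<in> N \<inter> iso_span" "u = \<phi> a" "b \<in> N \<inter> iso_span" "v = \<phi> b" by blast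
      then have "u + v = \<phi> (a + b)" using \<phi>(2) by (simp add: lin_on_def)
      then show "u + v \<in> \<phi> ` (N \<inter> iso_span)" using cvs.subspace_add[OF sub' ab(1,3)] by blast
    next
      fix c v assume "v \<in> \<phi> ` (N \<inter> iso_span)"
      then obtain a where a: "a \<in> N \<inter> iso_span" "v = \<phi> a" by blast
      then have "cscale c v = \<phi> (cscale c a)" using \<phi>(2) by (simp add: lin_on_def)
      then show "cscale c v \<in> \<phi> ` (N \<inter> iso_span)" using cvs.subspace_scale[OF sub' a(1)] by blast
    qed
  qed
  fix x assume x: "x \<in> N"
  then have "\<phi> x \<in> irr" using im by blast
  then obtain z where "z \<in> N \<inter> iso_span" "\<phi> x = \<phi> z" using \<open>irr \<subseteq> _\<close> by blast
  then show "x \<in> iso_span" using inj_onD[OF inj, of x z] x by auto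
qed

lemma isotypic_eq_iso_span:
  assumes irr: "irrep \<xi> = irr" shows "isotypic k \<xi> = iso_span"
proof
  show "isotypic k \<xi> \<subseteq> iso_span"
    unfolding isotypic_def irr
  proof (rule span_subset_subspaceI)
    show "\<Union> {N. subrep k N \<and> (\<exists>\<phi>. bij_betw \<phi> N irr \<and> lin_on N \<phi> \<and> equivar_on k N act gact \<phi>)} \<subseteq> iso_span"
      using iso_subrep_subset by blast
  qed (simp add: iso_span_def)
  show "iso_span \<subseteq> isotypic k \<xi>"
    unfolding iso_span_def isotypic_def irr
  proof (rule span_subset_subspaceI[OF _ cvs.subspace_span], safe)
    fix p v assume pv: "p \<in> polys k" "v \<in> irr"
    show "rx (E p) v \<in> cvs.span (\<Union> {N. subrep k N \<and> (\<exists>\<phi>. bij_betw \<phi> N irr \<and> lin_on N \<phi> \<and> equivar_on k N act gact \<phi>)})"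
    proof (cases "E p = 0")
      case True
      then show ?thesis by (simp add: module_hom.zero[OF A.lin_rext_left] cvs.span_zero)
    next
      case False
      then show ?thesis using rx_in_iso_subrep[OF pv(1) False] pv(2) by (intro cvs.span_base) blast
    qed
  qed
qed

end

subsection \<open>The isotypic component as a tensor product\<close>

lemma lookup_tens: "lookup (tens p v) g = cscale (lookup v g) p"
  by (simp add: tens_def Poly_Mapping.map.rep_eq when_def)

lemma lookup_tens_mult: "lookup (tens_mult f F) g = f * lookup F g"
  by (simp add: tens_mult_def Poly_Mapping.map.rep_eq when_def)

lemma tens_in_tensor: "p \<in> M \<Longrightarrow> v \<in> V \<Longrightarrow> tens p v \<in> tensor M V"
  unfolding tensor_def by (intro CollectI exI[of _ "Suc 0"] exI[of _ "\<lambda>_. p"] exI[of _ "\<lambda>_. v"]) simp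

lemma zero_in_tensor: "0 \<in> tensor M V"
  unfolding tensor_def by (intro CollectI exI[of _ 0]) simp

lemma tensor_add:
  assumes "F \<in> tensor M V" "G \<in> tensor M V" shows "F + G \<in> tensor M V"
proof -
  obtain N :: nat and p v where F: "F = (\<Sum>i<N. tens (p i) (v i))" "\<forall>i<N. p i \<in> M \<and> v i \<in> V"
    using assms(1) unfolding tensor_def by blast
  obtain N' :: nat and p' v' where G: "G = (\<Sum>i<N'. tens (p' i) (v' i))" "\<forall>i<N'. p' i \<in> M \<and> v' i \<in> V"
    using assms(2) unfolding tensor_def by blast
  let ?p = "\<lambda>i. if i < N then p i else p' (i - N)" and ?v = "\<lambda>i. if i < N then v i else v' (i - N)"
  have "(\<Sum>i<N + N'. tens (?p i) (?v i)) = (\<Sum>i<N. tens (?p i) (?v i)) + (\<Sum>i\<in>{N..<N + N'}. tens (?p i) (?v i))"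
    by (simp only: lessThan_atLeast0 sum.atLeastLessThan_concat[OF le0 le_add1])
  also have "(\<Sum>i<N. tens (?p i) (?v i)) = F" by (simp add: F(1))
  also have "(\<Sum>i\<in>{N..<N + N'}. tens (?p i) (?v i)) = G"
    unfolding G(1) by (rule sum.reindex_bij_witness[of _ "\<lambda>i. i + N" "\<lambda>i. i - N"]) auto
  finally have "F + G = (\<Sum>i<N + N'. tens (?p i) (?v i))" ..
  moreover have "\<forall>i<N + N'. ?p i \<in> M \<and> ?v i \<in> V" using F(2) G(2) by auto
  ultimately show ?thesis unfolding tensor_def mem_Collect_eq by (intro exI conjI)
qed

lemma tensor_induct [consumes 1, case_names zero add]:
  assumes "F \<in> tensor M V" and "P 0"
    and "\<And>p v G. p \<in> M \<Longrightarrow> v \<in> V \<Longrightarrow> P G \<Longrightarrow> P (tens p v + G)"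
  shows "P F"
proof -
  obtain N :: nat and p v where F: "F = (\<Sum>i<N. tens (p i) (v i))" "\<forall>i<N. p i \<in> M \<and> v i \<in> V"
    using assms(1) unfolding tensor_def by blast
  have "P (\<Sum>i<n. tens (p i) (v i))" if "n \<le> N" for n
    using that F(2) by (induction n) (simp_all add: assms add.commute)
  then show ?thesis by (simp add: F(1))
qed

context tableau_pair
begin

abbreviation "M \<equiv> (\<lambda>p. act (E p) \<pi>) ` polys k"

lemma M_eq: "esym k cell' act ` polys k = M"
  by (rule esym_image_conj)

lemma bij_\<pi>: "bij \<pi>"
  by (rule permutes_bij[OF \<pi>_permutes])

lemma act_\<pi>_inv [simp]: "act (act p \<pi>) (inv \<pi>) = p"
  using \<pi>_permutes by (simp add: act_comp bij_\<pi> bij_imp_bij_inv permutes_inv_o)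

text \<open>\<open>to_tensor p\<close> is the function \<open>g \<mapsto> p g\<inverse> e\<close>, normalized and transported to the second tableau.
  It is defined on all polynomials and visibly linear over the symmetric ones; \<open>from_tensor\<close> is
  multiplication.\<close>

definition to_tensor :: "mpol \<Rightarrow> ((nat \<Rightarrow> nat) \<Rightarrow>\<^sub>0 mpol)" where
  "to_tensor p = (\<Sum>g | g permutes X. single g (cscale (1 / c\<^sub>e\<^sup>2) (act (E (act p (inv g))) \<pi>)))"

definition from_tensor :: "((nat \<Rightarrow> nat) \<Rightarrow>\<^sub>0 mpol) \<Rightarrow> mpol" where
  "from_tensor F = (\<Sum>g | g permutes X. act (act (lookup F g) (inv \<pi>)) g)"

lemma lookup_to_tensor:
  "lookup (to_tensor p) g = (if g permutes X then cscale (1 / c\<^sub>e\<^sup>2) (act (E (act p (inv g))) \<pi>) else 0)"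
  by (simp add: to_tensor_def lookup_sum_single)

lemma to_tensor_add: "to_tensor (p + q) = to_tensor p + to_tensor q"
  by (rule poly_mapping_eqI)
    (simp add: lookup_to_tensor lookup_add act_add module_hom.add[OF A.lin_esym] cvs.scale_right_distrib)

lemma to_tensor_0 [simp]: "to_tensor 0 = 0"
  using to_tensor_add[of 0 0] by simp

lemma from_tensor_add: "from_tensor (F + G) = from_tensor F + from_tensor G"
  by (simp add: from_tensor_def lookup_add act_add sum.distrib)

lemma from_tensor_0 [simp]: "from_tensor 0 = 0"
  by (simp add: from_tensor_def)

lemma from_tensor_tens: "from_tensor (tens (act p \<pi>) v) = rx p v"
  by (simp add: from_tensor_def lookup_tens act_scale rext_def)

lemma to_tensor_rx:
  assumes "v \<in> irr" shows "to_tensor (rx (E p) v) = tens (act (E p) \<pi>) v"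
proof (rule poly_mapping_eqI)
  fix g show "lookup (to_tensor (rx (E p) v)) g = lookup (tens (act (E p) \<pi>) v) g"
  proof (cases "g permutes X")
    case True
    then show ?thesis
      using esym_const_nonzero by (simp add: lookup_to_tensor lookup_tens E_act_rx[OF assms True] act_scale)
  next
    case False
    have "v \<in> GA k" using assms irr_GA by blast
    then have "g \<notin> keys v" using False by (auto simp: GA_def)
    then show ?thesis using False by (simp add: lookup_to_tensor lookup_tens in_keys_iff)
  qed
qed

lemma tensor_inverse:
  assumes "F \<in> tensor M irr" shows "from_tensor F \<in> iso_span" "to_tensor (from_tensor F) = F"
proof -
  have "from_tensor F \<in> iso_span \<and> to_tensor (from_tensor F) = F"
    using assms
  proof (induction rule: tensor_induct)
    case zero
    show ?case by (simp add: iso_span_def cvs.span_zero)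
  next
    case (add m v G)
    then obtain p where p: "p \<in> polys k" "m = act (E p) \<pi>" by blast
    have "rx (E p) v \<in> iso_span" unfolding iso_span_def using p add by (intro cvs.span_base) blast
    then have "rx (E p) v + from_tensor G \<in> iso_span" using add unfolding iso_span_def by (intro cvs.span_add) auto
    then show ?case using add by (simp add: p(2) from_tensor_add from_tensor_tens to_tensor_add to_tensor_rx)
  qed
  then show "from_tensor F \<in> iso_span" "to_tensor (from_tensor F) = F" by blast+
qed

lemma iso_span_inverse:
  assumes "p \<in> iso_span" shows "to_tensor p \<in> tensor M irr" "from_tensor (to_tensor p) = p"
proof -
  have "to_tensor p \<in> tensor M irr \<and> from_tensor (to_tensor p) = p"
    using assms unfolding iso_span_def
  proof (induction rule: cvs.span_induct_alt)
    case base
    show ?case by (simp add: zero_in_tensor)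
  next
    case (step c x y)
    then obtain p v where pv: "p \<in> polys k" "v \<in> irr" "x = rx (E p) v" by blast
    have x: "cscale c x = rx (E p) (cscale c v)" by (simp add: pv module_hom.scale[OF A.lin_rext_right])
    have v: "cscale c v \<in> irr" using pv(2) by (rule cvs.span_scale)
    have "tens (act (E p) \<pi>) (cscale c v) \<in> tensor M irr" using pv(1) v by (intro tens_in_tensor) auto
    then show ?case using step
      by (simp add: x to_tensor_add to_tensor_rx[OF v] from_tensor_add from_tensor_tens tensor_add)
  qed
  then show "to_tensor p \<in> tensor M irr" "from_tensor (to_tensor p) = p" by blast+
qed

lemma bij_to_tensor: "bij_betw to_tensor iso_span (tensor M irr)"
  by (rule bij_betw_byWitness[where f' = from_tensor]) (auto simp: tensor_inverse iso_span_inverse)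

lemma to_tensor_sym_mult: "f \<in> sympolys k \<Longrightarrow> to_tensor (f * p) = tens_mult f (to_tensor p)"
  by (rule poly_mapping_eqI)
    (simp add: lookup_to_tensor lookup_tens_mult act_mult sympolys_act \<pi>_permutes permutes_inv esym_sym_mult cscale_mult_right)

lemma to_tensor_act: "\<sigma> permutes X \<Longrightarrow> to_tensor (act p \<sigma>) = gact (to_tensor p) \<sigma>"
proof (rule poly_mapping_eqI)
  fix g assume \<sigma>: "\<sigma> permutes X"
  note bs = permutes_bij[OF \<sigma>]
  have "inv (g \<circ> inv \<sigma>) = \<sigma> \<circ> inv g" if "g permutes X"
    using permutes_bij[OF that] bs by (simp add: o_inv_distrib bij_imp_bij_inv inv_inv_eq)
  then show "lookup (to_tensor (act p \<sigma>)) g = lookup (gact (to_tensor p) \<sigma>) g"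
    by (simp add: lookup_gact[OF bs] lookup_to_tensor permutes_comp_inv_iff[OF \<sigma>] act_comp bs permutes_bij bij_imp_bij_inv)
qed

lemma homog_E: "homog s p \<Longrightarrow> homog s (E p)"
  by (simp add: homog_iff_hom_part hom_part_esym)

lemma homog_to_tensor:
  assumes "p \<in> iso_span" shows "homog s p \<longleftrightarrow> tens_homog s (to_tensor p)"
proof
  assume "homog s p"
  then have "homog s (act (E (act p (inv g))) \<pi>)" if "g permutes X" for g
    using that by (intro homog_act homog_E bij_\<pi> permutes_bij[OF permutes_inv])
  then show "tens_homog s (to_tensor p)" by (simp add: tens_homog_def lookup_to_tensor homog_scale)
next
  assume "tens_homog s (to_tensor p)"
  then have "homog s (from_tensor (to_tensor p))"
    unfolding from_tensor_def tens_homog_def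
    by (intro homog_sum homog_act) (auto simp: permutes_bij bij_\<pi> bij_imp_bij_inv)
  then show "homog s p" by (simp add: iso_span_inverse[OF assms])
qed

subsection \<open>The multiplicity space of the coinvariants\<close>

lemma submod_M: "submod (sympolys k) M"
  using T'.submod_esym by (simp add: M_eq)

lemma subspace_M: "cvs.subspace M"
  by (rule submod_subspace[OF submod_M])

abbreviation "J \<equiv> coinv_ideal k"
abbreviation "L \<equiv> augm_mult k M"

lemma L_eq_span: "L = cvs.span {f * m | f m. f \<in> augm k \<and> m \<in> M}"
  by (rule augm_mult_eq_span[OF submod_M])

lemma subspace_L: "cvs.subspace L"
  by (simp add: L_eq_span)

text \<open>Symmetrization commutes with symmetric factors, so it maps \<open>I A\<close> into \<open>I M\<close>, for the augmentation ideal \<open>I\<close>.\<close>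

lemma act_E_coinv_ideal: assumes "q \<in> J" shows "act (E q) \<pi> \<in> L"
  using assms unfolding coinv_ideal_eq_span L_eq_span
proof (rule span_image_subset[OF _ lin_comp[OF lin_act A.lin_esym]])
  fix s assume "s \<in> {f * p | f p. f \<in> augm k \<and> p \<in> polys k}"
  then obtain f p where fp: "f \<in> augm k" "p \<in> polys k" "s = f * p" by blast
  have "act (E s) \<pi> = f * act (E p) \<pi>"
    using augm_sympolys[OF fp(1)] by (simp add: fp(3) esym_sym_mult act_mult sympolys_act \<pi>_permutes)
  then show "act (E s) \<pi> \<in> cvs.span {f * m | f m. f \<in> augm k \<and> m \<in> M}"
    using fp by (intro cvs.span_base) blast
qed

text \<open>The module belongs to one tableau and the representation to the other; moving \<open>m\<close> back along \<open>\<pi>\<close>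
  makes \<open>v \<mapsto> mul m v\<close> a homomorphism.\<close>

definition mul :: "mpol \<Rightarrow> galg \<Rightarrow> mpol" where "mul m v = rx (act m (inv \<pi>)) v"

lemma mul_act: "mul (act (E p) \<pi>) v = rx (E p) v"
  by (simp add: mul_def)

lemma mul_add_left: "mul (m + m') v = mul m v + mul m' v"
  by (simp add: mul_def act_add module_hom.add[OF A.lin_rext_left])

lemma mul_scale_left: "mul (cscale c m) v = cscale c (mul m v)"
  by (simp add: mul_def act_scale module_hom.scale[OF A.lin_rext_left])

lemma lin_mul_left: "lin (\<lambda>m. mul m v)"
  by (rule linI) (simp_all add: mul_add_left mul_scale_left)

lemma mul_polys: "m \<in> polys k \<Longrightarrow> mul m v \<in> polys k"
  unfolding mul_def by (intro rx_polys act_polys permutes_inv \<pi>_permutes)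

lemma M_polys: "m \<in> M \<Longrightarrow> m \<in> polys k"
  by (auto intro: act_polys \<pi>_permutes esym_polys)

lemma mul_sym_mult: "f \<in> sympolys k \<Longrightarrow> mul (f * m) v = f * mul m v"
proof -
  assume f: "f \<in> sympolys k"
  have "mul (f * m) v = (\<Sum>g | g permutes X. cscale (lookup v g) (f * act (act m (inv \<pi>)) g))"
    unfolding mul_def rext_def
    by (intro sum.cong refl) (simp add: act_mult sympolys_act[OF f] \<pi>_permutes permutes_inv)
  then show ?thesis by (simp add: mul_def rext_def sum_distrib_left cscale_mult_right)
qed

lemma mul_L: assumes "m \<in> L" shows "mul m v \<in> J"
  using assms unfolding coinv_ideal_eq_span L_eq_span
proof (rule span_image_subset[OF _ lin_mul_left])
  fix s assume "s \<in> {f * m | f m. f \<in> augm k \<and> m \<in> M}"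
  then obtain f m where fm: "f \<in> augm k" "m \<in> M" "s = f * m" by blast
  then have "mul s v = f * mul m v" by (simp add: mul_sym_mult augm_sympolys)
  then show "mul s v \<in> cvs.span {f * p | f p. f \<in> augm k \<and> p \<in> polys k}"
    using fm mul_polys[OF M_polys[OF fm(2)]] by (intro cvs.span_base) blast
qed

lemma homog_mul: "homog s m \<Longrightarrow> homog s (mul m v)"
  unfolding mul_def rext_def
  by (intro homog_sum homog_scale homog_act) (auto simp: permutes_bij bij_\<pi> bij_imp_bij_inv)

text \<open>The element \<open>m\<close> is \<open>p e\<close>, moved along \<open>\<pi>\<close>, and \<open>p e e = c p e\<close>. So \<open>p e\<close> lies in the ideal, and
  symmetrizing it again gives an element of \<open>L\<close>, namely \<open>c m\<close>.\<close>

lemma in_L_if_mul_in_J: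
  assumes m: "m \<in> M" and J: "mul m e \<in> J" shows "m \<in> L"
proof -
  obtain p where p: "p \<in> polys k" "m = act (E p) \<pi>" using m by blast
  have "cscale c\<^sub>e (E p) \<in> J" using J by (simp add: p(2) mul_act A.rext_symmetrizer A.esym_esym)
  then have "cscale (1 / c\<^sub>e) (cscale c\<^sub>e (E p)) \<in> J" by (rule cvs.subspace_scale[OF subspace_coinv_ideal])
  then have "E p \<in> J" using esym_const_nonzero by simp
  then have "act (E (E p)) \<pi> \<in> L" by (rule act_E_coinv_ideal)
  then have "cscale (1 / c\<^sub>e) (act (E (E p)) \<pi>) \<in> L" by (rule cvs.subspace_scale[OF subspace_L])
  then show ?thesis using esym_const_nonzero by (simp add: A.esym_esym act_scale p(2))
qed

text \<open>The homomorphism \<open>v \<mapsto> \<psi> (m v)\<close>, where \<open>m\<close> is any representative of the class \<open>Y\<close>.\<close>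

definition class_hom :: "(mpol set \<Rightarrow> galg) \<Rightarrow> mpol set \<Rightarrow> galg \<Rightarrow> galg" where
  "class_hom \<psi> Y = restrict (\<lambda>v. \<psi> (coset J (mul (SOME m. m \<in> M \<and> Y = coset L m) v))) irr"

context
  fixes \<psi> assumes \<psi>: "coinvariants_iso k \<psi>"
begin

lemma \<psi>_bij: "bij_betw \<psi> (quot (polys k) J) (GA k)"
  and \<psi>_lin: "lin_on (polys k) (\<lambda>p. \<psi> (coset J p))"
  and \<psi>_equivar: "equivar_on k (polys k) act gact (\<lambda>p. \<psi> (coset J p))"
  using \<psi> by (simp_all add: coinvariants_iso_def Let_def coinv_ideal_def)

lemma \<psi>_GA: "p \<in> polys k \<Longrightarrow> \<psi> (coset J p) \<in> GA k"
  using \<psi>_bij by (auto simp: bij_betw_def quot_def)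

lemma \<psi>_eq_iff:
  assumes "p \<in> polys k" "q \<in> polys k" shows "\<psi> (coset J p) = \<psi> (coset J q) \<longleftrightarrow> p - q \<in> J"
proof -
  have "coset J p \<in> quot (polys k) J" "coset J q \<in> quot (polys k) J" using assms by (auto simp: quot_def)
  then have "\<psi> (coset J p) = \<psi> (coset J q) \<longleftrightarrow> coset J p = coset J q"
    using \<psi>_bij by (auto simp: bij_betw_def inj_on_def)
  then show ?thesis by (simp add: coset_eq_iff[OF subspace_coinv_ideal])
qed

lemma class_hom_coset:
  assumes m: "m \<in> M" shows "class_hom \<psi> (coset L m) = restrict (\<lambda>v. \<psi> (coset J (mul m v))) irr"
proof -
  \<comment> \<open>The representative chosen by the definition; another one changes \<open>mul m v\<close> by an element of the ideal.\<close>
  define m' where "m' = (SOME m'. m' \<in> M \<and> coset L m = coset L m')"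
  have m': "m' \<in> M \<and> coset L m = coset L m'" unfolding m'_def by (rule someI[of _ m]) (simp add: m)
  then have "m - m' \<in> L" by (simp add: coset_eq_iff[OF subspace_L])
  then have "mul m v - mul m' v \<in> J" for v
    using mul_L[of "m - m'"] by (simp add: module_hom.diff[OF lin_mul_left])
  then have "\<psi> (coset J (mul m v)) = \<psi> (coset J (mul m' v))" for v
    using m m' by (subst \<psi>_eq_iff) (auto simp: mul_polys M_polys)
  then show ?thesis by (simp add: class_hom_def m'_def)
qed

lemma class_hom_Hom:
  assumes irr: "irrep \<xi> = irr" and m: "m \<in> M" shows "class_hom \<psi> (coset L m) \<in> Hom_irrep k \<xi>"
proof -
  have polys: "mul m v \<in> polys k" for v using m by (intro mul_polys M_polys)
  have right: "mul m (u + v) = mul m u + mul m v" "mul m (cscale c v) = cscale c (mul m v)" for u v c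
    by (simp_all add: mul_def module_hom.add[OF A.lin_rext_right] module_hom.scale[OF A.lin_rext_right])
  have "mul m (gact v \<sigma>) = act (mul m v) \<sigma>" if "\<sigma> permutes X" for v \<sigma>
    using that by (simp add: mul_def A.rext_gact)
  then show ?thesis
    unfolding class_hom_coset[OF m] Hom_irrep_def irr
    using \<psi>_lin \<psi>_equivar polys right \<psi>_GA
    by (auto simp: lin_on_def equivar_on_def cvs.span_add cvs.span_scale gact_irr)
qed

text \<open>A homomorphism is determined by its value at \<open>e\<close>. If \<open>p\<close> represents this value then so does \<open>p e e\<close>, up to
  the factor \<open>c\<^sup>2\<close>, and so \<open>h\<close> comes from a multiple of \<open>p e\<close>.\<close>

lemma Hom_eq_class_hom:
  assumes irr: "irrep \<xi> = irr" and h: "h \<in> Hom_irrep k \<xi>" and p: "p \<in> polys k" "h e = \<psi> (coset J p)"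
  shows "h = class_hom \<psi> (coset L (act (E (cscale (1 / c\<^sub>e\<^sup>2) p)) \<pi>))"
proof -
  let ?q = "cscale (1 / c\<^sub>e\<^sup>2) p"
  have q: "?q \<in> polys k" using p(1) by (rule cvs.subspace_scale[OF subspace_polys])
  have h': "h \<in> irr \<rightarrow>\<^sub>E GA k" "lin_on irr h" "equivar_on k irr gact gact h" using h by (auto simp: Hom_irrep_def irr)
  note lin = \<psi>_lin[unfolded lin_on_def]
  have "E p \<in> polys k \<and> \<psi> (coset J (E p)) = esym k cell gact (\<psi> (coset J p))"
    by (rule equivar_esym[OF subspace_polys act_polys \<psi>_lin \<psi>_equivar p(1)])
  also have "\<psi> (coset J p) = h e" by (simp add: p(2))
  also have "esym k cell gact (h e) = h (esym k cell gact e)"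
    using equivar_esym[OF cvs.subspace_span gact_irr h'(2,3) e_irr] by simp
  also have "\<dots> = cscale c\<^sub>e (h e)" using h'(2) e_irr by (simp add: esym_gact_e lin_on_def)
  finally have Ep: "E p \<in> polys k" "\<psi> (coset J (E p)) = cscale c\<^sub>e (h e)" by auto
  have eq: "v \<in> irr \<and> h v = \<psi> (coset J (rx (E ?q) v))" if "v \<in> irr" for v
    using that
  proof (induction rule: cvs.span_induct_alt)
    case base
    have "h (cscale 0 0) = cscale 0 (h 0)" using h'(2) cvs.span_zero unfolding lin_on_def by blast
    moreover have "\<psi> (coset J (cscale 0 0)) = cscale 0 (\<psi> (coset J 0))" using lin cvs.subspace_0[OF subspace_polys] by blast
    ultimately show ?case by (simp add: module_hom.zero[OF A.lin_rext_right] cvs.span_zero)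
  next
    case (step a x y)
    then obtain \<sigma> where \<sigma>: "\<sigma> permutes X" "x = gact e \<sigma>" by blast
    have xi: "x \<in> irr" unfolding \<sigma>(2) by (rule gact_irr[OF \<sigma>(1) e_irr])
    have yi: "y \<in> irr" and y: "h y = \<psi> (coset J (rx (E ?q) y))" using step.IH by blast+
    have "rx (E ?q) x = cscale (1 / c\<^sub>e) (act (E p) \<sigma>)"
      unfolding \<sigma>(2) rx_E_gact_e[OF \<sigma>(1)]
      using esym_const_nonzero by (simp add: module_hom.scale[OF A.lin_esym] act_scale power2_eq_square)
    then have "\<psi> (coset J (rx (E ?q) x)) = cscale (1 / c\<^sub>e) (gact (cscale c\<^sub>e (h e)) \<sigma>)"
      using lin act_polys[OF \<sigma>(1) Ep(1)] \<psi>_equivar Ep \<sigma>(1) by (simp add: equivar_on_def)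
    also have "\<dots> = h x"
      using esym_const_nonzero h'(3) \<sigma> e_irr by (simp add: module_hom.scale[OF lin_gact] equivar_on_def)
    finally have x: "\<psi> (coset J (rx (E ?q) x)) = h x" .
    have r: "rx (E ?q) v \<in> polys k" for v by (intro rx_polys esym_polys q)
    have "h (cscale a x + y) = cscale a (h x) + h y"
      using h'(2) cvs.span_scale[OF xi, of a] xi yi by (simp add: lin_on_def)
    also have "\<dots> = cscale a (\<psi> (coset J (rx (E ?q) x))) + \<psi> (coset J (rx (E ?q) y))" by (simp only: x y)
    also have "\<dots> = \<psi> (coset J (cscale a (rx (E ?q) x) + rx (E ?q) y))"
      using lin r cvs.subspace_scale[OF subspace_polys r, of a] by simp
    finally show ?case using xi yi
      by (simp add: module_hom.add[OF A.lin_rext_right] module_hom.scale[OF A.lin_rext_right] cvs.span_add cvs.span_scale)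
  qed
  have m: "act (E ?q) \<pi> \<in> M" using q by blast
  show ?thesis
  proof
    fix v show "h v = class_hom \<psi> (coset L (act (E ?q) \<pi>)) v"
      using eq PiE_arb[OF h'(1)] by (cases "v \<in> irr") (simp_all add: class_hom_coset[OF m] mul_act)
  qed
qed

text \<open>For the grading: \<open>v \<mapsto> m v\<close> preserves degrees, and conversely the value at \<open>e\<close> of a homogeneous
  homomorphism has a homogeneous representative \<open>p\<close>, which makes \<open>p e\<close> homogeneous.\<close>

theorem class_hom_iso:
  assumes irr: "irrep \<xi> = irr"
  shows "bij_betw (class_hom \<psi>) (quot M L) (Hom_irrep k \<xi>)"
    and "\<forall>v\<in>irr. lin_on M (\<lambda>p. class_hom \<psi> (coset L p) v)"
    and "class_hom \<psi> ` quot_grade M L s = {h \<in> Hom_irrep k \<xi>. h ` irr \<subseteq> \<psi> ` quot_grade (polys k) J s}"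
proof -
  have rep: "\<exists>p\<in>polys k. h e = \<psi> (coset J p)" if "h \<in> Hom_irrep k \<xi>" for h
  proof -
    have "h e \<in> GA k" using that e_irr by (auto simp: Hom_irrep_def irr)
    then show ?thesis using \<psi>_bij by (auto simp: bij_betw_def quot_def)
  qed
  have pre: "\<exists>m\<in>M. m = act (E (cscale (1 / c\<^sub>e\<^sup>2) p)) \<pi>" if "p \<in> polys k" for p
    using cvs.subspace_scale[OF subspace_polys that] by blast
  show "bij_betw (class_hom \<psi>) (quot M L) (Hom_irrep k \<xi>)"
  proof (rule bij_betw_imageI)
    show "inj_on (class_hom \<psi>) (quot M L)"
    proof (rule inj_onI)
      fix Y Z assume "Y \<in> quot M L" "Z \<in> quot M L" and eq: "class_hom \<psi> Y = class_hom \<psi> Z"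
      then obtain m m' where m: "m \<in> M" "Y = coset L m" and m': "m' \<in> M" "Z = coset L m'" by (auto simp: quot_def)
      have "\<psi> (coset J (mul m e)) = \<psi> (coset J (mul m' e))"
        using fun_cong[OF eq, of e] e_irr by (simp add: m(2) m'(2) class_hom_coset[OF m(1)] class_hom_coset[OF m'(1)])
      then have "mul m e - mul m' e \<in> J"
        using m(1) m'(1) by (subst (asm) \<psi>_eq_iff) (auto simp: mul_polys M_polys)
      then have "mul (m - m') e \<in> J" by (simp add: module_hom.diff[OF lin_mul_left])
      moreover have "m - m' \<in> M" using m(1) m'(1) by (rule cvs.subspace_diff[OF subspace_M])
      ultimately have "m - m' \<in> L" by (intro in_L_if_mul_in_J)
      then show "Y = Z" by (simp add: m(2) m'(2) coset_eq_iff[OF subspace_L])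
    qed
    show "class_hom \<psi> ` quot M L = Hom_irrep k \<xi>"
    proof (intro equalityI subsetI)
      fix h assume "h \<in> class_hom \<psi> ` quot M L"
      then show "h \<in> Hom_irrep k \<xi>" using class_hom_Hom[OF irr] by (auto simp: quot_def)
    next
      fix h assume h: "h \<in> Hom_irrep k \<xi>"
      from rep[OF h] obtain p where p: "p \<in> polys k" "h e = \<psi> (coset J p)" by blast
      show "h \<in> class_hom \<psi> ` quot M L"
        using Hom_eq_class_hom[OF irr h p] pre[OF p(1)] by (auto simp: quot_def)
    qed
  qed
  show "\<forall>v\<in>irr. lin_on M (\<lambda>p. class_hom \<psi> (coset L p) v)"
  proof
    fix v assume v: "v \<in> irr"
    have hom: "class_hom \<psi> (coset L m) v = \<psi> (coset J (mul m v))" if "m \<in> M" for m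
      using v by (simp add: class_hom_coset[OF that])
    have polys: "mul m v \<in> polys k" if "m \<in> M" for m using that by (intro mul_polys M_polys)
    show "lin_on M (\<lambda>p. class_hom \<psi> (coset L p) v)"
      unfolding lin_on_def
    proof (intro conjI ballI allI)
      fix m m' assume m: "m \<in> M" "m' \<in> M"
      have "m + m' \<in> M" by (rule cvs.subspace_add[OF subspace_M m])
      then show "class_hom \<psi> (coset L (m + m')) v = class_hom \<psi> (coset L m) v + class_hom \<psi> (coset L m') v"
        using m polys \<psi>_lin by (simp only: hom mul_add_left lin_on_def)
    next
      fix c m assume m: "m \<in> M"
      have "cscale c m \<in> M" by (rule cvs.subspace_scale[OF subspace_M m])
      then show "class_hom \<psi> (coset L (cscale c m)) v = cscale c (class_hom \<psi> (coset L m) v)"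
        using m polys \<psi>_lin by (simp only: hom mul_scale_left lin_on_def)
    qed
  qed
  show "class_hom \<psi> ` quot_grade M L s = {h \<in> Hom_irrep k \<xi>. h ` irr \<subseteq> \<psi> ` quot_grade (polys k) J s}"
  proof (intro equalityI subsetI)
    fix h assume "h \<in> class_hom \<psi> ` quot_grade M L s"
    then obtain m where m: "m \<in> M" "homog s m" "h = class_hom \<psi> (coset L m)" by (auto simp: quot_grade_def)
    have "h v \<in> \<psi> ` quot_grade (polys k) J s" if "v \<in> irr" for v
      using that homog_mul[OF m(2), of v] mul_polys[OF M_polys[OF m(1)], of v]
      by (auto simp: m(3) class_hom_coset[OF m(1)] quot_grade_def)
    then show "h \<in> {h \<in> Hom_irrep k \<xi>. h ` irr \<subseteq> \<psi> ` quot_grade (polys k) J s}"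
      using class_hom_Hom[OF irr m(1)] m(3) by blast
  next
    fix h assume h: "h \<in> {h \<in> Hom_irrep k \<xi>. h ` irr \<subseteq> \<psi> ` quot_grade (polys k) J s}"
    then have hom: "h \<in> Hom_irrep k \<xi>" and "h e \<in> \<psi> ` quot_grade (polys k) J s" using e_irr by blast+
    then obtain p where p: "p \<in> polys k" "homog s p" "h e = \<psi> (coset J p)" by (auto simp: quot_grade_def)
    have "homog s (act (E (cscale (1 / c\<^sub>e\<^sup>2) p)) \<pi>)" by (intro homog_act homog_E homog_scale bij_\<pi> p(2))
    then show "h \<in> class_hom \<psi> ` quot_grade M L s"
      using Hom_eq_class_hom[OF irr hom p(1,3)] pre[OF p(1)] by (auto simp: quot_grade_def)
  qed
qed

end

end

section \<open>Freeness and the graded rank\<close>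

lemma homog_basis_independent:
  assumes B: "homog_basis (sympolys k) N B" shows "cvs.independent B"
  unfolding cvs.independent_explicit_module
proof (intro allI impI)
  fix t u v assume t: "finite t" "t \<subseteq> B" "(\<Sum>v\<in>t. cscale (u v) v) = 0" "v \<in> t"
  have "(\<Sum>b\<in>t. single 0 (u b) * b) = 0" using t(3) by (simp add: cscale_conv_mult)
  moreover have "(\<lambda>b. single 0 (u b)) ` t \<subseteq> sympolys k" by auto
  ultimately have "\<forall>b\<in>t. single 0 (u b) = (0::mpol)"
    using B t(1,2) unfolding homog_basis_def is_basis_def by blast
  then have "lookup (single 0 (u v) :: mpol) 0 = 0" using t(4) by simp
  then show "u v = 0" by simp
qed

lemma homog_basis_subset: "homog_basis (sympolys k) N B \<Longrightarrow> B \<subseteq> N"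
  using gen_submod_base[of _ B "sympolys k"] by (auto simp: homog_basis_def is_basis_def)

lemma finite_homog_basis_degree:
  assumes B: "homog_basis (sympolys k) N B" and N: "N \<subseteq> polys k"
  shows "finite {b \<in> B. homog s b}"
proof -
  have "{b \<in> B. homog s b} \<subseteq> cvs.span (mon ` {m \<in> Mon k. mdeg m = s})"
    using homog_basis_subset[OF B] N by (auto simp: polys_deg_alt[symmetric] polys_deg_def)
  moreover have "cvs.independent {b \<in> B. homog s b}"
    by (rule cvs.independent_mono[OF homog_basis_independent[OF B]]) auto
  ultimately show ?thesis using cvs.independent_span_bound finite_Mon_deg by blast
qed

text \<open>Multiplying a basis of the symmetric polynomials of degree \<open>d - s\<close> with the basis elements of
  degree \<open>s\<close> gives, for all \<open>s\<close> together, a basis of the degree \<open>d\<close> part of the module.\<close>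

lemma homog_basis_count:
  assumes B: "homog_basis (sympolys k) N B" and N: "N \<subseteq> polys k" "submod (sympolys k) N"
    and Lb: "\<And>j. finite (Lb j)" "\<And>j. cvs.independent (Lb j)" "\<And>j. cvs.span (Lb j) = sympolys k \<inter> polys_deg k j"
    and Fb: "cvs.independent (Fb d)" "cvs.span (Fb d) = N \<inter> polys_deg k d"
  shows "(\<Sum>s\<le>d. card {b \<in> B. homog s b} * card (Lb (d - s))) = card (Fb d)"
proof -
  define Bs where "Bs s = {b \<in> B. homog s b}" for s
  have fin: "finite (Bs s)" for s unfolding Bs_def by (rule finite_homog_basis_degree[OF B N(1)])
  have B0: "0 \<notin> B" using homog_basis_independent[OF B] cvs.dependent_zero by blast
  have Bs_unique: "s = t" if "b \<in> Bs s" "b \<in> Bs t" for b s t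
    using that B0 homog_unique[of s b t] by (auto simp: Bs_def)
  define T where "T = (SIGMA s:{..d}. Bs s \<times> Lb (d - s))"
  define f where "f = (\<lambda>(s :: nat, b, l). l * b :: mpol)"
  have finT: "finite T" using fin Lb(1) by (auto simp: T_def)
  have Lsym: "l \<in> sympolys k" "homog j l" if "l \<in> Lb j" for l j
  proof -
    have "l \<in> sympolys k \<inter> polys_deg k j" using cvs.span_base[OF that] Lb(3) by simp
    then show "l \<in> sympolys k" "homog j l" by (auto simp: polys_deg_def)
  qed
  have indep: "a t = 0" if sum: "(\<Sum>t\<in>T. cscale (a t) (f t)) = 0" and t: "t \<in> T" for a t
  proof -
    obtain s b l where sbl: "t = (s, b, l)" "s \<le> d" "b \<in> Bs s" "l \<in> Lb (d - s)" using t by (auto simp: T_def)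
    \<comment> \<open>Degrees of basis elements are unique, so a relation can be sorted by basis elements; their
      coefficients are symmetric.\<close>
    define deg where "deg b = (THE s. b \<in> Bs s)" for b
    have deg: "deg b = s" if "b \<in> Bs s" for b s
      unfolding deg_def using that Bs_unique by (intro the_equality) auto
    define c where "c b = (\<Sum>l\<in>Lb (d - deg b). cscale (a (deg b, b, l)) l)" for b
    have "(\<Sum>t\<in>T. cscale (a t) (f t)) = (\<Sum>s\<le>d. \<Sum>b\<in>Bs s. \<Sum>l\<in>Lb (d - s). cscale (a (s, b, l)) (l * b))"
      using fin Lb(1) by (simp add: T_def f_def sum.cartesian_product sum.Sigma split_def)
    also have "\<dots> = (\<Sum>s\<le>d. \<Sum>b\<in>Bs s. c b * b)"
      by (intro sum.cong refl) (simp add: c_def deg sum_distrib_right cscale_mult_left)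
    also have "\<dots> = (\<Sum>b\<in>(\<Union>s\<le>d. Bs s). c b * b)"
      using fin Bs_unique by (intro sum.UNION_disjoint[symmetric]) auto
    finally have "(\<Sum>b\<in>(\<Union>s\<le>d. Bs s). c b * b) = 0" using sum by simp
    moreover have "finite (\<Union>s\<le>d. Bs s)" "(\<Union>s\<le>d. Bs s) \<subseteq> B" using fin by (auto simp: Bs_def)
    moreover have "c ` (\<Union>s\<le>d. Bs s) \<subseteq> sympolys k"
      unfolding c_def using Lsym(1) by (intro image_subsetI cvs.subspace_sum[OF subspace_sympolys] cvs.subspace_scale[OF subspace_sympolys])
    ultimately have "\<forall>b\<in>(\<Union>s\<le>d. Bs s). c b = 0"
      using B unfolding homog_basis_def is_basis_def by blast
    then have "c b = 0" using sbl by blast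
    then have "(\<Sum>l\<in>Lb (d - s). cscale (a (s, b, l)) l) = 0" by (simp add: c_def deg[OF sbl(3)])
    then show ?thesis
      using cvs.independentD[OF Lb(2)[of "d - s"] Lb(1)[of "d - s"] order_refl,
          where u = "\<lambda>l. a (s, b, l)" and v = l] sbl by simp
  qed
  have T_basis: "inj_on f T" "cvs.independent (f ` T)"
    using indep by (auto intro!: independent_familyI[OF finT])
  have "cvs.span (f ` T) = N \<inter> polys_deg k d"
  proof
    show "cvs.span (f ` T) \<subseteq> N \<inter> polys_deg k d"
    proof (rule span_subset_subspaceI)
      show "f ` T \<subseteq> N \<inter> polys_deg k d"
      proof (intro image_subsetI)
        fix t assume "t \<in> T"
        then obtain s b l where sbl: "t = (s, b, l)" "s \<le> d" "b \<in> B" "homog s b" "l \<in> Lb (d - s)" by (auto simp: T_def Bs_def)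
        have "l * b \<in> N" using N(2) Lsym(1)[OF sbl(5)] homog_basis_subset[OF B] sbl(3) by (auto simp: submod_def)
        moreover have "homog ((d - s) + s) (l * b)" using Lsym(2)[OF sbl(5)] sbl(4) by (rule homog_mult)
        ultimately show "f t \<in> N \<inter> polys_deg k d" using sbl(2) N(1) by (auto simp: f_def sbl(1) polys_deg_def)
      qed
    qed (intro cvs.subspace_inter submod_subspace[OF N(2)] subspace_polys_deg)
    show "N \<inter> polys_deg k d \<subseteq> cvs.span (f ` T)"
    proof
      fix p assume p: "p \<in> N \<inter> polys_deg k d"
      then have "p \<in> gen_submod (sympolys k) B" using B by (simp add: homog_basis_def is_basis_def)
      then have "p \<in> cvs.span {l * b | l b. l \<in> sympolys k \<and> b \<in> B}" by (simp add: gen_submod_eq_span)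
      then have "hom_part d p \<in> cvs.span (f ` T)"
      proof (rule span_image_subset[OF _ lin_hom_part])
        fix q assume "q \<in> {l * b | l b. l \<in> sympolys k \<and> b \<in> B}"
        then obtain l b where lb: "l \<in> sympolys k" "b \<in> B" "q = l * b" by blast
        obtain s where s: "homog s b" using B lb(2) by (auto simp: homog_basis_def)
        show "hom_part d q \<in> cvs.span (f ` T)"
        proof (cases "s \<le> d")
          case True
          have "hom_part (d - s) l \<in> sympolys k \<inter> polys_deg k (d - s)"
            using sympolys_hom_part[OF lb(1)] hom_part_polys[OF sympolys_polys[OF lb(1)]] by blast
          then have "hom_part (d - s) l \<in> cvs.span (Lb (d - s))" by (simp add: Lb(3))
          then have "hom_part (d - s) l * b \<in> cvs.span (f ` T)"
          proof (rule span_image_subset[OF _ lin_mult_right])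
            fix l' assume "l' \<in> Lb (d - s)"
            then have "(s, b, l') \<in> T" using True lb(2) s by (simp add: T_def Bs_def)
            then have "f (s, b, l') \<in> f ` T" by (rule imageI)
            then show "l' * b \<in> cvs.span (f ` T)" by (intro cvs.span_base) (simp add: f_def)
          qed
          then show ?thesis using True by (simp add: lb(3) hom_part_homog_mult[OF s])
        next
          case False
          then show ?thesis by (simp add: lb(3) hom_part_homog_mult[OF s] cvs.span_zero)
        qed
      qed
      then show "p \<in> cvs.span (f ` T)" using p by (simp add: polys_deg_def homog_iff_hom_part)
    qed
  qed
  then have "cvs.span (f ` T) = cvs.span (Fb d)" by (simp add: Fb(2))
  then have "card (f ` T) = card (Fb d)"
    using cvs.dim_span_eq_card_independent[OF T_basis(2)] cvs.dim_span_eq_card_independent[OF Fb(1)] by simp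
  moreover have "card (f ` T) = (\<Sum>s\<le>d. card (Bs s) * card (Lb (d - s)))"
    using fin Lb(1) by (simp add: card_image[OF T_basis(1)]) (simp add: T_def card_cartesian_product)
  ultimately show ?thesis by (simp add: Bs_def)
qed

context tableau
begin

lemma esym_image_Int_polys_deg: "esym k cell act ` polys k \<inter> polys_deg k d = esym k cell act ` polys_deg k d"
proof
  show "esym k cell act ` polys_deg k d \<subseteq> esym k cell act ` polys k \<inter> polys_deg k d"
    using esym_polys by (auto simp: polys_deg_def homog_iff_hom_part hom_part_esym)
  show "esym k cell act ` polys k \<inter> polys_deg k d \<subseteq> esym k cell act ` polys_deg k d"
  proof
    fix p assume p: "p \<in> esym k cell act ` polys k \<inter> polys_deg k d"
    then obtain q where q: "q \<in> polys k" "p = esym k cell act q" by blast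
    have "p = esym k cell act (hom_part d q)"
      using p by (simp add: q(2) hom_part_esym[symmetric] polys_deg_def homog_iff_hom_part)
    then show "p \<in> esym k cell act ` polys_deg k d" using hom_part_polys[OF q(1)] by blast
  qed
qed

lemma graded_esym: "graded (esym k cell act ` polys k)"
  unfolding graded_def
proof (intro ballI allI)
  fix p s assume "p \<in> esym k cell act ` polys k"
  then obtain q where q: "q \<in> polys k" "p = esym k cell act q" by blast
  then have "hom_part s p = esym k cell act (hom_part s q)" by (simp add: hom_part_esym)
  then show "hom_part s p \<in> esym k cell act ` polys k" using hom_part_polys[OF q(1)] by (auto simp: polys_deg_def)
qed

text \<open>The harmonic polynomials are stable under the symmetrizer, so a homogeneous linear basis of the
  symmetrized ones is linearly independent inside the harmonic polynomials, hence also over the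
  symmetric polynomials.\<close>

lemma ex_homog_basis_esym: "\<exists>B. homog_basis (sympolys k) (esym k cell act ` polys k) B"
proof -
  let ?es = "esym k cell act"
  let ?H = "?es ` harmonic k"
  have es_H: "?es h \<in> harmonic k" if "h \<in> harmonic k" for h
    unfolding esym_def bsym_def asym_def using that
    by (intro cvs.subspace_sum[OF subspace_harmonic] cvs.subspace_scale[OF subspace_harmonic] harmonic_act stab_permutes)
  have subH: "cvs.subspace ?H" by (rule module_hom.subspace_image[OF A.lin_esym subspace_harmonic])
  obtain B where B: "B \<subseteq> {p \<in> ?H. \<exists>s. homog s p}" "cvs.independent B" "{p \<in> ?H. \<exists>s. homog s p} \<subseteq> cvs.span B"
    using cvs.maximal_independent_subset by blast
  have H_span: "?H \<subseteq> cvs.span B"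
  proof
    fix p assume "p \<in> ?H"
    then obtain h where h: "h \<in> harmonic k" "p = ?es h" by blast
    obtain n where n: "(\<Sum>s\<le>n. hom_part s p) = p" using ex_sum_hom_part by blast
    have "hom_part s p \<in> {p \<in> ?H. \<exists>s. homog s p}" for s
      using harmonic_hom_part[OF h(1)] homog_hom_part[of s p] by (auto simp: h(2) hom_part_esym)
    then have "(\<Sum>s\<le>n. hom_part s p) \<in> cvs.span B" using B(3) by (intro cvs.span_sum) blast
    then show "p \<in> cvs.span B" by (simp add: n)
  qed
  have "gen_submod (sympolys k) B = ?es ` polys k"
  proof
    show "gen_submod (sympolys k) B \<subseteq> ?es ` polys k"
      using B(1) harmonic_polys by (intro gen_submod_minimal submod_esym) blast
    show "?es ` polys k \<subseteq> gen_submod (sympolys k) B"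
    proof (intro image_subsetI)
      fix p assume "p \<in> polys k"
      then have "p \<in> cvs.span {f * h | f h. f \<in> sympolys k \<and> h \<in> harmonic k}"
        by (simp add: polys_eq_gen_harmonic gen_submod_eq_span)
      then show "?es p \<in> gen_submod (sympolys k) B" unfolding gen_submod_eq_span
      proof (rule span_image_subset[OF _ A.lin_esym])
        fix q assume "q \<in> {f * h | f h. f \<in> sympolys k \<and> h \<in> harmonic k}"
        then obtain f h where fh: "f \<in> sympolys k" "h \<in> harmonic k" "q = f * h" by blast
        have "cvs.span B \<subseteq> gen_submod (sympolys k) B"
          by (intro span_subset_subspaceI subspace_gen_submod) (auto intro: gen_submod_base)
        then have "?es h \<in> gen_submod (sympolys k) B" using H_span fh(2) by blast
        then have "f * ?es h \<in> gen_submod (sympolys k) B" by (rule gen_submod_mult[OF fh(1)])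
        then show "?es q \<in> cvs.span {f * g | f g. f \<in> sympolys k \<and> g \<in> B}"
          by (simp add: fh(3) esym_sym_mult[OF fh(1)] gen_submod_eq_span)
      qed
    qed
  qed
  moreover have "B \<subseteq> harmonic k" using B(1) es_H by blast
  ultimately have "homog_basis (sympolys k) (?es ` polys k) B"
    unfolding homog_basis_def is_basis_def
  proof (intro conjI allI impI)
    fix F c assume "finite F \<and> F \<subseteq> B \<and> c ` F \<subseteq> sympolys k \<and> (\<Sum>b\<in>F. c b * b) = 0"
    then show "\<forall>b\<in>F. c b = 0" using harmonic_independent_over_sympolys[OF \<open>B \<subseteq> harmonic k\<close> B(2)] by blast
  qed (use B(1) in auto)
  then show ?thesis by blast
qed

end

text \<open>For the one-row shape the row group is the whole symmetric group and the symmetrized polynomials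
  are the symmetric ones, so their generating function is a special case of the general one.\<close>

lemma tableau_one_row: "1 \<le> k \<Longrightarrow> tableau [k] k (\<lambda>x. (1, x))"
proof (intro tableau.intro)
  show "bij_betw (\<lambda>x. (1, x)) {1..k} (boxes [k])"
    by (rule bij_betw_byWitness[where f' = snd]) (auto simp: boxes_def part_def)
qed (simp add: is_partition_def)

lemma esym_one_row: "esym k (\<lambda>x. (1, x)) act p = (\<Sum>g | g permutes {1..k}. act p g)"
proof -
  have C: "stab k (\<lambda>x. x) = {id}"
  proof (intro equalityI subsetI)
    fix g assume g: "g \<in> stab k (\<lambda>x. x)"
    have "g x = x" for x using g by (cases "x \<in> {1..k}") (auto simp: stab_def permutes_def simp del: atLeastAtMost_iff)
    then show "g \<in> {id}" by (auto simp: fun_eq_iff)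
  qed simp
  have R: "stab k (\<lambda>x. 1) = {g. g permutes {1..k}}" by (simp add: stab_def)
  show ?thesis by (simp add: esym_def bsym_def asym_def C R)
qed

lemma sympolys_eq_esym_one_row: "sympolys k = esym k (\<lambda>x. (1, x)) act ` polys k"
proof
  show "sympolys k \<subseteq> esym k (\<lambda>x. (1, x)) act ` polys k"
  proof
    fix f assume f: "f \<in> sympolys k"
    let ?n = "card {g. g permutes {1..k}}"
    have n: "?n \<noteq> 0" by (simp add: card_permutations[of _ k])
    let ?p = "cscale (1 / of_nat ?n) f"
    have "act ?p g = ?p" if "g permutes {1..k}" for g using f that by (simp add: act_scale sympolys_act)
    then have "(\<Sum>g | g permutes {1..k}. act ?p g) = (\<Sum>g | g permutes {1..k}. ?p)" by (intro sum.cong) auto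
    also have "\<dots> = cscale (of_nat ?n) ?p" by (rule cvs.sum_constant_scale)
    finally have "f = esym k (\<lambda>x. (1, x)) act ?p" unfolding esym_one_row using n by simp
    then show "f \<in> esym k (\<lambda>x. (1, x)) act ` polys k"
      using cvs.subspace_scale[OF subspace_polys sympolys_polys[OF f]] by blast
  qed
  show "esym k (\<lambda>x. (1, x)) act ` polys k \<subseteq> sympolys k"
  proof (intro image_subsetI)
    fix p assume p: "p \<in> polys k"
    have "act (\<Sum>g | g permutes {1..k}. act p g) \<sigma> = (\<Sum>g | g permutes {1..k}. act p g)" if s: "\<sigma> permutes {1..k}" for \<sigma>
    proof -
      have "act (\<Sum>g | g permutes {1..k}. act p g) \<sigma> = (\<Sum>g | g permutes {1..k}. act p (g \<circ> \<sigma>))"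
        by (simp add: act_sum act_comp permutes_bij permutes_bij[OF s])
      also have "\<dots> = (\<Sum>g | g permutes {1..k}. act p g)"
        by (rule sum.reindex_bij_witness[of _ "\<lambda>g. g \<circ> inv \<sigma>" "\<lambda>g. g \<circ> \<sigma>"])
          (auto simp: o_assoc[symmetric] permutes_inv_o[OF s] permutes_comp_inv_iff[OF s] permutes_compose[OF s])
      finally show ?thesis .
    qed
    moreover have "(\<Sum>g | g permutes {1..k}. act p g) \<in> polys k" using p by (intro polys_sum act_polys) auto
    ultimately show "esym k (\<lambda>x. (1, x)) act p \<in> sympolys k" by (simp add: esym_one_row sympolys_def)
  qed
qed

lemma kostka_one_row: "1 \<le> k \<Longrightarrow> kostka_transpose [k] = 1"
proof -
  assume k: "1 \<le> k"
  have "jt 1 (\<lambda>i. part [k] (Suc i)) = hgen (int k)"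
    unfolding jt_def by (subst det_single) (simp_all add: jt_mat_def part_def)
  then show ?thesis
    using kostka_transpose_eq_jt[of "[k]"] k by (simp add: is_partition_def mult.commute One_nat_def)
qed

text \<open>The generating function of the basis is the quotient of the one for the symmetrized polynomials by
  the one for the symmetric polynomials.\<close>

lemma (in tableau) homog_basis_esym_gf:
  assumes k: "1 \<le> k" and B: "homog_basis (sympolys k) (esym k cell act ` polys k) B"
  shows "of_nat (card {b \<in> B. homog s b}) = fps_nth (kostka_transpose \<xi>) s"
proof -
  interpret R: tableau "[k]" k "\<lambda>x. (1, x)" by (rule tableau_one_row[OF k])
  define Lb where "Lb j = (\<lambda>m. esym k (\<lambda>x. (1, x)) act (mon m)) ` rtab k (\<lambda>x. (1, x)) j" for j
  define Fb where "Fb d = (\<lambda>m. esym k cell act (mon m)) ` rtab k cell d" for d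
  have count: "(\<Sum>s\<le>d. card {b \<in> B. homog s b} * card (Lb (d - s))) = card (Fb d)" for d
  proof (rule homog_basis_count[OF B])
    show "esym k cell act ` polys k \<subseteq> polys k" using esym_polys by blast
    show "cvs.span (Lb j) = sympolys k \<inter> polys_deg k j" for j
      unfolding Lb_def R.span_esym_rtab sympolys_eq_esym_one_row R.esym_image_Int_polys_deg ..
    show "cvs.span (Fb d) = esym k cell act ` polys k \<inter> polys_deg k d"
      unfolding Fb_def span_esym_rtab esym_image_Int_polys_deg ..
  qed (simp_all add: submod_esym Lb_def Fb_def esym_rtab_independent R.esym_rtab_independent)
  have card: "card (Lb j) = card (rtab k (\<lambda>x. (1, x)) j)" "card (Fb j) = card (rtab k cell j)" for j
    unfolding Lb_def Fb_def by (rule card_image, rule R.esym_rtab_independent esym_rtab_independent)+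
  define b l r :: "rat fps" where "b = Abs_fps (\<lambda>s. of_nat (card {b \<in> B. homog s b}))"
    and "l = Abs_fps (\<lambda>j. of_nat (card (rtab k (\<lambda>x. (1, x)) j)))"
    and "r = Abs_fps (\<lambda>d. of_nat (card (rtab k cell d)))"
  have count': "(\<Sum>s\<le>d. card {b \<in> B. homog s b} * card (rtab k (\<lambda>x. (1, x)) (d - s))) = card (rtab k cell d)" for d
    using count[of d] unfolding card .
  have "b * l = r"
  proof (rule fps_ext)
    fix d
    have "fps_nth (b * l) d
        = of_nat (\<Sum>s\<le>d. card {b \<in> B. homog s b} * card (rtab k (\<lambda>x. (1, x)) (d - s)))"
      by (simp add: fps_mult_nth b_def l_def atLeast0AtMost)
    then show "fps_nth (b * l) d = fps_nth r d" unfolding count' by (simp add: r_def)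
  qed
  moreover have "l * qfac k = 1" using R.rtab_gf kostka_one_row[OF k] by (simp add: l_def)
  moreover have "r * qfac k = kostka_transpose \<xi>" using rtab_gf by (simp add: r_def)
  ultimately have "b = kostka_transpose \<xi>" by (metis mult.assoc mult_1_right)
  then show ?thesis by (metis b_def fps_nth_Abs_fps)
qed

theorem theorem1:
  fixes k n :: nat and \<xi> :: "nat list"
  assumes "1 \<le> k" and "1 \<le> n"
    and "is_partition \<xi>" and "length \<xi> = n + 1" and "sum_list \<xi> = k"
  shows
    "(graded (Mmod k \<xi>) \<and>
      (\<exists>B. homog_basis (sympolys k) (Mmod k \<xi>) B) \<and>
      (\<forall>B. homog_basis (sympolys k) (Mmod k \<xi>) B \<longrightarrow>
         (\<forall>s. finite {b \<in> B. homog s b} \<and>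
              of_nat (card {b \<in> B. homog s b}) = fps_nth (kostka_transpose \<xi>) s)))
     \<and>
     (\<exists>\<phi>. bij_betw \<phi> (isotypic k \<xi>) (tensor (Mmod k \<xi>) (irrep \<xi>)) \<and>
          (\<forall>p\<in>isotypic k \<xi>. \<forall>q\<in>isotypic k \<xi>. \<phi> (p + q) = \<phi> p + \<phi> q) \<and>
          (\<forall>f\<in>sympolys k. \<forall>p\<in>isotypic k \<xi>. \<phi> (f * p) = tens_mult f (\<phi> p)) \<and>
          equivar_on k (isotypic k \<xi>) act gact \<phi> \<and>
          (\<forall>s. \<forall>p\<in>isotypic k \<xi>. homog s p \<longleftrightarrow> tens_homog s (\<phi> p)))
     \<and>
     (let J = augm_mult k (polys k); L = augm_mult k (Mmod k \<xi>)
      in (\<exists>\<psi>. coinvariants_iso k \<psi>) \<and>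
         (\<forall>\<psi>. coinvariants_iso k \<psi> \<longrightarrow>
           (\<exists>\<theta>. bij_betw \<theta> (quot (Mmod k \<xi>) L) (Hom_irrep k \<xi>) \<and>
                (\<forall>v\<in>irrep \<xi>. lin_on (Mmod k \<xi>) (\<lambda>p. \<theta> (coset L p) v)) \<and>
                (\<forall>s. \<theta> ` quot_grade (Mmod k \<xi>) L s =
                     {h \<in> Hom_irrep k \<xi>. h ` irrep \<xi> \<subseteq> \<psi> ` quot_grade (polys k) J s}))))"
proof -
  interpret tableau_pair \<xi> k "std_cell \<xi>" "col_cell \<xi>"
    using tableau_std_cell[OF assms(3)] tableau_col_cell[OF assms(3)] by (simp add: tableau_pair_def assms(5))
  have Mmod: "Mmod k \<xi> = esym k (col_cell \<xi>) act ` polys k"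
    using Mmod_eq_esym[OF assms(3)] by (simp add: assms(5))
  have esym_sub: "esym k (col_cell \<xi>) act ` polys k \<subseteq> polys k" using T'.esym_polys by blast
  have M: "Mmod k \<xi> = M" unfolding Mmod by (rule M_eq)
  have irr: "irrep \<xi> = irr" by (simp add: irrep_def young_symmetrizer_eq assms(5))
  have "graded (Mmod k \<xi>) \<and> (\<exists>B. homog_basis (sympolys k) (Mmod k \<xi>) B) \<and>
      (\<forall>B. homog_basis (sympolys k) (Mmod k \<xi>) B \<longrightarrow>
         (\<forall>s. finite {b \<in> B. homog s b} \<and> of_nat (card {b \<in> B. homog s b}) = fps_nth (kostka_transpose \<xi>) s))"
    unfolding Mmod
    using T'.graded_esym T'.ex_homog_basis_esym T'.homog_basis_esym_gf[OF assms(1)]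
      finite_homog_basis_degree[OF _ esym_sub] by blast
  moreover have "\<exists>\<phi>. bij_betw \<phi> (isotypic k \<xi>) (tensor (Mmod k \<xi>) (irrep \<xi>)) \<and>
          (\<forall>p\<in>isotypic k \<xi>. \<forall>q\<in>isotypic k \<xi>. \<phi> (p + q) = \<phi> p + \<phi> q) \<and>
          (\<forall>f\<in>sympolys k. \<forall>p\<in>isotypic k \<xi>. \<phi> (f * p) = tens_mult f (\<phi> p)) \<and>
          equivar_on k (isotypic k \<xi>) act gact \<phi> \<and>
          (\<forall>s. \<forall>p\<in>isotypic k \<xi>. homog s p \<longleftrightarrow> tens_homog s (\<phi> p))"
    unfolding M irr isotypic_eq_iso_span[OF irr] equivar_on_def
    by (intro exI[of _ to_tensor] conjI ballI allI impI bij_to_tensor to_tensor_add to_tensor_sym_mult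
        to_tensor_act homog_to_tensor)
  moreover have "let J = augm_mult k (polys k); L = augm_mult k (Mmod k \<xi>)
      in (\<exists>\<psi>. coinvariants_iso k \<psi>) \<and>
         (\<forall>\<psi>. coinvariants_iso k \<psi> \<longrightarrow>
           (\<exists>\<theta>. bij_betw \<theta> (quot (Mmod k \<xi>) L) (Hom_irrep k \<xi>) \<and>
                (\<forall>v\<in>irrep \<xi>. lin_on (Mmod k \<xi>) (\<lambda>p. \<theta> (coset L p) v)) \<and>
                (\<forall>s. \<theta> ` quot_grade (Mmod k \<xi>) L s =
                     {h \<in> Hom_irrep k \<xi>. h ` irrep \<xi> \<subseteq> \<psi> ` quot_grade (polys k) J s})))"
    unfolding Let_def M irr coinv_ideal_def[symmetric]
  proof (intro conjI allI impI ex_coinvariants_iso)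
    fix \<psi> assume \<psi>: "coinvariants_iso k \<psi>"
    show "\<exists>\<theta>. bij_betw \<theta> (quot M L) (Hom_irrep k \<xi>) \<and>
        (\<forall>v\<in>irr. lin_on M (\<lambda>p. \<theta> (coset L p) v)) \<and>
        (\<forall>s. \<theta> ` quot_grade M L s = {h \<in> Hom_irrep k \<xi>. h ` irr \<subseteq> \<psi> ` quot_grade (polys k) J s})"
      by (intro exI[of _ "class_hom \<psi>"] conjI allI class_hom_iso[OF \<psi> irr])
  qed
  ultimately show ?thesis by blast
qed

end
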